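(* Let $N\ge1$, $p\in(1,\infty)$ and let $\Omega\subseteq\mathbb{R}^N$ be a bounded open set with Lipschitz boundary. Let $q:[0,\frac12]\to\mathbb{R}$ be $C^1$ with $\lim_{s\to0^+}q(s)=p$, $\mu:=q'(0)\in(0,\frac{p^2}{N})$, and $q(s)\in(p,p_s^* )$ for $s\in(0,\frac12]$, where $p_s^*=\frac{Np}{N-sp}$. Let $a:[0,\frac12]\times\Omega\to\mathbb{R}$ satisfy: (a$_0$) for a.e. $x\in\Omega$, $a(\cdot,x)\in C^1([0,\frac12])$ and $\lim_{s\to0^+}a(s,x)=1$; (a$_1$) for some $\delta\in(0,1)$, for all $s\in(0,\frac12]$, $a(s,\cdot)\in L^{\nu(s)}(\Omega)$, where $\nu(s)>\max\left\{\frac{p_s^*}{p_s^*-q(s)},\,1+\frac{(N-sp)p}{s(p^2-N\mu-\delta p^2)}\right\}$; (a$_2$) $a'(s,\cdot):=\frac{\partial a(s,\cdot)}{\partial s}\in L^\infty(\Omega)$ for all $s\in[0,\frac12]$ and $\sup_{s\in[0,1/2]}\|a'(s,\cdot)\|_{L^\infty(\Omega)}<\infty$; (a$_3$) there are constants $0<c_1\le c_2$ independent of $s$ with $c_1\le\|a(s,\cdot)\|_{L^{\nu(s)}(\Omega)}^{\frac1{p-q(s)}}\le c_2$ for all $s\in(0,\frac12]$. Let $(u_s)$, with $u_s\in W_0^{s,p}(\Omega)$ and $s$ ranging over a sequence in $(0,\frac12)$ tending to $0$, be a sequence of nontrivial least energy solutions of $$(-\Delta_p)^su=a(s,x)|u|^{q(s)-2}u\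 \text{ in }\Omega,\qquad u=0\ \text{ in }\mathbb{R}^N\setminus\Omega.$$ Then there exists a nontrivial least energy solution $u_0\in X_{L_{\Delta_p}}(\Omega)$ of $$L_{\Delta_p}u=a'(0,x)|u|^{p-2}u+\mu|u|^{p-2}u\ln|u|\ \text{ in }\Omega,\qquad u=0\ \text{ in }\mathbb{R}^N\setminus\Omega,$$ such that, up to a subsequence, $u_s\to u_0$ in $L^p(\Omega)$ as $s\to0^+$.
   Context: Write $h(t):=|t|^{p-2}t$; $|t|^{p}\ln|t|$ and $h(t)\ln|t|$ are $0$ at $t=0$; functions on $\Omega$ are extended by $0$ to $\mathbb{R}^N$. Fractional problem. $C_{N,s,p}:=\frac{sp\,2^{2s-1}\Gamma(\frac{N+sp}2)}{\pi^{N/2}\Gamma(1-s)}$, $[u]_{s,p,\mathbb{R}^N}^p:=\frac{C_{N,s,p}}2\iint_{\mathbb{R}^N\times\mathbb{R}^N}\frac{|u(x)-u(y)|^p}{|x-y|^{N+sp}}dxdy$, $W_0^{s,p}(\Omega):=\{u\in L^p(\mathbb{R}^N):[u]_{s,p,\mathbb{R}^N}<\infty,\ u=0\text{ a.e. in }\mathbb{R}^N\setminus\Omega\}$. A weak solution is $u\in W_0^{s,p}(\Omega)$ with $\frac{C_{N,s,p}}2\iint\frac{h(u(x)-u(y))(v(x)-v(y))}{|x-y|^{N+sp}}dxdy=\int_\Omega a(s,x)|u|^{q(s)-2}uv\,dx$ for all $v\in W_0^{s,p}(\Omega)$. With $J_{s,p}(u):=\frac1p[u]_{s,p,\mathbb{R}^N}^p-\frac1{q(s)}\int_\Omega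 a(s,x)|u|^{q(s)}dx$ and $\mathcal{N}_{s,p}:=\{u\in W_0^{s,p}(\Omega)\setminus\{0\}:[u]_{s,p,\mathbb{R}^N}^p=\int_\Omega a(s,x)|u|^{q(s)}dx\}$, a weak solution $u$ is of least energy if $J_{s,p}(u)=\inf_{\mathcal{N}_{s,p}}J_{s,p}$. Limit problem. $C_{N,p}:=\frac{p\,\Gamma(N/2)}{2\pi^{N/2}}$, $[u]_{X_{L_{\Delta_p}}(\Omega)}^p:=C_{N,p}\iint_{|x-y|\le 1}\frac{|u(x)-u(y)|^p}{|x-y|^N}dxdy$, $X_{L_{\Delta_p}}(\Omega):=\{u\in L^p(\Omega): [u]_{X_{L_{\Delta_p}}(\Omega)}<\infty,\ u=0\text{ in }\mathbb{R}^N\setminus\Omega\}$. With $\Upsilon(z_1,z_2,t_1,t_2):=h(z_1-z_2)(t_1-t_2)-h(z_1)t_1-h(z_2)t_2$, $$\mathcal{E}_{L_{\Delta_p}}(u,v):=\frac{C_{N,p}}{2}\iint_{|x-y|\le1}\frac{h(u(x)-u(y))(v(x)-v(y))}{|x-y|^N}dxdy+\frac{C_{N,p}}{2}\iint_{|x-y|\ge1}\frac{\Upsilon(u(x),u(y),v(x),v(y))}{|x-y|^N}dxdy+\rho_N\int_{\mathbb{R}^N}h(u)v\,dx,$$ $\rho_N:=2\ln2-\gamma_E+\frac p2\psi_0(\frac N2)$, $\gamma_E=-\Gamma'(1)$, $\psi_0=\Gamma'/\Gamma$. A weak solution is $u\in X_{L_{\Delta_p}}(\Omega)$ with $\mathcal{E}_{L_{\Delta_p}}(u,v)=\int_\Omega(a'(0,x)+\mu\ln|u|)h(u)v\,dx$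 for all $v\in X_{L_{\Delta_p}}(\Omega)$. With $J_{L_{\Delta_p}}(u):=\frac1p\mathcal{E}_{L_{\Delta_p}}(u,u)-\frac1p\int_\Omega a'(0,x)|u|^pdx-\frac\mu{p^2}\int_\Omega|u|^p(\ln|u|^p-1)dx$ and $\mathcal{N}_{L_{\Delta_p}}:=\{u\in X_{L_{\Delta_p}}(\Omega)\setminus\{0\}:\mathcal{E}_{L_{\Delta_p}}(u,u)=\int_\Omega(a'(0,x)+\mu\ln|u|)|u|^pdx\}$, a weak solution $u$ is of least energy if $J_{L_{\Delta_p}}(u)=\inf_{\mathcal{N}_{L_{\Delta_p}}}J_{L_{\Delta_p}}$. *)

theory Defs
  imports "HOL-Analysis.Analysis" "HOL-Probability.Essential_Supremum"
begin

text \<open>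
  \<open>\<real>\<^sup>N\<close> is a Euclidean space \<open>'a\<close> with \<open>N = DIM('a)\<close>; a double integral is an integral over
  \<open>'a \<times> 'a\<close>. Functions on \<open>\<Omega>\<close> are total functions on \<open>'a\<close>. Functions are not quotiented by
  almost everywhere equality, so that ``\<open>u \<noteq> 0\<close>'' reads ``not almost everywhere \<open>0\<close>''.

  Where a formula has the value \<open>0\<close> by convention (powers of \<open>0\<close>, \<open>ln 0\<close> multiplied by a power
  of \<open>0\<close>), HOL gives the same value, since \<open>0 powr r = 0\<close>. The
  diagonal \<open>x = y\<close>, where \<open>_ / 0 = 0\<close>, is a null set.
\<close>

subsection \<open>Function spaces and domains\<close>

text \<open>Locally, after a rotation, \<open>\<Omega>\<close> lies strictly above the graph of a Lipschitz function of the
  coordinates orthogonal to a unit vector \<open>e\<close>.\<close>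

definition lipschitz_boundary :: "'a::euclidean_space set \<Rightarrow> bool" where
  "lipschitz_boundary \<Omega> \<longleftrightarrow>
     (\<forall>z \<in> frontier \<Omega>. \<exists>e r L g. norm e = 1 \<and> 0 < r \<and> L-lipschitz_on {y. y \<bullet> e = 0} g \<and>
        \<Omega> \<inter> ball z r = {y \<in> ball z r. g (y - (y \<bullet> e) *\<^sub>R e) < y \<bullet> e})"

definition Lp_fun :: "'a measure \<Rightarrow> real \<Rightarrow> ('a \<Rightarrow> real) \<Rightarrow> bool" where
  "Lp_fun M p f \<longleftrightarrow> f \<in> borel_measurable M \<and> integrable M (\<lambda>x. \<bar>f x\<bar> powr p)"

definition Lp_norm :: "'a measure \<Rightarrow> real \<Rightarrow> ('a \<Rightarrow> real) \<Rightarrow> real" where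
  "Lp_norm M p f = (LINT x|M. \<bar>f x\<bar> powr p) powr (1 / p)"

definition Linf_norm :: "'a measure \<Rightarrow> ('a \<Rightarrow> real) \<Rightarrow> ereal" where
  "Linf_norm M f = esssup M (\<lambda>x. ereal \<bar>f x\<bar>)"

definition Linf_fun :: "'a measure \<Rightarrow> ('a \<Rightarrow> real) \<Rightarrow> bool" where
  "Linf_fun M f \<longleftrightarrow> f \<in> borel_measurable M \<and> Linf_norm M f < \<infinity>"

text \<open>\<open>f\<close> is of class \<open>C\<^sup>1\<close> on \<open>S\<close> with derivative \<open>f'\<close> (one-sided at the endpoints of an interval).\<close>

definition C1_on :: "real set \<Rightarrow> (real \<Rightarrow> real) \<Rightarrow> (real \<Rightarrow> real) \<Rightarrow> bool" where
  "C1_on S f f' \<longleftrightarrow>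
     (\<forall>t \<in> S. (f has_real_derivative f' t) (at t within S)) \<and> continuous_on S f'"

definition nontrivial :: "('a::euclidean_space \<Rightarrow> real) \<Rightarrow> bool" where
  "nontrivial u \<longleftrightarrow> \<not> (AE x in lebesgue. u x = 0)"

definition h :: "real \<Rightarrow> real \<Rightarrow> real" where
  "h p t = \<bar>t\<bar> powr (p - 2) * t"

definition crit_exp :: "nat \<Rightarrow> real \<Rightarrow> real \<Rightarrow> real" where
  "crit_exp N s p = real N * p / (real N - s * p)"

subsection \<open>The fractional problem\<close>

definition C_frac :: "nat \<Rightarrow> real \<Rightarrow> real \<Rightarrow> real" where
  "C_frac N s p = s * p * 2 powr (2 * s - 1) * Gamma ((real N + s * p) / 2)
                    / (pi powr (real N / 2) * Gamma (1 - s))"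

definition W0 :: "real \<Rightarrow> real \<Rightarrow> 'a::euclidean_space set \<Rightarrow> ('a \<Rightarrow> real) set" where
  "W0 s p \<Omega> = {u. Lp_fun lebesgue p u \<and>
     integrable lebesgue (\<lambda>(x::'a, y::'a).
       \<bar>u x - u y\<bar> powr p / norm (x - y) powr (real DIM('a) + s * p)) \<and>
     (AE x in lebesgue. x \<notin> \<Omega> \<longrightarrow> u x = 0)}"

text \<open>The \<open>p\<close>-th power of the seminorm \<open>[u]\<close>.\<close>

definition seminorm_frac_p :: "real \<Rightarrow> real \<Rightarrow> ('a::euclidean_space \<Rightarrow> real) \<Rightarrow> real" where
  "seminorm_frac_p s p u = C_frac DIM('a) s p / 2 *
     (LINT (x::'a, y::'a)|lebesgue.
        \<bar>u x - u y\<bar> powr p / norm (x - y) powr (real DIM('a) + s * p))"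

definition E_frac :: "real \<Rightarrow> real \<Rightarrow> ('a::euclidean_space \<Rightarrow> real) \<Rightarrow> ('a \<Rightarrow> real) \<Rightarrow> real" where
  "E_frac s p u v = C_frac DIM('a) s p / 2 *
     (LINT (x::'a, y::'a)|lebesgue.
        h p (u x - u y) * (v x - v y) / norm (x - y) powr (real DIM('a) + s * p))"

text \<open>In the following, \<open>b\<close> and \<open>r\<close> stand for \<open>a(s, \<cdot>)\<close> and \<open>q(s)\<close>.\<close>

definition weak_sol_frac ::
  "real \<Rightarrow> real \<Rightarrow> 'a::euclidean_space set \<Rightarrow> ('a \<Rightarrow> real) \<Rightarrow> real \<Rightarrow> ('a \<Rightarrow> real) \<Rightarrow> bool" where
  "weak_sol_frac s p \<Omega> b r u \<longleftrightarrow> u \<in> W0 s p \<Omega> \<and>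
     (\<forall>v \<in> W0 s p \<Omega>.
        E_frac s p u v = (LINT x|lebesgue_on \<Omega>. b x * \<bar>u x\<bar> powr (r - 2) * u x * v x))"

definition J_frac ::
  "real \<Rightarrow> real \<Rightarrow> 'a::euclidean_space set \<Rightarrow> ('a \<Rightarrow> real) \<Rightarrow> real \<Rightarrow> ('a \<Rightarrow> real) \<Rightarrow> real" where
  "J_frac s p \<Omega> b r u = 1 / p * seminorm_frac_p s p u
     - 1 / r * (LINT x|lebesgue_on \<Omega>. b x * \<bar>u x\<bar> powr r)"

definition Nehari_frac ::
  "real \<Rightarrow> real \<Rightarrow> 'a::euclidean_space set \<Rightarrow> ('a \<Rightarrow> real) \<Rightarrow> real \<Rightarrow> ('a \<Rightarrow> real) set" where
  "Nehari_frac s p \<Omega> b r = {u \<in> W0 s p \<Omega>. nontrivial u \<and>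
     seminorm_frac_p s p u = (LINT x|lebesgue_on \<Omega>. b x * \<bar>u x\<bar> powr r)}"

text \<open>The infimum is taken in \<open>ereal\<close>, where it exists for every set.\<close>

definition least_energy_sol_frac ::
  "real \<Rightarrow> real \<Rightarrow> 'a::euclidean_space set \<Rightarrow> ('a \<Rightarrow> real) \<Rightarrow> real \<Rightarrow> ('a \<Rightarrow> real) \<Rightarrow> bool" where
  "least_energy_sol_frac s p \<Omega> b r u \<longleftrightarrow> weak_sol_frac s p \<Omega> b r u \<and>
     ereal (J_frac s p \<Omega> b r u) = (INF v \<in> Nehari_frac s p \<Omega> b r. ereal (J_frac s p \<Omega> b r v))"

subsection \<open>The limit problem\<close>

definition C_lim :: "nat \<Rightarrow> real \<Rightarrow> real" where
  "C_lim N p = p * Gamma (real N / 2) / (2 * pi powr (real N / 2))"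

definition rho :: "nat \<Rightarrow> real \<Rightarrow> real" where
  "rho N p = 2 * ln 2 - euler_mascheroni + p / 2 * Digamma (real N / 2)"

text \<open>As in \<open>W0\<close>, finiteness of the seminorm is integrability of its nonnegative integrand; the
  positive constant factor is immaterial for it.\<close>

definition X_space :: "real \<Rightarrow> 'a::euclidean_space set \<Rightarrow> ('a \<Rightarrow> real) set" where
  "X_space p \<Omega> = {u. Lp_fun (lebesgue_on \<Omega>) p u \<and>
     set_integrable lebesgue {(x::'a, y::'a). norm (x - y) \<le> 1}
       (\<lambda>(x, y). \<bar>u x - u y\<bar> powr p / norm (x - y) ^ DIM('a)) \<and>
     (\<forall>x. x \<notin> \<Omega> \<longrightarrow> u x = 0)}"

definition Upsilon :: "real \<Rightarrow> real \<Rightarrow> real \<Rightarrow> real \<Rightarrow> real \<Rightarrow> real" where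
  "Upsilon p z1 z2 t1 t2 = h p (z1 - z2) * (t1 - t2) - h p z1 * t1 - h p z2 * t2"

definition E_lim :: "real \<Rightarrow> ('a::euclidean_space \<Rightarrow> real) \<Rightarrow> ('a \<Rightarrow> real) \<Rightarrow> real" where
  "E_lim p u v =
     C_lim DIM('a) p / 2 *
       (LINT z:{(x::'a, y::'a). norm (x - y) \<le> 1}|lebesgue.
          (case z of (x, y) \<Rightarrow> h p (u x - u y) * (v x - v y) / norm (x - y) ^ DIM('a)))
   + C_lim DIM('a) p / 2 *
       (LINT z:{(x::'a, y::'a). norm (x - y) \<ge> 1}|lebesgue.
          (case z of (x, y) \<Rightarrow> Upsilon p (u x) (u y) (v x) (v y) / norm (x - y) ^ DIM('a)))
   + rho DIM('a) p * (LINT x|lebesgue. h p (u x) * v x)"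

text \<open>In the following, \<open>b\<close> stands for \<open>a'(0, \<cdot>)\<close>.\<close>

definition weak_sol_lim ::
  "real \<Rightarrow> 'a::euclidean_space set \<Rightarrow> ('a \<Rightarrow> real) \<Rightarrow> real \<Rightarrow> ('a \<Rightarrow> real) \<Rightarrow> bool" where
  "weak_sol_lim p \<Omega> b \<mu> u \<longleftrightarrow> u \<in> X_space p \<Omega> \<and>
     (\<forall>v \<in> X_space p \<Omega>.
        E_lim p u v = (LINT x|lebesgue_on \<Omega>. (b x + \<mu> * ln \<bar>u x\<bar>) * h p (u x) * v x))"

definition J_lim ::
  "real \<Rightarrow> 'a::euclidean_space set \<Rightarrow> ('a \<Rightarrow> real) \<Rightarrow> real \<Rightarrow> ('a \<Rightarrow> real) \<Rightarrow> real" where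
  "J_lim p \<Omega> b \<mu> u = 1 / p * E_lim p u u
     - 1 / p * (LINT x|lebesgue_on \<Omega>. b x * \<bar>u x\<bar> powr p)
     - \<mu> / p\<^sup>2 * (LINT x|lebesgue_on \<Omega>. \<bar>u x\<bar> powr p * (ln (\<bar>u x\<bar> powr p) - 1))"

definition Nehari_lim ::
  "real \<Rightarrow> 'a::euclidean_space set \<Rightarrow> ('a \<Rightarrow> real) \<Rightarrow> real \<Rightarrow> ('a \<Rightarrow> real) set" where
  "Nehari_lim p \<Omega> b \<mu> = {u \<in> X_space p \<Omega>. nontrivial u \<and>
     E_lim p u u = (LINT x|lebesgue_on \<Omega>. (b x + \<mu> * ln \<bar>u x\<bar>) * \<bar>u x\<bar> powr p)}"

definition least_energy_sol_lim ::
  "real \<Rightarrow> 'a::euclidean_space set \<Rightarrow> ('a \<Rightarrow> real) \<Rightarrow> real \<Rightarrow> ('a \<Rightarrow> real) \<Rightarrow> bool" where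
  "least_energy_sol_lim p \<Omega> b \<mu> u \<longleftrightarrow> weak_sol_lim p \<Omega> b \<mu> u \<and>
     ereal (J_lim p \<Omega> b \<mu> u) = (INF v \<in> Nehari_lim p \<Omega> b \<mu>. ereal (J_lim p \<Omega> b \<mu> v))"

end

theory Submission
 imports Defs "HOL-Probability.Probability" "HOL-Real_Asymp.Real_Asymp" "HOL-Complex_Analysis.Great_Picard"
begin

text \<open>
 By (a\<open>\<^sub>0\<close>) and (a\<open>\<^sub>2\<close>), \<open>\<bar>a(s, \<cdot>) - 1\<bar> \<le> M s\<close>. As \<open>s \<rightarrow> 0\<close>, the fractional form is \<open>\<integral> h(u) v\<close> plus \<open>s\<close> times the
 form of the limit operator, up to \<open>o(s)\<close>, and \<open>\<integral> a |u|\<^sup>q\<close> is \<open>\<integral> |u|\<^sup>p\<close> plus \<open>s\<close> times its limit right-hand side \<open>LT\<close>. At first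
 order the Nehari identity of \<open>u\<^sub>s\<close> thus compares the two limit functionals. A Sobolev inequality that is sharp enough
 as \<open>s \<rightarrow> 0\<close> shows, because \<open>\<mu> < p\<^sup>2/N\<close>, that \<open>u\<^sub>s\<close> is bounded in \<open>X\<close> and bounded away from \<open>0\<close> in \<open>L\<^sup>p\<close>; \<open>X\<close> embeds
 compactly into \<open>L\<^sup>p\<close>, and Fatou's lemma in the expanded equation gives \<open>E0 u\<^sub>0 u\<^sub>0 \<le> LT u\<^sub>0 u\<^sub>0\<close> for a limit \<open>u\<^sub>0\<close>. Comparing
 \<open>u\<^sub>s\<close> with multiples of a Lipschitz function \<open>v\<close> on the Nehari set yields
 \<open>ln (\<integral> |u\<^sub>0|\<^sup>p) \<le> ln (\<integral> |v|\<^sup>p) + p (E0 v v - LT v v) / (\<mu> \<integral> |v|\<^sup>p)\<close>, which extends to all \<open>v \<in> X\<close> by density; only here is the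
 regularity of the boundary used. With \<open>v = u\<^sub>0\<close> this gives the Nehari identity of \<open>u\<^sub>0\<close>, so \<open>u\<^sub>0\<close> minimises the difference
 of the two sides: the first variation is the weak equation, and on the Nehari set the inequality says that the
 energy \<open>\<mu>/p\<^sup>2 \<integral> |v|\<^sup>p\<close> is least at \<open>u\<^sub>0\<close>.
\<close>

text \<open>Everything that matters happens at order \<open>s\<close>: the leading parts of the form
  and of the right-hand side are both the integral of \<open>\<bar>u\<bar> powr p\<close> and
  cancel. Estimates of leading terms must therefore have constants \<open>1 + O(s)\<close>, and a
  loss is affordable only at order \<open>s\<close>. For this reason the Sobolev inequality is
  proved with explicit constants, for the exponent \<open>p + s * p\<^sup>2 / N\<close>, equal to
  the critical one to first order. The exponent \<open>q(s)\<close>, about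
  \<open>p + \<mu> * s\<close>, interpolates between \<open>p\<close> and it with a weight tending
  to \<open>\<mu> * N / p\<^sup>2\<close>, and the gap between this and \<open>1\<close> absorbs
  both the energy and the loss. The second obstacle is the logarithm: no majorant is at hand when
  \<open>u\<^sub>s\<close> tests its own equation. Bounded truncations are used instead, against
  which the singular part of the form still has a sign. In the other direction a competitor needs
  finite energy of some positive order, which elements of X may lack; hence Lipschitz competitors.
  As the energy enters the comparison with a positive coefficient, density is needed only with an
  upper bound for the energy, which inward shifts and averaging provide.\<close>

abbreviation nn_integral_lborel :: "('a::euclidean_space \<Rightarrow> ennreal) \<Rightarrow> ennreal" (binder "\<integral>\<^sub>+" 10) where
 "nn_integral_lborel f \<equiv> nn_integral lborel f"

abbreviation incr :: "('a \<Rightarrow> real) \<Rightarrow> 'a \<times> 'a \<Rightarrow> real" where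
 "incr u z \<equiv> u (fst z) - u (snd z)"

abbreviation Upsilon_at :: "real \<Rightarrow> ('a \<Rightarrow> real) \<Rightarrow> ('a \<Rightarrow> real) \<Rightarrow> 'a \<times> 'a \<Rightarrow> real" where
 "Upsilon_at p u v z \<equiv> Upsilon p (u (fst z)) (u (snd z)) (v (fst z)) (v (snd z))"

section \<open>Elementary inequalities\<close>

lemma h_0 [simp]: "h p 0 = 0"
 by (simp add: h_def)

lemma integrable_dominated:
 fixes f g :: "'b \<Rightarrow> real"
 assumes "integrable N g" "f \<in> borel_measurable N" "\<And>x. \<bar>f x\<bar> \<le> g x"
 shows "integrable N f"
 by (rule Bochner_Integration.integrable_bound[OF assms(1,2)]) (auto intro!: AE_I2 order_trans[OF assms(3) abs_ge_self])

lemma powr_mult_self: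
 fixes x :: real
 assumes "0 \<le> x" shows "x powr y * x = x powr (y + 1)"
 using powr_mult_base[OF assms, of y] by (simp add: ac_simps)

lemma abs_h: "\<bar>h p t\<bar> = \<bar>t\<bar> powr (p - 1)"
 by (simp add: h_def abs_mult powr_mult_self)

lemma h_mult_self: "h p t * t = \<bar>t\<bar> powr p"
proof -
 have "h p t * t = \<bar>t\<bar> powr (p - 2) * \<bar>t\<bar> * \<bar>t\<bar>" by (simp add: h_def)
 then show ?thesis by (simp add: powr_mult_self)
qed

lemma h_measurable [measurable]: "h p \<in> borel_measurable borel"
 unfolding h_def[abs_def] by measurable

lemma h_sgn: "h p t = sgn t * \<bar>t\<bar> powr (p - 1)"
proof -
 have "h p t = sgn t * \<bar>h p t\<bar>" by (auto simp: h_def sgn_if abs_mult)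
 then show ?thesis by (simp add: abs_h)
qed

lemma h_mult_same_sign_nonneg:
 assumes "0 \<le> t * r" shows "0 \<le> h p t * r"
proof -
 have "h p t * r = \<bar>t\<bar> powr (p - 2) * (t * r)" by (simp add: h_def)
 then show ?thesis using assms by (metis mult_nonneg_nonneg powr_ge_zero)
qed

lemma powr_le_max: fixes a b :: real
 assumes "0 \<le> a" "0 \<le> b" "0 < p" shows "max a b powr p \<le> a powr p + b powr p"
 using assms by (cases "a \<le> b") (auto simp: max_def)

lemma powr_add_le:
 fixes a b :: real
 assumes "0 \<le> a" "0 \<le> b" "0 < p" shows "(a + b) powr p \<le> 2 powr p * (a powr p + b powr p)"
proof -
 have "(a + b) powr p \<le> (2 * max a b) powr p" using assms by (intro powr_mono2) auto
 also have "\<dots> = 2 powr p * max a b powr p" using assms by (simp add: powr_mult)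
 also have "\<dots> \<le> 2 powr p * (a powr p + b powr p)" using powr_le_max[OF assms] by simp
 finally show ?thesis .
qed

lemma abs_diff_powr_le:
 fixes a b :: real
 assumes "0 < p" shows "\<bar>a - b\<bar> powr p \<le> 2 powr p * (\<bar>a\<bar> powr p + \<bar>b\<bar> powr p)"
proof -
 have "\<bar>a - b\<bar> powr p \<le> (\<bar>a\<bar> + \<bar>b\<bar>) powr p" using assms by (intro powr_mono2) auto
 also have "\<dots> \<le> 2 powr p * (\<bar>a\<bar> powr p + \<bar>b\<bar> powr p)" using assms by (intro powr_add_le) auto
 finally show ?thesis .
qed

lemma abs_add_powr_le:
 fixes a b :: real
 assumes "0 < p" shows "\<bar>a + b\<bar> powr p \<le> 2 powr p * (\<bar>a\<bar> powr p + \<bar>b\<bar> powr p)"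
 using abs_diff_powr_le[OF assms, of a "-b"] by simp

lemma abs_h_mult_le:
 assumes "1 < p" shows "\<bar>h p a * b\<bar> \<le> \<bar>a\<bar> powr p + \<bar>b\<bar> powr p"
proof -
 let ?m = "max \<bar>a\<bar> \<bar>b\<bar>"
 have "\<bar>h p a * b\<bar> = \<bar>a\<bar> powr (p - 1) * \<bar>b\<bar>" by (simp add: abs_mult abs_h)
 also have "\<dots> \<le> ?m powr (p - 1) * ?m powr 1" using assms by (intro mult_mono powr_mono2) auto
 also have "\<dots> = ?m powr p" using powr_mult_self[of ?m "p - 1"] by simp
 also have "\<dots> \<le> \<bar>a\<bar> powr p + \<bar>b\<bar> powr p" using assms by (intro powr_le_max) auto
 finally show ?thesis .
qed

lemma abs_powr_has_derivative:
 assumes "1 < p"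
 shows "((\<lambda>t. \<bar>t\<bar> powr p) has_real_derivative p * h p t) (at t)"
proof (cases "t = 0")
 case True
 have "((\<lambda>y. \<bar>y\<bar> powr p / y) \<longlongrightarrow> 0) (at 0)"
 proof (rule Lim_null_comparison)
  show "\<forall>\<^sub>F y in at 0. norm (\<bar>y\<bar> powr p / y) \<le> \<bar>y\<bar> powr (p - 1)"
   unfolding eventually_at_filter
   by (rule always_eventually) (auto simp: powr_diff abs_mult divide_simps)
  have "((\<lambda>y::real. \<bar>y\<bar> powr (p - 1)) \<longlongrightarrow> \<bar>0\<bar> powr (p - 1)) (at 0)"
   using assms by (intro tendsto_powr' tendsto_rabs tendsto_ident_at) auto
  then show "((\<lambda>y::real. \<bar>y\<bar> powr (p - 1)) \<longlongrightarrow> 0) (at 0)" by simp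
 qed
 then show ?thesis using True assms by (simp add: has_field_derivative_iff)
next
 case False
 consider "t > 0" | "t < 0" using False by linarith
 then show ?thesis
 proof cases
  case 1
  have "((\<lambda>t. t powr p) has_real_derivative p * t powr (p - 1)) (at t)"
   using 1 by (auto intro!: derivative_eq_intros)
  then have "((\<lambda>t. \<bar>t\<bar> powr p) has_real_derivative p * t powr (p - 1)) (at t)"
   by (rule has_field_derivative_transform_within[where d = t]) (use 1 in \<open>auto simp: dist_real_def\<close>)
  then show ?thesis using 1 by (simp add: h_sgn)
 next
  case 2
  have "((\<lambda>t. (- t) powr p) has_real_derivative - (p * (- t) powr (p - 1))) (at t)"
   using 2 by (auto intro!: derivative_eq_intros)
  then have "((\<lambda>t. \<bar>t\<bar> powr p) has_real_derivative - (p * (- t) powr (p - 1))) (at t)"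
   by (rule has_field_derivative_transform_within[where d = "-t"]) (use 2 in \<open>auto simp: dist_real_def\<close>)
  then show ?thesis using 2 by (simp add: h_sgn)
 qed
qed

lemma isCont_h:
 assumes "1 < p" shows "isCont (h p) t"
proof -
 have "h p = (\<lambda>t. sgn t * \<bar>t\<bar> powr (p - 1))" by (auto simp: h_sgn)
 moreover have "isCont (\<lambda>t. sgn t * \<bar>t\<bar> powr (p - 1)) t"
 proof (cases "t = 0")
  case True
  have "((\<lambda>y. sgn y * \<bar>y\<bar> powr (p - 1)) \<longlongrightarrow> 0) (at 0)"
  proof (rule Lim_null_comparison)
   show "\<forall>\<^sub>F y in at 0. norm (sgn y * \<bar>y\<bar> powr (p - 1)) \<le> \<bar>y\<bar> powr (p - 1)"
    by (rule always_eventually) (auto simp: abs_mult sgn_if)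
   have "((\<lambda>y::real. \<bar>y\<bar> powr (p - 1)) \<longlongrightarrow> \<bar>0\<bar> powr (p - 1)) (at 0)"
    using assms by (intro tendsto_powr' tendsto_rabs tendsto_ident_at) auto
   then show "((\<lambda>y::real. \<bar>y\<bar> powr (p - 1)) \<longlongrightarrow> 0) (at 0)" by simp
  qed
  then show ?thesis using True by (simp add: isCont_def)
 next
  case False
  then show ?thesis using assms by (intro continuous_intros) (auto intro!: continuous_intros)
 qed
 ultimately show ?thesis by simp
qed

lemma abs_Upsilon_le:
 assumes "1 < p"
 shows "\<bar>Upsilon p z1 z2 t1 t2\<bar> \<le> (2 powr p + 1) * ((\<bar>z1\<bar> powr p + \<bar>z2\<bar> powr p) + (\<bar>t1\<bar> powr p + \<bar>t2\<bar> powr p))"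
proof -
 have "\<bar>Upsilon p z1 z2 t1 t2\<bar> \<le> \<bar>h p (z1 - z2) * (t1 - t2)\<bar> + \<bar>h p z1 * t1\<bar> + \<bar>h p z2 * t2\<bar>"
  unfolding Upsilon_def by linarith
 moreover have "\<bar>h p (z1 - z2) * (t1 - t2)\<bar> \<le> \<bar>z1 - z2\<bar> powr p + \<bar>t1 - t2\<bar> powr p"
   "\<bar>h p z1 * t1\<bar> \<le> \<bar>z1\<bar> powr p + \<bar>t1\<bar> powr p" "\<bar>h p z2 * t2\<bar> \<le> \<bar>z2\<bar> powr p + \<bar>t2\<bar> powr p"
  using assms by (auto intro!: abs_h_mult_le)
 moreover have "\<bar>z1 - z2\<bar> powr p \<le> 2 powr p * (\<bar>z1\<bar> powr p + \<bar>z2\<bar> powr p)"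
   "\<bar>t1 - t2\<bar> powr p \<le> 2 powr p * (\<bar>t1\<bar> powr p + \<bar>t2\<bar> powr p)"
  using assms by (auto intro!: abs_diff_powr_le)
 ultimately show ?thesis by (simp add: algebra_simps)
qed

section \<open>Radial integrals and the normalising constants\<close>

definition sphere_area :: "nat \<Rightarrow> real" where
 "sphere_area n = real n * unit_ball_vol (real n)"

lemma sphere_area_pos: "0 < n \<Longrightarrow> 0 < sphere_area n"
 by (simp add: sphere_area_def)

text \<open>Polar coordinates without a surface measure: the law of the norm is determined by its
  values on the half-lines \<open>{..r}\<close>. These are ball volumes, whose derivative in the
  radius is the density.\<close>

lemma distr_norm_lborel:
 "distr lborel borel (norm :: 'a::euclidean_space \<Rightarrow> real) =
   density lborel (\<lambda>r. ennreal (sphere_area DIM('a) * r ^ (DIM('a) - 1)) * indicator {0..} r)"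
 (is "?D = ?E")
proof (rule measure_eqI_generator_eq[where E = "range atMost" and A = "\<lambda>i. {.. real i}"])
 show "Int_stable (range (atMost :: real \<Rightarrow> _))"
  by (auto simp: Int_stable_def)
 show "range atMost \<subseteq> Pow (UNIV :: real set)" by simp
 show "sets ?D = sigma_sets UNIV (range atMost)" "sets ?E = sigma_sets UNIV (range atMost)"
  using borel_eq_atMost[where 'a = real] by (auto simp: image_def dest: arg_cong[of _ _ sets])
 show "range (\<lambda>i. {..real i}) \<subseteq> range atMost" by auto
 show "(\<Union>i. {..real i}) = UNIV" by (auto intro: real_arch_simple)
 have eq: "emeasure ?D {..r} = (if r < 0 then 0 else ennreal (unit_ball_vol DIM('a) * r ^ DIM('a)))" for r
 proof -
  have "emeasure ?D {..r} = emeasure lborel (norm -` {..r} \<inter> space lborel :: 'a set)"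
   by (simp add: emeasure_distr)
  also have "norm -` {..r} \<inter> space lborel = (cball 0 r :: 'a set)" by auto
  finally show ?thesis by (simp add: emeasure_cball)
 qed
 show "emeasure ?D {..real i} \<noteq> \<infinity>" for i by (simp add: eq)
 fix X :: "real set" assume "X \<in> range atMost"
 then obtain r where X: "X = {..r}" by auto
 show "emeasure ?D X = emeasure ?E X"
 proof (cases "r < 0")
  case True
  have "emeasure ?E X = 0"
   using True by (subst emeasure_density) (auto simp: X indicator_def intro!: nn_integral_zero' AE_I2)
  then show ?thesis using True by (simp add: X eq)
 next
  case False
  let ?w = "unit_ball_vol (real DIM('a))"
  have "emeasure ?E X = (\<integral>\<^sub>+x. ennreal (sphere_area DIM('a) * x ^ (DIM('a) - 1)) * indicator {0..r} x)"
   by (subst emeasure_density) (auto simp: X indicator_def intro!: nn_integral_cong)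
  also have "\<dots> = ennreal (?w * r ^ DIM('a) - ?w * 0 ^ DIM('a))"
   using False
   by (intro nn_integral_FTC_Icc)
     (auto intro!: derivative_eq_intros mult_nonneg_nonneg simp: sphere_area_def)
  also have "?w * r ^ DIM('a) - ?w * 0 ^ DIM('a) = ?w * r ^ DIM('a)" by simp
  finally show ?thesis using False by (simp add: X eq)
 qed
qed

lemma nn_integral_radial:
 assumes [measurable]: "f \<in> borel_measurable borel"
 shows "(\<integral>\<^sub>+z. f (norm (z::'a::euclidean_space))) =
   (\<integral>\<^sub>+r. ennreal (sphere_area DIM('a) * r ^ (DIM('a) - 1)) * indicator {0..} r * f r)"
proof -
 have "(\<integral>\<^sub>+z. f (norm (z::'a))) = (\<integral>\<^sup>+r. f r \<partial>distr lborel borel (norm :: 'a \<Rightarrow> real))"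
  by (simp add: nn_integral_distr)
 also have "\<dots> = (\<integral>\<^sub>+r. ennreal (sphere_area DIM('a) * r ^ (DIM('a) - 1)) * indicator {0..} r * f r)"
  unfolding distr_norm_lborel by (subst nn_integral_density) auto
 finally show ?thesis .
qed

lemma radial_powr:
 assumes "0 < r"
 shows "sphere_area DIM('a::euclidean_space) * r ^ (DIM('a) - 1) * r powr - (real DIM('a) + e)
    = sphere_area DIM('a) * r powr (- e - 1)"
proof -
 have "r ^ (DIM('a) - 1) * r powr - (real DIM('a) + e)
   = r powr (real DIM('a) - 1) * r powr - (real DIM('a) + e)"
  using assms by (simp add: powr_realpow[symmetric] of_nat_diff)
 also have "\<dots> = r powr ((real DIM('a) - 1) + - (real DIM('a) + e))" by (rule powr_add[symmetric])
 also have "(real DIM('a) - 1) + - (real DIM('a) + e) = - e - 1" by simp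
 finally have "r ^ (DIM('a) - 1) * r powr - (real DIM('a) + e) = r powr (- e - 1)" .
 then show ?thesis by (simp add: mult.assoc)
qed

text \<open>The antiderivative \<open>F\<close> is a parameter so that the power case and the
  logarithmic case \<open>e = 0\<close>, which have different primitives, share one
  computation.\<close>

lemma radial_annulus:
 assumes "0 < R" "R \<le> 1"
  and F: "\<And>r. R \<le> r \<Longrightarrow> r \<le> 1 \<Longrightarrow> (F has_real_derivative r powr (- e - 1)) (at r)"
 shows "(\<integral>\<^sub>+z. ennreal (indicator {R<..1} (norm z) * norm (z::'a::euclidean_space) powr - (real DIM('a) + e)))
   = ennreal (sphere_area DIM('a) * (F 1 - F R))"
proof -
 let ?S = "sphere_area DIM('a)"
 have S: "0 \<le> ?S" by (simp add: less_imp_le sphere_area_pos)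
 have "(\<integral>\<^sub>+z. ennreal (indicator {R<..1} (norm z) * norm (z::'a) powr - (real DIM('a) + e)))
  = (\<integral>\<^sub>+r. ennreal (?S * r ^ (DIM('a) - 1)) * indicator {0..} r
      * ennreal (indicator {R<..1} r * r powr - (real DIM('a) + e)))"
  by (rule nn_integral_radial) measurable
 also have "\<dots> = (\<integral>\<^sub>+r. ennreal (?S * r powr (- e - 1)) * indicator {R..1} r)"
 proof (rule nn_integral_cong_AE)
  have "AE r in lborel. r \<noteq> R" by (rule AE_lborel_singleton)
  then show "AE r in lborel. ennreal (?S * r ^ (DIM('a) - 1)) * indicator {0..} r
      * ennreal (indicator {R<..1} r * r powr - (real DIM('a) + e))
     = ennreal (?S * r powr (- e - 1)) * indicator {R..1} r"
  proof eventually_elim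
   case (elim r)
   then show ?case using assms radial_powr[of r e, where 'a='a] S
    by (auto simp: indicator_def simp flip: ennreal_mult)
  qed
 qed
 also have "\<dots> = ennreal (?S * F 1 - ?S * F R)"
  using assms S
  by (intro nn_integral_FTC_Icc) (auto intro!: DERIV_cmult F[THEN has_field_derivative_at_within])
 finally show ?thesis by (simp add: right_diff_distrib)
qed

lemma radial_annulus_powr:
 assumes "0 < R" "R \<le> 1" "e \<noteq> 0"
 shows "(\<integral>\<^sub>+z. ennreal (indicator {R<..1} (norm z) * norm (z::'a::euclidean_space) powr - (real DIM('a) + e)))
   = ennreal (sphere_area DIM('a) / e * (R powr - e - 1))"
proof -
 have "((\<lambda>r. - (r powr - e) / e) has_real_derivative r powr (- e - 1)) (at r)" if "R \<le> r" for r
  using that assms by (auto intro!: derivative_eq_intros)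
 from radial_annulus[OF assms(1,2) this, where 'a='a]
 show ?thesis using assms by (simp add: field_simps)
qed

lemma radial_annulus_log:
 assumes "0 < R" "R \<le> 1"
 shows "(\<integral>\<^sub>+z. ennreal (indicator {R<..1} (norm z) * norm (z::'a::euclidean_space) powr - real DIM('a)))
   = ennreal (sphere_area DIM('a) * ln (1 / R))"
proof -
 have "(ln has_real_derivative r powr (- 0 - 1)) (at r)" if "R \<le> r" for r
  using that assms by (auto intro!: derivative_eq_intros simp: powr_minus divide_inverse)
 from radial_annulus[OF assms(1,2) this, where 'a='a]
 show ?thesis using assms by (simp add: ln_div)
qed

lemma radial_exterior:
 assumes "0 < e"
 shows "(\<integral>\<^sub>+z. ennreal (indicator {1<..} (norm z) * norm (z::'a::euclidean_space) powr - (real DIM('a) + e)))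
   = ennreal (sphere_area DIM('a) / e)"
proof -
 let ?S = "sphere_area DIM('a)"
 have S: "0 \<le> ?S" by (simp add: less_imp_le sphere_area_pos)
 have "(\<integral>\<^sub>+z. ennreal (indicator {1<..} (norm z) * norm (z::'a) powr - (real DIM('a) + e)))
  = (\<integral>\<^sub>+r. ennreal (?S * r ^ (DIM('a) - 1)) * indicator {0..} r
      * ennreal (indicator {1<..} r * r powr - (real DIM('a) + e)))"
  by (rule nn_integral_radial) measurable
 also have "\<dots> = (\<integral>\<^sub>+r. ennreal (?S * r powr (- e - 1)) * indicator {1..} r)"
 proof (rule nn_integral_cong_AE)
  have "AE r in lborel. r \<noteq> (1::real)" by (rule AE_lborel_singleton)
  then show "AE r in lborel. ennreal (?S * r ^ (DIM('a) - 1)) * indicator {0..} r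
      * ennreal (indicator {1<..} r * r powr - (real DIM('a) + e))
     = ennreal (?S * r powr (- e - 1)) * indicator {1..} r"
  proof eventually_elim
   case (elim r)
   then show ?case using radial_powr[of r e, where 'a='a] S
    by (auto simp: indicator_def simp flip: ennreal_mult)
  qed
 qed
 also have "\<dots> = ennreal (0 - ?S * (- (1 powr - e) / e))"
 proof (rule nn_integral_FTC_atLeast)
  show "((\<lambda>r. ?S * (- (r powr - e) / e)) has_real_derivative ?S * r powr (- e - 1)) (at r)" if "1 \<le> r" for r
   using that assms by (auto intro!: derivative_eq_intros)
  have "((\<lambda>r. ?S * (- (r powr - e) / e)) \<longlongrightarrow> ?S * (- 0 / e)) at_top"
   using assms by (intro tendsto_intros tendsto_neg_powr filterlim_ident) auto
  then show "((\<lambda>r. ?S * (- (r powr - e) / e)) \<longlongrightarrow> 0) at_top" by simp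
 qed (use S in auto)
 finally show ?thesis by simp
qed

lemma radial_ball_finite:
 assumes "0 < b"
 shows "(\<integral>\<^sub>+z. ennreal (indicator {..1} (norm z) * norm (z::'a::euclidean_space) powr - (real DIM('a) - b))) < \<infinity>"
proof -
 \<comment> \<open>The ball is exhausted by annuli, so that the integrals are only computed away
   from the singularity. The origin itself is harmless because \<open>0 powr _ = 0\<close>.\<close>
 let ?f = "\<lambda>n (z::'a). ennreal (indicator {1 / real (Suc n)<..1} (norm z) * norm z powr - (real DIM('a) - b))"
 have inc: "incseq ?f"
 proof (rule incseq_SucI, rule le_funI)
  fix n and z :: 'a
  have "1 / real (Suc (Suc n)) \<le> 1 / real (Suc n)" by (intro divide_left_mono) auto
  then show "?f n z \<le> ?f (Suc n) z" by (auto simp: indicator_def)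
 qed
 have "(\<integral>\<^sub>+z. ennreal (indicator {..1} (norm z) * norm (z::'a) powr - (real DIM('a) - b)))
   = (\<integral>\<^sub>+z. (SUP n. ?f n z))"
 proof (rule nn_integral_cong)
  fix z :: 'a
  have "\<exists>n. 1 / real (Suc n) < norm z" if "z \<noteq> 0"
   using that nat_approx_posE[of "norm z"] by auto
  then obtain n where n: "z \<noteq> 0 \<Longrightarrow> 1 / real (Suc n) < norm z" by blast
  show "ennreal (indicator {..1} (norm z) * norm (z::'a) powr - (real DIM('a) - b)) = (SUP n. ?f n z)"
  proof (rule antisym)
   have "ennreal (indicator {..1} (norm z) * norm (z::'a) powr - (real DIM('a) - b)) \<le> ?f n z"
    using n by (cases "z = 0") (auto simp: indicator_def)
   then show "ennreal (indicator {..1} (norm z) * norm (z::'a) powr - (real DIM('a) - b)) \<le> (SUP n. ?f n z)"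
    by (rule SUP_upper2[rotated]) simp
  qed (auto intro!: SUP_least simp: indicator_def)
 qed
 also have "\<dots> = (SUP n. \<integral>\<^sup>+z. ?f n z \<partial>lborel)"
  using inc by (intro nn_integral_monotone_convergence_SUP) measurable
 also have "\<dots> \<le> ennreal (sphere_area DIM('a) / b)"
 proof (rule SUP_least)
  fix n
  have "(\<integral>\<^sub>+z. ?f n z) = ennreal (sphere_area DIM('a) / (- b) * ((1 / real (Suc n)) powr b - 1))"
   using radial_annulus_powr[of "1 / real (Suc n)" "- b", where 'a='a] assms by simp
  also have "\<dots> \<le> ennreal (sphere_area DIM('a) / b)"
  proof (rule ennreal_leI)
   have "sphere_area DIM('a) / (- b) * ((1 / real (Suc n)) powr b - 1)
     = sphere_area DIM('a) / b * (1 - (1 / real (Suc n)) powr b)" using assms by (simp add: field_simps)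
   also have "\<dots> \<le> sphere_area DIM('a) / b * 1"
    using assms sphere_area_pos[of "DIM('a)"] by (intro mult_left_mono) auto
   finally show "sphere_area DIM('a) / (- b) * ((1 / real (Suc n)) powr b - 1) \<le> sphere_area DIM('a) / b" by simp
  qed
  finally show "(\<integral>\<^sub>+z. ?f n z) \<le> ennreal (sphere_area DIM('a) / b)" .
 qed
 finally show ?thesis by (simp add: le_less_trans)
qed

text \<open>The coefficient of the zero order term of the fractional form: the far kernel has mass
  \<open>sphere_area / (s * p)\<close> in each variable, and this times \<open>C_frac\<close> is
  \<open>kappa\<close>. It equals \<open>1\<close> at \<open>s = 0\<close> and so separates the
  leading term from the first order correction.\<close>

definition kappa :: "nat \<Rightarrow> real \<Rightarrow> real \<Rightarrow> real" where
 "kappa n p s = 2 powr (2 * s) * Gamma ((real n + s * p) / 2) / (Gamma (real n / 2) * Gamma (1 - s))"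

lemma C_frac_kappa:
 assumes "0 < n"
 shows "C_frac n s p * sphere_area n = s * p * kappa n p s"
proof -
 have "unit_ball_vol (real n) * real n * Gamma (real n / 2) = 2 * pi powr (real n / 2)"
  using Gamma_plus1[of "real n / 2"] assms
  by (simp add: unit_ball_vol_def field_simps Gamma_eq_zero_iff nonpos_Ints_def)
 then have S: "sphere_area n = 2 * pi powr (real n / 2) / Gamma (real n / 2)"
  using assms by (simp add: sphere_area_def field_simps Gamma_eq_zero_iff nonpos_Ints_def)
 have "(2::real) powr (2 * s - 1) = 2 powr (2 * s) / 2" by (simp add: powr_diff)
 then show ?thesis by (simp only: C_frac_def kappa_def S) (simp add: mult_ac)
qed

lemma C_lim_sphere_area:
 assumes "0 < n" shows "C_lim n p * sphere_area n = p"
proof -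
 have "unit_ball_vol (real n) * real n * Gamma (real n / 2) = 2 * pi powr (real n / 2)"
  using Gamma_plus1[of "real n / 2"] assms
  by (simp add: unit_ball_vol_def field_simps Gamma_eq_zero_iff nonpos_Ints_def)
 then show ?thesis
  using assms by (simp add: sphere_area_def C_lim_def field_simps Gamma_eq_zero_iff nonpos_Ints_def)
qed

lemma kappa_pos:
 assumes "0 < n" "0 \<le> s" "s < 1" "0 < p" shows "0 < kappa n p s"
 using assms unfolding kappa_def
 by (intro divide_pos_pos mult_pos_pos) (auto intro!: Gamma_real_pos add_pos_nonneg)

lemma kappa_0: "0 < n \<Longrightarrow> kappa n p 0 = 1"
 by (simp add: kappa_def Gamma_eq_zero_iff nonpos_Ints_def)

text \<open>Since \<open>kappa\<close> is \<open>1\<close> at \<open>0\<close>, its derivative there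
  is the logarithmic one: \<open>2 * ln 2\<close> comes from the power of \<open>2\<close>,
  \<open>p / 2 * Digamma (n / 2)\<close> from the Gamma factor in the numerator, and
  \<open>Digamma 1 = - euler_mascheroni\<close> from \<open>Gamma (1 - s)\<close>. Thus
  \<open>rho\<close> is produced by the normalisation and the far mass.\<close>

lemma kappa_has_derivative:
 assumes "0 < n"
 shows "((\<lambda>s. kappa n p s) has_real_derivative rho n p) (at 0)"
proof -
 let ?g = "Gamma (real n / 2)"
 have g: "?g > 0" using assms by (intro Gamma_real_pos) auto
 have ni: "real n / 2 \<notin> \<int>\<^sub>\<le>\<^sub>0" using assms by (auto simp: nonpos_Ints_def)
 have ni1: "(1::real) \<notin> \<int>\<^sub>\<le>\<^sub>0" by (auto simp: nonpos_Ints_def)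
 show ?thesis
  unfolding kappa_def
  using g ni ni1
  by (auto intro!: derivative_eq_intros simp: rho_def field_simps)
qed

section \<open>Near and far parts of the Gagliardo form\<close>

lemma fst_borel_measurable [measurable]:
 "(fst :: 'a::euclidean_space \<times> 'b::euclidean_space \<Rightarrow> 'a) \<in> borel_measurable borel"
 by (intro borel_measurable_continuous_onI continuous_intros)

lemma snd_borel_measurable [measurable]:
 "(snd :: 'a::euclidean_space \<times> 'b::euclidean_space \<Rightarrow> 'b) \<in> borel_measurable borel"
 by (intro borel_measurable_continuous_onI continuous_intros)

lemma Pair_borel_measurable [measurable]: "(\<lambda>y. (x::'a::euclidean_space, y::'b::euclidean_space)) \<in> borel_measurable borel"
 "(\<lambda>x. (x::'a::euclidean_space, y::'b::euclidean_space)) \<in> borel_measurable borel"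
 by (intro borel_measurable_continuous_onI continuous_intros)+

lemma nn_integral_pair_lborel:
 fixes f :: "'a::euclidean_space \<times> 'b::euclidean_space \<Rightarrow> ennreal"
 assumes "f \<in> borel_measurable borel"
 shows "(\<integral>\<^sub>+z. f z) = (\<integral>\<^sub>+x. \<integral>\<^sub>+y. f (x, y))"
  and "(\<integral>\<^sub>+z. f z) = (\<integral>\<^sub>+y. \<integral>\<^sub>+x. f (x, y))"
proof -
 have f: "f \<in> borel_measurable (lborel \<Otimes>\<^sub>M lborel)" using assms by (simp add: lborel_prod)
 from lborel.nn_integral_fst[OF f] lborel_pair.nn_integral_snd[of "\<lambda>(x, y). f (x, y)"] f
 show "(\<integral>\<^sub>+z. f z) = (\<integral>\<^sub>+x. \<integral>\<^sub>+y. f (x, y))"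
  "(\<integral>\<^sub>+z. f z) = (\<integral>\<^sub>+y. \<integral>\<^sub>+x. f (x, y))"
  by (simp_all add: lborel_prod)
qed

lemma nn_integral_lborel_shift:
 fixes c :: "'a::euclidean_space"
 assumes "f \<in> borel_measurable borel"
 shows "(\<integral>\<^sub>+x. f (c + x)) = (\<integral>\<^sub>+x. f x)"
 using nn_integral_distr[of "(+) c" lborel borel f] assms by (simp add: lborel_distr_plus)

lemma nn_integral_lborel_shift':
 fixes c :: "'a::euclidean_space"
 assumes "f \<in> borel_measurable borel"
 shows "(\<integral>\<^sub>+x. f (x - c)) = (\<integral>\<^sub>+x. f x)"
 using nn_integral_lborel_shift[OF assms, of "-c"] by simp

lemma nn_integral_lborel_minus:
 fixes f :: "'a::euclidean_space \<Rightarrow> ennreal"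
 assumes [measurable]: "f \<in> borel_measurable borel"
 shows "(\<integral>\<^sub>+x. f (- x)) = (\<integral>\<^sub>+x. f x)"
proof -
 have "distr lborel borel (uminus :: 'a \<Rightarrow> 'a) = lborel"
  using lborel_affine[of "-1" "0::'a"] by (simp add: density_1)
 then show ?thesis using nn_integral_distr[of "uminus" lborel borel f] by simp
qed

lemma nn_integral_lborel_reflect:
 fixes c :: "'a::euclidean_space"
 assumes [measurable]: "f \<in> borel_measurable borel"
 shows "(\<integral>\<^sub>+x. f (c - x)) = (\<integral>\<^sub>+x. f x)"
proof -
 have "(\<integral>\<^sub>+x. f (c - x)) = (\<integral>\<^sub>+x. f (c + x))"
  using nn_integral_lborel_minus[of "\<lambda>x. f (c + x)"] by simp
 then show ?thesis by (simp add: nn_integral_lborel_shift)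
qed

lemma AE_lborel_pair:
 assumes "AE x in lborel. P x"
 shows "AE z in lborel. P (fst (z :: 'a::euclidean_space \<times> 'b::euclidean_space))"
 and "AE z in lborel. P (snd (z :: 'b::euclidean_space \<times> 'a::euclidean_space))"
proof -
 obtain A where "{x \<in> space lborel. \<not> P x} \<subseteq> A" "emeasure lborel A = 0" "A \<in> sets lborel"
  using assms by (rule AE_E)
 then have A: "A \<in> null_sets lborel" "{x. \<not> P x} \<subseteq> A" by auto
 have [measurable]: "A \<in> sets borel" using A by auto
 have "(\<integral>\<^sup>+z. indicator A (fst z) \<partial>(lborel :: ('a \<times> 'b) measure)) = 0"
  using A by (subst nn_integral_pair_lborel(2)) (auto simp: null_sets_def)
 then have "AE z in (lborel :: ('a \<times> 'b) measure). indicator A (fst z) = (0::ennreal)"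
  by (subst (asm) nn_integral_0_iff_AE) auto
 then show "AE z in lborel. P (fst (z :: 'a \<times> 'b))"
  by eventually_elim (use A in \<open>auto simp: indicator_def split: if_splits\<close>)
 have "(\<integral>\<^sup>+z. indicator A (snd z) \<partial>(lborel :: ('b \<times> 'a) measure)) = 0"
  using A by (subst nn_integral_pair_lborel(1)) (auto simp: null_sets_def)
 then have "AE z in (lborel :: ('b \<times> 'a) measure). indicator A (snd z) = (0::ennreal)"
  by (subst (asm) nn_integral_0_iff_AE) auto
 then show "AE z in lborel. P (snd (z :: 'b \<times> 'a))"
  by eventually_elim (use A in \<open>auto simp: indicator_def split: if_splits\<close>)
qed

text \<open>The parameter \<open>e\<close> is \<open>s * p\<close> for the fractional form and
  \<open>0\<close> for the limit form; a negative \<open>e\<close> occurs once a Lipschitz factor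
  has been used to lower the singularity. On the diagonal the value is \<open>0\<close>.\<close>

definition kn :: "real \<Rightarrow> 'a::euclidean_space \<times> 'a \<Rightarrow> real" where
 "kn e z = indicator {..1} (norm (fst z - snd z)) * norm (fst z - snd z) powr - (real DIM('a) + e)"

definition kf :: "real \<Rightarrow> 'a::euclidean_space \<times> 'a \<Rightarrow> real" where
 "kf e z = indicator {1<..} (norm (fst z - snd z)) * norm (fst z - snd z) powr - (real DIM('a) + e)"

lemma kn_measurable [measurable]: "kn e \<in> borel_measurable borel"
 unfolding kn_def[abs_def] by measurable

lemma kf_measurable [measurable]: "kf e \<in> borel_measurable borel"
 unfolding kf_def[abs_def] by measurable

lemma kn_nonneg [simp]: "0 \<le> kn e z" and kf_nonneg [simp]: "0 \<le> kf e z"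
 by (auto simp: kn_def kf_def)

lemma kn_plus_kf: "kn e (x, y) + kf e (x, y) = norm (x - y) powr - (real DIM('a) + e)"
 for x y :: "'a::euclidean_space"
 by (auto simp: kn_def kf_def indicator_def)

lemma kn_sym: "kn e (x, y) = kn e (y, x)" and kf_sym: "kf e (x, y) = kf e (y, x)"
 by (auto simp: kn_def kf_def norm_minus_commute)

lemma kn_weight: "norm (fst z - snd z) powr a * kn e z = kn (e - a) (z :: 'a::euclidean_space \<times> 'a)"
proof -
 let ?n = "norm (fst z - snd z)"
 have "?n powr a * ?n powr - (real DIM('a) + e) = ?n powr (a + - (real DIM('a) + e))" by (rule powr_add[symmetric])
 also have "a + - (real DIM('a) + e) = - (real DIM('a) + (e - a))" by simp
 finally show ?thesis by (simp add: kn_def mult.left_commute)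
qed

lemma kf_le_1: "0 \<le> e \<Longrightarrow> kf e z \<le> 1"
proof -
 assume "0 \<le> e"
 then have "a powr - (real n + e) \<le> 1" if "1 < a" for a :: real and n
  using powr_mono[of "- (real n + e)" 0 a] that by simp
 then show ?thesis unfolding kf_def by (cases "1 < norm (fst z - snd z)") simp_all
qed

lemma kn_mono: "e \<le> e' \<Longrightarrow> kn e z \<le> kn e' z"
proof -
 assume "e \<le> e'"
 moreover have "a powr - (n + e) \<le> a powr - (n + e')" if "0 < a" "a \<le> 1" "e \<le> e'" for a n :: real
  using powr_mono'[of "- (n + e')" "- (n + e)" a] that by simp
 ultimately show ?thesis
  by (cases "fst z = snd z") (auto simp: kn_def indicator_def)
qed

lemma nn_integral_kf:
 assumes "0 < e"
 shows "(\<integral>\<^sub>+y. ennreal (kf e (x::'a::euclidean_space, y))) = ennreal (sphere_area DIM('a) / e)"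
proof -
 have "(\<integral>\<^sub>+y. ennreal (kf e (x, y))) =
   (\<integral>\<^sub>+z. ennreal (indicator {1<..} (norm z) * norm (z::'a) powr - (real DIM('a) + e)))"
  unfolding kf_def fst_conv snd_conv
  by (rule nn_integral_lborel_reflect[where f = "\<lambda>z. ennreal (indicator {1<..} (norm z) * norm (z::'a) powr - (real DIM('a) + e))"]) measurable
 then show ?thesis by (simp only: radial_exterior[OF assms])
qed

lemma nn_integral_kn_finite:
 assumes "e < 0"
 shows "(\<integral>\<^sub>+y. ennreal (kn e (x::'a::euclidean_space, y)))
   = (\<integral>\<^sub>+y. ennreal (kn e (0::'a, y)))"
  and "(\<integral>\<^sub>+y. ennreal (kn e (0::'a::euclidean_space, y))) < \<infinity>"
proof -
 have *: "(\<integral>\<^sub>+y. ennreal (kn e (x, y))) =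
   (\<integral>\<^sub>+z. ennreal (indicator {..1} (norm z) * norm (z::'a) powr - (real DIM('a) + e)))" for x :: 'a
  unfolding kn_def fst_conv snd_conv
  by (rule nn_integral_lborel_reflect[where f = "\<lambda>z. ennreal (indicator {..1} (norm z) * norm (z::'a) powr - (real DIM('a) + e))"]) measurable
 show "(\<integral>\<^sub>+y. ennreal (kn e (x, y))) = (\<integral>\<^sub>+y. ennreal (kn e (0::'a, y)))"
  by (simp only: *)
 show "(\<integral>\<^sub>+y. ennreal (kn e (0::'a, y))) < \<infinity>"
  unfolding * using radial_ball_finite[of "-e", where 'a='a] assms by simp
qed

lemma integrable_kf_fst:
 fixes f :: "'a::euclidean_space \<Rightarrow> real"
 assumes "0 < e" and f: "integrable lborel f"
 shows "integrable lborel (\<lambda>z. f (fst z) * kf e z)" "integrable lborel (\<lambda>z. f (snd z) * kf e z)"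
  and "(LBINT z. f (fst z) * kf e z) = sphere_area DIM('a) / e * (LBINT x. f x)"
  and "(LBINT z. f (snd z) * kf e z) = sphere_area DIM('a) / e * (LBINT x. f x)"
proof -
 have [measurable]: "f \<in> borel_measurable borel" using borel_measurable_integrable[OF f] by simp
 let ?c = "sphere_area DIM('a) / e"
 have c: "0 \<le> ?c" using assms sphere_area_pos[of "DIM('a)"] by simp
 have fin: "(\<integral>\<^sub>+x. ennreal \<bar>f x\<bar>) < \<infinity>" using f by (simp add: integrable_iff_bounded)
 have swap: "(\<integral>\<^sub>+x. ennreal (kf e (x, y))) = ennreal ?c" for y :: 'a
  using nn_integral_kf[OF assms(1), of y] by (simp add: kf_sym[of e _ y])
 have "(\<integral>\<^sub>+z. ennreal (norm (f (fst z) * kf e z)))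
   = (\<integral>\<^sub>+x. (\<integral>\<^sub>+y. ennreal \<bar>f x\<bar> * ennreal (kf e (x, y))))"
  by (subst nn_integral_pair_lborel(1)) (auto simp: abs_mult ennreal_mult)
 also have "\<dots> = (\<integral>\<^sub>+x. ennreal \<bar>f x\<bar>) * ennreal ?c"
  by (subst nn_integral_cmult, simp) (simp add: nn_integral_kf[OF assms(1)] nn_integral_multc)
 finally show 1: "integrable lborel (\<lambda>z. f (fst z) * kf e z)"
  using fin by (intro integrableI_bounded) (auto simp: ennreal_mult_less_top)
 have "(\<integral>\<^sub>+z. ennreal (norm (f (snd z) * kf e z)))
   = (\<integral>\<^sub>+y. (\<integral>\<^sub>+x. ennreal \<bar>f y\<bar> * ennreal (kf e (x, y))))"
  by (subst nn_integral_pair_lborel(2)) (auto simp: abs_mult ennreal_mult)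
 also have "\<dots> = (\<integral>\<^sub>+x. ennreal \<bar>f x\<bar>) * ennreal ?c"
  by (subst nn_integral_cmult, simp) (simp add: swap nn_integral_multc)
 finally show 2: "integrable lborel (\<lambda>z. f (snd z) * kf e z)"
  using fin by (intro integrableI_bounded) (auto simp: ennreal_mult_less_top)
 have k: "(LBINT y. kf e (x, y)) = ?c" "(LBINT y. kf e (y, x)) = ?c" for x :: 'a
  using nn_integral_kf[OF assms(1), of x] swap[of x] c by (auto intro!: integral_eq_nn_integral[THEN trans])
 have "(LBINT z. f (fst z) * kf e z) = (LBINT x. (LBINT y. f x * kf e (x, y)))"
  using lborel_pair.integral_fst'[of "\<lambda>z. f (fst z) * kf e z"] 1 by (simp add: lborel_prod)
 then show "(LBINT z. f (fst z) * kf e z) = ?c * (LBINT x. f x)"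
  by (simp add: k)
 have "(LBINT z. f (snd z) * kf e z) = (LBINT y. (LBINT x. f y * kf e (x, y)))"
  using lborel_pair.integral_snd[of "\<lambda>x y. f y * kf e (x, y)"] 2 by (simp add: lborel_prod case_prod_beta')
 then show "(LBINT z. f (snd z) * kf e z) = ?c * (LBINT x. f x)"
  by (simp add: k)
qed

definition near :: "real \<Rightarrow> real \<Rightarrow> ('a::euclidean_space \<Rightarrow> real) \<Rightarrow> ('a \<Rightarrow> real) \<Rightarrow> real" where
 "near p e u v = (LBINT z. h p (incr u z) * (incr v z) * kn e z)"

definition far :: "real \<Rightarrow> real \<Rightarrow> ('a::euclidean_space \<Rightarrow> real) \<Rightarrow> ('a \<Rightarrow> real) \<Rightarrow> real" where
 "far p e u v = (LBINT z. Upsilon_at p u v z * kf e z)"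

text \<open>The Borel measurable elements of \<open>X\<close> (for \<open>e = 0\<close>) and of \<open>W\<^sub>0\<^sup>s\<^sup>,\<^sup>p\<close> (for \<open>e = s p\<close>).\<close>

definition Xe :: "real \<Rightarrow> 'a::euclidean_space set \<Rightarrow> real \<Rightarrow> ('a \<Rightarrow> real) set" where
 "Xe p \<Omega> e = {u \<in> borel_measurable borel. (\<forall>x. x \<notin> \<Omega> \<longrightarrow> u x = 0) \<and>
   integrable lborel (\<lambda>x. \<bar>u x\<bar> powr p) \<and>
   integrable lborel (\<lambda>z. \<bar>incr u z\<bar> powr p * kn e z)}"

lemma XeD:
 assumes "u \<in> Xe p \<Omega> e"
 shows "u \<in> borel_measurable borel" "\<And>x. x \<notin> \<Omega> \<Longrightarrow> u x = 0"
  "integrable lborel (\<lambda>x. \<bar>u x\<bar> powr p)"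
  "integrable lborel (\<lambda>z. \<bar>incr u z\<bar> powr p * kn e z)"
 using assms by (auto simp: Xe_def)

lemma Xe_antimono:
 assumes "e \<le> e'" "u \<in> Xe p \<Omega> e'" shows "u \<in> Xe p \<Omega> e"
proof -
 note [measurable] = XeD(1)[OF assms(2)]
 have "integrable lborel (\<lambda>z. \<bar>incr u z\<bar> powr p * kn e z)"
  by (rule Bochner_Integration.integrable_bound[OF XeD(4)[OF assms(2)]])
    (auto intro!: mult_left_mono kn_mono assms)
 then show ?thesis using assms by (auto simp: Xe_def)
qed

lemma near_self: "near p e u u = (LBINT z. \<bar>incr u z\<bar> powr p * kn e z)"
 by (simp add: near_def h_mult_self)

lemma near_self_nonneg: "0 \<le> near p e u u"
 unfolding near_self by (intro integral_nonneg_AE) auto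

lemma nn_integral_near:
 assumes "u \<in> Xe p \<Omega> e"
 shows "(\<integral>\<^sub>+z. ennreal (\<bar>incr u z\<bar> powr p * kn e z)) = ennreal (near p e u u)"
 unfolding near_self using XeD[OF assms] by (intro nn_integral_eq_integral) auto

lemma integrable_h_mult:
 fixes u v :: "'a::euclidean_space \<Rightarrow> real"
 assumes "1 < p" and [measurable]: "u \<in> borel_measurable borel" "v \<in> borel_measurable borel"
  and i: "integrable lborel (\<lambda>x. \<bar>u x\<bar> powr p)" "integrable lborel (\<lambda>x. \<bar>v x\<bar> powr p)"
 shows "integrable lborel (\<lambda>x. h p (u x) * v x)"
 by (rule Bochner_Integration.integrable_bound[OF Bochner_Integration.integrable_add[OF i]])
   (use abs_h_mult_le[OF assms(1)] in auto)

lemma near_bound: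
 assumes "1 < p"
 shows "\<bar>h p a * b * kn e z\<bar> \<le> \<bar>a\<bar> powr p * kn e z + \<bar>b\<bar> powr p * kn e z"
 using mult_right_mono[OF abs_h_mult_le[OF assms, of a b] kn_nonneg[of e z]]
 by (simp add: abs_mult distrib_right)

lemma near_integrable:
 assumes "1 < p" and u: "u \<in> Xe p \<Omega> e" and v: "v \<in> Xe p \<Omega> e"
 shows "integrable lborel (\<lambda>z. h p (incr u z) * (incr v z) * kn e z)"
proof -
 note [measurable] = XeD(1)[OF u] XeD(1)[OF v]
 show ?thesis
  by (rule integrable_dominated[OF Bochner_Integration.integrable_add[OF XeD(4)[OF u] XeD(4)[OF v]] _ near_bound[OF assms(1)]]) measurable
qed

text \<open>Suited to \<open>Upsilon\<close>, whose contribution vanishes as soon as one of the two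
  points lies outside \<open>\<Omega>\<close>. On pairs inside \<open>\<Omega>\<close> the bound
  \<open>kf e z \<le> 1\<close>, uniform in \<open>e \<ge> 0\<close>, and the finite measure of
  \<open>\<Omega>\<close> give a majorant that survives the limit \<open>e \<rightarrow> 0\<close>,
  where the far kernel stops being integrable in one variable.\<close>

definition far_maj :: "'a set \<Rightarrow> ('a \<Rightarrow> real) \<Rightarrow> 'a::euclidean_space \<times> 'a \<Rightarrow> real" where
 "far_maj \<Omega> f z = f (fst z) * indicator \<Omega> (snd z) + indicator \<Omega> (fst z) * f (snd z)"

lemma far_maj_integrable:
 fixes f :: "'a::euclidean_space \<Rightarrow> real"
 assumes \<Omega>: "bounded \<Omega>" "open \<Omega>" and f: "integrable lborel f"
 shows "integrable lborel (far_maj \<Omega> f)"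
  and "(LBINT z. far_maj \<Omega> f z) = 2 * measure lborel \<Omega> * (LBINT x. f x)"
proof -
 have [measurable]: "\<Omega> \<in> sets borel" "f \<in> borel_measurable borel" using \<Omega> borel_measurable_integrable[OF f] by auto
 have em: "emeasure lborel \<Omega> < \<infinity>" by (rule emeasure_bounded_finite[OF \<Omega>(1)])
 have fin: "(\<integral>\<^sub>+x. ennreal \<bar>f x\<bar>) < \<infinity>" using f by (simp add: integrable_iff_bounded)
 have "(\<integral>\<^sup>+z. ennreal (norm (f (fst z) * indicator \<Omega> (snd z))) \<partial>(lborel :: ('a \<times> 'a) measure))
   = (\<integral>\<^sub>+x. (\<integral>\<^sub>+y. ennreal \<bar>f x\<bar> * indicator \<Omega> y))"
  by (subst nn_integral_pair_lborel(1)) (auto simp: abs_mult indicator_def intro!: nn_integral_cong)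
 also have "\<dots> = (\<integral>\<^sub>+x. ennreal \<bar>f x\<bar>) * emeasure lborel \<Omega>"
  by (simp add: nn_integral_cmult nn_integral_multc)
 finally have 1: "integrable lborel (\<lambda>z. f (fst z) * indicator \<Omega> (snd z) :: real)"
  using fin em by (intro integrableI_bounded) (auto simp: ennreal_mult_less_top)
 have "(\<integral>\<^sup>+z. ennreal (norm (indicator \<Omega> (fst z) * f (snd z))) \<partial>(lborel :: ('a \<times> 'a) measure))
   = (\<integral>\<^sub>+y. (\<integral>\<^sub>+x. ennreal \<bar>f y\<bar> * indicator \<Omega> x))"
  by (subst nn_integral_pair_lborel(2)) (auto simp: abs_mult indicator_def intro!: nn_integral_cong)
 also have "\<dots> = (\<integral>\<^sub>+x. ennreal \<bar>f x\<bar>) * emeasure lborel \<Omega>"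
  by (simp add: nn_integral_cmult nn_integral_multc)
 finally have 2: "integrable lborel (\<lambda>z. indicator \<Omega> (fst z) * f (snd z) :: real)"
  using fin em by (intro integrableI_bounded) (auto simp: ennreal_mult_less_top)
 show "integrable lborel (far_maj \<Omega> f)" unfolding far_maj_def[abs_def] using 1 2 by simp
 have "(LBINT z. f (fst z) * indicator \<Omega> (snd z)) = (LBINT x. (LBINT y. f x * indicator \<Omega> y))"
  using lborel_pair.integral_fst'[of "\<lambda>z. f (fst z) * indicator \<Omega> (snd z)"] 1 by (simp add: lborel_prod)
 moreover have "(LBINT z. indicator \<Omega> (fst z) * f (snd z)) = (LBINT y. (LBINT x. indicator \<Omega> x * f y))"
  using lborel_pair.integral_snd[of "\<lambda>x y. indicator \<Omega> x * f y"] 2 by (simp add: lborel_prod case_prod_beta')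
 moreover have "(LBINT z. far_maj \<Omega> f z)
   = (LBINT z. f (fst z) * indicator \<Omega> (snd z)) + (LBINT z. indicator \<Omega> (fst z) * f (snd z))"
  unfolding far_maj_def using 1 2 by (rule Bochner_Integration.integral_add)
 ultimately show "(LBINT z. far_maj \<Omega> f z) = 2 * measure lborel \<Omega> * (LBINT x. f x)"
  by simp
qed

lemma far_bound:
 fixes u v :: "'a::euclidean_space \<Rightarrow> real"
 assumes "1 < p" "0 \<le> e" "\<And>x. x \<notin> \<Omega> \<Longrightarrow> u x = 0" "\<And>x. x \<notin> \<Omega> \<Longrightarrow> v x = 0"
  and f: "\<And>x. \<bar>u x\<bar> powr p + \<bar>v x\<bar> powr p \<le> f x"
 shows "\<bar>Upsilon_at p u v z * kf e z\<bar> \<le> (2 powr p + 1) * far_maj \<Omega> f z"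
proof -
 let ?U = "Upsilon_at p u v z"
 have f0: "0 \<le> f x" for x using f[of x] by (meson add_nonneg_nonneg order_trans powr_ge_zero)
 have "\<bar>?U * kf e z\<bar> \<le> \<bar>?U\<bar>"
  using kf_le_1[OF assms(2), of z] by (simp add: abs_mult mult_left_le)
 also have "\<dots> \<le> (2 powr p + 1) * far_maj \<Omega> f z"
 proof (cases "fst z \<in> \<Omega> \<and> snd z \<in> \<Omega>")
  case True
  have "\<bar>?U\<bar> \<le> (2 powr p + 1) * (f (fst z) + f (snd z))"
   using abs_Upsilon_le[OF assms(1), of "u (fst z)" "u (snd z)" "v (fst z)" "v (snd z)"] f[of "fst z"] f[of "snd z"]
   by (elim order_trans) (intro mult_left_mono, auto)
  then show ?thesis using True by (simp add: far_maj_def)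
 next
  case False
  then have "?U = 0" using assms(3,4) by (auto simp: Upsilon_def h_def)
  then show ?thesis using f0 by (auto simp: far_maj_def intro!: mult_nonneg_nonneg)
 qed
 finally show ?thesis .
qed

lemma far_integrable:
 assumes "1 < p" "0 \<le> e" and \<Omega>: "bounded \<Omega>" "open \<Omega>" and u: "u \<in> Xe p \<Omega> e1" and v: "v \<in> Xe p \<Omega> e2"
 shows "integrable lborel (\<lambda>z. Upsilon_at p u v z * kf e z)"
  and "\<bar>far p e u v\<bar> \<le> (2 powr p + 1) * (2 * measure lborel \<Omega> * (LBINT x. \<bar>u x\<bar> powr p + \<bar>v x\<bar> powr p))"
proof -
 note [measurable] = XeD(1)[OF u] XeD(1)[OF v]
 let ?f = "\<lambda>x. \<bar>u x\<bar> powr p + \<bar>v x\<bar> powr p"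
 have f: "integrable lborel ?f" using XeD(3)[OF u] XeD(3)[OF v] by simp
 note m = far_maj_integrable[OF \<Omega> f]
 have b: "\<bar>Upsilon_at p u v z * kf e z\<bar> \<le> (2 powr p + 1) * far_maj \<Omega> ?f z" for z
  by (rule far_bound[OF assms(1,2) XeD(2)[OF u] XeD(2)[OF v]]) auto
 have mi: "integrable lborel (\<lambda>z. (2 powr p + 1) * far_maj \<Omega> ?f z)" using m(1) by simp
 show i: "integrable lborel (\<lambda>z. Upsilon_at p u v z * kf e z)"
  by (rule integrable_dominated[OF mi _ b]) (unfold Upsilon_def, measurable)
 have "\<bar>far p e u v\<bar> \<le> (LBINT z. \<bar>Upsilon_at p u v z * kf e z\<bar>)"
  unfolding far_def by (rule integral_abs_bound)
 also have "\<dots> \<le> (LBINT z. (2 powr p + 1) * far_maj \<Omega> ?f z)"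
  using i mi b by (intro integral_mono) auto
 also have "\<dots> = (2 powr p + 1) * (2 * measure lborel \<Omega> * (LBINT x. ?f x))"
  by (simp add: m(2))
 finally show "\<bar>far p e u v\<bar> \<le> (2 powr p + 1) * (2 * measure lborel \<Omega> * (LBINT x. ?f x))" .
qed

lemma integral_lebesgue_borel:
 fixes f :: "'a::euclidean_space \<Rightarrow> real"
 assumes "f \<in> borel_measurable borel"
 shows "integral\<^sup>L lebesgue f = integral\<^sup>L lborel f" "integrable lebesgue f = integrable lborel f"
 using assms by (simp_all add: integral_completion integrable_completion)

text \<open>On distant pairs only the \<open>\<Upsilon>\<close> part of the integrand remains integrable as \<open>s \<rightarrow> 0\<close>; the rest is
 integrated exactly and contributes a term of order \<open>1/s\<close> to the double integral.\<close>

lemma E_frac_eq: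
 assumes p: "1 < p" and s: "0 < s" and \<Omega>: "bounded \<Omega>" "open (\<Omega> :: 'a::euclidean_space set)"
  and u: "u \<in> Xe p \<Omega> (s * p)" and v: "v \<in> Xe p \<Omega> (s * p)"
 shows "E_frac s p u v = C_frac DIM('a) s p / 2 * (near p (s * p) u v + far p (s * p) u v)
      + kappa DIM('a) p s * (LBINT x. h p (u x) * v x)"
proof -
 note [measurable] = XeD(1)[OF u] XeD(1)[OF v]
 have e: "0 < s * p" using p s by simp
 have hi: "integrable lborel (\<lambda>x. h p (u x) * v x)"
  using XeD[OF u] XeD[OF v] p by (intro integrable_h_mult) auto
 let ?A = "\<lambda>z. h p (incr u z) * (incr v z) * kn (s * p) z"
 let ?B = "\<lambda>z. Upsilon_at p u v z * kf (s * p) z"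
 let ?H = "\<lambda>x. h p (u x) * v x"
 have "E_frac s p u v = C_frac DIM('a) s p / 2 * (LBINT z. h p (incr u z) * (incr v z) /
    norm (fst z - snd z) powr (real DIM('a) + s * p))"
  unfolding E_frac_def by (simp add: case_prod_beta' integral_lebesgue_borel)
 also have "(LBINT z. h p (incr u z) * (incr v z) /
    norm (fst z - snd z) powr (real DIM('a) + s * p)) =
   (LBINT z. (?A z + ?B z) + (?H (fst z) * kf (s * p) z + ?H (snd z) * kf (s * p) z))"
 proof (rule Bochner_Integration.integral_cong[OF refl])
  fix z :: "'a \<times> 'a"
  have "h p (incr u z) * (incr v z) / norm (fst z - snd z) powr (real DIM('a) + s * p)
    = h p (incr u z) * (incr v z) * (kn (s * p) z + kf (s * p) z)"
   using kn_plus_kf[of "s * p" "fst z" "snd z"] by (simp only: powr_minus divide_inverse prod.collapse)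
  then show "h p (incr u z) * (incr v z) / norm (fst z - snd z) powr (real DIM('a) + s * p)
   = (?A z + ?B z) + (?H (fst z) * kf (s * p) z + ?H (snd z) * kf (s * p) z)"
   by (simp add: Upsilon_def algebra_simps)
 qed
 also have "\<dots> = (near p (s * p) u v + far p (s * p) u v) +
   (sphere_area DIM('a) / (s * p) * (LBINT x. ?H x) + sphere_area DIM('a) / (s * p) * (LBINT x. ?H x))"
  using near_integrable[OF p u v] far_integrable(1)[OF p less_imp_le[OF e] \<Omega> u v] integrable_kf_fst[OF e hi]
  by (simp add: near_def far_def)
 also have "C_frac DIM('a) s p / 2 * \<dots> = C_frac DIM('a) s p / 2 * (near p (s * p) u v + far p (s * p) u v)
   + (C_frac DIM('a) s p * sphere_area DIM('a)) / (s * p) * (LBINT x. ?H x)"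
  by (simp add: algebra_simps)
 also have "(C_frac DIM('a) s p * sphere_area DIM('a)) / (s * p) = kappa DIM('a) p s"
  using p s by (simp add: C_frac_kappa)
 finally show ?thesis .
qed

lemma seminorm_frac_p_E_frac: "seminorm_frac_p s p u = E_frac s p u u"
 by (simp add: seminorm_frac_p_def E_frac_def h_mult_self)

section \<open>Sobolev and logarithmic inequalities\<close>

lemma unit_ball_vol_neq_0 [simp]: "unit_ball_vol (real n) \<noteq> 0"
 using unit_ball_vol_pos[of "real n"] by linarith

text \<open>Where \<open>norm (x - y) > R\<close> the kernel is at most
  \<open>R powr - (DIM('a) + e)\<close>, so a set as small as the ball of radius \<open>R\<close>
  removes at most \<open>unit_ball_vol * R powr - e\<close> of the mass. Against the leading part
  \<open>sphere_area / e * R powr - e\<close> of the annulus mass this is a relative loss of only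
  \<open>e / DIM('a)\<close>.\<close>

lemma kernel_outside_small_set:
 fixes E :: "'a::euclidean_space set"
 assumes [measurable]: "E \<in> sets borel" and R: "0 < R" "R \<le> 1" and e: "0 \<le> e"
  and small: "emeasure lborel (- E) \<le> ennreal (unit_ball_vol DIM('a) * R ^ DIM('a))"
 shows "(\<integral>\<^sub>+z. ennreal (indicator {R<..1} (norm z) * norm (z::'a) powr - (real DIM('a) + e)))
   \<le> (\<integral>\<^sub>+y. ennreal (indicator E y * kn e (x, y))) + ennreal (unit_ball_vol DIM('a) * R powr - e)"
proof -
 let ?k = "\<lambda>z::'a. indicator {R<..1} (norm z) * norm z powr - (real DIM('a) + e)"
 let ?r = "R powr - (real DIM('a) + e)"
 have "(\<integral>\<^sub>+z. ennreal (?k z)) = (\<integral>\<^sub>+y. ennreal (?k (x - y)))"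
  by (rule nn_integral_lborel_reflect[symmetric, where f = "\<lambda>z. ennreal (?k z)"]) measurable
 also have "\<dots> \<le> (\<integral>\<^sub>+y. ennreal (indicator E y * kn e (x, y)) + ennreal ?r * indicator (- E) y)"
 proof (rule nn_integral_mono)
  fix y
  have "?k (x - y) \<le> indicator E y * kn e (x, y) + ?r * indicator (- E) y"
  proof (cases "R < norm (x - y) \<and> norm (x - y) \<le> 1")
   case True
   have "norm (x - y) powr - (real DIM('a) + e) \<le> ?r"
    using True R e by (intro powr_mono2') auto
   then show ?thesis using True by (auto simp: kn_def indicator_def)
  next
   case False
   have "0 \<le> indicator E y * kn e (x, y) + ?r * indicator (- E) y" by (intro add_nonneg_nonneg mult_nonneg_nonneg) auto
   then show ?thesis using False by (auto simp: indicator_def)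
  qed
  then have "ennreal (?k (x - y)) \<le> ennreal (indicator E y * kn e (x, y) + ?r * indicator (- E) y)" by (rule ennreal_leI)
  also have "\<dots> = ennreal (indicator E y * kn e (x, y)) + ennreal ?r * indicator (- E) y"
   by (subst ennreal_plus) (auto simp: indicator_def)
  finally show "ennreal (?k (x - y)) \<le> \<dots>" .
 qed
 also have "\<dots> = (\<integral>\<^sub>+y. ennreal (indicator E y * kn e (x, y))) + ennreal ?r * emeasure lborel (- E)"
  by (subst nn_integral_add) (auto simp: nn_integral_cmult_indicator)
 also have "ennreal ?r * emeasure lborel (- E) \<le> ennreal ?r * ennreal (unit_ball_vol DIM('a) * R ^ DIM('a))"
  using small by (intro mult_left_mono) auto
 also have "\<dots> = ennreal (unit_ball_vol DIM('a) * R powr - e)"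
 proof -
  have "?r * R ^ DIM('a) = R powr (- (real DIM('a) + e) + real DIM('a))"
   using R by (simp only: powr_add powr_realpow)
  then have "?r * (unit_ball_vol DIM('a) * R ^ DIM('a)) = unit_ball_vol DIM('a) * R powr - e"
   by (simp add: mult_ac)
  then show ?thesis using R by (simp flip: ennreal_mult)
 qed
 finally show ?thesis by (simp add: add_left_mono)
qed

text \<open>Only pairs on which the values of \<open>u\<close> differ by a large factor are kept; those on which
 \<open>\<bar>u y\<bar>\<close> is not small against \<open>\<bar>u x\<bar>\<close> form a small set by Chebyshev's inequality.\<close>

lemma near_lower_bound:
 fixes u :: "'a::euclidean_space \<Rightarrow> real"
 assumes p: "0 < p" and \<tau>: "0 < \<tau>" "\<tau> < 1" and [measurable]: "u \<in> borel_measurable borel"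
 shows "2 * (\<integral>\<^sub>+x. ennreal ((1 - \<tau>) powr p * \<bar>u x\<bar> powr p) *
      (\<integral>\<^sub>+y. ennreal (indicator {y. \<bar>u y\<bar> \<le> \<tau> * \<bar>u x\<bar>} y * kn e (x, y))))
   \<le> (\<integral>\<^sub>+z. ennreal (\<bar>incr u z\<bar> powr p * kn e z))"
proof -
 let ?\<theta> = "(1 - \<tau>) powr p"
 let ?f = "\<lambda>x y. ?\<theta> * \<bar>u x\<bar> powr p * (of_bool (\<bar>u y\<bar> \<le> \<tau> * \<bar>u x\<bar>) * kn e (x, y))"
 have m1: "(\<lambda>z. ennreal (?f (fst z) (snd z))) \<in> borel_measurable borel"
  "(\<lambda>z. ennreal (?f (snd z) (fst z))) \<in> borel_measurable borel"
  by measurable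
 let ?I = "\<integral>\<^sup>+x. \<integral>\<^sup>+y. ennreal (?f x y) \<partial>lborel \<partial>lborel"
 have I: "?I = (\<integral>\<^sub>+x. ennreal (?\<theta> * \<bar>u x\<bar> powr p) *
      (\<integral>\<^sub>+y. ennreal (indicator {y. \<bar>u y\<bar> \<le> \<tau> * \<bar>u x\<bar>} y * kn e (x, y))))"
 proof (rule nn_integral_cong)
  fix x
  have "(\<integral>\<^sub>+y. ennreal (?f x y)) = (\<integral>\<^sub>+y. ennreal (?\<theta> * \<bar>u x\<bar> powr p) *
    ennreal (indicator {y. \<bar>u y\<bar> \<le> \<tau> * \<bar>u x\<bar>} y * kn e (x, y)))"
   by (rule nn_integral_cong) (simp add: ennreal_mult[symmetric] indicator_def)
  then show "(\<integral>\<^sub>+y. ennreal (?f x y)) = ennreal (?\<theta> * \<bar>u x\<bar> powr p) *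
    (\<integral>\<^sub>+y. ennreal (indicator {y. \<bar>u y\<bar> \<le> \<tau> * \<bar>u x\<bar>} y * kn e (x, y)))"
   by (simp add: nn_integral_cmult)
 qed
 have *: "?f x y \<le> \<bar>u x - u y\<bar> powr p * kn e (x, y)" for x y
 proof (cases "\<bar>u y\<bar> \<le> \<tau> * \<bar>u x\<bar>")
  case True
  have "?\<theta> * \<bar>u x\<bar> powr p = ((1 - \<tau>) * \<bar>u x\<bar>) powr p" using \<tau> by (simp add: powr_mult)
  also have "\<dots> \<le> \<bar>u x - u y\<bar> powr p"
  proof (rule powr_mono2)
   have "(1 - \<tau>) * \<bar>u x\<bar> = \<bar>u x\<bar> - \<tau> * \<bar>u x\<bar>" by (simp add: left_diff_distrib)
   then show "(1 - \<tau>) * \<bar>u x\<bar> \<le> \<bar>u x - u y\<bar>" using True by linarith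
  qed (use p \<tau> in auto)
  finally show ?thesis using True by (auto intro: mult_right_mono)
 qed simp
 \<comment> \<open>Both orderings of a pair fit under the same integrand because at most one of them
   contributes: \<open>\<bar>u y\<bar> \<le> \<tau> * \<bar>u x\<bar>\<close> with
   \<open>u x \<noteq> 0\<close> excludes the reverse relation. The resulting factor
   \<open>2\<close> matches the halved constant \<open>p / (2 * sphere_area)\<close> of the
   form.\<close>
 have le: "?f x y + ?f y x \<le> \<bar>u x - u y\<bar> powr p * kn e (x, y)" for x y
 proof (cases "?f x y = 0")
  case True
  then show ?thesis using *[of y x] by (simp only: kn_sym[of e y x] abs_minus_commute[of "u y"])
 next
  case False
  then have 1: "u x \<noteq> 0" "\<bar>u y\<bar> \<le> \<tau> * \<bar>u x\<bar>" by auto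
  have "\<bar>u y\<bar> < \<bar>u x\<bar>" using 1 \<tau> by (smt (verit) mult_less_cancel_right2 zero_less_abs_iff)
  then have "\<not> \<bar>u x\<bar> \<le> \<tau> * \<bar>u y\<bar>" using \<tau> by (smt (verit) mult_left_le_one_le abs_ge_zero)
  then show ?thesis using *[of x y] by simp
 qed
 have "(\<integral>\<^sub>+z. ennreal (?f (fst z) (snd z)) + ennreal (?f (snd z) (fst z)))
   \<le> (\<integral>\<^sub>+z. ennreal (\<bar>incr u z\<bar> powr p * kn e z))"
 proof (rule nn_integral_mono)
  fix z :: "'a \<times> 'a"
  have "ennreal (?f (fst z) (snd z)) + ennreal (?f (snd z) (fst z)) = ennreal (?f (fst z) (snd z) + ?f (snd z) (fst z))"
   by (rule ennreal_plus[symmetric]) auto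
  also have "\<dots> \<le> ennreal (\<bar>incr u z\<bar> powr p * kn e z)"
   using le[of "fst z" "snd z"] by (intro ennreal_leI) (simp only: prod.collapse)
  finally show "ennreal (?f (fst z) (snd z)) + ennreal (?f (snd z) (fst z)) \<le> \<dots>" .
 qed
 moreover have "(\<integral>\<^sub>+z. ennreal (?f (fst z) (snd z)) + ennreal (?f (snd z) (fst z)))
   = (\<integral>\<^sub>+z. ennreal (?f (fst z) (snd z))) + (\<integral>\<^sub>+z. ennreal (?f (snd z) (fst z)))"
  using m1 by (intro nn_integral_add) auto
 moreover have "(\<integral>\<^sub>+z. ennreal (?f (fst z) (snd z))) = ?I"
  using nn_integral_pair_lborel(1)[OF m1(1)] by simp
 moreover have "(\<integral>\<^sub>+z. ennreal (?f (snd z) (fst z))) = ?I"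
  using nn_integral_pair_lborel(2)[OF m1(2)] by simp
 ultimately show ?thesis unfolding I by (simp add: mult_2)
qed

lemma chebyshev_powr:
 fixes u :: "'a::euclidean_space \<Rightarrow> real"
 assumes p: "0 < p" and t: "0 < t" and [measurable]: "u \<in> borel_measurable borel"
  and i: "integrable lborel (\<lambda>x. \<bar>u x\<bar> powr p)"
 shows "emeasure lborel (- {y. \<bar>u y\<bar> \<le> t}) \<le> ennreal ((LBINT x. \<bar>u x\<bar> powr p) / t powr p)"
proof -
 have "emeasure lborel (- {y. \<bar>u y\<bar> \<le> t}) = (\<integral>\<^sub>+y. indicator (- {y. \<bar>u y\<bar> \<le> t}) y)"
  by (subst nn_integral_indicator) auto
 also have "\<dots> \<le> (\<integral>\<^sub>+y. ennreal (\<bar>u y\<bar> powr p / t powr p))"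
 proof (rule nn_integral_mono)
  fix y
  show "indicator (- {y. \<bar>u y\<bar> \<le> t}) y \<le> ennreal (\<bar>u y\<bar> powr p / t powr p)"
   using powr_mono2[of p t "\<bar>u y\<bar>"] p t
   by (auto simp: indicator_def ennreal_1[symmetric] le_divide_eq simp del: ennreal_1 intro!: ennreal_leI)
 qed
 also have "\<dots> = ennreal (LBINT x. \<bar>u x\<bar> powr p / t powr p)"
  using i t by (intro nn_integral_eq_integral) auto
 finally show ?thesis by simp
qed

definition ball_rad :: "'a::euclidean_space itself \<Rightarrow> real \<Rightarrow> real" where
 "ball_rad _ m = (m / unit_ball_vol DIM('a)) powr (1 / DIM('a))"

lemma ball_rad:
 assumes "0 < m"
 shows "0 < ball_rad TYPE('a::euclidean_space) m"
  "unit_ball_vol DIM('a) * ball_rad TYPE('a) m ^ DIM('a) = m"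
  "ball_rad TYPE('a) m powr - e = (unit_ball_vol DIM('a) / m) powr (e / DIM('a))"
  "ln (1 / ball_rad TYPE('a) m) = ln (unit_ball_vol DIM('a) / m) / DIM('a)"
proof -
 have w: "0 < unit_ball_vol (real DIM('a))" by simp
 then have q: "0 < m / unit_ball_vol DIM('a)" using assms by simp
 show "0 < ball_rad TYPE('a::euclidean_space) m" using assms by (simp add: ball_rad_def)
 have "ball_rad TYPE('a) m ^ DIM('a) = m / unit_ball_vol DIM('a)"
  using q assms by (simp add: ball_rad_def powr_powr flip: powr_realpow)
 then show "unit_ball_vol DIM('a) * ball_rad TYPE('a) m ^ DIM('a) = m" using w by simp
 have inv: "unit_ball_vol DIM('a) / m = inverse (m / unit_ball_vol DIM('a))" by (simp add: divide_inverse)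
 show "ball_rad TYPE('a) m powr - e = (unit_ball_vol DIM('a) / m) powr (e / DIM('a))"
 proof -
  have "(Q powr b) powr - e = inverse Q powr (e * b)" if "0 < Q" for Q b :: real
   using that by (simp add: powr_def ln_inverse)
  from this[OF q, of "1 / DIM('a)"] show ?thesis unfolding inv ball_rad_def by simp
 qed
 show "ln (1 / ball_rad TYPE('a) m) = ln (unit_ball_vol DIM('a) / m) / DIM('a)"
  unfolding inv using q w assms by (simp add: ball_rad_def ln_powr ln_div ln_inverse diff_divide_distrib)
qed

text \<open>By Chebyshev's inequality the set where
  \<open>\<bar>u y\<bar> > \<tau> * \<bar>u x\<bar>\<close> has at most the measure of a ball of
  some radius \<open>R\<close>, and \<open>w * \<bar>u x\<bar> powr p\<close> is
  \<open>R powr - DIM('a)\<close>. The bounds are the mass of the annulus from \<open>R\<close> to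
  \<open>1\<close> minus the part that the exceptional set can hide.\<close>

lemma kernel_small_values:
 fixes u :: "'a::euclidean_space \<Rightarrow> real"
 assumes p: "0 < p" and \<tau>: "0 < \<tau>" and [measurable]: "u \<in> borel_measurable borel"
  and i: "integrable lborel (\<lambda>x. \<bar>u x\<bar> powr p)" and ux: "u x \<noteq> 0" and y: "0 < (LBINT x. \<bar>u x\<bar> powr p)"
  and e: "0 \<le> e"
 defines "w \<equiv> unit_ball_vol (real DIM('a)) * \<tau> powr p / (LBINT x. \<bar>u x\<bar> powr p)"
 defines "G \<equiv> \<integral>\<^sup>+y. ennreal (indicator {y. \<bar>u y\<bar> \<le> \<tau> * \<bar>u x\<bar>} y * kn e (x, y)) \<partial>lborel"
 shows "0 < e \<Longrightarrow> ennreal (max 0 (sphere_area DIM('a) / e * ((1 - e / DIM('a)) * (w * \<bar>u x\<bar> powr p) powr (e / DIM('a)) - 1))) \<le> G"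
  and "e = 0 \<Longrightarrow> ennreal (max 0 (unit_ball_vol (real DIM('a)) * (ln (w * \<bar>u x\<bar> powr p) - 1))) \<le> G"
proof -
 let ?y = "LBINT x. \<bar>u x\<bar> powr p"
 let ?\<omega> = "unit_ball_vol (real DIM('a))"
 let ?R = "ball_rad TYPE('a) (?y / (\<tau> * \<bar>u x\<bar>) powr p)"
 have m: "0 < ?y / (\<tau> * \<bar>u x\<bar>) powr p" using y \<tau> ux by simp
 note R = ball_rad[OF m, where 'a='a]
 have wm: "?\<omega> / (?y / (\<tau> * \<bar>u x\<bar>) powr p) = w * \<bar>u x\<bar> powr p"
  using \<tau> by (simp add: w_def powr_mult field_simps)
 have small: "emeasure lborel (- {y. \<bar>u y\<bar> \<le> \<tau> * \<bar>u x\<bar>}) \<le> ennreal (?\<omega> * ?R ^ DIM('a))"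
  unfolding R(2) by (rule chebyshev_powr) (use p \<tau> ux i in auto)
 have key: "(\<integral>\<^sub>+z. ennreal (indicator {?R<..1} (norm z) * norm (z::'a) powr - (real DIM('a) + e)))
   \<le> G + ennreal (?\<omega> * ?R powr - e)" if "?R \<le> 1"
  unfolding G_def by (rule kernel_outside_small_set[OF _ R(1) that e small]) measurable
 have sub: "ennreal a \<le> b + ennreal c \<Longrightarrow> 0 \<le> c \<Longrightarrow> ennreal (max 0 (a - c)) \<le> b" for a b c
 proof -
  assume *: "ennreal a \<le> b + ennreal c" "0 \<le> c"
  have "ennreal (a - c) \<le> b"
   using * by (cases b) (auto simp flip: ennreal_plus simp: ennreal_le_iff2 ennreal_leI split: if_splits)
  then show ?thesis by (auto simp: max_def)
 qed
 {
  assume e: "0 < e"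
  let ?q = "(w * \<bar>u x\<bar> powr p) powr (e / DIM('a))"
  have Re: "?R powr - e = ?q" unfolding R(3) wm ..
  \<comment> \<open>\<open>?\<omega>\<close> is \<open>sphere_area / DIM('a)\<close>, so the hidden
    part appears as the factor \<open>1 - e / DIM('a)\<close>.\<close>
  have a: "sphere_area DIM('a) / e * (?q - 1) - ?\<omega> * ?q = sphere_area DIM('a) / e * ((1 - e / DIM('a)) * ?q - 1)"
   using e by (simp add: sphere_area_def field_simps)
  show "ennreal (max 0 (sphere_area DIM('a) / e * ((1 - e / DIM('a)) * ?q - 1))) \<le> G"
  proof (cases "?R \<le> 1")
   case True
   show ?thesis
    using key[OF True] radial_annulus_powr[OF R(1) True, of e, where 'a='a] e R(1)
    unfolding Re a[symmetric] by (intro sub) auto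
  \<comment> \<open>For a radius beyond \<open>1\<close> the annulus is empty and the expression
    under \<open>max 0\<close> is nonpositive.\<close>
  next
   case False
   then have "?q \<le> 1" using e powr_mono2'[of "-e" 1 ?R] unfolding Re[symmetric] by simp
   moreover have "(1 - e / DIM('a)) * ?q \<le> 1 * ?q" using e by (intro mult_right_mono) auto
   ultimately have "sphere_area DIM('a) / e * ((1 - e / DIM('a)) * ?q - 1) \<le> 0"
    using e sphere_area_pos[of "DIM('a)"] by (intro mult_nonneg_nonpos) auto
   then show ?thesis by (simp add: max_def)
  qed
 }
 {
  assume e: "e = 0"
  have a: "sphere_area DIM('a) * ln (1 / ?R) - ?\<omega> * ?R powr - e = ?\<omega> * (ln (w * \<bar>u x\<bar> powr p) - 1)"
   unfolding R(4) wm using R(1) by (simp add: sphere_area_def e algebra_simps)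
  show "ennreal (max 0 (?\<omega> * (ln (w * \<bar>u x\<bar> powr p) - 1))) \<le> G"
  proof (cases "?R \<le> 1")
   case True
   show ?thesis
    using key[OF True] radial_annulus_log[OF R(1) True, where 'a='a] e R(1)
    unfolding a[symmetric] by (intro sub) auto
  next
   case False
   then have "ln (1 / ?R) < 0" using R(1) by (subst ln_less_zero_iff) auto
   then have "ln (w * \<bar>u x\<bar> powr p) < 0" unfolding R(4) wm by (simp add: divide_less_0_iff)
   then have "?\<omega> * (ln (w * \<bar>u x\<bar> powr p) - 1) \<le> 0" by (intro mult_nonneg_nonpos) auto
   then show ?thesis by (simp add: max_def)
  qed
 }
qed

text \<open>The pointwise kernel bound is weighted with \<open>\<bar>u x\<bar> powr p\<close> and
  integrated. With \<open>e = s * p\<close> the exponent \<open>p + p * e / DIM('a)\<close> agrees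
  with the critical exponent to first order in \<open>s\<close>. For fixed \<open>w\<close> the
  factor of its integral inside the bracket is \<open>1 + O(e)\<close>; a cruder constant there
  would spoil every comparison at order \<open>s\<close>. The parameter \<open>\<tau>\<close> costs
  a fixed power of itself inside \<open>w\<close> and the outer factor
  \<open>(1 - \<tau>) powr p\<close>.\<close>

lemma near_sobolev:
 fixes u :: "'a::euclidean_space \<Rightarrow> real"
 assumes p: "1 < p" and e: "0 < e" "e < real DIM('a)" and \<tau>: "0 < \<tau>" "\<tau> < 1" and u: "u \<in> Xe p \<Omega> e"
  and y: "0 < (LBINT x. \<bar>u x\<bar> powr p)"
 defines "w \<equiv> unit_ball_vol (real DIM('a)) * \<tau> powr p / (LBINT x. \<bar>u x\<bar> powr p)"
 shows "integrable lborel (\<lambda>x. \<bar>u x\<bar> powr (p + p * e / DIM('a)))"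
  and "2 * (1 - \<tau>) powr p * (sphere_area DIM('a) / e) * ((1 - e / DIM('a)) * w powr (e / DIM('a)) *
      (LBINT x. \<bar>u x\<bar> powr (p + p * e / DIM('a))) - (LBINT x. \<bar>u x\<bar> powr p)) \<le> near p e u u"
proof -
 note [measurable] = XeD(1)[OF u]
 note i = XeD(3)[OF u]
 let ?\<theta> = "(1 - \<tau>) powr p"
 let ?S = "sphere_area DIM('a) / e"
 let ?c = "(1 - e / DIM('a)) * w powr (e / DIM('a))"
 let ?r = "p + p * e / DIM('a)"
 have w0: "0 < w" using y \<tau> by (simp add: w_def)
 have c0: "0 < ?c" using e w0 by simp
 have S0: "0 < ?S" using e sphere_area_pos[of "DIM('a)"] by simp
 \<comment> \<open>The positive part makes the integrand admissible for the nonnegative integral, so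
   that the same estimate yields integrability of the higher power; dropping \<open>max 0\<close> at
   the end only decreases it.\<close>
 define g where "g = (\<lambda>x. \<bar>u x\<bar> powr p * max 0 (?S * (?c * \<bar>u x\<bar> powr (p * e / DIM('a)) - 1)))"
 have g0: "0 \<le> g x" for x by (simp add: g_def)
 have [measurable]: "g \<in> borel_measurable borel" unfolding g_def by measurable
 have "(\<integral>\<^sub>+x. ennreal (2 * ?\<theta> * g x)) \<le> 2 * (\<integral>\<^sub>+x. ennreal (?\<theta> * \<bar>u x\<bar> powr p) *
      (\<integral>\<^sub>+y. ennreal (indicator {y. \<bar>u y\<bar> \<le> \<tau> * \<bar>u x\<bar>} y * kn e (x, y))))"
 proof -
  have "(\<integral>\<^sub>+x. ennreal (2 * ?\<theta> * g x)) = 2 * (\<integral>\<^sub>+x. ennreal (?\<theta> * g x))"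
   using g0 by (subst nn_integral_cmult[symmetric]) (auto simp: ennreal_mult mult.assoc)
  also have "\<dots> \<le> 2 * (\<integral>\<^sub>+x. ennreal (?\<theta> * \<bar>u x\<bar> powr p) *
      (\<integral>\<^sub>+y. ennreal (indicator {y. \<bar>u y\<bar> \<le> \<tau> * \<bar>u x\<bar>} y * kn e (x, y))))"
  proof (intro mult_left_mono nn_integral_mono)
   fix x
   show "ennreal (?\<theta> * g x) \<le> ennreal (?\<theta> * \<bar>u x\<bar> powr p) *
      (\<integral>\<^sub>+y. ennreal (indicator {y. \<bar>u y\<bar> \<le> \<tau> * \<bar>u x\<bar>} y * kn e (x, y)))"
   proof (cases "u x = 0")
    case False
    have "(w * \<bar>u x\<bar> powr p) powr (e / DIM('a)) = w powr (e / DIM('a)) * \<bar>u x\<bar> powr (p * e / DIM('a))"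
     using w0 by (simp add: powr_mult powr_powr)
    then have "?\<theta> * g x = (?\<theta> * \<bar>u x\<bar> powr p) *
      max 0 (?S * ((1 - e / DIM('a)) * (w * \<bar>u x\<bar> powr p) powr (e / DIM('a)) - 1))"
     by (simp only: g_def mult.assoc)
    then have "ennreal (?\<theta> * g x) = ennreal (?\<theta> * \<bar>u x\<bar> powr p) *
      ennreal (max 0 (?S * ((1 - e / DIM('a)) * (w * \<bar>u x\<bar> powr p) powr (e / DIM('a)) - 1)))"
     by (simp only: ennreal_mult max.cobounded1 mult_nonneg_nonneg powr_ge_zero)
    also have "\<dots> \<le> ennreal (?\<theta> * \<bar>u x\<bar> powr p) *
      (\<integral>\<^sub>+y. ennreal (indicator {y. \<bar>u y\<bar> \<le> \<tau> * \<bar>u x\<bar>} y * kn e (x, y)))"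
     unfolding w_def using p \<tau> e y False i by (intro mult_left_mono kernel_small_values(1)) auto
    finally show ?thesis .
   qed (simp add: g_def)
  qed auto
  finally show ?thesis .
 qed
 also have "\<dots> \<le> (\<integral>\<^sub>+z. ennreal (\<bar>incr u z\<bar> powr p * kn e z))"
  using p \<tau> by (intro near_lower_bound) auto
 also have "\<dots> = ennreal (near p e u u)" by (rule nn_integral_near[OF u])
 finally have le: "(\<integral>\<^sub>+x. ennreal (2 * ?\<theta> * g x)) \<le> ennreal (near p e u u)" .
 have \<theta>: "0 < ?\<theta>" using \<tau> by simp
 have gi': "integrable lborel (\<lambda>x. 2 * ?\<theta> * g x)"
  using le g0 \<theta> by (intro integrableI_bounded) (auto simp: le_less_trans abs_mult)
 then have gi: "integrable lborel g" using \<theta> by simp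
 have "\<bar>u x\<bar> powr ?r \<le> (g x + ?S * \<bar>u x\<bar> powr p) / (?S * ?c)" for x
 proof -
  have "\<bar>u x\<bar> powr p * (?S * (?c * \<bar>u x\<bar> powr (p * e / DIM('a)) - 1)) \<le> g x"
   unfolding g_def by (intro mult_left_mono) auto
  moreover have "\<bar>u x\<bar> powr ?r = \<bar>u x\<bar> powr p * \<bar>u x\<bar> powr (p * e / DIM('a))" by (simp add: powr_add)
  moreover have "P * (S * (c * Q - 1)) \<le> G \<Longrightarrow> T = P * Q \<Longrightarrow> S * c * T \<le> G + S * P" for P S c Q G T :: real
   by (simp add: algebra_simps)
  ultimately have "?S * ?c * \<bar>u x\<bar> powr ?r \<le> g x + ?S * \<bar>u x\<bar> powr p" by blast
  then show ?thesis using mult_pos_pos[OF S0 c0] by (metis pos_le_divide_eq mult.commute)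
 qed
 then have "norm (\<bar>u x\<bar> powr ?r) \<le> norm ((g x + ?S * \<bar>u x\<bar> powr p) / (?S * ?c))" for x
  unfolding real_norm_def by (metis abs_ge_self abs_of_nonneg order_trans powr_ge_zero)
 then show zi: "integrable lborel (\<lambda>x. \<bar>u x\<bar> powr ?r)"
  by (intro Bochner_Integration.integrable_bound[where g = "\<lambda>x. \<bar>u x\<bar> powr ?r"
    and f = "\<lambda>x. (g x + ?S * \<bar>u x\<bar> powr p) / (?S * ?c)"] integrable_divide Bochner_Integration.integrable_add gi
    integrable_mult_right i AE_I2) auto
 have "(LBINT x. 2 * ?\<theta> * g x) \<le> near p e u u"
  using le gi' g0 near_self_nonneg[of p e u] \<theta>
  by (subst (asm) nn_integral_eq_integral) (auto)
 moreover have "2 * ?\<theta> * ?S * (?c * (LBINT x. \<bar>u x\<bar> powr ?r) - (LBINT x. \<bar>u x\<bar> powr p))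
   = (LBINT x. 2 * ?\<theta> * ?S * (?c * \<bar>u x\<bar> powr ?r - \<bar>u x\<bar> powr p))"
  using zi i by simp
 moreover have "\<dots> \<le> (LBINT x. 2 * ?\<theta> * g x)"
 proof (rule integral_mono)
  show "integrable lborel (\<lambda>x. 2 * ?\<theta> * ?S * (?c * \<bar>u x\<bar> powr ?r - \<bar>u x\<bar> powr p))" using zi i by simp
  fix x
  have "\<bar>u x\<bar> powr p * (?S * (?c * \<bar>u x\<bar> powr (p * e / DIM('a)) - 1)) \<le> g x"
   unfolding g_def by (intro mult_left_mono) auto
  moreover have "\<bar>u x\<bar> powr ?r = \<bar>u x\<bar> powr p * \<bar>u x\<bar> powr (p * e / DIM('a))" by (simp add: powr_add)
  moreover have "P * (S * (c * Q - 1)) \<le> G \<Longrightarrow> T = P * Q \<Longrightarrow> S * (c * T - P) \<le> G" for P S c Q G T :: real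
   by (simp add: algebra_simps)
  ultimately have "?S * (?c * \<bar>u x\<bar> powr ?r - \<bar>u x\<bar> powr p) \<le> g x" by blast
  then have "2 * ?\<theta> * (?S * (?c * \<bar>u x\<bar> powr ?r - \<bar>u x\<bar> powr p)) \<le> 2 * ?\<theta> * g x"
   by (intro mult_left_mono) auto
  then show "2 * ?\<theta> * ?S * (?c * \<bar>u x\<bar> powr ?r - \<bar>u x\<bar> powr p) \<le> 2 * ?\<theta> * g x" by (simp only: mult.assoc)
 qed (rule gi')
 ultimately show "2 * ?\<theta> * ?S * (?c * (LBINT x. \<bar>u x\<bar> powr ?r) - (LBINT x. \<bar>u x\<bar> powr p)) \<le> near p e u u"
  by linarith
qed

text \<open>The case \<open>e = 0\<close> of the same argument, with \<open>\<tau> = 1/2\<close>: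
  the annulus mass is now logarithmic, so the seminorm of \<open>X\<close> pays for a factor
  \<open>ln\<close>. This gives the right-hand side of the limit problem a meaning on all of
  \<open>X\<close>.\<close>

lemma X_log_integrable:
 fixes u :: "'a::euclidean_space \<Rightarrow> real"
 assumes p: "1 < p" and u: "u \<in> Xe p \<Omega> 0"
 shows "integrable lborel (\<lambda>x. \<bar>u x\<bar> powr p * ln (1 + \<bar>u x\<bar>))"
proof (cases "(LBINT x. \<bar>u x\<bar> powr p) = 0")
 case True
 note [measurable] = XeD(1)[OF u]
 have "AE x in lborel. \<bar>u x\<bar> powr p = 0"
  using True XeD(3)[OF u] by (subst (asm) integral_nonneg_eq_0_iff_AE) auto
 then have "AE x in lborel. \<bar>u x\<bar> powr p * ln (1 + \<bar>u x\<bar>) = 0" by auto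
 then show ?thesis by (subst integrable_cong_AE[where g = "\<lambda>_. 0"]) auto
next
 case False
 note [measurable] = XeD(1)[OF u]
 note i = XeD(3)[OF u]
 let ?y = "LBINT x. \<bar>u x\<bar> powr p"
 have "0 \<le> ?y" by (intro integral_nonneg_AE) auto
 with False have y: "0 < ?y" by linarith
 let ?\<omega> = "unit_ball_vol (real DIM('a))"
 define w where "w = ?\<omega> * (1/2) powr p / ?y"
 have w0: "0 < w" using y by (simp add: w_def)
 define g where "g = (\<lambda>x. \<bar>u x\<bar> powr p * max 0 (?\<omega> * (ln (w * \<bar>u x\<bar> powr p) - 1)))"
 have g0: "0 \<le> g x" for x by (simp add: g_def)
 let ?\<theta> = "(1/2 :: real) powr p"
 have "(\<integral>\<^sub>+x. ennreal (2 * ?\<theta> * g x)) = 2 * (\<integral>\<^sub>+x. ennreal (?\<theta> * g x))"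
  using g0 unfolding g_def by (subst nn_integral_cmult[symmetric]) (auto simp: ennreal_mult mult.assoc)
 also have "\<dots> \<le> 2 * (\<integral>\<^sub>+x. ennreal ((1 - 1/2) powr p * \<bar>u x\<bar> powr p) *
    (\<integral>\<^sub>+y. ennreal (indicator {y. \<bar>u y\<bar> \<le> (1/2) * \<bar>u x\<bar>} y * kn 0 (x, y))))"
 proof (intro mult_left_mono nn_integral_mono)
  fix x
  show "ennreal (?\<theta> * g x) \<le> ennreal ((1 - 1/2) powr p * \<bar>u x\<bar> powr p) *
     (\<integral>\<^sub>+y. ennreal (indicator {y. \<bar>u y\<bar> \<le> (1/2) * \<bar>u x\<bar>} y * kn 0 (x, y)))"
  proof (cases "u x = 0")
   case False
   have "?\<theta> * g x = ((1 - 1/2) powr p * \<bar>u x\<bar> powr p) *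
     max 0 (?\<omega> * (ln (w * \<bar>u x\<bar> powr p) - 1))"
    by (simp add: g_def)
   then have "ennreal (?\<theta> * g x) = ennreal ((1 - 1/2) powr p * \<bar>u x\<bar> powr p) *
     ennreal (max 0 (?\<omega> * (ln (w * \<bar>u x\<bar> powr p) - 1)))"
    by (simp only: ennreal_mult max.cobounded1 mult_nonneg_nonneg powr_ge_zero)
   also have "\<dots> \<le> ennreal ((1 - 1/2) powr p * \<bar>u x\<bar> powr p) *
     (\<integral>\<^sub>+y. ennreal (indicator {y. \<bar>u y\<bar> \<le> (1/2) * \<bar>u x\<bar>} y * kn 0 (x, y)))"
    unfolding w_def using p y False i by (intro mult_left_mono kernel_small_values(2)) auto
   finally show ?thesis .
  qed (simp add: g_def)
 qed auto
 also have "\<dots> \<le> (\<integral>\<^sub>+z. ennreal (\<bar>incr u z\<bar> powr p * kn 0 z))"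
  using p by (intro near_lower_bound) auto
 also have "\<dots> = ennreal (near p 0 u u)" by (rule nn_integral_near[OF u])
 finally have le: "(\<integral>\<^sub>+x. ennreal (2 * ?\<theta> * g x)) \<le> ennreal (near p 0 u u)" .
 have "integrable lborel (\<lambda>x. 2 * ?\<theta> * g x)"
  using le g0 by (intro integrableI_bounded) (auto simp: le_less_trans abs_mult g_def)
 then have gi: "integrable lborel g" by simp
 \<comment> \<open>Converts \<open>ln (w * t powr p) - 1\<close> into \<open>ln (1 + t)\<close>:
   \<open>ln 2\<close> pays for replacing \<open>1 + t\<close> by \<open>max 1 t\<close>, and
   solving \<open>ln (w * t powr p)\<close> for \<open>ln t\<close> leaves
   \<open>(\<bar>ln w\<bar> + 1) / p\<close>.\<close>
 define C where "C = ln 2 + (\<bar>ln w\<bar> + 1) / p"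
 have "norm (\<bar>u x\<bar> powr p * ln (1 + \<bar>u x\<bar>)) \<le> norm (g x / (?\<omega> * p) + C * \<bar>u x\<bar> powr p)" for x
 proof (cases "u x = 0")
  case False
  let ?t = "\<bar>u x\<bar>"
  have t: "0 < ?t" using False by simp
  have "ln (1 + ?t) \<le> ln 2 + max 0 (ln ?t)"
  proof (cases "?t \<le> 1")
   case True
   then have "ln (1 + ?t) \<le> ln 2" by simp
   then show ?thesis by linarith
  next
   case False
   then have "ln (1 + ?t) \<le> ln (2 * ?t)" by simp
   also have "\<dots> = ln 2 + ln ?t" using t by (simp add: ln_mult)
   finally show ?thesis by simp
  qed
  moreover have "ln ?t = (ln (w * ?t powr p) - ln w) / p" using t w0 p by (simp add: ln_mult ln_powr)
  moreover have "(ln (w * ?t powr p) - ln w) / p \<le> (max 0 (ln (w * ?t powr p) - 1) + (\<bar>ln w\<bar> + 1)) / p"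
   using p by (intro divide_right_mono) auto
  moreover have "0 \<le> (max 0 (ln (w * ?t powr p) - 1) + (\<bar>ln w\<bar> + 1)) / p" using p by simp
  ultimately have "ln (1 + ?t) \<le> C + max 0 (ln (w * ?t powr p) - 1) / p"
   unfolding C_def add_divide_distrib by (smt (verit))
  moreover have "max 0 (?\<omega> * (ln (w * ?t powr p) - 1)) = ?\<omega> * max 0 (ln (w * ?t powr p) - 1)"
   by (simp add: max_mult_distrib_left)
  ultimately have "?t powr p * ln (1 + ?t) \<le> ?t powr p * (C + max 0 (?\<omega> * (ln (w * ?t powr p) - 1)) / (?\<omega> * p))"
   by (intro mult_left_mono) auto
  then have "?t powr p * ln (1 + ?t) \<le> g x / (?\<omega> * p) + C * ?t powr p"
   by (simp add: g_def algebra_simps)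
  then show ?thesis using t by (simp only: real_norm_def) (simp add: abs_mult)
 qed simp
 then show ?thesis using gi i
  by (intro Bochner_Integration.integrable_bound[where g = "\<lambda>x. \<bar>u x\<bar> powr p * ln (1 + \<bar>u x\<bar>)"
    and f = "\<lambda>x. g x / (?\<omega> * p) + C * \<bar>u x\<bar> powr p"]) (auto intro!: AE_I2)
qed

section \<open>Compactness\<close>

lemma h_mono: "1 < p \<Longrightarrow> x \<le> y \<Longrightarrow> h p x \<le> h p y"
 unfolding h_sgn using powr_mono2[of "p - 1" x y] powr_mono2[of "p - 1" "- y" "- x"]
 by (auto simp: sgn_if abs_if intro: order_trans[of _ 0])

lemma convex_on_abs_powr: "1 < p \<Longrightarrow> convex_on UNIV (\<lambda>t::real. \<bar>t\<bar> powr p)"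
 by (rule convex_on_realI[where f' = "\<lambda>t. p * h p t"])
   (auto intro: abs_powr_has_derivative h_mono)

lemma jensen_abs_powr:
 fixes \<rho> f :: "'a::euclidean_space \<Rightarrow> real"
 assumes p: "1 < p" and [measurable]: "\<rho> \<in> borel_measurable borel" "f \<in> borel_measurable borel"
  and \<rho>: "\<And>x. 0 \<le> \<rho> x" "integrable lborel \<rho>" "(LBINT x. \<rho> x) = 1"
  and i: "integrable lborel (\<lambda>x. \<rho> x * f x)"
 shows "ennreal (\<bar>LBINT x. \<rho> x * f x\<bar> powr p) \<le> (\<integral>\<^sub>+x. ennreal (\<rho> x * \<bar>f x\<bar> powr p))"
proof (cases "(\<integral>\<^sub>+x. ennreal (\<rho> x * \<bar>f x\<bar> powr p)) = \<infinity>")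
 case False
 let ?D = "density lborel (\<lambda>x. ennreal (\<rho> x))"
 have "(\<integral>\<^sub>+x. ennreal (\<rho> x)) = 1"
  using \<rho> by (subst nn_integral_eq_integral) auto
 then interpret D: prob_space ?D
  by (intro prob_spaceI) (simp add: emeasure_density)
 have ip: "integrable lborel (\<lambda>x. \<rho> x * \<bar>f x\<bar> powr p)"
  using False \<rho>(1) by (intro integrableI_bounded) (auto simp: abs_mult less_top)
 have "\<bar>LINT x|?D. f x\<bar> powr p \<le> (LINT x|?D. \<bar>f x\<bar> powr p)"
  using i ip \<rho>(1) p
  by (intro D.jensens_inequality[where I = UNIV and q = "\<lambda>t. \<bar>t\<bar> powr p"])
    (auto simp: integrable_density convex_on_abs_powr)
 then have "\<bar>LBINT x. \<rho> x * f x\<bar> powr p \<le> (LBINT x. \<rho> x * \<bar>f x\<bar> powr p)"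
  using \<rho>(1) by (simp add: integral_density)
 then show ?thesis
  using ip \<rho>(1) by (subst nn_integral_eq_integral) (auto intro: ennreal_leI)
qed simp

lemma Lp_subsequence:
 fixes f :: "nat \<Rightarrow> 'a::euclidean_space \<Rightarrow> real"
 assumes p: "1 < p" and [measurable]: "\<And>k. f k \<in> borel_measurable borel"
  and i: "\<And>k. integrable lborel (\<lambda>x. \<bar>f k x\<bar> powr p)"
  and cauchy: "\<And>\<epsilon>. 0 < \<epsilon> \<Longrightarrow> \<exists>K. \<forall>m\<ge>K. \<forall>n\<ge>K. (LBINT x. \<bar>f m x - f n x\<bar> powr p) \<le> \<epsilon>"
 obtains r g G where "strict_mono (r :: nat \<Rightarrow> nat)" "g \<in> borel_measurable borel"
  "AE x in lborel. (\<lambda>k. f (r k) x) \<longlonglongrightarrow> g x" "integrable lborel G" "\<And>x. 0 \<le> G x"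
  "AE x in lborel. \<forall>k. \<bar>f (r k) x\<bar> powr p \<le> G x"
  "AE x in lborel. \<bar>g x\<bar> powr p \<le> G x" "integrable lborel (\<lambda>x. \<bar>g x\<bar> powr p)"
  "(\<lambda>k. LBINT x. \<bar>f (r k) x - g x\<bar> powr p) \<longlonglongrightarrow> 0"
proof -
 \<comment> \<open>The rate leaves room for the weight \<open>2 powr (k * p)\<close>: the weighted
   increments still have integrals at most \<open>(1/2) ^ k\<close>, and undoing the weight bounds
   the \<open>k\<close>-th increment pointwise by \<open>H x powr (1/p) * (1/2) ^ k\<close>.\<close>
 have "\<forall>k. \<exists>K. \<forall>m\<ge>K. \<forall>n\<ge>K. (LBINT x. \<bar>f m x - f n x\<bar> powr p) \<le> 2 powr - (real k * (p + 1))"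
  using cauchy by simp
 then obtain K where K: "\<And>k m n. m \<ge> K k \<Longrightarrow> n \<ge> K k \<Longrightarrow> (LBINT x. \<bar>f m x - f n x\<bar> powr p) \<le> 2 powr - (real k * (p + 1))"
  by metis
 define r where "r = rec_nat (K 0) (\<lambda>k m. max (Suc m) (K (Suc k)))"
 have r_Suc: "r (Suc k) = max (Suc (r k)) (K (Suc k))" for k by (simp add: r_def)
 have mono: "strict_mono r" by (rule strict_mono_Suc_iff[THEN iffD2]) (simp add: r_Suc less_max_iff_disj)
 have rK: "K k \<le> r k" for k by (cases k) (simp_all add: r_Suc, simp add: r_def)
 define D where "D = (\<lambda>k x. \<bar>f (r (Suc k)) x - f (r k) x\<bar> powr p)"
 have [measurable]: "D k \<in> borel_measurable borel" for k unfolding D_def by measurable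
 have D0: "0 \<le> D k x" for k x by (simp add: D_def)
 have Di: "integrable lborel (D k)" for k
  unfolding D_def
  by (rule Bochner_Integration.integrable_bound[of _ "\<lambda>x. 2 powr p * (\<bar>f (r (Suc k)) x\<bar> powr p + \<bar>f (r k) x\<bar> powr p)"])
    (use i p abs_diff_powr_le[of p] in \<open>auto intro!: AE_I2 simp: abs_of_nonneg\<close>)
 have DI: "(LBINT x. D k x) \<le> 2 powr - (real k * (p + 1))" for k
  unfolding D_def using rK[of k] strict_monoD[OF mono, of k "Suc k"] by (intro K) auto
 define H' where "H' = (\<lambda>x. \<Sum>k. ennreal (2 powr (real k * p) * D k x))"
 have [measurable]: "H' \<in> borel_measurable borel" unfolding H'_def by measurable
 have "(\<integral>\<^sub>+x. H' x) = (\<Sum>k. \<integral>\<^sup>+x. ennreal (2 powr (real k * p) * D k x) \<partial>lborel)"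
  unfolding H'_def by (rule nn_integral_suminf) measurable
 also have "\<dots> \<le> (\<Sum>k. ennreal ((1/2) ^ k))"
 proof (rule suminf_le)
  fix k
  have "(\<integral>\<^sub>+x. ennreal (2 powr (real k * p) * D k x)) = ennreal (LBINT x. 2 powr (real k * p) * D k x)"
   using Di D0 by (intro nn_integral_eq_integral) auto
  also have "\<dots> \<le> ennreal (2 powr (real k * p) * 2 powr - (real k * (p + 1)))"
   using DI[of k] by (intro ennreal_leI) (simp add: mult_left_mono)
  also have "2 powr (real k * p) * 2 powr - (real k * (p + 1)) = (1/2::real) ^ k"
  proof -
   have "2 powr (real k * p) * 2 powr - (real k * (p + 1)) = (2::real) powr - real k"
    by (simp flip: powr_add add: algebra_simps)
   then show ?thesis by (simp add: powr_minus powr_realpow power_one_over inverse_eq_divide)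
  qed
  finally show "(\<integral>\<^sub>+x. ennreal (2 powr (real k * p) * D k x)) \<le> ennreal ((1/2) ^ k)" .
 qed auto
 also have "\<dots> = ennreal (\<Sum>k. (1/2) ^ k)" by (rule suminf_ennreal2) auto
 finally have fin: "(\<integral>\<^sub>+x. H' x) < \<infinity>" by (simp add: le_less_trans)
 then have AEH: "AE x in lborel. H' x \<noteq> \<infinity>" by (intro nn_integral_PInf_AE) auto
 define H where "H = (\<lambda>x. enn2real (H' x))"
 have [measurable]: "H \<in> borel_measurable borel" unfolding H_def by measurable
 have H0: "0 \<le> H x" for x by (simp add: H_def)
 have Hi: "integrable lborel H"
 proof (rule integrableI_bounded)
  have "(\<integral>\<^sub>+x. ennreal (norm (H x))) = (\<integral>\<^sub>+x. H' x)"
   by (rule nn_integral_cong_AE) (use AEH in \<open>eventually_elim, auto simp: H_def less_top\<close>)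
  then show "(\<integral>\<^sub>+x. ennreal (norm (H x))) < \<infinity>" using fin by simp
 qed simp
 have step: "\<bar>f (r (Suc k)) x - f (r k) x\<bar> \<le> H x powr (1/p) * (1/2) ^ k" if "H' x \<noteq> \<infinity>" for x k
 proof -
  have "ennreal (2 powr (real k * p) * D k x) \<le> H' x"
   unfolding H'_def using sum_le_suminf[of "\<lambda>k. ennreal (2 powr (real k * p) * D k x)" "{k}"] by simp
  also have "H' x = ennreal (H x)" using that by (simp add: H_def less_top)
  finally have *: "2 powr (real k * p) * D k x \<le> H x" using H0 by simp
  have "2 powr (real k * p) * D k x = (2 ^ k * \<bar>f (r (Suc k)) x - f (r k) x\<bar>) powr p"
   by (simp add: D_def powr_mult powr_powr flip: powr_realpow)
  with * have "((2 ^ k * \<bar>f (r (Suc k)) x - f (r k) x\<bar>) powr p) powr (1/p) \<le> H x powr (1/p)"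
   using p by (intro powr_mono2) auto
  then show ?thesis using p by (simp add: powr_powr field_simps)
 qed
 define g where "g = (\<lambda>x. lim (\<lambda>k. f (r k) x))"
 have gm[measurable]: "g \<in> borel_measurable borel" unfolding g_def by measurable
 have sum_step: "\<bar>f (r (k + m)) x - f (r k) x\<bar> \<le> 2 * H x powr (1/p) * (1/2) ^ k" if "H' x \<noteq> \<infinity>" for x k m
 proof -
  have "f (r (k + m)) x - f (r k) x = (\<Sum>j<m. f (r (Suc (k + j))) x - f (r (k + j)) x)"
   by (subst sum_lessThan_telescope[of "\<lambda>j. f (r (k + j)) x", simplified]) simp
  also have "\<bar>\<dots>\<bar> \<le> (\<Sum>j<m. H x powr (1/p) * (1/2) ^ (k + j))"
   by (intro order_trans[OF sum_abs] sum_mono step that)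
  also have "\<dots> = H x powr (1/p) * (1/2) ^ k * (\<Sum>j<m. (1/2) ^ j)" by (simp add: power_add sum_distrib_left mult_ac)
  also have "\<dots> \<le> H x powr (1/p) * (1/2) ^ k * 2"
   by (intro mult_left_mono) (auto simp: geometric_sum)
  finally show ?thesis by (simp add: mult_ac)
 qed
 have conv: "(\<lambda>k. f (r k) x) \<longlonglongrightarrow> g x" if "H' x \<noteq> \<infinity>" for x
 proof -
  have "summable (\<lambda>k. f (r (Suc k)) x - f (r k) x)"
   by (rule summable_comparison_test'[where g = "\<lambda>k. H x powr (1/p) * (1/2) ^ k"])
     (use step[OF that] in \<open>auto intro: summable_mult summable_geometric\<close>)
  then have "convergent (\<lambda>n. f (r n) x - f (r 0) x)"
   unfolding summable_iff_convergent sum_lessThan_telescope[of "\<lambda>k. f (r k) x"] .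
  then have "convergent (\<lambda>k. f (r k) x)" by (simp add: convergent_diff_const_right_iff)
  then show ?thesis unfolding g_def by (simp add: convergent_LIMSEQ_iff)
 qed
 \<comment> \<open>Comes from writing \<open>f (r k) x\<close> as \<open>f (r 0) x\<close> plus a
   difference, which the geometric series bounds by \<open>2 * H x powr (1/p)\<close>.\<close>
 define G where "G = (\<lambda>x. 2 powr p * (\<bar>f (r 0) x\<bar> powr p + 2 powr p * H x))"
 have Gi: "integrable lborel G" unfolding G_def using i Hi by simp
 have G0: "0 \<le> G x" for x using H0 by (simp add: G_def)
 have bd: "\<bar>f (r k) x\<bar> powr p \<le> G x" if "H' x \<noteq> \<infinity>" for k x
 proof -
  have "\<bar>f (r k) x - f (r 0) x\<bar> \<le> 2 * H x powr (1/p)" using sum_step[OF that, of 0 k] by simp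
  then have "\<bar>f (r k) x - f (r 0) x\<bar> powr p \<le> (2 * H x powr (1/p)) powr p" using p by (intro powr_mono2) auto
  also have "\<dots> = 2 powr p * H x" using p H0[of x] by (simp add: powr_mult powr_powr)
  finally have *: "\<bar>f (r k) x - f (r 0) x\<bar> powr p \<le> 2 powr p * H x" .
  have "\<bar>f (r k) x\<bar> powr p = \<bar>f (r 0) x + (f (r k) x - f (r 0) x)\<bar> powr p" by simp
  also have "\<dots> \<le> 2 powr p * (\<bar>f (r 0) x\<bar> powr p + \<bar>f (r k) x - f (r 0) x\<bar> powr p)"
   using p by (intro abs_add_powr_le) auto
  also have "\<dots> \<le> G x" unfolding G_def using * by (intro mult_left_mono add_left_mono) auto
  finally show ?thesis .
 qed
 have gbd: "\<bar>g x\<bar> powr p \<le> G x" if "H' x \<noteq> \<infinity>" for x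
 proof -
  have "(\<lambda>k. \<bar>f (r k) x\<bar> powr p) \<longlonglongrightarrow> \<bar>g x\<bar> powr p"
   using p by (intro tendsto_powr' tendsto_rabs conv that) auto
  then show ?thesis by (rule LIMSEQ_le_const2) (use bd[OF that] in auto)
 qed
 have gi: "integrable lborel (\<lambda>x. \<bar>g x\<bar> powr p)"
  by (rule Bochner_Integration.integrable_bound[OF Gi])
    (use AEH gbd G0 in \<open>auto elim!: eventually_mono\<close>)
 have "(\<lambda>k. LBINT x. \<bar>f (r k) x - g x\<bar> powr p) \<longlonglongrightarrow> integral\<^sup>L lborel (\<lambda>x::'a. 0::real)"
 proof (rule integral_dominated_convergence[where w = "\<lambda>x. 2 powr p * (G x + G x)"])
  show "AE x in lborel. (\<lambda>k. \<bar>f (r k) x - g x\<bar> powr p) \<longlonglongrightarrow> 0"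
   using AEH
  proof eventually_elim
   case (elim x)
   have "(\<lambda>k. \<bar>f (r k) x - g x\<bar> powr p) \<longlonglongrightarrow> \<bar>g x - g x\<bar> powr p"
    using p by (intro tendsto_powr' tendsto_rabs tendsto_diff tendsto_const conv elim) auto
   then show ?case by simp
  qed
  show "AE x in lborel. norm (\<bar>f (r k) x - g x\<bar> powr p) \<le> 2 powr p * (G x + G x)" for k
   using AEH
  proof eventually_elim
   case (elim x)
   have "\<bar>f (r k) x - g x\<bar> powr p \<le> 2 powr p * (\<bar>f (r k) x\<bar> powr p + \<bar>g x\<bar> powr p)"
    using p by (intro abs_diff_powr_le) auto
   also have "\<dots> \<le> 2 powr p * (G x + G x)" using bd[OF elim] gbd[OF elim] by (intro mult_left_mono add_mono) auto
   finally show ?case by simp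
  qed
 qed (use Gi in auto)
 then show ?thesis
  using AEH bd gbd conv
  by (intro that[of r g G] mono gm Gi G0 gi) (auto elim: eventually_mono)
qed

text \<open>The mass of this kernel is large compared with \<open>\<epsilon>\<^sup>N\<close>, while it is bounded by \<open>\<epsilon>\<^sup>N\<close> times the singular
 kernel: averages against it are therefore close to \<open>u\<close> in \<open>L\<^sup>p\<close>, uniformly on bounded subsets of \<open>X\<close>.\<close>

definition log_kernel :: "real \<Rightarrow> 'a::euclidean_space \<Rightarrow> real" where
 "log_kernel \<epsilon> z = max 0 (1 - norm z) * (\<epsilon> / (norm z + \<epsilon>)) ^ DIM('a)"

lemma log_kernel_bounds:
 assumes "0 < \<epsilon>"
 shows "0 \<le> log_kernel \<epsilon> (z::'a)" "log_kernel \<epsilon> (z::'a) \<le> 1"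
  "x \<noteq> y \<Longrightarrow> log_kernel \<epsilon> (x - y) \<le> \<epsilon> ^ DIM('a) * (kn 0 (x, y :: 'a::euclidean_space))"
proof -
 show "0 \<le> log_kernel \<epsilon> z" using assms by (simp add: log_kernel_def)
 have "\<epsilon> / (norm z + \<epsilon>) \<le> 1" using assms by (simp add: divide_le_eq add_nonneg_pos)
 then show "log_kernel \<epsilon> z \<le> 1"
  using assms unfolding log_kernel_def by (intro mult_le_one power_le_one) auto
 let ?n = "norm (x - y)"
 assume "x \<noteq> y"
 then have n: "0 < ?n" by simp
 show "log_kernel \<epsilon> (x - y) \<le> \<epsilon> ^ DIM('a) * kn 0 (x, y)"
 proof (cases "?n \<le> 1")
  case True
  have "log_kernel \<epsilon> (x - y) \<le> 1 * (\<epsilon> / ?n) ^ DIM('a)"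
   unfolding log_kernel_def using n assms
   by (intro mult_mono power_mono divide_left_mono mult_pos_pos add_pos_pos) auto
  then show ?thesis using True n by (simp add: kn_def powr_minus powr_realpow divide_inverse power_mult_distrib power_inverse)
 next
  case False
  then show ?thesis using assms by (simp add: log_kernel_def)
 qed
qed

lemma log_kernel_measurable [measurable]: "log_kernel \<epsilon> \<in> borel_measurable borel"
 unfolding log_kernel_def[abs_def] by measurable

lemma log_kernel_lipschitz:
 assumes \<epsilon>: "0 < \<epsilon>"
 shows "\<bar>log_kernel \<epsilon> z - log_kernel \<epsilon> w\<bar> \<le> (1 + real DIM('a) / \<epsilon>) * norm (z - w :: 'a::euclidean_space)"
proof -
 let ?b = "\<lambda>z::'a. \<epsilon> / (norm z + \<epsilon>)"
 let ?m = "\<lambda>z::'a. max 0 (1 - norm z)"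
 have b: "0 \<le> ?b z" "?b z \<le> 1" for z using \<epsilon> by (auto simp: divide_le_eq add_nonneg_pos)
 have "\<bar>?b z - ?b w\<bar> = \<epsilon> * \<bar>norm w - norm z\<bar> / ((norm z + \<epsilon>) * (norm w + \<epsilon>))"
 proof -
  have "?b z - ?b w = \<epsilon> * (norm w - norm z) / ((norm z + \<epsilon>) * (norm w + \<epsilon>))"
  proof -
   have "\<epsilon> / A - \<epsilon> / B = \<epsilon> * (B - A) / (A * B)" if "0 < A" "0 < B" for A B :: real
    using that by (simp add: field_simps)
   from this[of "norm z + \<epsilon>" "norm w + \<epsilon>"] show ?thesis using \<epsilon> by (simp add: add_nonneg_pos)
  qed
  then show ?thesis using \<epsilon> by (simp add: abs_mult)
 qed
 also have "\<dots> \<le> \<epsilon> * norm (z - w) / (\<epsilon> * \<epsilon>)"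
  using \<epsilon> norm_triangle_ineq3[of w z] by (intro frac_le mult_left_mono mult_mono) (auto simp: norm_minus_commute)
 finally have 1: "\<bar>?b z - ?b w\<bar> \<le> norm (z - w) / \<epsilon>" using \<epsilon> by simp
 have "norm (?b z ^ DIM('a) - ?b w ^ DIM('a)) \<le> real DIM('a) * norm (?b z - ?b w)"
  using b[of z] b[of w] by (intro norm_power_diff) (auto simp only: real_norm_def abs_of_nonneg)
 then have 2: "\<bar>?b z ^ DIM('a) - ?b w ^ DIM('a)\<bar> \<le> real DIM('a) * (norm (z - w) / \<epsilon>)"
  using 1 by (smt (verit) mult_left_mono of_nat_0_le_iff real_norm_def)
 have 3: "\<bar>?m z - ?m w\<bar> \<le> norm (z - w)"
  using norm_triangle_ineq3[of z w] by (auto simp: max_def)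
 have "log_kernel \<epsilon> z - log_kernel \<epsilon> w = (?m z - ?m w) * ?b z ^ DIM('a) + ?m w * (?b z ^ DIM('a) - ?b w ^ DIM('a))"
  by (simp add: log_kernel_def algebra_simps)
 also have "\<bar>\<dots>\<bar> \<le> \<bar>?m z - ?m w\<bar> * \<bar>?b z ^ DIM('a)\<bar> + \<bar>?m w\<bar> * \<bar>?b z ^ DIM('a) - ?b w ^ DIM('a)\<bar>"
  by (rule order_trans[OF abs_triangle_ineq]) (simp add: abs_mult)
 also have "\<dots> \<le> norm (z - w) * 1 + 1 * (real DIM('a) * (norm (z - w) / \<epsilon>))"
 proof -
  have "\<bar>?b z ^ DIM('a)\<bar> \<le> 1" using power_le_one[OF b, of z "DIM('a)"] b(1)[of z] by (simp only: abs_of_nonneg zero_le_power)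
  moreover have "\<bar>?m w\<bar> \<le> 1" by simp
  ultimately show ?thesis by (intro add_mono mult_mono 2 3) auto
 qed
 finally show ?thesis by (simp add: algebra_simps)
qed

lemma log_kernel_integrable:
 assumes "0 < \<epsilon>" shows "integrable lborel (log_kernel \<epsilon> :: 'a::euclidean_space \<Rightarrow> real)"
proof (rule Bochner_Integration.integrable_bound)
 show "integrable lborel (indicat_real (cball (0::'a) 1))"
  by (intro integrable_real_indicator) (use emeasure_bounded_finite[OF bounded_cball] in auto)
 have "norm (log_kernel \<epsilon> z) \<le> norm (indicat_real (cball (0::'a) 1) z)" for z :: 'a
 proof (cases "norm z \<le> 1")
  case True
  then show ?thesis using log_kernel_bounds(1,2)[OF assms, of z] by simp
 qed (simp add: log_kernel_def)
 then show "AE z in lborel. norm (log_kernel \<epsilon> (z::'a)) \<le> norm (indicat_real (cball (0::'a) 1) z)"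
  by (intro AE_I2)
qed measurable

text \<open>On the annulus \<open>\<epsilon> < norm z \<le> 1\<close> one has
  \<open>norm z + \<epsilon> \<le> 2 * norm z\<close>, so the kernel is at least
  \<open>(\<epsilon> / 2) ^ N * (1 - norm z) * norm z powr - N\<close> there. The term
  \<open>norm z\<close> of the cut-off costs a bounded radial integral, whence the
  \<open>- 1\<close>.\<close>

lemma log_kernel_mass:
 assumes \<epsilon>: "0 < \<epsilon>" "\<epsilon> \<le> 1"
 shows "\<epsilon> ^ DIM('a) * (sphere_area DIM('a) * (ln (1 / \<epsilon>) - 1)) \<le> 2 ^ DIM('a) * (LBINT z. log_kernel \<epsilon> (z::'a::euclidean_space))"
proof -
 let ?N = "DIM('a)"
 let ?A = "\<lambda>e z::'a. indicator {\<epsilon><..1} (norm z) * norm z powr - (real ?N + e)"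
 have pw: "norm z powr - (real ?N + - 1) = norm z * norm z powr - (real ?N + 0)" if "z \<noteq> 0" for z :: 'a
  using that powr_mult_base[of "norm z" "- real ?N"] by simp
 have pt: "?A 0 z \<le> (2 / \<epsilon>) ^ ?N * log_kernel \<epsilon> z + ?A (-1) z" for z
 proof (cases "\<epsilon> < norm z \<and> norm z \<le> 1")
  case True
  then have z: "0 < norm z" "z \<noteq> 0" using \<epsilon> by auto
  have "norm z powr - (real ?N + 0) = (1 / norm z) ^ ?N"
   using z by (simp add: powr_minus powr_realpow power_one_over inverse_eq_divide)
  also have "\<dots> \<le> ((2 / \<epsilon>) * (\<epsilon> / (norm z + \<epsilon>))) ^ ?N"
   using True \<epsilon> z by (intro power_mono) (auto simp: field_simps)
  finally have "(1 - norm z) * norm z powr - (real ?N + 0) \<le> (1 - norm z) * ((2 / \<epsilon>) * (\<epsilon> / (norm z + \<epsilon>))) ^ ?N"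
   using True by (intro mult_left_mono) auto
  also have "\<dots> = (2 / \<epsilon>) ^ ?N * log_kernel \<epsilon> z"
   using True unfolding log_kernel_def power_mult_distrib by (simp add: max_def)
  finally show ?thesis using True pw[OF z(2)] by (simp add: left_diff_distrib)
 next
  case False
  then show ?thesis using \<epsilon> log_kernel_bounds(1)[OF \<epsilon>(1), of z] by (auto simp: indicator_def)
 qed
 have "ennreal (sphere_area ?N * ln (1 / \<epsilon>)) = (\<integral>\<^sub>+z. ennreal (?A 0 z))"
  using radial_annulus_log[OF \<epsilon>, where 'a='a] by simp
 also have "\<dots> \<le> (\<integral>\<^sub>+z. ennreal ((2 / \<epsilon>) ^ ?N * log_kernel \<epsilon> z + ?A (-1) z))"
  using pt by (intro nn_integral_mono ennreal_leI) auto
 also have "\<dots> = (\<integral>\<^sub>+z. ennreal ((2 / \<epsilon>) ^ ?N * log_kernel \<epsilon> z) + ennreal (?A (-1) z))"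
  using \<epsilon> log_kernel_bounds(1)[OF \<epsilon>(1), where 'a='a] by (intro nn_integral_cong ennreal_plus) auto
 also have "\<dots> = (\<integral>\<^sub>+z. ennreal ((2 / \<epsilon>) ^ ?N * log_kernel \<epsilon> (z::'a))) + (\<integral>\<^sub>+z. ennreal (?A (-1) z))"
  by (rule nn_integral_add) measurable
 also have "(\<integral>\<^sub>+z. ennreal (?A (-1) z)) = ennreal (sphere_area ?N * (1 - \<epsilon>))"
  using radial_annulus_powr[OF \<epsilon>, of "-1", where 'a='a] \<epsilon> by (simp only:) (simp add: algebra_simps)
 also have "(\<integral>\<^sub>+z. ennreal ((2 / \<epsilon>) ^ ?N * log_kernel \<epsilon> (z::'a))) = ennreal ((2 / \<epsilon>) ^ ?N * (LBINT z. log_kernel \<epsilon> (z::'a)))"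
  using log_kernel_integrable[OF \<epsilon>(1), where 'a='a] log_kernel_bounds(1)[OF \<epsilon>(1), where 'a='a] \<epsilon>
  by (subst nn_integral_eq_integral) auto
 also have "\<dots> + ennreal (sphere_area ?N * (1 - \<epsilon>)) = ennreal ((2 / \<epsilon>) ^ ?N * (LBINT z. log_kernel \<epsilon> (z::'a)) + sphere_area ?N * (1 - \<epsilon>))"
  using \<epsilon> sphere_area_pos[of ?N] log_kernel_bounds(1)[OF \<epsilon>(1), where 'a='a]
  by (intro ennreal_plus[symmetric] mult_nonneg_nonneg) auto
 finally have "sphere_area ?N * ln (1 / \<epsilon>) \<le> (2 / \<epsilon>) ^ ?N * (LBINT z. log_kernel \<epsilon> (z::'a)) + sphere_area ?N * (1 - \<epsilon>)"
  using \<epsilon> sphere_area_pos[of ?N] log_kernel_bounds(1)[OF \<epsilon>(1), where 'a='a]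
  by (subst (asm) ennreal_le_iff) (auto intro!: add_nonneg_nonneg mult_nonneg_nonneg)
 moreover have "0 \<le> sphere_area ?N * \<epsilon>" using sphere_area_pos[of ?N] \<epsilon> by simp
 ultimately have "sphere_area ?N * (ln (1 / \<epsilon>) - 1) \<le> (2 / \<epsilon>) ^ ?N * (LBINT z. log_kernel \<epsilon> (z::'a))"
  by (simp add: algebra_simps)
 then have "\<epsilon> ^ ?N * (sphere_area ?N * (ln (1 / \<epsilon>) - 1)) \<le> \<epsilon> ^ ?N * ((2 / \<epsilon>) ^ ?N * (LBINT z. log_kernel \<epsilon> (z::'a)))"
  using \<epsilon> by (intro mult_left_mono) auto
 also have "\<dots> = (\<epsilon> * (2 / \<epsilon>)) ^ ?N * (LBINT z. log_kernel \<epsilon> (z::'a))" by (simp only: power_mult_distrib mult.assoc)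
 also have "\<epsilon> * (2 / \<epsilon>) = 2" using \<epsilon> by simp
 finally show ?thesis .
qed


lemma Lp_imp_L1:
 fixes u :: "'a::euclidean_space \<Rightarrow> real"
 assumes p: "1 < p" and \<Omega>: "bounded \<Omega>" "open \<Omega>" and [measurable]: "u \<in> borel_measurable borel"
  and 0: "\<And>x. x \<notin> \<Omega> \<Longrightarrow> u x = 0" and i: "integrable lborel (\<lambda>x. \<bar>u x\<bar> powr p)"
 shows "integrable lborel u" "(LBINT x. \<bar>u x\<bar>) \<le> measure lborel \<Omega> + (LBINT x. \<bar>u x\<bar> powr p)"
proof -
 have [measurable]: "\<Omega> \<in> sets borel" using \<Omega> by auto
 have em: "emeasure lborel \<Omega> < \<infinity>" by (rule emeasure_bounded_finite[OF \<Omega>(1)])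
 have ii: "integrable lborel (indicat_real \<Omega>)" using em by (intro integrable_real_indicator) auto
 have le: "\<bar>u x\<bar> \<le> indicator \<Omega> x + \<bar>u x\<bar> powr p" for x
 proof (cases "x \<in> \<Omega>")
  case True
  have "\<bar>u x\<bar> \<le> \<bar>u x\<bar> powr p" if "1 \<le> \<bar>u x\<bar>" using powr_mono[of 1 p "\<bar>u x\<bar>"] that p by simp
  moreover have "0 \<le> \<bar>u x\<bar> powr p" "indicator \<Omega> x = (1::real)" using True by auto
  ultimately show ?thesis by (cases "1 \<le> \<bar>u x\<bar>") linarith+
 qed (simp add: 0)
 show u1: "integrable lborel u"
  by (rule Bochner_Integration.integrable_bound[OF Bochner_Integration.integrable_add[OF ii i]])
    (use le in \<open>auto intro!: AE_I2 order_trans[OF _ abs_ge_self]\<close>)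
 have "(LBINT x. \<bar>u x\<bar>) \<le> (LBINT x. indicator \<Omega> x + \<bar>u x\<bar> powr p)"
  using u1 ii i le by (intro integral_mono) auto
 then show "(LBINT x. \<bar>u x\<bar>) \<le> measure lborel \<Omega> + (LBINT x. \<bar>u x\<bar> powr p)"
  using ii i em by simp
qed

lemma log_kernel_approx:
 fixes u :: "'a::euclidean_space \<Rightarrow> real"
 assumes p: "1 < p" and \<Omega>: "bounded \<Omega>" "open \<Omega>" and u: "u \<in> Xe p \<Omega> 0" and \<epsilon>: "0 < \<epsilon>"
  and Z: "0 < (LBINT z. log_kernel \<epsilon> (z::'a))"
 defines "Z \<equiv> LBINT z. log_kernel \<epsilon> (z::'a)"
 shows "(\<integral>\<^sub>+x. ennreal (\<bar>u x - (LBINT z. log_kernel \<epsilon> (x - z) * u z) / Z\<bar> powr p))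
   \<le> ennreal (\<epsilon> ^ DIM('a) / Z * near p 0 u u)"
proof -
 note [measurable] = XeD(1)[OF u]
 have Z0: "0 < Z" using Z by (simp add: Z_def)
 have u1: "integrable lborel u" by (rule Lp_imp_L1(1)[OF p \<Omega> XeD(1-3)[OF u]])
 have ki: "integrable lborel (\<lambda>z. log_kernel \<epsilon> (x - z))" "(LBINT z. log_kernel \<epsilon> (x - z)) = Z" for x :: 'a
 proof -
  have eq: "(\<integral>\<^sub>+z. ennreal (log_kernel \<epsilon> (x - z))) = ennreal Z"
   using nn_integral_lborel_reflect[of "\<lambda>z. ennreal (log_kernel \<epsilon> z)" x]
    nn_integral_eq_integral[OF log_kernel_integrable[OF \<epsilon>, where 'a='a]] log_kernel_bounds(1)[OF \<epsilon>, where 'a='a]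
   by (simp add: Z_def)
  show 1: "integrable lborel (\<lambda>z. log_kernel \<epsilon> (x - z))"
   using eq log_kernel_bounds(1)[OF \<epsilon>, where 'a='a] by (intro integrableI_bounded) auto
  then show "(LBINT z. log_kernel \<epsilon> (x - z)) = Z"
   using eq log_kernel_bounds(1)[OF \<epsilon>, where 'a='a] Z0 by (subst integral_eq_nn_integral) auto
 qed
 have kui: "integrable lborel (\<lambda>z. log_kernel \<epsilon> (x - z) * u z)" for x :: 'a
  using log_kernel_bounds(1,2)[OF \<epsilon>, where 'a='a]
  by (intro Bochner_Integration.integrable_bound[OF u1]) (auto simp: abs_mult intro!: AE_I2 mult_left_le_one_le)
 have pt: "ennreal (\<bar>u x - (LBINT z. log_kernel \<epsilon> (x - z) * u z) / Z\<bar> powr p)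
   \<le> (\<integral>\<^sub>+z. ennreal (\<epsilon> ^ DIM('a) / Z) * ennreal (\<bar>u x - u z\<bar> powr p * kn 0 (x, z)))" for x
 proof -
  have "u x - (LBINT z. log_kernel \<epsilon> (x - z) * u z) / Z
    = (LBINT z. log_kernel \<epsilon> (x - z) / Z * u x) - (LBINT z. log_kernel \<epsilon> (x - z) / Z * u z)"
   using ki Z0 by simp
  also have "\<dots> = (LBINT z. log_kernel \<epsilon> (x - z) / Z * (u x - u z))"
  proof -
   have "integrable lborel (\<lambda>z. log_kernel \<epsilon> (x - z) / Z * u x)" "integrable lborel (\<lambda>z. log_kernel \<epsilon> (x - z) / Z * u z)"
    using ki(1)[of x] integrable_divide[OF kui[of x], of Z] by simp_all
   from Bochner_Integration.integral_diff[OF this] show ?thesis by (simp only: right_diff_distrib)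
  qed
  finally have "ennreal (\<bar>u x - (LBINT z. log_kernel \<epsilon> (x - z) * u z) / Z\<bar> powr p)
    = ennreal (\<bar>LBINT z. log_kernel \<epsilon> (x - z) / Z * (u x - u z)\<bar> powr p)" by simp
  also have "\<dots> \<le> (\<integral>\<^sub>+z. ennreal (log_kernel \<epsilon> (x - z) / Z * \<bar>u x - u z\<bar> powr p))"
  proof (rule jensen_abs_powr[OF p])
   have "integrable lborel (\<lambda>z. log_kernel \<epsilon> (x - z) / Z * u x)" "integrable lborel (\<lambda>z. log_kernel \<epsilon> (x - z) / Z * u z)"
    using ki(1)[of x] integrable_divide[OF kui[of x], of Z] by simp_all
   from Bochner_Integration.integrable_diff[OF this]
   show "integrable lborel (\<lambda>z. log_kernel \<epsilon> (x - z) / Z * (u x - u z))" by (simp only: right_diff_distrib)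
   show "integrable lborel (\<lambda>z. log_kernel \<epsilon> (x - z) / Z)" using ki(1)[of x] by simp
   show "(LBINT z. log_kernel \<epsilon> (x - z) / Z) = 1" using ki(2)[of x] Z0 by simp
   show "0 \<le> log_kernel \<epsilon> (x - z) / Z" for z using log_kernel_bounds(1)[OF \<epsilon>, of "x - z"] Z0 by simp
  qed measurable
  also have "\<dots> \<le> (\<integral>\<^sub>+z. ennreal (\<epsilon> ^ DIM('a) / Z) * ennreal (\<bar>u x - u z\<bar> powr p * kn 0 (x, z)))"
  proof (rule nn_integral_mono)
   fix z
   have "log_kernel \<epsilon> (x - z) / Z * \<bar>u x - u z\<bar> powr p \<le> \<epsilon> ^ DIM('a) * kn 0 (x, z) / Z * \<bar>u x - u z\<bar> powr p"
   proof (cases "x = z")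
    case False
    then show ?thesis using Z0 \<epsilon> by (intro mult_right_mono divide_right_mono log_kernel_bounds(3)) auto
   qed simp
   then have "ennreal (log_kernel \<epsilon> (x - z) / Z * \<bar>u x - u z\<bar> powr p)
     \<le> ennreal (\<epsilon> ^ DIM('a) / Z * (\<bar>u x - u z\<bar> powr p * kn 0 (x, z)))"
    by (intro ennreal_leI) (simp add: mult_ac)
   then show "ennreal (log_kernel \<epsilon> (x - z) / Z * \<bar>u x - u z\<bar> powr p)
     \<le> ennreal (\<epsilon> ^ DIM('a) / Z) * ennreal (\<bar>u x - u z\<bar> powr p * kn 0 (x, z))"
    by (subst ennreal_mult[symmetric]) (use Z0 \<epsilon> in auto)
  qed
  finally show ?thesis .
 qed
 have "(\<integral>\<^sub>+x. ennreal (\<bar>u x - (LBINT z. log_kernel \<epsilon> (x - z) * u z) / Z\<bar> powr p))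
  \<le> (\<integral>\<^sub>+x. (\<integral>\<^sub>+z. ennreal (\<epsilon> ^ DIM('a) / Z) * ennreal (\<bar>u x - u z\<bar> powr p * kn 0 (x, z))))"
  by (intro nn_integral_mono pt)
 also have "\<dots> = (\<integral>\<^sub>+z. ennreal (\<epsilon> ^ DIM('a) / Z) * ennreal (\<bar>incr u z\<bar> powr p * kn 0 z))"
  by (subst nn_integral_pair_lborel(1)) auto
 also have "\<dots> = ennreal (\<epsilon> ^ DIM('a) / Z * near p 0 u u)"
 proof (subst nn_integral_cmult)
  show "ennreal (\<epsilon> ^ DIM('a) / Z) * (\<integral>\<^sub>+z. ennreal (\<bar>incr u z\<bar> powr p * kn 0 z))
    = ennreal (\<epsilon> ^ DIM('a) / Z * near p 0 u u)"
   unfolding nn_integral_near[OF u]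
   by (rule ennreal_mult[symmetric]) (use Z0 \<epsilon> near_self_nonneg[of p 0 u] in auto)
 qed measurable
 finally show ?thesis .
qed

text \<open>At a fixed scale the averages are bounded and equi-Lipschitz, so convergence on a
  countable dense set, for all scales \<open>1 / (n + 1)\<close> at once, spreads to every point. On
  the bounded set \<open>\<Omega>\<close> this gives convergence of the averages in the
  \<open>p\<close>-th mean. They approximate the functions uniformly in \<open>k\<close>, which
  transfers the Cauchy property to the functions themselves.\<close>

lemma X_compact:
 fixes u :: "nat \<Rightarrow> 'a::euclidean_space \<Rightarrow> real"
 assumes p: "1 < p" and \<Omega>: "bounded \<Omega>" "open \<Omega>" and u: "\<And>k. u k \<in> Xe p \<Omega> 0"
  and bd: "\<And>k. (LBINT x. \<bar>u k x\<bar> powr p) \<le> C" "\<And>k. near p 0 (u k) (u k) \<le> C"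
 obtains r where "strict_mono (r :: nat \<Rightarrow> nat)"
  "\<And>\<epsilon>. 0 < \<epsilon> \<Longrightarrow> \<exists>K. \<forall>m\<ge>K. \<forall>n\<ge>K. (LBINT x. \<bar>u (r m) x - u (r n) x\<bar> powr p) \<le> \<epsilon>"
proof -
 note [measurable] = XeD(1)[OF u]
 have [measurable]: "\<Omega> \<in> sets borel" using \<Omega> by auto
 define L where "L = measure lborel \<Omega> + C"
 have u1: "integrable lborel (u k)" "(LBINT x. \<bar>u k x\<bar>) \<le> L" for k
  using Lp_imp_L1[OF p \<Omega> XeD(1-3)[OF u[of k]]] bd(1)[of k] by (auto simp: L_def)
 have C0: "0 \<le> C" using near_self_nonneg[of p 0 "u 0"] bd(2)[of 0] by linarith
 have L0: "0 \<le> L" using C0 by (simp add: L_def)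
 define e where "e n = 1 / real (Suc n)" for n
 have e: "0 < e n" "e n \<le> 1" for n by (auto simp: e_def)
 define c where "c k = (\<lambda>(n, x). LBINT z. log_kernel (e n) (x - z) * u k z)" for k
 have kui: "integrable lborel (\<lambda>z. log_kernel (e n) (x - z) * u k z)" for n k and x :: 'a
  using log_kernel_bounds(1,2)[OF e(1), where 'a='a]
  by (intro Bochner_Integration.integrable_bound[OF u1(1)[of k]]) (auto simp: abs_mult intro!: AE_I2 mult_left_le_one_le)
 have cb: "\<bar>c k (n, x)\<bar> \<le> L" for k n x
 proof -
  have "\<bar>c k (n, x)\<bar> \<le> (LBINT z. \<bar>log_kernel (e n) (x - z) * u k z\<bar>)" unfolding c_def by (simp add: integral_abs_bound)
  also have "\<dots> \<le> (LBINT z. \<bar>u k z\<bar>)"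
   using u1 log_kernel_bounds(1,2)[OF e(1), where 'a='a]
   by (intro integral_mono integrable_abs[OF kui]) (auto simp: abs_mult intro!: mult_left_le_one_le)
  finally show ?thesis using u1(2)[of k] by simp
 qed
 have clip: "\<bar>c k (n, x) - c k (n, y)\<bar> \<le> (1 + real DIM('a) / e n) * L * norm (x - y)" for k n x y
 proof -
  have "\<bar>c k (n, x) - c k (n, y)\<bar> = \<bar>LBINT z. (log_kernel (e n) (x - z) - log_kernel (e n) (y - z)) * u k z\<bar>"
   using kui by (simp add: c_def left_diff_distrib)
  also have "\<dots> \<le> (LBINT z. \<bar>(log_kernel (e n) (x - z) - log_kernel (e n) (y - z)) * u k z\<bar>)"
   by (rule integral_abs_bound)
  also have "\<dots> \<le> (LBINT z. (1 + real DIM('a) / e n) * norm (x - y) * \<bar>u k z\<bar>)"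
  proof (rule integral_mono)
   show "integrable lborel (\<lambda>z. \<bar>(log_kernel (e n) (x - z) - log_kernel (e n) (y - z)) * u k z\<bar>)"
    using kui by (simp add: left_diff_distrib)
   show "\<bar>(log_kernel (e n) (x - z) - log_kernel (e n) (y - z)) * u k z\<bar> \<le> (1 + real DIM('a) / e n) * norm (x - y) * \<bar>u k z\<bar>" for z
    using log_kernel_lipschitz[OF e(1), of n "x - z" "y - z"] by (simp add: abs_mult mult_right_mono)
  qed (use u1 in auto)
  also have "\<dots> = (1 + real DIM('a) / e n) * norm (x - y) * (LBINT z. \<bar>u k z\<bar>)" by simp
  also have "\<dots> \<le> (1 + real DIM('a) / e n) * norm (x - y) * L"
   using u1(2) e[of n] by (intro mult_left_mono) auto
  finally show ?thesis by (simp add: mult_ac)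
 qed
 obtain D :: "'a set" where D: "countable D" "\<And>X. open X \<Longrightarrow> X \<noteq> {} \<Longrightarrow> \<exists>d\<in>D. d \<in> X"
  using countable_dense_setE by blast
 obtain r where r: "strict_mono (r :: nat \<Rightarrow> nat)" and
  rc: "\<And>i. i \<in> (UNIV :: nat set) \<times> D \<Longrightarrow> \<exists>l. (\<lambda>k. c (r k) i) \<longlonglongrightarrow> l"
 proof (rule function_convergent_subsequence[of "(UNIV :: nat set) \<times> D" c L])
  show "countable ((UNIV :: nat set) \<times> D)" using D(1) by simp
  show "norm (c k i) \<le> L" for k i using cb[of k "fst i" "snd i"] by simp
 qed (use that in blast)
 have conv: "convergent (\<lambda>k. c (r k) (n, x))" for n x
 proof (rule real_Cauchy_convergent, rule CauchyI)
  fix \<eta> :: real assume \<eta>: "0 < \<eta>"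
  let ?M = "(1 + real DIM('a) / e n) * L + 1"
  have M: "0 < ?M" "0 \<le> (1 + real DIM('a) / e n) * L" using e[of n] L0 by (auto intro!: add_nonneg_pos mult_nonneg_nonneg)
  obtain d where d: "d \<in> D" "d \<in> ball x (\<eta> / (4 * ?M))"
  proof -
   have "0 < \<eta> / (4 * ?M)" using \<eta> M by (intro divide_pos_pos mult_pos_pos) auto
   then have "ball x (\<eta> / (4 * ?M)) \<noteq> {}" by (simp only: ball_eq_empty not_le)
   then show ?thesis using D(2)[OF open_ball] that by blast
  qed
  have dx: "\<bar>c k (n, x) - c k (n, d)\<bar> \<le> \<eta> / 4" for k
  proof -
   have "\<bar>c k (n, x) - c k (n, d)\<bar> \<le> ?M * norm (x - d)"
    using clip[of k n x d] M by (elim order_trans) (auto intro!: mult_right_mono)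
   also have "\<dots> \<le> ?M * (\<eta> / (4 * ?M))" using d M by (intro mult_left_mono) (auto simp: dist_norm)
   also have "\<dots> = \<eta> / 4"
   proof -
    have "A * (\<eta> / (4 * A)) = \<eta> / 4" if "0 < A" for A using that by simp
    from this[OF M(1)] show ?thesis .
   qed
   finally show ?thesis .
  qed
  have "Cauchy (\<lambda>k. c (r k) (n, d))" using rc[of "(n, d)"] d by (auto intro: LIMSEQ_imp_Cauchy)
  then obtain K where K: "\<And>i j. i \<ge> K \<Longrightarrow> j \<ge> K \<Longrightarrow> \<bar>c (r i) (n, d) - c (r j) (n, d)\<bar> < \<eta> / 4"
   using CauchyD[of _ "\<eta> / 4"] \<eta> by fastforce
  have "norm (c (r i) (n, x) - c (r j) (n, x)) < \<eta>" if "i \<ge> K" "j \<ge> K" for i j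
   using dx[of "r i"] dx[of "r j"] K[OF that] \<eta> unfolding real_norm_def by linarith
  then show "\<exists>M. \<forall>i\<ge>M. \<forall>j\<ge>M. norm (c (r i) (n, x) - c (r j) (n, x)) < \<eta>" by blast
 qed
 define V where "V n x = lim (\<lambda>k. c (r k) (n, x))" for n x
 have V: "(\<lambda>k. c (r k) (n, x)) \<longlonglongrightarrow> V n x" for n x
  using conv[of n x] by (simp add: V_def convergent_LIMSEQ_iff)
 have cm[measurable]: "(\<lambda>x. c k (n, x)) \<in> borel_measurable borel" for k n
  unfolding c_def prod.case by measurable
 have Vm[measurable]: "V n \<in> borel_measurable borel" for n
  by (rule borel_measurable_LIMSEQ_real[OF V]) measurable
 have Vb: "\<bar>V n x\<bar> \<le> L" for n x
  by (rule LIMSEQ_le_const2[OF tendsto_rabs[OF V]]) (use cb in auto)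
 have ii: "integrable lborel (indicat_real \<Omega>)"
  using emeasure_bounded_finite[OF \<Omega>(1)] by (intro integrable_real_indicator) auto
 define Z where "Z n = (LBINT z. log_kernel (e n) (z::'a))" for n
 show ?thesis
 proof (rule that[OF r])
  fix \<eta> :: real assume \<eta>: "0 < \<eta>"
  \<comment> \<open>The approximation error at scale \<open>e n\<close> decays only like
    \<open>1 / ln (1 / e n)\<close>, because the kernel of \<open>X\<close> is just barely singular;
    any decay is enough here.\<close>
  have "((\<lambda>n. C * 2 ^ DIM('a) / (sphere_area DIM('a) * (ln (1 / e n) - 1))) \<longlongrightarrow> 0) sequentially"
  proof -
   have "filterlim (\<lambda>n. sphere_area DIM('a) * (ln (1 / e n) - 1)) at_top sequentially"
    using sphere_area_pos[of "DIM('a)"] unfolding e_def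
    by (intro filterlim_tendsto_pos_mult_at_top[OF tendsto_const]) (simp, real_asymp)
   then show ?thesis by (rule real_tendsto_divide_at_top[OF tendsto_const])
  qed
  moreover have "filterlim (\<lambda>n. ln (1 / e n) - 1) at_top sequentially" unfolding e_def by real_asymp
  then have "eventually (\<lambda>n. 0 < ln (1 / e n) - 1) sequentially" unfolding filterlim_at_top_dense by blast
  \<comment> \<open>Two approximation errors and two differences of averages enter, each with the
    factor \<open>4 powr p\<close> that results from splitting a \<open>p\<close>-th power of a sum
    twice. Each of the four receives a quarter of \<open>\<eta>\<close>.\<close>
  moreover have "0 < \<eta> / (4 * 4 powr p)" using \<eta> by simp
  ultimately have "eventually (\<lambda>n. 0 < ln (1 / e n) - 1 \<and> C * 2 ^ DIM('a) / (sphere_area DIM('a) * (ln (1 / e n) - 1)) < \<eta> / (4 * 4 powr p)) sequentially"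
   by (intro eventually_conj order_tendstoD(2))
  then obtain n where n: "0 < ln (1 / e n) - 1" "C * 2 ^ DIM('a) / (sphere_area DIM('a) * (ln (1 / e n) - 1)) < \<eta> / (4 * 4 powr p)"
   by (auto simp: eventually_sequentially)
  have S: "0 < sphere_area DIM('a) * (ln (1 / e n) - 1)" using n(1) sphere_area_pos[of "DIM('a)"] by simp
  have mass: "e n ^ DIM('a) * (sphere_area DIM('a) * (ln (1 / e n) - 1)) \<le> 2 ^ DIM('a) * Z n"
   unfolding Z_def by (rule log_kernel_mass[OF e])
  have "0 < e n ^ DIM('a) * (sphere_area DIM('a) * (ln (1 / e n) - 1))" using S e by simp
  then have Z0: "0 < Z n" using mass by (smt (verit) zero_less_mult_pos zero_less_power)
  have eZ: "e n ^ DIM('a) / Z n \<le> 2 ^ DIM('a) / (sphere_area DIM('a) * (ln (1 / e n) - 1))"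
   using mass Z0 S by (simp add: field_simps)
  have "e n ^ DIM('a) / Z n * C \<le> 2 ^ DIM('a) / (sphere_area DIM('a) * (ln (1 / e n) - 1)) * C"
   using C0 by (intro mult_right_mono eZ)
  then have eZC: "e n ^ DIM('a) / Z n * C \<le> \<eta> / (4 * 4 powr p)" using n(2) by (simp add: mult.commute)
  let ?v = "\<lambda>k x. c k (n, x) / Z n"
  have near: "(\<integral>\<^sub>+x. ennreal (\<bar>u k x - ?v k x\<bar> powr p)) \<le> ennreal (\<eta> / (4 * 4 powr p))" for k
  proof -
   have "(\<integral>\<^sub>+x. ennreal (\<bar>u k x - ?v k x\<bar> powr p)) \<le> ennreal (e n ^ DIM('a) / Z n * near p 0 (u k) (u k))"
    using log_kernel_approx[OF p \<Omega> u[of k] e(1)[of n]] Z0 by (simp add: Z_def c_def)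
   also have "\<dots> \<le> ennreal (e n ^ DIM('a) / Z n * C)"
    using bd(2) Z0 e(1)[of n] by (intro ennreal_leI mult_left_mono) auto
   also have "\<dots> \<le> ennreal (\<eta> / (4 * 4 powr p))" by (rule ennreal_leI[OF eZC])
   finally show ?thesis .
  qed
  let ?w = "\<lambda>x. V n x / Z n"
  let ?t = "\<lambda>k x. indicator \<Omega> x * \<bar>?v (r k) x - ?w x\<bar> powr p"
  have tb: "norm (?t k x) \<le> indicator \<Omega> x * (2 * L / Z n) powr p" for k x
  proof -
   have "\<bar>?v (r k) x - ?w x\<bar> \<le> 2 * L / Z n"
   proof -
    have "\<bar>?v (r k) x - ?w x\<bar> = \<bar>c (r k) (n, x) - V n x\<bar> / Z n"
     using Z0 by (simp add: abs_divide flip: diff_divide_distrib)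
    also have "\<dots> \<le> 2 * L / Z n" using Z0 cb[of "r k" n x] Vb[of n x] by (intro divide_right_mono) auto
    finally show ?thesis .
   qed
   then show ?thesis using p by (auto simp: abs_mult indicator_def intro!: powr_mono2)
  qed
  have ti: "integrable lborel (?t k)" for k
   by (rule Bochner_Integration.integrable_bound[OF integrable_mult_left[OF ii, of "(2 * L / Z n) powr p"]])
     (measurable, intro AE_I2 order_trans[OF tb], unfold real_norm_def, rule abs_ge_self)
  have "(\<lambda>k. LBINT x. ?t k x) \<longlonglongrightarrow> integral\<^sup>L lborel (\<lambda>x::'a. 0::real)"
  proof (rule integral_dominated_convergence[where w = "\<lambda>x. indicator \<Omega> x * (2 * L / Z n) powr p"])
   show "AE x in lborel. (\<lambda>k. ?t k x) \<longlonglongrightarrow> 0"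
   proof (rule AE_I2)
    fix x
    have "(\<lambda>k. ?t k x) \<longlonglongrightarrow> indicator \<Omega> x * \<bar>?w x - ?w x\<bar> powr p"
     using p Z0 by (intro tendsto_mult tendsto_const tendsto_powr' tendsto_rabs tendsto_diff tendsto_divide V) auto
    then show "(\<lambda>k. ?t k x) \<longlonglongrightarrow> 0" by simp
   qed
   show "AE x in lborel. norm (?t k x) \<le> indicator \<Omega> x * (2 * L / Z n) powr p" for k
    by (intro AE_I2 tb)
  qed (use ii in auto)
  then have "(\<lambda>k. LBINT x. ?t k x) \<longlonglongrightarrow> 0" by simp
  then have "eventually (\<lambda>k. (LBINT x. ?t k x) < \<eta> / (4 * 4 powr p)) sequentially"
   using \<open>0 < \<eta> / (4 * 4 powr p)\<close> by (rule order_tendstoD(2))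
  then obtain K where K: "\<And>k. k \<ge> K \<Longrightarrow> (LBINT x. ?t k x) < \<eta> / (4 * 4 powr p)"
   by (auto simp: eventually_sequentially)
  have "(LBINT x. \<bar>u (r i) x - u (r j) x\<bar> powr p) \<le> \<eta>" if ij: "i \<ge> K" "j \<ge> K" for i j
  proof -
   let ?T = "\<lambda>k x. \<bar>u (r k) x - ?v (r k) x\<bar> powr p"
   have pt: "\<bar>u (r i) x - u (r j) x\<bar> powr p \<le> 4 powr p * ((?T i x + ?T j x) + (?t i x + ?t j x))" for x
   proof (cases "x \<in> \<Omega>")
    case True
    have "4 powr p = 2 powr p * (2 powr p :: real)" by (simp flip: powr_mult)
    have "\<bar>u (r i) x - u (r j) x\<bar> powr p = \<bar>(u (r i) x - ?w x) - (u (r j) x - ?w x)\<bar> powr p" by simp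
    also have "\<dots> \<le> 2 powr p * (\<bar>u (r i) x - ?w x\<bar> powr p + \<bar>u (r j) x - ?w x\<bar> powr p)"
     using p by (intro abs_diff_powr_le) auto
    also have "\<dots> \<le> 2 powr p * (2 powr p * (?T i x + ?t i x) + 2 powr p * (?T j x + ?t j x))"
    proof -
     have "\<bar>u (r k) x - ?w x\<bar> powr p \<le> 2 powr p * (?T k x + ?t k x)" for k
      using abs_add_powr_le[of p "u (r k) x - ?v (r k) x" "?v (r k) x - ?w x"] p True by simp
     then show ?thesis by (intro mult_left_mono add_mono) auto
    qed
    also have "\<dots> = (2 powr p * 2 powr p) * ((?T i x + ?T j x) + (?t i x + ?t j x))" by (simp add: algebra_simps)
    finally show ?thesis by (simp only: \<open>4 powr p = 2 powr p * (2 powr p :: real)\<close>)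
   next
    case False
    have "0 \<le> 4 powr p * ((?T i x + ?T j x) + (?t i x + ?t j x))" by (intro mult_nonneg_nonneg add_nonneg_nonneg) auto
    then show ?thesis using False XeD(2)[OF u] by simp
   qed
   have en: "ennreal a * ((ennreal b + ennreal c) + (ennreal d + ennreal f)) = ennreal (a * ((b + c) + (d + f)))"
    if "0 \<le> a" "0 \<le> b" "0 \<le> c" "0 \<le> d" "0 \<le> f" for a b c d f
    using that by (simp add: ennreal_mult)
   have "(\<integral>\<^sub>+x. ennreal (\<bar>u (r i) x - u (r j) x\<bar> powr p))
    \<le> (\<integral>\<^sub>+x. ennreal (4 powr p) * ((ennreal (?T i x) + ennreal (?T j x)) + (ennreal (?t i x) + ennreal (?t j x))))"
   proof (rule nn_integral_mono)
    fix x
    have "ennreal (4 powr p) * ((ennreal (?T i x) + ennreal (?T j x)) + (ennreal (?t i x) + ennreal (?t j x)))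
     = ennreal (4 powr p * ((?T i x + ?T j x) + (?t i x + ?t j x)))"
     by (rule en) auto
    then show "ennreal (\<bar>u (r i) x - u (r j) x\<bar> powr p) \<le> ennreal (4 powr p) * ((ennreal (?T i x) + ennreal (?T j x)) + (ennreal (?t i x) + ennreal (?t j x)))"
     using ennreal_leI[OF pt[of x]] by simp
   qed
   also have "\<dots> = ennreal (4 powr p) * (((\<integral>\<^sub>+x. ennreal (?T i x)) + (\<integral>\<^sub>+x. ennreal (?T j x)))
     + ((\<integral>\<^sub>+x. ennreal (?t i x)) + (\<integral>\<^sub>+x. ennreal (?t j x))))"
    by (simp add: nn_integral_cmult nn_integral_add)
   also have "\<dots> \<le> ennreal (4 powr p) * ((ennreal (\<eta> / (4 * 4 powr p)) + ennreal (\<eta> / (4 * 4 powr p))) + (ennreal (\<eta> / (4 * 4 powr p)) + ennreal (\<eta> / (4 * 4 powr p))))"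
   proof (intro mult_left_mono add_mono near)
    have "(\<integral>\<^sub>+x. ennreal (?t k x)) \<le> ennreal (\<eta> / (4 * 4 powr p))" if "k \<ge> K" for k
     using K[OF that] by (subst nn_integral_eq_integral[OF ti]) (auto intro!: ennreal_leI)
    then show "(\<integral>\<^sub>+x. ennreal (?t i x)) \<le> ennreal (\<eta> / (4 * 4 powr p))"
     "(\<integral>\<^sub>+x. ennreal (?t j x)) \<le> ennreal (\<eta> / (4 * 4 powr p))" using ij by auto
   qed auto
   also have "\<dots> = ennreal (4 powr p * ((\<eta> / (4 * 4 powr p) + \<eta> / (4 * 4 powr p)) + (\<eta> / (4 * 4 powr p) + \<eta> / (4 * 4 powr p))))"
    using \<eta> by (intro en) auto
   also have "4 powr p * ((\<eta> / (4 * 4 powr p) + \<eta> / (4 * 4 powr p)) + (\<eta> / (4 * 4 powr p) + \<eta> / (4 * 4 powr p))) = \<eta>"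
    by (simp add: field_simps)
   finally have le: "(\<integral>\<^sub>+x. ennreal (\<bar>u (r i) x - u (r j) x\<bar> powr p)) \<le> ennreal \<eta>" .
   show ?thesis using le \<eta> by (intro integral_real_bounded) auto
  qed
  then show "\<exists>K. \<forall>m\<ge>K. \<forall>n\<ge>K. (LBINT x. \<bar>u (r m) x - u (r n) x\<bar> powr p) \<le> \<eta>" by blast
 qed
qed

section \<open>Expansion in the order of the operator\<close>

lemma lin_bound_of_derivative:
 fixes f :: "real \<Rightarrow> real"
 assumes "(f has_real_derivative D) (at 0)" "s \<longlonglongrightarrow> 0" "\<And>k. 0 < s k"
 shows "(\<lambda>k. (f (s k) - f 0) / s k) \<longlonglongrightarrow> D"
  and "eventually (\<lambda>k. \<bar>f (s k) - f 0\<bar> \<le> (\<bar>D\<bar> + 1) * s k) sequentially"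
proof -
 have "((\<lambda>h. (f (0 + h) - f 0) / h) \<longlongrightarrow> D) (at 0)"
  using assms(1) by (simp add: DERIV_def)
 moreover have "filterlim s (at 0) sequentially"
  using assms(2,3) by (auto simp: filterlim_at intro!: always_eventually less_imp_neq[THEN not_sym])
 ultimately show lim: "(\<lambda>k. (f (s k) - f 0) / s k) \<longlonglongrightarrow> D"
  using filterlim_compose by fastforce
 have "eventually (\<lambda>k. dist ((f (s k) - f 0) / s k) D < 1) sequentially"
  using lim by (rule tendstoD) simp
 then show "eventually (\<lambda>k. \<bar>f (s k) - f 0\<bar> \<le> (\<bar>D\<bar> + 1) * s k) sequentially"
 proof eventually_elim
  case (elim k)
  then have "\<bar>(f (s k) - f 0) / s k\<bar> \<le> \<bar>D\<bar> + 1" by (simp add: dist_real_def)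
  then show ?case using assms(3)[of k] by (simp add: abs_divide divide_le_eq)
 qed
qed

lemma exp_diff_quotient_tendsto:
 fixes s a :: "nat \<Rightarrow> real"
 assumes "s \<longlonglongrightarrow> 0" "\<And>k. 0 < s k" "(\<lambda>k. a k / s k) \<longlonglongrightarrow> A"
 shows "(\<lambda>k. (exp (a k) - 1) / s k) \<longlonglongrightarrow> A"
proof -
 have a0: "a \<longlonglongrightarrow> 0"
 proof -
  have "(\<lambda>k. a k / s k * s k) \<longlonglongrightarrow> A * 0" using assms by (intro tendsto_mult) auto
  moreover have "a k / s k * s k = a k" for k using assms(2)[of k] by simp
  ultimately show ?thesis by simp
 qed
 define g where "g t = (if t = 0 then 1 else (exp t - 1) / t)" for t :: real
 have "isCont g 0"
 proof -
  have "((\<lambda>h. (exp (0 + h) - exp 0) / h) \<longlongrightarrow> exp (0::real)) (at 0)"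
   using DERIV_exp[of "0::real"] unfolding DERIV_def by simp
  then have "((\<lambda>h. (exp h - 1) / h) \<longlongrightarrow> 1) (at (0::real))" by simp
  then have "(g \<longlongrightarrow> 1) (at 0)"
   by (rule Lim_transform_eventually) (auto simp: g_def eventually_at_filter)
  then show ?thesis by (simp add: isCont_def g_def)
 qed
 then have "(\<lambda>k. g (a k)) \<longlonglongrightarrow> g 0" using a0 by (rule isCont_tendsto_compose)
 then have "(\<lambda>k. g (a k) * (a k / s k)) \<longlonglongrightarrow> 1 * A"
  using assms(3) by (intro tendsto_mult) (auto simp: g_def)
 moreover have "(\<lambda>k. g (a k) * (a k / s k)) = (\<lambda>k. (exp (a k) - 1) / s k)" by (simp add: g_def fun_eq_iff)
 ultimately show ?thesis by simp
qed

lemma ln_quotient_tendsto: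
 fixes s a :: "nat \<Rightarrow> real"
 assumes "s \<longlonglongrightarrow> 0" "\<And>k. 0 < s k" "a \<longlonglongrightarrow> A"
 shows "(\<lambda>k. ln (1 + s k * a k) / s k) \<longlonglongrightarrow> A"
proof -
 define g where "g t = (if t = 0 then 1 else ln (1 + t) / t)" for t :: real
 have "isCont g 0"
 proof -
  have "((\<lambda>t. ln (1 + t)) has_real_derivative 1) (at (0::real))"
   by (auto intro!: derivative_eq_intros)
  then have "((\<lambda>h. ln (1 + h) / h) \<longlongrightarrow> 1) (at (0::real))" by (simp add: DERIV_def)
  then have "(g \<longlongrightarrow> 1) (at 0)"
   by (rule Lim_transform_eventually) (auto simp: g_def eventually_at_filter)
  then show ?thesis by (simp add: isCont_def g_def)
 qed
 moreover have "(\<lambda>k. s k * a k) \<longlonglongrightarrow> 0" using tendsto_mult[OF assms(1,3)] by simp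
 ultimately have "(\<lambda>k. g (s k * a k)) \<longlonglongrightarrow> g 0" by (rule isCont_tendsto_compose)
 then have "(\<lambda>k. g (s k * a k) * a k) \<longlonglongrightarrow> 1 * A"
  using assms(3) by (intro tendsto_mult) (auto simp: g_def)
 moreover have "g (s k * a k) * a k = ln (1 + s k * a k) / s k" for k
  using assms(2)[of k] by (simp add: g_def)
 ultimately show ?thesis by simp
qed

lemma abs_powr_minus_one_le:
 fixes t d :: real
 assumes "0 < t" "0 \<le> d" shows "\<bar>t powr d - 1\<bar> \<le> d * \<bar>ln t\<bar> * max 1 (t powr d)"
proof -
 have 1: "t powr d - 1 \<le> t powr d * (d * ln t)"
  using exp_ge_add_one_self[of "- (d * ln t)"] assms
  by (simp add: powr_def exp_minus field_simps)
 have "t powr d = exp (d * ln t)" using assms by (simp add: powr_def)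
 then have 2: "d * ln t \<le> t powr d - 1" using exp_ge_add_one_self[of "d * ln t"] by linarith
 show ?thesis
 proof (cases "1 \<le> t")
  case True
  then have "1 \<le> t powr d" using assms by (simp add: ge_one_powr_ge_zero)
  then show ?thesis using 1 True by (simp add: max_def mult_ac)
 next
  case False
  then have "t powr d \<le> 1" "ln t < 0" using assms powr_le1[of d t] by auto
  then show ?thesis using 2 by (simp add: max_def)
 qed
qed

text \<open>A majorant uniform in \<open>s\<close>. For \<open>t \<ge> 1\<close> the factor
  \<open>t powr d\<close>, with \<open>d \<le> 1/2\<close>, and the logarithm each cost at most a
  multiple of \<open>t powr (1/2)\<close>, together one power. For \<open>t < 1\<close> the
  logarithm is absorbed by half of \<open>t powr (p - 1)\<close>, and what remains still tends to
  \<open>0\<close> with \<open>t\<close>; this is used at the zeros of the limit function.\<close>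

lemma perturbation_bound:
 fixes p M \<mu> :: real
 assumes p: "1 < p" and "0 \<le> M" "0 \<le> \<mu>" and t: "0 \<le> t" and s: "0 < s" and d: "0 < d" "d \<le> 1/2" "d \<le> 2 * \<mu> * s"
  and a: "\<bar>a - 1\<bar> \<le> M * s"
 shows "t powr (p - 1) * \<bar>(a * t powr d - 1) / s\<bar>
  \<le> (M + 4 * \<mu> + 4 * \<mu> / (p - 1)) * (t powr (p - 1) + t powr ((p - 1) / 2) + t powr p)"
proof (cases "t = 0")
 case False
 then have t: "0 < t" using t by simp
 have "\<bar>a * t powr d - 1\<bar> \<le> \<bar>a - 1\<bar> * t powr d + \<bar>t powr d - 1\<bar>"
 proof -
  have "a * t powr d - 1 = (a - 1) * t powr d + (t powr d - 1)" by (simp add: algebra_simps)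
  then show ?thesis using abs_triangle_ineq[of "(a - 1) * t powr d" "t powr d - 1"] by (simp add: abs_mult)
 qed
 also have "\<dots> \<le> (M * s) * max 1 (t powr d) + (2 * \<mu> * s) * \<bar>ln t\<bar> * max 1 (t powr d)"
  using a d t abs_powr_minus_one_le[OF t, of d]
  by (intro add_mono mult_mono order_trans[OF abs_powr_minus_one_le] mult_right_mono) auto
 finally have "\<bar>(a * t powr d - 1) / s\<bar> \<le> (M + 2 * \<mu> * \<bar>ln t\<bar>) * max 1 (t powr d)"
  using s by (simp add: abs_divide divide_le_eq algebra_simps)
 then have 1: "t powr (p - 1) * \<bar>(a * t powr d - 1) / s\<bar> \<le> t powr (p - 1) * ((M + 2 * \<mu> * \<bar>ln t\<bar>) * max 1 (t powr d))"
  by (intro mult_left_mono) auto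
 show ?thesis
 proof (cases "1 \<le> t")
  case True
  have "t powr d \<le> t powr (1/2)" using True d by (intro powr_mono) auto
  moreover have "1 \<le> t powr (1/2)" using True by (simp add: ge_one_powr_ge_zero)
  moreover have "\<bar>ln t\<bar> \<le> 2 * t powr (1/2)"
   using ln_bound[of "t powr (1/2)"] True by (simp add: ln_powr)
  moreover have "1 * t powr (1/2) \<le> t powr (1/2) * t powr (1/2)" using \<open>1 \<le> t powr (1/2)\<close> by (intro mult_right_mono) auto
  ultimately have "(M + 2 * \<mu> * \<bar>ln t\<bar>) * max 1 (t powr d) \<le> (M * t powr (1/2) + 2 * \<mu> * (2 * t powr (1/2))) * t powr (1/2)"
   using assms(2,3) by (intro mult_mono add_mono mult_left_mono) (auto simp: mult_le_cancel_left1)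
  also have "\<dots> = (M + 4 * \<mu>) * (t powr (1/2) * t powr (1/2))" by (simp add: algebra_simps)
  also have "t powr (1/2) * t powr (1/2) = t" using t by (simp flip: powr_add)
  finally have "t powr (p - 1) * ((M + 2 * \<mu> * \<bar>ln t\<bar>) * max 1 (t powr d)) \<le> t powr (p - 1) * ((M + 4 * \<mu>) * t)"
   by (intro mult_left_mono) auto
  also have "\<dots> = (M + 4 * \<mu>) * t powr p" using powr_mult_self[of t "p - 1"] t by (simp add: mult_ac)
  also have "\<dots> \<le> (M + 4 * \<mu> + 4 * \<mu> / (p - 1)) * (t powr (p - 1) + t powr ((p - 1) / 2) + t powr p)"
   using assms(1,2,3) by (intro mult_mono) auto
  finally show ?thesis using 1 by linarith
 next
  case False
  have "t powr d \<le> 1" using False t d by (intro powr_le1) auto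
  then have m: "max 1 (t powr d) = 1" by (simp add: max_def)
  have "\<bar>ln t\<bar> = - ln t" using False t by simp
  also have "\<dots> = 2 / (p - 1) * ln (t powr - ((p - 1) / 2))" using p t by (simp add: ln_powr)
  also have "\<dots> \<le> 2 / (p - 1) * t powr - ((p - 1) / 2)"
   using p t by (intro mult_left_mono ln_bound) auto
  finally have "t powr (p - 1) * \<bar>ln t\<bar> \<le> t powr (p - 1) * (2 / (p - 1) * t powr - ((p - 1) / 2))"
   by (intro mult_left_mono) auto
  also have "\<dots> = 2 / (p - 1) * t powr ((p - 1) + - ((p - 1) / 2))" by (simp only: powr_add) (simp add: mult_ac)
  also have "(p - 1) + - ((p - 1) / 2) = (p - 1) / 2" by (simp add: field_simps)
  finally have l: "t powr (p - 1) * \<bar>ln t\<bar> \<le> 2 / (p - 1) * t powr ((p - 1) / 2)" .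
  have "t powr (p - 1) * ((M + 2 * \<mu> * \<bar>ln t\<bar>) * max 1 (t powr d))
    = M * t powr (p - 1) + 2 * \<mu> * (t powr (p - 1) * \<bar>ln t\<bar>)" unfolding m by (simp add: algebra_simps)
  also have "\<dots> \<le> M * t powr (p - 1) + 2 * \<mu> * (2 / (p - 1) * t powr ((p - 1) / 2))"
   using assms(3) by (intro add_left_mono mult_left_mono l) auto
  also have "\<dots> = M * t powr (p - 1) + 4 * \<mu> / (p - 1) * t powr ((p - 1) / 2)" by simp
  also have "\<dots> \<le> (M + 4 * \<mu> + 4 * \<mu> / (p - 1)) * t powr (p - 1) + (M + 4 * \<mu> + 4 * \<mu> / (p - 1)) * t powr ((p - 1) / 2)"
   using assms(1,2,3) by (intro add_mono mult_right_mono) auto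
  also have "\<dots> \<le> (M + 4 * \<mu> + 4 * \<mu> / (p - 1)) * (t powr (p - 1) + t powr ((p - 1) / 2) + t powr p)"
   using assms(1,2,3) by (simp add: distrib_left)
  finally show ?thesis using 1 by linarith
 qed
qed simp

text \<open>\<open>Q k\<close>, \<open>\<alpha> k\<close> and \<open>b\<close> stand for \<open>q(s k)\<close>, \<open>a(s k, \<cdot>)\<close> and \<open>a'(0, \<cdot>)\<close>.\<close>

locale small_order =
 fixes \<Omega> :: "'a::euclidean_space set" and p \<mu> M :: real
  and s Q :: "nat \<Rightarrow> real" and \<alpha> :: "nat \<Rightarrow> 'a \<Rightarrow> real" and b :: "'a \<Rightarrow> real"
 assumes p: "1 < p" and \<Omega>: "bounded \<Omega>" "open \<Omega>"
  and \<mu>: "0 < \<mu>" "\<mu> < p\<^sup>2 / DIM('a)"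
  and s: "\<And>k. 0 < s k" "\<And>k. s k < 1/2" "s \<longlonglongrightarrow> 0"
  and Q: "\<And>k. p < Q k" "(\<lambda>k. (Q k - p) / s k) \<longlonglongrightarrow> \<mu>"
  and \<alpha>m [measurable]: "\<And>k. \<alpha> k \<in> borel_measurable borel" and M: "0 \<le> M"
  and \<alpha>: "AE x in lborel. x \<in> \<Omega> \<longrightarrow> (\<forall>k. \<bar>\<alpha> k x - 1\<bar> \<le> M * s k)"
  and bm [measurable]: "b \<in> borel_measurable borel"
  and b: "AE x in lborel. x \<in> \<Omega> \<longrightarrow> (\<lambda>k. (\<alpha> k x - 1) / s k) \<longlonglongrightarrow> b x"
begin

lemma \<Omega>_measurable [measurable]: "\<Omega> \<in> sets borel"
 using \<Omega> by auto

lemma indicator_integrable: "integrable lborel (indicat_real \<Omega>)"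
 using emeasure_bounded_finite[OF \<Omega>(1)] by (intro integrable_real_indicator) auto

section \<open>Limits of the far part, the zero order term and the right-hand side\<close>

definition Y :: "('a \<Rightarrow> real) \<Rightarrow> real" where
 "Y u = (LBINT x. \<bar>u x\<bar> powr p)"

definition E0 :: "('a \<Rightarrow> real) \<Rightarrow> ('a \<Rightarrow> real) \<Rightarrow> real" where
 "E0 u v = C_lim DIM('a) p / 2 * (near p 0 u v + far p 0 u v) + rho DIM('a) p * (LBINT x. h p (u x) * v x)"

definition LT :: "('a \<Rightarrow> real) \<Rightarrow> ('a \<Rightarrow> real) \<Rightarrow> real" where
 "LT u v = (LBINT x. (b x + \<mu> * ln \<bar>u x\<bar>) * h p (u x) * v x)"

abbreviation e :: "nat \<Rightarrow> real" where "e k \<equiv> s k * p"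

lemma e_pos: "0 < e k" using s p by simp

lemma e_tendsto: "e \<longlonglongrightarrow> 0"
 using tendsto_mult[OF s(3) tendsto_const[of p]] by simp

lemma S_pos: "0 < sphere_area DIM('a)" by (simp add: sphere_area_pos)

lemma C_lim_eq: "C_lim DIM('a) p = p / sphere_area DIM('a)"
 using C_lim_sphere_area[of "DIM('a)" p] S_pos by (simp add: field_simps)

text \<open>Pulling \<open>kappa\<close> out of the whole form leaves a coefficient of
  \<open>s k\<close> that no longer depends on the order and equals
  \<open>C_lim / 2\<close>.\<close>

lemma E_frac_expansion:
 assumes "u \<in> Xe p \<Omega> (e k)" "v \<in> Xe p \<Omega> (e k)"
 shows "E_frac (s k) p u v = kappa DIM('a) p (s k) * ((LBINT x. h p (u x) * v x) + s k * (p / (2 * sphere_area DIM('a))) * (near p (e k) u v + far p (e k) u v))"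
proof -
 have "C_frac DIM('a) (s k) p = s k * p * kappa DIM('a) p (s k) / sphere_area DIM('a)"
  using C_frac_kappa[of "DIM('a)" "s k" p] S_pos by (simp add: field_simps)
 then have "C_frac DIM('a) (s k) p / 2 = kappa DIM('a) p (s k) * (s k * (p / (2 * sphere_area DIM('a))))"
  using S_pos by (simp add: field_simps)
 then show ?thesis
  unfolding E_frac_eq[OF p s(1)[of k] \<Omega> assms] by (simp only:) (simp add: algebra_simps add_divide_distrib)
qed

lemma kappa_tendsto: "(\<lambda>k. (kappa DIM('a) p (s k) - 1) / s k) \<longlonglongrightarrow> rho DIM('a) p" "(\<lambda>k. kappa DIM('a) p (s k)) \<longlonglongrightarrow> 1"
 and kappa_bound: "eventually (\<lambda>k. \<bar>kappa DIM('a) p (s k) - 1\<bar> \<le> (\<bar>rho DIM('a) p\<bar> + 1) * s k) sequentially"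
proof -
 have k0: "kappa DIM('a) p 0 = 1" by (simp add: kappa_0)
 note d = kappa_has_derivative[of "DIM('a)" p]
 show "(\<lambda>k. (kappa DIM('a) p (s k) - 1) / s k) \<longlonglongrightarrow> rho DIM('a) p"
  "eventually (\<lambda>k. \<bar>kappa DIM('a) p (s k) - 1\<bar> \<le> (\<bar>rho DIM('a) p\<bar> + 1) * s k) sequentially"
  using lin_bound_of_derivative[OF d s(3,1)] by (simp_all add: k0)
 have "isCont (kappa DIM('a) p) 0" using d by (intro DERIV_isCont) auto
 from isCont_tendsto_compose[OF this s(3)] show "(\<lambda>k. kappa DIM('a) p (s k)) \<longlonglongrightarrow> 1" by (simp add: k0)
qed

lemma kappa_gt_0: "0 < kappa DIM('a) p (s k)"
 using s(1)[of k] s(2)[of k] p by (intro kappa_pos) auto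

lemma kf_tendsto: "(\<lambda>k. kf (e k) (z::'a\<times>'a)) \<longlonglongrightarrow> kf 0 z"
 unfolding kf_def
proof (cases "fst z = snd z")
 case False
 then show "(\<lambda>k. indicat_real {1<..} (norm (fst z - snd z)) * norm (fst z - snd z) powr - (real DIM('a) + e k))
  \<longlonglongrightarrow> indicat_real {1<..} (norm (fst z - snd z)) * norm (fst z - snd z) powr - (real DIM('a) + 0)"
  by (intro tendsto_mult tendsto_const tendsto_powr tendsto_minus tendsto_add e_tendsto) auto
qed simp

lemma kn_tendsto: "(\<lambda>k. kn (e k) (z::'a\<times>'a)) \<longlonglongrightarrow> kn 0 z"
 unfolding kn_def
proof (cases "fst z = snd z")
 case False
 then show "(\<lambda>k. indicat_real {..1} (norm (fst z - snd z)) * norm (fst z - snd z) powr - (real DIM('a) + e k))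
  \<longlonglongrightarrow> indicat_real {..1} (norm (fst z - snd z)) * norm (fst z - snd z) powr - (real DIM('a) + 0)"
  by (intro tendsto_mult tendsto_const tendsto_powr tendsto_minus tendsto_add e_tendsto) auto
qed simp

text \<open>The orders \<open>e'\<close> are left open because two kinds of limit share this proof:
  along \<open>e k\<close> for the fractional problems, and at the fixed order \<open>0\<close> for
  truncations and recovery sequences.\<close>

lemma far_tendsto:
 fixes u v :: "nat \<Rightarrow> 'a \<Rightarrow> real"
 assumes [measurable]: "\<And>k. u k \<in> borel_measurable borel" "\<And>k. v k \<in> borel_measurable borel"
   "u0 \<in> borel_measurable borel" "v0 \<in> borel_measurable borel"
  and z: "\<And>k x. x \<notin> \<Omega> \<Longrightarrow> u k x = 0" "\<And>k x. x \<notin> \<Omega> \<Longrightarrow> v k x = 0"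
  and c: "AE x in lborel. (\<lambda>k. u k x) \<longlonglongrightarrow> u0 x" "AE x in lborel. (\<lambda>k. v k x) \<longlonglongrightarrow> v0 x"
  and G: "integrable lborel G" "AE x in lborel. \<forall>k. \<bar>u k x\<bar> powr p + \<bar>v k x\<bar> powr p \<le> G x"
  and e': "\<And>k. 0 \<le> e' k" "\<And>z::'a\<times>'a. (\<lambda>k. kf (e' k) z) \<longlonglongrightarrow> kf 0 z"
 shows "(\<lambda>k. far p (e' k) (u k) (v k)) \<longlonglongrightarrow> far p 0 u0 v0"
 unfolding far_def
proof (rule integral_dominated_convergence[where w = "\<lambda>z. (2 powr p + 1) * far_maj \<Omega> G z"])
 show "(\<lambda>z. Upsilon_at p u0 v0 z * kf 0 z) \<in> borel_measurable lborel"
  "(\<lambda>z. Upsilon p (u k (fst z)) (u k (snd z)) (v k (fst z)) (v k (snd z)) * kf (e' k) z) \<in> borel_measurable lborel" for k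
  unfolding Upsilon_def by measurable
 show "integrable lborel (\<lambda>z. (2 powr p + 1) * far_maj \<Omega> G z)"
  using far_maj_integrable(1)[OF \<Omega> G(1)] by simp
 show "AE z in lborel. (\<lambda>k. Upsilon p (u k (fst z)) (u k (snd z)) (v k (fst z)) (v k (snd z)) * kf (e' k) z)
   \<longlonglongrightarrow> Upsilon_at p u0 v0 z * kf 0 z"
  using AE_lborel_pair(1)[OF c(1), where 'b='a] AE_lborel_pair(2)[OF c(1), where 'b='a]
   AE_lborel_pair(1)[OF c(2), where 'b='a] AE_lborel_pair(2)[OF c(2), where 'b='a]
  unfolding Upsilon_def
  by eventually_elim (intro tendsto_intros e' isCont_tendsto_compose[OF isCont_h[OF p]])
 show "AE z in lborel. norm (Upsilon p (u k (fst z)) (u k (snd z)) (v k (fst z)) (v k (snd z)) * kf (e' k) z)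
   \<le> (2 powr p + 1) * far_maj \<Omega> G z" for k
  using AE_lborel_pair(1)[OF G(2), where 'b='a] AE_lborel_pair(2)[OF G(2), where 'b='a]
 proof eventually_elim
  case (elim z)
  let ?f = "\<lambda>x. \<bar>u k x\<bar> powr p + \<bar>v k x\<bar> powr p"
  have "\<bar>Upsilon p (u k (fst z)) (u k (snd z)) (v k (fst z)) (v k (snd z)) * kf (e' k) z\<bar> \<le> (2 powr p + 1) * far_maj \<Omega> ?f z"
   by (rule far_bound[OF p e'(1) z]) auto
  also have "\<dots> \<le> (2 powr p + 1) * far_maj \<Omega> G z"
   unfolding far_maj_def using elim by (intro mult_left_mono add_mono mult_right_mono) auto
  finally show ?case by simp
 qed
qed

lemma h_mult_tendsto:
 fixes u v :: "nat \<Rightarrow> 'a \<Rightarrow> real"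
 assumes [measurable]: "\<And>k. u k \<in> borel_measurable borel" "\<And>k. v k \<in> borel_measurable borel"
   "u0 \<in> borel_measurable borel" "v0 \<in> borel_measurable borel"
  and c: "AE x in lborel. (\<lambda>k. u k x) \<longlonglongrightarrow> u0 x" "AE x in lborel. (\<lambda>k. v k x) \<longlonglongrightarrow> v0 x"
  and G: "integrable lborel G" "AE x in lborel. \<forall>k. \<bar>u k x\<bar> powr p + \<bar>v k x\<bar> powr p \<le> G x"
 shows "(\<lambda>k. LBINT x. h p (u k x) * v k x) \<longlonglongrightarrow> (LBINT x. h p (u0 x) * v0 x)"
proof (rule integral_dominated_convergence[where w = G])
 show "AE x in lborel. (\<lambda>k. h p (u k x) * v k x) \<longlonglongrightarrow> h p (u0 x) * v0 x"
  using c by eventually_elim (intro tendsto_intros isCont_tendsto_compose[OF isCont_h[OF p]])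
 show "AE x in lborel. norm (h p (u k x) * v k x) \<le> G x" for k
  using G(2) by eventually_elim (metis abs_h_mult_le[OF p] order_trans real_norm_def)
qed (use G in auto)

lemma Q_tendsto: "(\<lambda>k. Q k - p) \<longlonglongrightarrow> 0"
proof -
 have "(\<lambda>k. (Q k - p) / s k * s k) \<longlonglongrightarrow> \<mu> * 0" by (intro tendsto_mult Q s)
 moreover have "(Q k - p) / s k * s k = Q k - p" for k using s(1)[of k] by simp
 ultimately show ?thesis by simp
qed

lemma Q_bounds: "eventually (\<lambda>k. Q k - p \<le> 1/2 \<and> Q k - p \<le> 2 * \<mu> * s k \<and> \<mu> / 2 * s k \<le> Q k - p) sequentially"
proof -
 have "eventually (\<lambda>k. Q k - p < 1/2) sequentially" using Q_tendsto by (rule order_tendstoD) simp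
 moreover have "eventually (\<lambda>k. (Q k - p) / s k < 2 * \<mu>) sequentially" using Q(2) \<mu> by (intro order_tendstoD) auto
 moreover have "eventually (\<lambda>k. \<mu> / 2 < (Q k - p) / s k) sequentially" using Q(2) \<mu> by (intro order_tendstoD) auto
 ultimately show ?thesis
  by eventually_elim (use s in \<open>auto simp: pos_divide_less_eq pos_less_divide_eq\<close>)
qed

text \<open>Chosen so that \<open>\<alpha> k x * \<bar>u x\<bar> powr (Q k - 2) * u x\<close> is
  \<open>h p (u x)\<close> plus \<open>s k\<close> times \<open>pert k u x * h p (u x)\<close>. In
  the weak equation the leading terms then cancel up to \<open>kappa - 1\<close>, and division by
  \<open>s k\<close> is possible.\<close>

definition pert :: "nat \<Rightarrow> ('a \<Rightarrow> real) \<Rightarrow> 'a \<Rightarrow> real" where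
 "pert k u x = (\<alpha> k x * \<bar>u x\<bar> powr (Q k - p) - 1) / s k"

text \<open>The uniform bound \<open>K\<close> on the test functions makes domination work:
  \<open>pert\<close> times \<open>h\<close> is controlled by lower powers and
  \<open>\<bar>u k x\<bar> powr p\<close>, for which only the majorant \<open>G\<close> is known,
  and this leaves no room for an unbounded factor.\<close>

lemma pert_tendsto:
 fixes u v :: "nat \<Rightarrow> 'a \<Rightarrow> real"
 assumes [measurable]: "\<And>k. u k \<in> borel_measurable borel" "\<And>k. v k \<in> borel_measurable borel"
   "u0 \<in> borel_measurable borel" "v0 \<in> borel_measurable borel"
  and z: "\<And>k x. x \<notin> \<Omega> \<Longrightarrow> u k x = 0"
  and c: "AE x in lborel. (\<lambda>k. u k x) \<longlonglongrightarrow> u0 x" "AE x in lborel. (\<lambda>k. v k x) \<longlonglongrightarrow> v0 x"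
  and G: "integrable lborel G" "AE x in lborel. \<forall>k. \<bar>u k x\<bar> powr p \<le> G x" and K: "\<And>k x. \<bar>v k x\<bar> \<le> K"
 shows "(\<lambda>k. LBINT x. pert k (u k) x * h p (u k x) * v k x) \<longlonglongrightarrow> LT u0 v0"
  and "eventually (\<lambda>k. integrable lborel (\<lambda>x. pert k (u k) x * h p (u k x) * v k x)) sequentially"
proof -
 define C where "C = M + 4 * \<mu> + 4 * \<mu> / (p - 1)"
 have C0: "0 \<le> C" using M \<mu> p by (simp add: C_def)
 have K0: "0 \<le> K" using K[of undefined undefined] abs_ge_zero order_trans by blast
 obtain k0 where k0: "\<And>k. k \<ge> k0 \<Longrightarrow> Q k - p \<le> 1/2 \<and> Q k - p \<le> 2 * \<mu> * s k"
  using Q_bounds unfolding eventually_sequentially by blast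
 have bound: "\<bar>pert k (u k) x * h p (u k x)\<bar> \<le>
   C * (\<bar>u k x\<bar> powr (p - 1) + \<bar>u k x\<bar> powr ((p - 1) / 2) + \<bar>u k x\<bar> powr p)"
  if "k \<ge> k0" "\<bar>\<alpha> k x - 1\<bar> \<le> M * s k" for k x
  using perturbation_bound[of p M \<mu> "\<bar>u k x\<bar>" "s k" "Q k - p" "\<alpha> k x"] p M \<mu> s(1)[of k] Q(1)[of k] k0[OF that(1)] that(2)
  by (simp add: abs_mult abs_h pert_def C_def mult.commute)
 have le1: "t powr a \<le> 1 + t powr p" if "0 \<le> t" "0 \<le> a" "a \<le> p" for t a :: real
 proof (cases "t \<le> 1")
  case True
  have "t powr a \<le> 1" using that True by (intro powr_le1) auto
  moreover have "0 \<le> t powr p" by simp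
  ultimately show ?thesis by linarith
 next
  case False
  then have "t powr a \<le> t powr p" using that by (intro powr_mono) auto
  then show ?thesis by simp
 qed
 let ?w = "\<lambda>x. indicator \<Omega> x * (C * (2 + 3 * G x) * K)"
 have Gm[measurable]: "G \<in> borel_measurable borel" using borel_measurable_integrable[OF G(1)] by simp
 have wi: "integrable lborel ?w"
 proof -
  have "integrable lborel (\<lambda>x. indicator \<Omega> x * G x)"
   by (rule Bochner_Integration.integrable_bound[OF G(1)]) (auto simp: indicator_def)
  then have "integrable lborel (\<lambda>x. (2 * C * K) * indicator \<Omega> x + (3 * C * K) * (indicator \<Omega> x * G x))"
   using indicator_integrable by simp
  then show ?thesis by (simp add: algebra_simps)
 qed
 have dom: "AE x in lborel. \<forall>k\<ge>k0. norm (pert k (u k) x * h p (u k x) * v k x) \<le> ?w x"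
  using \<alpha> G(2)
 proof eventually_elim
  case (elim x)
  show ?case
  proof (intro allI impI)
   fix k assume k: "k \<ge> k0"
   show "norm (pert k (u k) x * h p (u k x) * v k x) \<le> ?w x"
   proof (cases "x \<in> \<Omega>")
    case True
    have "\<bar>pert k (u k) x * h p (u k x)\<bar> \<le>
      C * (\<bar>u k x\<bar> powr (p - 1) + \<bar>u k x\<bar> powr ((p - 1) / 2) + \<bar>u k x\<bar> powr p)"
     using True elim k by (intro bound) auto
    also have "\<dots> \<le> C * ((1 + \<bar>u k x\<bar> powr p) + (1 + \<bar>u k x\<bar> powr p) + \<bar>u k x\<bar> powr p)"
     using p C0 by (intro mult_left_mono add_mono le1) auto
    also have "\<dots> \<le> C * (2 + 3 * G x)" using elim(2)[rule_format, of k] C0 by (intro mult_left_mono) auto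
    finally have "\<bar>pert k (u k) x * h p (u k x)\<bar> * \<bar>v k x\<bar> \<le> C * (2 + 3 * G x) * K"
     using K K0 by (intro mult_mono) (auto intro: order_trans[OF abs_ge_zero])
    then show ?thesis using True by (simp add: abs_mult)
   qed (use z in simp)
  qed
 qed
 have mm[measurable]: "pert k (u k) \<in> borel_measurable borel" for k unfolding pert_def[abs_def] by measurable
 show "eventually (\<lambda>k. integrable lborel (\<lambda>x. pert k (u k) x * h p (u k x) * v k x)) sequentially"
  unfolding eventually_sequentially
 proof (intro exI[of _ k0] allI impI)
  fix k assume k: "k0 \<le> k"
  show "integrable lborel (\<lambda>x. pert k (u k) x * h p (u k x) * v k x)"
  proof (rule Bochner_Integration.integrable_bound[OF wi])
   show "AE x in lborel. norm (pert k (u k) x * h p (u k x) * v k x) \<le> norm (?w x)"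
    using dom
   proof eventually_elim
    case (elim x)
    then have "norm (pert k (u k) x * h p (u k x) * v k x) \<le> ?w x" using k by blast
    also have "\<dots> \<le> norm (?w x)" by simp
    finally show ?case .
   qed
  qed measurable
 qed
 have pt: "AE x in lborel. (\<lambda>k. pert k (u k) x * h p (u k x) * v k x) \<longlonglongrightarrow> (b x + \<mu> * ln \<bar>u0 x\<bar>) * h p (u0 x) * v0 x"
  using \<alpha> b c
 proof eventually_elim
  case (elim x)
  show ?case
  proof (cases "x \<in> \<Omega>")
   case False
   then have "u k x = 0" for k using z by simp
   moreover from this have "u0 x = 0" using LIMSEQ_unique[OF elim(3)] by simp
   ultimately show ?thesis by simp
  next
   case True
   show ?thesis
   proof (cases "u0 x = 0")
    case u0: True
    \<comment> \<open>At a zero of the limit \<open>pert\<close> itself may diverge. Its product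
      with \<open>h\<close> is squeezed by the majorant, which vanishes with
      \<open>u k x\<close>.\<close>
    have "(\<lambda>k. pert k (u k) x * h p (u k x)) \<longlonglongrightarrow> 0"
    proof (rule Lim_null_comparison)
     show "eventually (\<lambda>k. norm (pert k (u k) x * h p (u k x)) \<le>
       C * (\<bar>u k x\<bar> powr (p - 1) + \<bar>u k x\<bar> powr ((p - 1) / 2) + \<bar>u k x\<bar> powr p)) sequentially"
      unfolding eventually_sequentially using bound elim(1) True by (intro exI[of _ k0]) auto
     have "(\<lambda>k. C * (\<bar>u k x\<bar> powr (p - 1) + \<bar>u k x\<bar> powr ((p - 1) / 2) + \<bar>u k x\<bar> powr p))
       \<longlonglongrightarrow> C * (\<bar>u0 x\<bar> powr (p - 1) + \<bar>u0 x\<bar> powr ((p - 1) / 2) + \<bar>u0 x\<bar> powr p)"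
      using p by (intro tendsto_mult tendsto_add tendsto_const tendsto_powr' tendsto_rabs elim) auto
     then show "(\<lambda>k. C * (\<bar>u k x\<bar> powr (p - 1) + \<bar>u k x\<bar> powr ((p - 1) / 2) + \<bar>u k x\<bar> powr p)) \<longlonglongrightarrow> 0"
      using u0 by simp
    qed
    from tendsto_mult[OF this elim(4)] show ?thesis using u0 by simp
   next
    case u0: False
    have al: "(\<lambda>k. (\<alpha> k x - 1) / s k) \<longlonglongrightarrow> b x" using elim(2) True by simp
    have ln: "(\<lambda>k. ln \<bar>u k x\<bar>) \<longlonglongrightarrow> ln \<bar>u0 x\<bar>" using u0 by (intro tendsto_ln tendsto_rabs elim) auto
    have "(\<lambda>k. (Q k - p) / s k * ln \<bar>u k x\<bar>) \<longlonglongrightarrow> \<mu> * ln \<bar>u0 x\<bar>" by (intro tendsto_mult Q ln)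
    then have ex: "(\<lambda>k. (exp ((Q k - p) * ln \<bar>u k x\<bar>) - 1) / s k) \<longlonglongrightarrow> \<mu> * ln \<bar>u0 x\<bar>"
     by (intro exp_diff_quotient_tendsto[OF s(3,1)]) simp
    have "(\<lambda>k. exp ((Q k - p) * ln \<bar>u k x\<bar>)) \<longlonglongrightarrow> exp (0 * ln \<bar>u0 x\<bar>)"
     by (intro tendsto_exp tendsto_mult Q_tendsto ln)
    \<comment> \<open>The difference quotient of the product of \<open>\<alpha> k x\<close> and
      \<open>\<bar>u k x\<bar> powr (Q k - p)\<close>, split as in the product rule.\<close>
    then have "(\<lambda>k. (\<alpha> k x - 1) / s k * exp ((Q k - p) * ln \<bar>u k x\<bar>) + (exp ((Q k - p) * ln \<bar>u k x\<bar>) - 1) / s k)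
      \<longlonglongrightarrow> b x * 1 + \<mu> * ln \<bar>u0 x\<bar>" by (intro tendsto_add tendsto_mult al ex) simp
    moreover have "eventually (\<lambda>k. (\<alpha> k x - 1) / s k * exp ((Q k - p) * ln \<bar>u k x\<bar>) + (exp ((Q k - p) * ln \<bar>u k x\<bar>) - 1) / s k
      = pert k (u k) x) sequentially"
    proof -
     have "eventually (\<lambda>k. u k x \<noteq> 0) sequentially" using elim(3) u0 by (rule tendsto_imp_eventually_ne)
     then show ?thesis
     proof eventually_elim
      case (elim k)
      then have "exp ((Q k - p) * ln \<bar>u k x\<bar>) = \<bar>u k x\<bar> powr (Q k - p)" by (simp add: powr_def)
      then show ?case unfolding pert_def by (simp add: add_divide_distrib[symmetric] algebra_simps)
     qed
    qed
    ultimately have "(\<lambda>k. pert k (u k) x) \<longlonglongrightarrow> b x + \<mu> * ln \<bar>u0 x\<bar>"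
     by (auto elim: Lim_transform_eventually)
    then show ?thesis by (intro tendsto_mult isCont_tendsto_compose[OF isCont_h[OF p]] elim)
   qed
  qed
 qed
 have "(\<lambda>k. LBINT x. pert (k + k0) (u (k + k0)) x * h p (u (k + k0) x) * v (k + k0) x) \<longlonglongrightarrow> LT u0 v0"
  unfolding LT_def
 proof (rule integral_dominated_convergence[where w = ?w])
  show "AE x in lborel. (\<lambda>k. pert (k + k0) (u (k + k0)) x * h p (u (k + k0) x) * v (k + k0) x) \<longlonglongrightarrow> (b x + \<mu> * ln \<bar>u0 x\<bar>) * h p (u0 x) * v0 x"
   using pt by eventually_elim (rule LIMSEQ_ignore_initial_segment)
  show "AE x in lborel. norm (pert (k + k0) (u (k + k0)) x * h p (u (k + k0) x) * v (k + k0) x) \<le> ?w x" for k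
   using dom by eventually_elim simp
 qed (use wi in measurable)
 then show "(\<lambda>k. LBINT x. pert k (u k) x * h p (u k x) * v k x) \<longlonglongrightarrow> LT u0 v0"
  by (rule LIMSEQ_offset)
qed

end

section \<open>A priori bounds\<close>

lemma lipschitz_bounded:
 fixes w :: "'a::euclidean_space \<Rightarrow> real"
 assumes "bounded \<Omega>" and L: "\<And>x y. \<bar>w x - w y\<bar> \<le> L * norm (x - y)" and 0: "\<And>x. x \<notin> \<Omega> \<Longrightarrow> w x = 0"
 obtains K where "\<And>x. \<bar>w x\<bar> \<le> K"
proof -
 obtain B where B: "\<And>x. x \<in> \<Omega> \<Longrightarrow> norm x \<le> B" using assms(1) by (auto simp: bounded_iff)
 have "\<Omega> \<noteq> UNIV" using assms(1) not_bounded_UNIV by auto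
 then obtain y where y: "y \<notin> \<Omega>" by auto
 have L0: "0 \<le> L"
 proof -
  obtain b :: 'a where "b \<in> Basis" using nonempty_Basis by blast
  then have "0 \<le> L * norm (b - 0)" using L[of b 0] by linarith
  then show ?thesis using \<open>b \<in> Basis\<close> by simp
 qed
 have "\<bar>w x\<bar> \<le> \<bar>L * (B + norm y)\<bar>" for x
 proof (cases "x \<in> \<Omega>")
  case True
  have "\<bar>w x\<bar> \<le> L * norm (x - y)" using L[of x y] 0[OF y] by simp
  also have "\<dots> \<le> L * (B + norm y)"
   using B[OF True] norm_triangle_ineq4[of x y] L0 by (intro mult_left_mono) auto
  finally show ?thesis by simp
 qed (simp add: 0)
 then show ?thesis by (rule that)
qed

text \<open>The Lipschitz bound takes \<open>norm (x - y) powr p\<close> out of the kernel and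
  leaves one of order \<open>e - p < 0\<close>, which is integrable. Such functions have finite
  energy of a fixed positive order, as the comparison with the fractional problems requires.\<close>

lemma lipschitz_in_Xe:
 fixes w :: "'a::euclidean_space \<Rightarrow> real"
 assumes p: "1 < p" and e: "e < p" and \<Omega>: "bounded \<Omega>" "open \<Omega>"
  and L: "\<And>x y. \<bar>w x - w y\<bar> \<le> L * norm (x - y)" and 0: "\<And>x. x \<notin> \<Omega> \<Longrightarrow> w x = 0"
 shows "w \<in> Xe p \<Omega> e"
proof -
 have [measurable]: "\<Omega> \<in> sets borel" using \<Omega> by auto
 have ii: "integrable lborel (indicat_real \<Omega>)"
  using emeasure_bounded_finite[OF \<Omega>(1)] by (intro integrable_real_indicator) auto
 obtain K where K: "\<And>x. \<bar>w x\<bar> \<le> K" using lipschitz_bounded[OF \<Omega>(1) L 0] by blast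
 define L' where "L' = \<bar>L\<bar>"
 have L': "\<bar>w x - w y\<bar> \<le> L' * norm (x - y)" for x y
 proof -
  have "L * norm (x - y) \<le> L' * norm (x - y)" by (intro mult_right_mono) (auto simp: L'_def)
  then show ?thesis using L[of x y] by linarith
 qed
 have "L'-lipschitz_on UNIV w"
  by (rule lipschitz_onI) (use L' in \<open>auto simp: dist_real_def dist_norm L'_def\<close>)
 then have "continuous_on UNIV w" by (rule lipschitz_on_continuous_on)
 then have [measurable]: "w \<in> borel_measurable borel" by (rule borel_measurable_continuous_onI)
 have i: "integrable lborel (\<lambda>x. \<bar>w x\<bar> powr p)"
 proof (rule Bochner_Integration.integrable_bound[OF integrable_mult_right[OF ii, of "K powr p"]])
  show "AE x in lborel. norm (\<bar>w x\<bar> powr p) \<le> norm (K powr p * indicator \<Omega> x)"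
   using K p 0 by (intro AE_I2) (auto simp: indicator_def intro!: powr_mono2)
 qed measurable
 define c0 where "c0 = (\<integral>\<^sub>+y. ennreal (kn (e - p) (0::'a, y)))"
 have ep: "e - p < 0" using e by simp
 have c: "c0 < \<infinity>" unfolding c0_def by (rule nn_integral_kn_finite(2)[OF ep])
 have c': "(\<integral>\<^sub>+y. ennreal (kn (e - p) (x::'a, y))) = c0"
  "(\<integral>\<^sub>+y. ennreal (kn (e - p) (y, x::'a))) = c0" for x
  unfolding c0_def kn_sym[of "e - p" _ x] by (rule nn_integral_kn_finite(1)[OF ep])+
 have pt: "\<bar>incr w z\<bar> powr p * kn e z
   \<le> L' powr p * indicator \<Omega> (fst z) * kn (e - p) z + L' powr p * indicator \<Omega> (snd z) * kn (e - p) z" for z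
 proof -
  have *: "\<bar>incr w z\<bar> powr p * kn e z \<le> L' powr p * kn (e - p) z"
  proof -
   let ?n = "norm (fst z - snd z)"
   have "\<bar>incr w z\<bar> powr p * kn e z \<le> (L' * ?n) powr p * kn e z"
    using L' p by (intro mult_right_mono powr_mono2) auto
   also have "\<dots> = L' powr p * (?n powr p * kn e z)" by (simp add: powr_mult L'_def)
   finally show ?thesis by (simp only: kn_weight)
  qed
  have nn: "0 \<le> L' powr p * kn (e - p) z" by simp
  show ?thesis
  proof (cases "fst z \<in> \<Omega> \<or> snd z \<in> \<Omega>")
   case True
   have "1 * (L' powr p * kn (e - p) z) \<le> (indicator \<Omega> (fst z) + indicator \<Omega> (snd z)) * (L' powr p * kn (e - p) z)"
    using True nn by (intro mult_right_mono) (auto simp: indicator_def)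
   then show ?thesis using * by (simp add: algebra_simps)
  next
   case False
   then show ?thesis using 0 by simp
  qed
 qed
 have "(\<integral>\<^sub>+z. ennreal (\<bar>incr w z\<bar> powr p * kn e z))
   \<le> (\<integral>\<^sub>+z. ennreal (L' powr p) * (indicator \<Omega> (fst z) * ennreal (kn (e - p) z)) + ennreal (L' powr p) * (indicator \<Omega> (snd z) * ennreal (kn (e - p) z)))"
 proof (rule nn_integral_mono)
  fix z :: "'a \<times> 'a"
  have "ennreal (\<bar>incr w z\<bar> powr p * kn e z)
   \<le> ennreal (L' powr p * indicator \<Omega> (fst z) * kn (e - p) z + L' powr p * indicator \<Omega> (snd z) * kn (e - p) z)"
   by (rule ennreal_leI[OF pt])
  also have "\<dots> = ennreal (L' powr p) * (indicator \<Omega> (fst z) * ennreal (kn (e - p) z)) + ennreal (L' powr p) * (indicator \<Omega> (snd z) * ennreal (kn (e - p) z))"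
   by (auto simp: indicator_def ennreal_mult)
  finally show "ennreal (\<bar>incr w z\<bar> powr p * kn e z) \<le> \<dots>" .
 qed
 also have "\<dots> = ennreal (L' powr p) * (\<integral>\<^sub>+z. indicator \<Omega> (fst z) * ennreal (kn (e - p) z))
   + ennreal (L' powr p) * (\<integral>\<^sub>+z. indicator \<Omega> (snd z) * ennreal (kn (e - p) z))"
  by (simp add: nn_integral_add nn_integral_cmult)
 also have "(\<integral>\<^sub>+z. indicator \<Omega> (fst z) * ennreal (kn (e - p) z)) = emeasure lborel \<Omega> * c0"
  by (subst nn_integral_pair_lborel(1)) (simp_all add: nn_integral_cmult nn_integral_multc c')
 also have "(\<integral>\<^sub>+z. indicator \<Omega> (snd z) * ennreal (kn (e - p) z)) = emeasure lborel \<Omega> * c0"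
  by (subst nn_integral_pair_lborel(2)) (simp_all add: nn_integral_cmult nn_integral_multc c')
 also have "ennreal (L' powr p) * (emeasure lborel \<Omega> * c0) + ennreal (L' powr p) * (emeasure lborel \<Omega> * c0) < \<infinity>"
  using c emeasure_bounded_finite[OF \<Omega>(1)] by (auto simp: ennreal_mult_less_top)
 finally have fin: "(\<integral>\<^sub>+z. ennreal (\<bar>incr w z\<bar> powr p * kn e z)) < \<infinity>" .
 have "integrable lborel (\<lambda>z. \<bar>incr w z\<bar> powr p * kn e z)"
  by (rule integrableI_nonneg[OF _ _ fin]) auto
 then show ?thesis using i 0 by (auto simp: Xe_def)
qed

lemma Xe_cmult:
 assumes "u \<in> Xe p \<Omega> e" shows "(\<lambda>x. c * u x) \<in> Xe p \<Omega> e"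
proof -
 note [measurable] = XeD(1)[OF assms]
 have eq: "\<bar>c * u (fst z) - c * u (snd z)\<bar> powr p * kn e z = \<bar>c\<bar> powr p * (\<bar>incr u z\<bar> powr p * kn e z)" for z
  by (simp add: right_diff_distrib[symmetric] abs_mult powr_mult)
 have "integrable lborel (\<lambda>z. \<bar>c * u (fst z) - c * u (snd z)\<bar> powr p * kn e z)"
  unfolding eq by (intro integrable_mult_right XeD(4)[OF assms])
 then show ?thesis using XeD(1-3)[OF assms] by (auto simp: Xe_def abs_mult powr_mult)
qed

text \<open>The quantitative core of the a priori bounds: \<open>X\<close> is the ratio of the energy to the
 \<open>p\<close>-th power of the norm, and \<open>T\<close> the (small) power of that norm produced by the Nehari identity.\<close>

lemma ratio_bound:
 fixes X T l \<eta> \<epsilon> :: real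
 assumes \<epsilon>: "0 \<le> \<epsilon>" "\<epsilon> \<le> 1/8" and l: "0 \<le> l" "l \<le> 1 - \<eta>" "0 < \<eta>" "14 * \<epsilon> \<le> \<eta>"
  and X: "1 - \<epsilon> \<le> X" "X \<le> (1 + \<epsilon>) * T * (1 - l + l * X * (1 + \<epsilon>) + \<epsilon>)" and T: "0 \<le> T"
 shows "1 - 4 * \<epsilon> \<le> T" and "T \<le> 1 + \<epsilon> \<Longrightarrow> X - 1 \<le> 28 * \<epsilon> / \<eta>"
proof -
 have lX: "0 \<le> l * X" using l X \<epsilon> by simp
 show "1 - 4 * \<epsilon> \<le> T"
 \<comment> \<open>For \<open>X \<ge> 1\<close> all terms of the bracket are compared with multiples
   of \<open>X\<close>, which then cancels. For \<open>X < 1\<close> the lower bound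
   \<open>1 - \<epsilon>\<close> takes the place of \<open>X\<close>.\<close>
 proof (cases "1 \<le> X")
  case True
  have "(1 - l) * 1 \<le> (1 - l) * X" using l True by (intro mult_left_mono) auto
  moreover have "l * X * \<epsilon> \<le> 1 * X * \<epsilon>" using l True \<epsilon> by (intro mult_right_mono) auto
  moreover have "\<epsilon> * 1 \<le> \<epsilon> * X" using True \<epsilon> by (intro mult_left_mono) auto
  ultimately have "1 - l + l * X * (1 + \<epsilon>) + \<epsilon> \<le> X * (1 + 2 * \<epsilon>)" by (simp add: algebra_simps)
  then have "X \<le> (1 + \<epsilon>) * T * (X * (1 + 2 * \<epsilon>))"
   using X(2) T \<epsilon> by (elim order_trans) (intro mult_left_mono, auto)
  then have "X * 1 \<le> X * ((1 + \<epsilon>) * (1 + 2 * \<epsilon>) * T)" by (simp add: mult_ac)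
  then have 1: "1 \<le> (1 + \<epsilon>) * (1 + 2 * \<epsilon>) * T" using True by (simp only: mult_le_cancel_left)
  have "(1 - 4 * \<epsilon>) * ((1 + \<epsilon>) * (1 + 2 * \<epsilon>)) = 1 - \<epsilon> * (1 + 10 * \<epsilon> + 8 * \<epsilon> * \<epsilon>)" by (simp add: algebra_simps)
  also have "\<dots> \<le> 1" using \<epsilon> by simp
  finally have "(1 - 4 * \<epsilon>) * ((1 + \<epsilon>) * (1 + 2 * \<epsilon>)) \<le> T * ((1 + \<epsilon>) * (1 + 2 * \<epsilon>))" using 1 by (simp add: mult_ac)
  moreover have "0 < (1 + \<epsilon>) * (1 + 2 * \<epsilon>)" using \<epsilon> by simp
  ultimately show ?thesis by (rule mult_right_le_imp_le)
 next
  case False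
  have "l * X * (1 + \<epsilon>) \<le> l * 1 * (1 + \<epsilon>)" using False l \<epsilon> by (intro mult_right_mono mult_left_mono) auto
  moreover have "l * \<epsilon> \<le> 1 * \<epsilon>" using l \<epsilon> by (intro mult_right_mono) auto
  ultimately have "1 - l + l * X * (1 + \<epsilon>) + \<epsilon> \<le> 1 + 2 * \<epsilon>" by (simp add: algebra_simps)
  then have "X \<le> (1 + \<epsilon>) * T * (1 + 2 * \<epsilon>)"
   using X(2) T \<epsilon> by (elim order_trans) (intro mult_left_mono, auto)
  then have 1: "1 - \<epsilon> \<le> T * ((1 + \<epsilon>) * (1 + 2 * \<epsilon>))" using X(1) by (simp add: mult_ac)
  have "(1 - 4 * \<epsilon>) * ((1 + \<epsilon>) * (1 + 2 * \<epsilon>)) = (1 - \<epsilon>) - \<epsilon> * (10 * \<epsilon> + 8 * \<epsilon> * \<epsilon>)" by (simp add: algebra_simps)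
  also have "\<dots> \<le> 1 - \<epsilon>" using \<epsilon> by simp
  finally have "(1 - 4 * \<epsilon>) * ((1 + \<epsilon>) * (1 + 2 * \<epsilon>)) \<le> T * ((1 + \<epsilon>) * (1 + 2 * \<epsilon>))" using 1 by linarith
  moreover have "0 < (1 + \<epsilon>) * (1 + 2 * \<epsilon>)" using \<epsilon> by simp
  ultimately show ?thesis by (rule mult_right_le_imp_le)
 qed
 assume T1: "T \<le> 1 + \<epsilon>"
 have q: "(1 + \<epsilon>) * (1 + \<epsilon>) \<le> 1 + 3 * \<epsilon>"
 proof -
  have "\<epsilon> * \<epsilon> \<le> 1 * \<epsilon>" using \<epsilon> by (intro mult_right_mono) auto
  then show ?thesis by (simp add: algebra_simps)
 qed
 have br: "0 \<le> 1 - l + l * X * (1 + \<epsilon>) + \<epsilon>" using lX l \<epsilon> by (intro add_nonneg_nonneg mult_nonneg_nonneg[OF lX]) auto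
 have "X \<le> (1 + 3 * \<epsilon>) * (1 - l + l * X * (1 + \<epsilon>) + \<epsilon>)"
 proof -
  have "(1 + \<epsilon>) * T \<le> (1 + \<epsilon>) * (1 + \<epsilon>)" using T1 \<epsilon> by (intro mult_left_mono) auto
  then have "(1 + \<epsilon>) * T \<le> 1 + 3 * \<epsilon>" using q by linarith
  then show ?thesis using X(2) br by (elim order_trans) (rule mult_right_mono)
 qed
 also have "\<dots> = (1 + 3 * \<epsilon>) * (1 - l) + (1 + 3 * \<epsilon>) * \<epsilon> + l * X * ((1 + 3 * \<epsilon>) * (1 + \<epsilon>))" by (simp add: algebra_simps)
 also have "\<dots> \<le> (1 - l + 3 * \<epsilon>) + 4 * \<epsilon> + l * X * (1 + 7 * \<epsilon>)"
 proof (intro add_mono mult_left_mono lX)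
  have "3 * \<epsilon> * (1 - l) \<le> 3 * \<epsilon> * 1" using \<epsilon> l by (intro mult_left_mono) auto
  then show "(1 + 3 * \<epsilon>) * (1 - l) \<le> 1 - l + 3 * \<epsilon>" by (simp add: algebra_simps)
  have ee: "\<epsilon> * \<epsilon> \<le> 1 * \<epsilon>" using \<epsilon> by (intro mult_right_mono) auto
  then show "(1 + 3 * \<epsilon>) * \<epsilon> \<le> 4 * \<epsilon>" "(1 + 3 * \<epsilon>) * (1 + \<epsilon>) \<le> 1 + 7 * \<epsilon>" by (simp_all add: algebra_simps)
 qed
 finally have "(X - 1) * (1 - l * (1 + 7 * \<epsilon>)) \<le> 7 * \<epsilon> + 7 * \<epsilon> * l" by (simp add: algebra_simps)
 also have "\<dots> \<le> 14 * \<epsilon>" using mult_left_mono[of l 1 "7 * \<epsilon>"] l \<epsilon> by simp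
 finally have f: "(X - 1) * (1 - l * (1 + 7 * \<epsilon>)) \<le> 14 * \<epsilon>" .
 \<comment> \<open>From \<open>l \<le> 1 - \<eta>\<close> and
   \<open>14 * \<epsilon> \<le> \<eta>\<close>: the perturbation of \<open>l\<close> uses up at most
   half of the gap.\<close>
 have g: "\<eta> / 2 \<le> 1 - l * (1 + 7 * \<epsilon>)"
 proof -
  have "l * (7 * \<epsilon>) \<le> 1 * (7 * \<epsilon>)" using l \<epsilon> by (intro mult_right_mono) auto
  then show ?thesis using l by (simp add: algebra_simps)
 qed
 show "X - 1 \<le> 28 * \<epsilon> / \<eta>"
 proof (cases "1 \<le> X")
  case True
  have "(X - 1) * (\<eta> / 2) \<le> (X - 1) * (1 - l * (1 + 7 * \<epsilon>))" using True g by (intro mult_left_mono) auto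
  then have "(X - 1) * (\<eta> / 2) \<le> 14 * \<epsilon>" using f by linarith
  then show ?thesis using l(3) by (simp add: field_simps)
 next
  case False
  moreover have "0 \<le> 28 * \<epsilon> / \<eta>" using \<epsilon> l by simp
  ultimately show ?thesis by linarith
 qed
qed

text \<open>Minimality is stated for the form instead of the energy: on the Nehari set the energy is
  the form times the positive constant \<open>1 / p - 1 / Q k\<close>.\<close>

locale small_order_sol = small_order +
 fixes u :: "nat \<Rightarrow> 'a \<Rightarrow> real"
 assumes uX: "\<And>k. u k \<in> Xe p \<Omega> (s k * p)" and uY: "\<And>k. 0 < (LBINT x. \<bar>u k x\<bar> powr p)"
  and weak: "\<And>k v. v \<in> Xe p \<Omega> (s k * p) \<Longrightarrow>
    E_frac (s k) p (u k) v = (LBINT x. \<alpha> k x * \<bar>u k x\<bar> powr (Q k - 2) * u k x * v x)"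
  and least: "\<And>k v. v \<in> Xe p \<Omega> (s k * p) \<Longrightarrow> 0 < (LBINT x. \<bar>v x\<bar> powr p) \<Longrightarrow>
    E_frac (s k) p v v = (LBINT x. \<alpha> k x * \<bar>v x\<bar> powr Q k) \<Longrightarrow>
    E_frac (s k) p (u k) (u k) \<le> E_frac (s k) p v v"
begin

section \<open>Energy comparison and the bounds that it implies\<close>

lemma pert_eq: "\<alpha> k x * \<bar>w x\<bar> powr (Q k - 2) * w x * v x = h p (w x) * v x + s k * (pert k w x * h p (w x) * v x)"
proof -
 have "\<bar>w x\<bar> powr (Q k - p) * h p (w x) = (\<bar>w x\<bar> powr (Q k - p) * \<bar>w x\<bar> powr (p - 2)) * w x" by (simp add: h_def)
 also have "\<dots> = \<bar>w x\<bar> powr (Q k - 2) * w x" by (simp flip: powr_add)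
 finally have *: "\<bar>w x\<bar> powr (Q k - 2) * w x = \<bar>w x\<bar> powr (Q k - p) * h p (w x)" ..
 have "s k * pert k w x = \<alpha> k x * \<bar>w x\<bar> powr (Q k - p) - 1" using s(1)[of k] by (simp add: pert_def)
 then have "h p (w x) * v x + s k * (pert k w x * h p (w x) * v x)
   = h p (w x) * v x + (\<alpha> k x * \<bar>w x\<bar> powr (Q k - p) - 1) * (h p (w x) * v x)" by (simp only: mult.assoc[symmetric])
 also have "\<dots> = \<alpha> k x * (\<bar>w x\<bar> powr (Q k - p) * h p (w x)) * v x" by (simp add: algebra_simps)
 finally show ?thesis using * by (simp add: mult.assoc)
qed

lemma powr_Q_eq: "\<alpha> k x * \<bar>w x\<bar> powr Q k = \<alpha> k x * \<bar>w x\<bar> powr (Q k - 2) * w x * w x"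
proof -
 have "\<bar>w x\<bar> powr (Q k - 2) * w x * w x = h (Q k) (w x) * w x" by (simp add: h_def)
 then show ?thesis by (simp add: h_mult_self mult.assoc)
qed

text \<open>As \<open>s k < 1/2\<close>, every kernel of order \<open>e k\<close> lies below the one
  of order \<open>p / 2\<close>. This is the reason for taking competitors in
  \<open>Xe p \<Omega> (p / 2)\<close>.\<close>

lemma near_tendsto:
 assumes w: "w \<in> Xe p \<Omega> (p / 2)"
 shows "(\<lambda>k. near p (e k) w w) \<longlonglongrightarrow> near p 0 w w"
 unfolding near_self
proof (rule integral_dominated_convergence[OF _ _ XeD(4)[OF w]])
 note [measurable] = XeD(1)[OF w]
 show "(\<lambda>z. \<bar>incr w z\<bar> powr p * kn 0 z) \<in> borel_measurable lborel"
  "(\<lambda>z. \<bar>incr w z\<bar> powr p * kn (e k) z) \<in> borel_measurable lborel" for k by measurable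
 show "AE z in lborel. (\<lambda>k. \<bar>incr w z\<bar> powr p * kn (e k) z) \<longlonglongrightarrow> \<bar>incr w z\<bar> powr p * kn 0 z"
  by (intro AE_I2 tendsto_mult tendsto_const kn_tendsto)
 have "e k \<le> p / 2" for k using mult_right_mono[of "s k" "1/2" p] s(2)[of k] p by simp
 then show "AE z in lborel. norm (\<bar>incr w z\<bar> powr p * kn (e k) z) \<le> \<bar>incr w z\<bar> powr p * kn (p / 2) z" for k
  by (intro AE_I2) (auto simp: abs_mult intro!: mult_left_mono kn_mono)
qed

text \<open>A multiple \<open>t * w\<close> lies on the Nehari set when
  \<open>t powr (Q k - p)\<close> is the quotient of the form by the right-hand side at
  \<open>w\<close>. Both are \<open>Y w * (1 + O(s k))\<close>, and \<open>Q k - p\<close> is itself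
  of order \<open>s k\<close>, so \<open>ln t\<close> has a finite limit, a quotient of first order
  terms. This is the origin of the exponential.\<close>

lemma energy_upper_bound:
 assumes w: "w \<in> Xe p \<Omega> (p / 2)" and K: "\<And>x. \<bar>w x\<bar> \<le> K" and Yw: "0 < Y w"
 obtains T where "T \<longlonglongrightarrow> Y w * exp (p * (E0 w w - LT w w) / (\<mu> * Y w))"
  "eventually (\<lambda>k. E_frac (s k) p (u k) (u k) \<le> T k) sequentially"
proof -
 note [measurable] = XeD(1)[OF w]
 have ek: "e k \<le> p / 2" for k using mult_right_mono[of "s k" "1/2" p] s(2)[of k] p by simp
 have wk: "w \<in> Xe p \<Omega> (e k)" for k by (rule Xe_antimono[OF ek w])
 let ?X = "\<lambda>k. E_frac (s k) p w w"
 let ?W = "\<lambda>k. LBINT x. \<alpha> k x * \<bar>w x\<bar> powr Q k"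
 let ?c = "p / (2 * sphere_area DIM('a))"
 define D where "D k = (kappa DIM('a) p (s k) - 1) / s k * Y w + kappa DIM('a) p (s k) * (?c * (near p (e k) w w + far p (e k) w w))" for k
 define R where "R k = (LBINT x. pert k w x * h p (w x) * w x)" for k
 have X: "?X k = Y w + s k * D k" for k
 proof -
  have "?X k = kappa DIM('a) p (s k) * (Y w + s k * ?c * (near p (e k) w w + far p (e k) w w))"
   using E_frac_expansion[OF wk wk, of k] by (simp add: h_mult_self Y_def)
  also have "\<dots> = Y w + s k * D k"
  proof -
   have "s k * D k = (kappa DIM('a) p (s k) - 1) * Y w + s k * (kappa DIM('a) p (s k) * (?c * (near p (e k) w w + far p (e k) w w)))"
    using s(1)[of k] by (simp add: D_def distrib_left)
   then show ?thesis by (simp add: algebra_simps)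
  qed
  finally show ?thesis .
 qed
 have far: "(\<lambda>k. far p (e k) w w) \<longlonglongrightarrow> far p 0 w w"
  using XeD[OF w] e_pos kf_tendsto
  by (intro far_tendsto[where G = "\<lambda>x. \<bar>w x\<bar> powr p + \<bar>w x\<bar> powr p"]) (auto intro: less_imp_le)
 have DL: "D \<longlonglongrightarrow> E0 w w"
 proof -
  have "D \<longlonglongrightarrow> rho DIM('a) p * Y w + 1 * (?c * (near p 0 w w + far p 0 w w))"
   unfolding D_def by (intro tendsto_add tendsto_mult tendsto_const kappa_tendsto near_tendsto[OF w] far)
  also have "rho DIM('a) p * Y w + 1 * (?c * (near p 0 w w + far p 0 w w)) = E0 w w"
   by (simp add: E0_def C_lim_eq Y_def h_mult_self)
  finally show ?thesis .
 qed
 note pt = pert_tendsto[of "\<lambda>_. w" "\<lambda>_. w" w w "\<lambda>x. \<bar>w x\<bar> powr p" K]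
 have RL: "R \<longlonglongrightarrow> LT w w" unfolding R_def using XeD[OF w] K by (intro pt(1)) auto
 have "eventually (\<lambda>k. integrable lborel (\<lambda>x. pert k w x * h p (w x) * w x)) sequentially"
  using XeD[OF w] K by (intro pt(2)) auto
 then have W: "eventually (\<lambda>k. ?W k = Y w + s k * R k) sequentially"
 proof eventually_elim
  case (elim k)
  have "integrable lborel (\<lambda>x. h p (w x) * w x)" using XeD(3)[OF w] by (simp add: h_mult_self)
  then have "?W k = (LBINT x. h p (w x) * w x) + s k * R k"
   unfolding powr_Q_eq pert_eq R_def using elim by simp
  then show ?case by (simp add: h_mult_self Y_def)
 qed
 have X1: "(\<lambda>k. 1 + s k * (D k / Y w)) \<longlonglongrightarrow> 1" "(\<lambda>k. 1 + s k * (R k / Y w)) \<longlonglongrightarrow> 1"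
  using tendsto_add[OF tendsto_const[of 1] tendsto_mult[OF s(3) tendsto_divide[OF DL tendsto_const[of "Y w"]]]]
   tendsto_add[OF tendsto_const[of 1] tendsto_mult[OF s(3) tendsto_divide[OF RL tendsto_const[of "Y w"]]]] Yw
  by auto
 \<comment> \<open>The logarithm of the factor that puts \<open>w\<close> on the Nehari set.\<close>
 define lt where "lt k = (ln (1 + s k * (D k / Y w)) - ln (1 + s k * (R k / Y w))) / (Q k - p)" for k
 have lt: "lt \<longlonglongrightarrow> (E0 w w / Y w - LT w w / Y w) / \<mu>"
 proof -
  have "(\<lambda>k. ln (1 + s k * (D k / Y w)) / s k) \<longlonglongrightarrow> E0 w w / Y w"
   using Yw by (intro ln_quotient_tendsto[OF s(3,1)] tendsto_divide DL tendsto_const) auto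
  moreover have "(\<lambda>k. ln (1 + s k * (R k / Y w)) / s k) \<longlonglongrightarrow> LT w w / Y w"
   using Yw by (intro ln_quotient_tendsto[OF s(3,1)] tendsto_divide RL tendsto_const) auto
  ultimately have "(\<lambda>k. (ln (1 + s k * (D k / Y w)) / s k - ln (1 + s k * (R k / Y w)) / s k) / ((Q k - p) / s k))
   \<longlonglongrightarrow> (E0 w w / Y w - LT w w / Y w) / \<mu>"
   by (rule tendsto_divide[OF tendsto_diff Q(2)]) (use \<mu> in auto)
  moreover have "(ln (1 + s k * (D k / Y w)) / s k - ln (1 + s k * (R k / Y w)) / s k) / ((Q k - p) / s k) = lt k" for k
   using s(1)[of k] Q(1)[of k] by (simp add: lt_def diff_divide_distrib[symmetric])
  ultimately show ?thesis by simp
 qed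
 define T where "T k = exp (p * lt k) * (Y w * (1 + s k * (D k / Y w)))" for k
 show ?thesis
 proof (rule that[of T])
  have "T \<longlonglongrightarrow> exp (p * ((E0 w w / Y w - LT w w / Y w) / \<mu>)) * (Y w * 1)"
   unfolding T_def by (intro tendsto_mult tendsto_exp tendsto_const lt X1)
  also have "p * ((E0 w w / Y w - LT w w / Y w) / \<mu>) = p * (E0 w w - LT w w) / (\<mu> * Y w)"
   using Yw \<mu> by (simp add: field_simps)
  finally show "T \<longlonglongrightarrow> Y w * exp (p * (E0 w w - LT w w) / (\<mu> * Y w))" by (simp add: mult.commute)
  have "eventually (\<lambda>k. 0 < 1 + s k * (D k / Y w)) sequentially" "eventually (\<lambda>k. 0 < 1 + s k * (R k / Y w)) sequentially"
   using X1 by (auto intro: order_tendstoD(1))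
  then show "eventually (\<lambda>k. E_frac (s k) p (u k) (u k) \<le> T k) sequentially"
   using W
  proof eventually_elim
   case (elim k)
   define t where "t = exp (lt k)"
   have t: "0 < t" by (simp add: t_def)
   have Xk: "?X k = Y w * (1 + s k * (D k / Y w))" using X[of k] Yw by (simp add: field_simps)
   have Wk: "?W k = Y w * (1 + s k * (R k / Y w))" using elim(3) Yw by (simp add: field_simps)
   have sc: "E_frac (s k) p (\<lambda>x. t * w x) (\<lambda>x. t * w x) = t powr p * ?X k"
   proof -
    have "h p (t * w x - t * w y) * (t * w x - t * w y) = t powr p * (h p (w x - w y) * (w x - w y))" for x y
    proof -
     have "h p (t * w x - t * w y) * (t * w x - t * w y) = \<bar>t * (w x - w y)\<bar> powr p"
      by (simp only: right_diff_distrib[symmetric] h_mult_self)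
     then show ?thesis using t by (simp add: h_mult_self abs_mult powr_mult)
    qed
    then show ?thesis unfolding E_frac_def by (simp add: case_prod_beta' mult.assoc flip: times_divide_eq_right)
   qed
   have "t powr (Q k - p) = (1 + s k * (D k / Y w)) / (1 + s k * (R k / Y w))"
   proof -
    have "t powr (Q k - p) = exp ((Q k - p) * lt k)" by (simp add: t_def powr_def)
    also have "(Q k - p) * lt k = ln (1 + s k * (D k / Y w)) - ln (1 + s k * (R k / Y w))"
     using Q(1)[of k] by (simp add: lt_def)
    finally show ?thesis using elim by (simp add: exp_diff)
   qed
   then have ne: "t powr p * ?X k = t powr Q k * ?W k"
   proof -
    assume "t powr (Q k - p) = (1 + s k * (D k / Y w)) / (1 + s k * (R k / Y w))"
    then have "t powr (Q k - p) * ?W k = ?X k" unfolding Xk Wk using elim by simp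
    then have "t powr p * ?X k = (t powr p * t powr (Q k - p)) * ?W k" by (simp add: mult.assoc)
    then show ?thesis by (simp flip: powr_add)
   qed
   have "E_frac (s k) p (u k) (u k) \<le> E_frac (s k) p (\<lambda>x. t * w x) (\<lambda>x. t * w x)"
   proof (rule least)
    show "(\<lambda>x. t * w x) \<in> Xe p \<Omega> (e k)" by (rule Xe_cmult[OF wk])
    show "0 < (LBINT x. \<bar>t * w x\<bar> powr p)"
     using t Yw by (simp add: abs_mult powr_mult Y_def)
    have "(LBINT x. \<alpha> k x * \<bar>t * w x\<bar> powr Q k) = t powr Q k * ?W k"
    proof -
     have "\<alpha> k x * \<bar>t * w x\<bar> powr Q k = t powr Q k * (\<alpha> k x * \<bar>w x\<bar> powr Q k)" for x
      using t by (simp add: abs_mult powr_mult)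
     then show ?thesis by (simp only: integral_mult_right_zero)
    qed
    then show "E_frac (s k) p (\<lambda>x. t * w x) (\<lambda>x. t * w x) = (LBINT x. \<alpha> k x * \<bar>t * w x\<bar> powr Q k)"
     unfolding sc ne by simp
   qed
   also have "\<dots> = T k" unfolding sc Xk T_def by (simp add: t_def powr_def)
   finally show ?case .
  qed
 qed
qed

lemma bump_exists:
 obtains w K where "w \<in> Xe p \<Omega> (p / 2)" "\<And>x. \<bar>w x\<bar> \<le> K" "0 < Y w"
proof -
 have "\<Omega> \<noteq> {}"
 proof
  assume "\<Omega> = {}"
  then have "u 0 x = 0" for x using XeD(2)[OF uX[of 0]] by auto
  then show False using uY[of 0] by simp
 qed
 then obtain c r where r: "0 < r" "ball c r \<subseteq> \<Omega>" using \<Omega>(2) by (meson ex_in_conv open_contains_ball)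
 define w where "w x = max 0 (r - dist c x)" for x
 have lip: "\<bar>w x - w y\<bar> \<le> 1 * norm (x - y)" for x y
  using dist_triangle[of c x y] dist_triangle[of c y x] by (auto simp: w_def dist_norm max_def norm_minus_commute)
 have z: "w x = 0" if "x \<notin> \<Omega>" for x   proof -
  have "\<not> dist c x < r" using that r(2) by (auto simp: subset_iff)
  then show ?thesis by (simp add: w_def max_def)
 qed
 have wX: "w \<in> Xe p \<Omega> (p / 2)" using p by (intro lipschitz_in_Xe[OF p _ \<Omega> lip z]) auto
 obtain K where K: "\<And>x. \<bar>w x\<bar> \<le> K" using lipschitz_bounded[OF \<Omega>(1) lip z] by blast
 have "Y w \<noteq> 0"
 proof
  assume "Y w = 0"
  then have "AE x in lborel. \<bar>w x\<bar> powr p = 0"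
   unfolding Y_def using XeD(3)[OF wX] by (subst (asm) integral_nonneg_eq_0_iff_AE) auto
  then have "AE x in lborel. x \<notin> ball c r" by eventually_elim (auto simp: w_def max_def split: if_splits)
  then have "ball c r \<in> null_sets lborel" by (rule AE_iff_null_sets[THEN iffD2, rotated]) simp
  then have "emeasure lborel (ball c r) = 0" by auto
  then show False using r(1) by (simp add: emeasure_ball mult_le_0_iff not_le)
 qed
 moreover have "0 \<le> Y w" unfolding Y_def by (intro integral_nonneg_AE) auto
 ultimately show ?thesis using that[OF wX K] by linarith
qed

lemma powr_le_linear:
 fixes x lam :: real
 assumes "0 \<le> x" "0 \<le> lam" "lam \<le> 1" shows "x powr lam \<le> 1 + lam * (x - 1)"
proof (cases "x = 0")
 case False
 then show ?thesis using Youngs_inequality_0[of lam "1 - lam" x 1] assms by (simp add: algebra_simps)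
qed (use assms in simp)

text \<open>Interpolation between the exponents \<open>p\<close> and \<open>p + p * e k / N\<close>,
  where \<open>lam\<close> is fixed by \<open>p * e k / N * lam = Q k - p\<close>. The tangent bound
  \<open>x powr lam \<le> 1 + lam * (x - 1)\<close> makes the result affine in \<open>Z\<close>. The
  Sobolev bound on \<open>Z\<close> is affine as well, so the two can be composed without losing
  constants.\<close>

lemma nehari_sobolev:
 fixes \<tau> :: real
 assumes k: "s k * p < real DIM('a)" and \<tau>: "0 < \<tau>" "\<tau> < 1" and lam: "(Q k - p) * DIM('a) / (s k * p\<^sup>2) \<le> 1"
 defines "\<theta> \<equiv> (1 - \<tau>) powr p"
 defines "f \<equiv> (1 - s k * p / DIM('a)) * (unit_ball_vol (real DIM('a)) * \<tau> powr p) powr (s k * p / DIM('a))"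
 defines "lam \<equiv> (Q k - p) * DIM('a) / (s k * p\<^sup>2)"
 obtains Z where "0 \<le> Z" "\<theta> * (f * Z - 1) * Y (u k) \<le> s k * (p / (2 * sphere_area DIM('a))) * near p (e k) (u k) (u k)"
  "integrable lborel (\<lambda>x. \<bar>u k x\<bar> powr Q k)"
  "(LBINT x. \<bar>u k x\<bar> powr Q k) \<le> Y (u k) powr ((Q k - p) / p) * (Y (u k) * ((1 - lam) + lam * Z))"
proof -
 note [measurable] = XeD(1)[OF uX]
 let ?N = "real DIM('a)"
 let ?r = "p + p * e k / ?N"
 define y where "y = Y (u k)"
 have y: "0 < y" using uY[of k] by (simp add: y_def Y_def)
 define z where "z = (LBINT x. \<bar>u k x\<bar> powr ?r)"
 \<comment> \<open>The higher integral made scale invariant: \<open>Z\<close> does not change when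
   \<open>u k\<close> is multiplied by a nonzero constant.\<close>
 define Z where "Z = z * y powr - (e k / ?N) / y"
 have z0: "0 \<le> z" unfolding z_def by (intro integral_nonneg_AE) auto
 have Z0: "0 \<le> Z" using z0 y by (simp add: Z_def)
 have lam0: "0 \<le> lam" "lam \<le> 1" using lam Q(1)[of k] s(1)[of k] p by (auto simp: lam_def)
 note sob = near_sobolev[OF p e_pos[of k] k \<tau> uX[of k] uY[of k]]
 have "2 * \<theta> * (sphere_area DIM('a) / e k) * ((1 - e k / ?N) * (unit_ball_vol ?N * \<tau> powr p / y) powr (e k / ?N) * z - y) \<le> near p (e k) (u k) (u k)"
  using sob(2) by (simp only: \<theta>_def y_def z_def Y_def)
 moreover have "(1 - e k / ?N) * (unit_ball_vol ?N * \<tau> powr p / y) powr (e k / ?N) * z = f * Z * y"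
  using y \<tau> unfolding f_def Z_def by (simp add: powr_divide powr_minus field_simps)
 ultimately have 1: "2 * \<theta> * (sphere_area DIM('a) / e k) * (f * Z * y - y) \<le> near p (e k) (u k) (u k)" by simp
 have c0: "0 \<le> s k * (p / (2 * sphere_area DIM('a)))" using s(1)[of k] p S_pos by simp
 from mult_left_mono[OF 1 c0]
 have 2: "\<theta> * (f * Z - 1) * y \<le> s k * (p / (2 * sphere_area DIM('a))) * near p (e k) (u k) (u k)"
 proof -
  have "s k * (p / (2 * sphere_area DIM('a))) * (2 * \<theta> * (sphere_area DIM('a) / e k) * (f * Z * y - y)) = \<theta> * (f * Z * y - y)"
   using s(1)[of k] p S_pos by simp
  then show ?thesis using mult_left_mono[OF 1 c0] by (simp add: algebra_simps)
 qed
 have pt: "\<bar>u k x\<bar> powr Q k \<le> y powr ((Q k - p) / p) * ((1 - lam) * \<bar>u k x\<bar> powr p + lam * (y powr - (e k / ?N) * \<bar>u k x\<bar> powr ?r))" for x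
 proof -
  let ?t = "\<bar>u k x\<bar>"
  \<comment> \<open>Interpolating after division by the norm \<open>m\<close> leaves the factor
    \<open>y powr ((Q k - p) / p)\<close> in front, from which the lower bound on
    \<open>Y (u k)\<close> is later read off.\<close>
  define m where "m = y powr (1 / p)"
  have m: "0 < m" using y by (simp add: m_def)
  have pe: "p * e k / ?N * lam = Q k - p" using s(1)[of k] p by (simp add: lam_def power2_eq_square)
  have "?t powr (Q k - p) = m powr (Q k - p) * (?t / m) powr (Q k - p)" using m by (simp add: powr_divide)
  also have "(?t / m) powr (Q k - p) = ((?t / m) powr (p * e k / ?N)) powr lam" by (simp only: powr_powr pe)
  also have "\<dots> \<le> 1 + lam * ((?t / m) powr (p * e k / ?N) - 1)" by (rule powr_le_linear) (use lam0 in auto)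
  finally have "?t powr (Q k - p) \<le> m powr (Q k - p) * (1 + lam * ((?t / m) powr (p * e k / ?N) - 1))" by (simp add: mult_left_mono)
  then have "?t powr p * ?t powr (Q k - p) \<le> ?t powr p * (m powr (Q k - p) * (1 + lam * ((?t / m) powr (p * e k / ?N) - 1)))"
   by (rule mult_left_mono) simp
  moreover have "?t powr p * ?t powr (Q k - p) = ?t powr Q k" by (simp flip: powr_add)
  moreover have "m powr (Q k - p) = y powr ((Q k - p) / p)" by (simp add: m_def powr_powr)
  moreover have "(?t / m) powr (p * e k / ?N) = ?t powr (p * e k / ?N) * y powr - (e k / ?N)"
  proof -
   have "m powr (p * e k / ?N) = y powr (e k / ?N)" using p by (simp add: m_def powr_powr)
   then show ?thesis using m by (simp add: powr_divide powr_minus) (simp add: divide_inverse)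
  qed
  moreover have "?t powr ?r = ?t powr p * ?t powr (p * e k / ?N)" by (simp add: powr_add)
  ultimately show ?thesis by (simp only:) (simp add: algebra_simps)
 qed
 have i1: "integrable lborel (\<lambda>x. y powr ((Q k - p) / p) * ((1 - lam) * \<bar>u k x\<bar> powr p + lam * (y powr - (e k / ?N) * \<bar>u k x\<bar> powr ?r)))"
  using sob(1) XeD(3)[OF uX[of k]] by simp
 have 3: "integrable lborel (\<lambda>x. \<bar>u k x\<bar> powr Q k)"
 proof (rule Bochner_Integration.integrable_bound[OF i1])
  show "AE x in lborel. norm (\<bar>u k x\<bar> powr Q k) \<le> norm (y powr ((Q k - p) / p) * ((1 - lam) * \<bar>u k x\<bar> powr p + lam * (y powr - (e k / ?N) * \<bar>u k x\<bar> powr ?r)))"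
  proof (rule AE_I2)
   fix x
   show "norm (\<bar>u k x\<bar> powr Q k) \<le> norm (y powr ((Q k - p) / p) * ((1 - lam) * \<bar>u k x\<bar> powr p + lam * (y powr - (e k / ?N) * \<bar>u k x\<bar> powr ?r)))"
   proof -
    have "norm (\<bar>u k x\<bar> powr Q k) = \<bar>u k x\<bar> powr Q k" by simp
    also note pt[of x]
    also note abs_ge_self
    finally show ?thesis by (simp only: real_norm_def)
   qed
  qed
 qed measurable
 have "(LBINT x. \<bar>u k x\<bar> powr Q k) \<le> (LBINT x. y powr ((Q k - p) / p) * ((1 - lam) * \<bar>u k x\<bar> powr p + lam * (y powr - (e k / ?N) * \<bar>u k x\<bar> powr ?r)))"
  by (intro integral_mono 3 i1 pt)
 also have "\<dots> = y powr ((Q k - p) / p) * ((1 - lam) * y + lam * (y powr - (e k / ?N) * z))"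
  using sob(1) XeD(3)[OF uX[of k]] by (simp add: y_def Y_def z_def)
 also have "(1 - lam) * y + lam * (y powr - (e k / ?N) * z) = y * ((1 - lam) + lam * Z)"
  using y by (simp add: Z_def field_simps)
 finally have 4: "(LBINT x. \<bar>u k x\<bar> powr Q k) \<le> y powr ((Q k - p) / p) * (y * ((1 - lam) + lam * Z))" .
 show ?thesis using that[OF Z0] 2 3 4 by (simp add: y_def)
qed

lemma nehari_upper:
 assumes i: "integrable lborel (\<lambda>x. \<bar>u k x\<bar> powr Q k)"
 shows "E_frac (s k) p (u k) (u k) \<le> (1 + M * s k) * (LBINT x. \<bar>u k x\<bar> powr Q k)"
proof -
 note [measurable] = XeD(1)[OF uX]
 have "E_frac (s k) p (u k) (u k) = (LBINT x. \<alpha> k x * \<bar>u k x\<bar> powr Q k)"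
  unfolding powr_Q_eq using weak[OF uX[of k]] .
 also have "\<dots> \<le> (LBINT x. (1 + M * s k) * \<bar>u k x\<bar> powr Q k)"
 proof (rule integral_mono_AE')
  show "integrable lborel (\<lambda>x. (1 + M * s k) * \<bar>u k x\<bar> powr Q k)" using i by simp
  show "AE x in lborel. \<alpha> k x * \<bar>u k x\<bar> powr Q k \<le> (1 + M * s k) * \<bar>u k x\<bar> powr Q k"
   using \<alpha>
  proof eventually_elim
   case (elim x)
   show ?case
   proof (cases "x \<in> \<Omega>")
    case True
    then have "\<alpha> k x \<le> 1 + M * s k" using elim by (auto dest: spec[of _ k])
    then show ?thesis by (intro mult_right_mono) auto
   qed (use XeD(2)[OF uX[of k]] in simp)
  qed
  show "AE x in lborel. 0 \<le> (1 + M * s k) * \<bar>u k x\<bar> powr Q k"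
   using M s(1)[of k] by (intro AE_I2 mult_nonneg_nonneg) auto
 qed
 finally show ?thesis by simp
qed

text \<open>Everything is measured relative to \<open>y = Y (u k)\<close>. The Sobolev inequality
  bounds \<open>Z\<close> by an affine function of the ratio \<open>X\<close> of the form to
  \<open>y\<close>, and the Nehari identity bounds \<open>X\<close> by an affine function of
  \<open>Z\<close>. Composed they give \<open>X \<le> (1 + \<epsilon>) * Tq * (1 - l + l * X * (1 +
  \<epsilon>) + \<epsilon>)\<close> with \<open>\<epsilon>\<close> of order \<open>s k\<close> and
  \<open>l\<close> bounded away from \<open>1\<close>. Then \<open>ratio_bound\<close> yields a
  lower bound on \<open>Tq\<close>, a power of \<open>y\<close> with exponent of order
  \<open>s k\<close>, and \<open>X - 1 = O(s k)\<close>.\<close>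

lemma a_priori:
 obtains C c where "0 < c" "0 < C" "eventually (\<lambda>k. near p (e k) (u k) (u k) \<le> C \<and> c \<le> Y (u k) \<and> Y (u k) \<le> C
   \<and> \<bar>E_frac (s k) p (u k) (u k) - Y (u k)\<bar> \<le> C * s k) sequentially"
proof -
 let ?N = "real DIM('a)" and ?S = "sphere_area DIM('a)"
 obtain w K where w: "w \<in> Xe p \<Omega> (p / 2)" "\<And>x. \<bar>w x\<bar> \<le> K" "0 < Y w" using bump_exists by blast
 obtain T where T: "T \<longlonglongrightarrow> Y w * exp (p * (E0 w w - LT w w) / (\<mu> * Y w))"
  "eventually (\<lambda>k. E_frac (s k) p (u k) (u k) \<le> T k) sequentially"
  using energy_upper_bound[OF w] by blast
 define C1 where "C1 = \<bar>Y w * exp (p * (E0 w w - LT w w) / (\<mu> * Y w))\<bar> + 1"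
 have C1: "1 \<le> C1" by (simp add: C1_def)
 have "eventually (\<lambda>k. T k < C1) sequentially" by (rule order_tendstoD(2)[OF T(1)]) (simp add: C1_def)
 with T(2) have x_le: "eventually (\<lambda>k. E_frac (s k) p (u k) (u k) \<le> C1) sequentially" by eventually_elim simp
 \<comment> \<open>The limit of the interpolation weight; \<open>\<mu> < p\<^sup>2 / N\<close> says
   that it is below \<open>1\<close>.\<close>
 define lam0 where "lam0 = \<mu> * ?N / p\<^sup>2"
 have lam0: "0 < lam0" "lam0 < 1" using \<mu> p by (auto simp: lam0_def field_simps)
 \<comment> \<open>Halfway between \<open>lam0\<close> and \<open>1\<close>, so that
   \<open>lam0 / \<theta> < 1\<close> still holds when \<open>\<theta> = (1 - \<tau>) powr p\<close>
   is the factor lost in the Sobolev inequality.\<close>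
 define \<theta> where "\<theta> = (1 + lam0) / 2"
 have \<theta>: "0 < \<theta>" "\<theta> < 1" "lam0 < \<theta>" using lam0 by (auto simp: \<theta>_def)
 define \<tau> where "\<tau> = 1 - \<theta> powr (1 / p)"
 have "\<theta> powr (1 / p) < 1 powr (1 / p)" using \<theta> p by (intro powr_less_mono2) auto
 then have \<tau>: "0 < \<tau>" "\<tau> < 1" "(1 - \<tau>) powr p = \<theta>" using \<theta> p by (auto simp: \<tau>_def powr_powr)
 define l where "l k = (Q k - p) * ?N / (s k * p\<^sup>2) / \<theta>" for k
 define \<eta> where "\<eta> = (1 - lam0 / \<theta>) / 2"
 have "0 < lam0 / \<theta>" "lam0 / \<theta> < 1" using \<theta> lam0 by auto
 then have \<eta>: "0 < \<eta>" "\<eta> < 1" by (auto simp: \<eta>_def)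
 have "(\<lambda>k. (Q k - p) / s k * (?N / p\<^sup>2 / \<theta>)) \<longlonglongrightarrow> \<mu> * (?N / p\<^sup>2 / \<theta>)" by (intro tendsto_mult Q tendsto_const)
 moreover have "(\<lambda>k. (Q k - p) / s k * (?N / p\<^sup>2 / \<theta>)) = l" by (simp add: l_def fun_eq_iff)
 ultimately have "l \<longlonglongrightarrow> lam0 / \<theta>" by (simp add: lam0_def)
 moreover have "lam0 / \<theta> < 1 - \<eta>" using \<theta> lam0 by (simp add: \<eta>_def field_simps)
 ultimately have l_lt: "eventually (\<lambda>k. l k < 1 - \<eta>) sequentially" by (rule order_tendstoD(2))
 have l0: "0 \<le> l k" for k using Q(1)[of k] s(1)[of k] \<theta> by (simp add: l_def)
 define W where "W = unit_ball_vol ?N * \<tau> powr p"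
 have W0: "0 < W" using \<tau> by (simp add: W_def)
 define f where "f t = (1 - t * p / ?N) * W powr (t * p / ?N)" for t
 have "(f has_real_derivative (- (p / ?N)) * W powr (0 * p / ?N) + (1 - 0 * p / ?N) * (W powr (0 * p / ?N) * (p / ?N * ln W))) (at 0)"
  unfolding f_def using W0 by (auto intro!: derivative_eq_intros simp: field_simps)
 then obtain Df where Df: "(f has_real_derivative Df) (at 0)" by blast
 define C3 where "C3 = \<bar>Df\<bar> + 1"
 have f_bd: "eventually (\<lambda>k. \<bar>f (s k) - 1\<bar> \<le> C3 * s k) sequentially"
  using lin_bound_of_derivative(2)[OF Df s(3,1)] W0 by (simp add: C3_def f_def)
 define C\<kappa> where "C\<kappa> = \<bar>rho DIM('a) p\<bar> + 1"
 define CB where "CB = (2 powr p + 1) * (2 * measure lborel \<Omega> * 2)"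
 define C2 where "C2 = p / (2 * ?S) * CB"
 have C0: "1 \<le> C3" "1 \<le> C\<kappa>" "0 \<le> CB" "0 \<le> C2" using p S_pos by (auto simp: C3_def C\<kappa>_def CB_def C2_def)
 define CY where "CY = 2 * C1"
 \<comment> \<open>One constant for all first order errors. The summand with \<open>ln CY\<close>
   bounds the growth of \<open>CY powr ((Q k - p) / p)\<close> beyond \<open>1\<close>, which enters
   the upper bound for \<open>Tq\<close>.\<close>
 define C4 where "C4 = M + 2 * C3 + 2 * C\<kappa> + 2 * C2 + 1 + 4 * \<mu> * ln CY / p"
 have lnCY: "0 \<le> ln CY" using C1 by (simp add: CY_def)
 then have cp: "0 \<le> 4 * \<mu> * ln CY / p" using \<mu> p by simp
 have C4: "M \<le> C4" "2 * C3 + 2 * C\<kappa> + 1 \<le> C4" "2 * C2 \<le> C4" "C\<kappa> + C2 \<le> C4" "4 * \<mu> * ln CY / p \<le> C4" "1 \<le> C4"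
  using M C0 cp unfolding C4_def by linarith+
 \<comment> \<open>\<open>Tq \<ge> 1 - 4 * \<epsilon>\<close> implies
   \<open>(Q k - p) / p * ln y \<ge> - 8 * \<epsilon>\<close>. With
   \<open>\<epsilon> = C4 * s k\<close> and \<open>Q k - p \<ge> \<mu> / 2 * s k\<close> the factor
   \<open>s k\<close> cancels and leaves this exponent as a lower bound for
   \<open>ln y\<close>.\<close>
 define c where "c = exp (- (16 * C4 * p / \<mu>))"
 define C5 where "C5 = (28 / \<eta> + 1) * C4 * CY"
 define C6 where "C6 = (C5 + 2 * C\<kappa> * C1 + C2 * CY) * (2 * ?S / p)"
 \<comment> \<open>The thresholds ensure, in this order,
   \<open>14 * \<epsilon> \<le> \<eta>\<close>, \<open>\<epsilon> \<le> 1/8\<close>, that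
   \<open>f\<close> and \<open>kappa\<close> stay within \<open>1/8\<close> of \<open>1\<close>, and
   \<open>s k * p < N\<close>.\<close>
 define s0 where "s0 = Min {\<eta> / (14 * C4), 1 / (8 * C4), 1 / (8 * C3 * C\<kappa>), ?N / p}"
 have "0 < s0" using \<eta> C4 C0 p unfolding s0_def by (subst Min_gr_iff) auto
 then have s_lt: "eventually (\<lambda>k. s k < s0) sequentially" using s(3) by (intro order_tendstoD)
 define C where "C = C6 + C5 + CY"
 have C50: "0 \<le> C5" "0 < CY" "0 \<le> C6"
  using \<eta> C4 C1 C0 S_pos p by (auto simp: C5_def CY_def C6_def intro!: mult_nonneg_nonneg add_nonneg_nonneg)
 show ?thesis
 proof (rule that[of c C])
  show "0 < c" "0 < C" using C50 by (auto simp: c_def C_def)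
  show "eventually (\<lambda>k. near p (e k) (u k) (u k) \<le> C \<and> c \<le> Y (u k) \<and> Y (u k) \<le> C
    \<and> \<bar>E_frac (s k) p (u k) (u k) - Y (u k)\<bar> \<le> C * s k) sequentially"
   using x_le l_lt f_bd kappa_bound s_lt Q_bounds
  proof eventually_elim
   case (elim k)
   define x where "x = E_frac (s k) p (u k) (u k)"
   define y where "y = Y (u k)"
   define A where "A = near p (e k) (u k) (u k)"
   define B where "B = far p (e k) (u k) (u k)"
   define \<kappa> where "\<kappa> = kappa DIM('a) p (s k)"
   define \<epsilon> where "\<epsilon> = C4 * s k"
   note sk = s(1)[of k]
   have y: "0 < y" using uY[of k] by (simp add: y_def Y_def)
   have A0: "0 \<le> A" unfolding A_def by (rule near_self_nonneg)
   have small: "s k < \<eta> / (14 * C4)" "s k < 1 / (8 * C4)" "s k < 1 / (8 * C3 * C\<kappa>)" "s k < ?N / p"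
    using elim(5) unfolding s0_def by (subst (asm) Min_gr_iff; auto)+
   have \<epsilon>0: "0 \<le> \<epsilon>" using sk C4 by (simp add: \<epsilon>_def)
   have \<epsilon>: "\<epsilon> \<le> 1/8" "14 * \<epsilon> \<le> \<eta>" using small C4 by (auto simp: \<epsilon>_def field_simps)
   have c3: "8 * (C3 * C\<kappa> * s k) \<le> 1" using small(3) C0 by (simp add: field_simps mult_pos_pos)
   have c3': "8 * (C3 * s k) \<le> 1" "8 * (C\<kappa> * s k) \<le> 1"
   proof -
    have "C3 * s k * 1 \<le> C3 * s k * C\<kappa>" "C\<kappa> * s k * 1 \<le> C\<kappa> * s k * C3" using C0 sk by (intro mult_left_mono; simp)+
    then show "8 * (C3 * s k) \<le> 1" "8 * (C\<kappa> * s k) \<le> 1" using c3 by (simp_all add: mult_ac)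
   qed
   have \<kappa>: "\<bar>\<kappa> - 1\<bar> \<le> C\<kappa> * s k" using elim(4) by (simp add: \<kappa>_def C\<kappa>_def)
   have \<kappa>': "1/2 \<le> \<kappa>" using \<kappa> c3'(2) by linarith
   define a where "a = s k * (p / (2 * ?S)) * A"
   define bB where "bB = s k * (p / (2 * ?S)) * B"
   have a0: "0 \<le> a" using A0 sk p S_pos by (simp add: a_def)
   have Bb: "\<bar>B\<bar> \<le> CB * y"
    using far_integrable(2)[OF p less_imp_le[OF e_pos] \<Omega> uX[of k] uX[of k], of k] XeD(3)[OF uX[of k]]
    by (simp add: B_def CB_def y_def Y_def)
   have bb: "\<bar>bB\<bar> \<le> C2 * s k * y"
   proof -
    have "\<bar>bB\<bar> = s k * (p / (2 * ?S)) * \<bar>B\<bar>" using sk p S_pos by (simp add: bB_def abs_mult)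
    also have "\<dots> \<le> s k * (p / (2 * ?S)) * (CB * y)" using sk p S_pos Bb by (intro mult_left_mono) auto
    finally show ?thesis by (simp add: C2_def mult_ac)
   qed
   have x: "x = \<kappa> * (y + a + bB)"
    using E_frac_expansion[OF uX[of k] uX[of k]]
    by (simp add: x_def \<kappa>_def y_def Y_def a_def bB_def A_def B_def h_mult_self distrib_left)
   have lam1: "(Q k - p) * ?N / (s k * p\<^sup>2) \<le> 1"
   proof -
    have "(Q k - p) * ?N / (s k * p\<^sup>2) = \<theta> * l k" using \<theta> by (simp add: l_def)
    also have "\<dots> \<le> 1 * 1" using \<theta> elim(2) \<eta> l0[of k] by (intro mult_mono) auto
    finally show ?thesis by simp
   qed
   have eN: "s k * p < ?N" using small(4) p by (simp add: field_simps)
   obtain Z where Z: "0 \<le> Z" "\<theta> * (f (s k) * Z - 1) * y \<le> a" "integrable lborel (\<lambda>x. \<bar>u k x\<bar> powr Q k)"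
    "(LBINT x. \<bar>u k x\<bar> powr Q k) \<le> y powr ((Q k - p) / p) * (y * ((1 - \<theta> * l k) + \<theta> * l k * Z))"
    using nehari_sobolev[OF eN \<tau>(1,2) lam1] \<theta>
    unfolding \<tau>(3) y_def[symmetric] W_def[symmetric] A_def[symmetric] a_def[symmetric] f_def[symmetric]
    by (auto simp: l_def)
   define X where "X = x / y"
   define Tq where "Tq = y powr ((Q k - p) / p)"
   have xy: "x = X * y" using y by (simp add: X_def)
   have Xlow: "1 - \<epsilon> \<le> X"
   proof -
    have "(1 - C2 * s k) * y \<le> y + a + bB" using a0 bb by (simp add: algebra_simps)
    moreover have "C2 * s k \<le> 1"
    proof -
     have "C2 * s k \<le> C4 * s k" using C4 C0 sk by (intro mult_right_mono) auto
     then show ?thesis using \<epsilon> by (simp add: \<epsilon>_def)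
    qed
    ultimately have "\<kappa> * ((1 - C2 * s k) * y) \<le> x" unfolding x using \<kappa>' by (intro mult_left_mono) auto
    moreover have "(1 - C\<kappa> * s k) * ((1 - C2 * s k) * y) \<le> \<kappa> * ((1 - C2 * s k) * y)"
     using \<kappa> y \<open>C2 * s k \<le> 1\<close> by (intro mult_right_mono) auto
    moreover have "(1 - \<epsilon>) * y \<le> (1 - C\<kappa> * s k) * ((1 - C2 * s k) * y)"
    proof -
     have "1 - \<epsilon> \<le> 1 - (C\<kappa> + C2) * s k" using C4 sk by (simp add: \<epsilon>_def mult_right_mono)
     also have "\<dots> \<le> (1 - C\<kappa> * s k) * (1 - C2 * s k)" using C0 sk by (simp add: algebra_simps)
     finally show ?thesis using y by (simp add: mult.assoc[symmetric] mult_right_mono)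
    qed
    ultimately have "(1 - \<epsilon>) * y \<le> X * y" using xy by linarith
    then show ?thesis using y by (simp add: mult_le_cancel_right)
   qed
   have X0: "0 \<le> X" using Xlow \<epsilon> by linarith
   \<comment> \<open>An upper bound for \<open>\<theta> * (f (s k) * Z)\<close> that is affine in
     \<open>X\<close>, obtained by solving the expansion of the form for its near part and inserting
     this into the Sobolev inequality.\<close>
   define q where "q = X / \<kappa> - 1 + \<theta> + C2 * s k"
   have fz: "\<theta> * (f (s k) * Z) \<le> q"
   proof -
    have "a = x / \<kappa> - y - bB" using x \<kappa>' by (simp add: field_simps)
    also have "\<dots> \<le> (X / \<kappa> - 1 + C2 * s k) * y" using bb y xy by (simp add: algebra_simps abs_le_iff)
    finally have "\<theta> * (f (s k) * Z - 1) * y \<le> (X / \<kappa> - 1 + C2 * s k) * y" using Z(2) by linarith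
    then have "\<theta> * (f (s k) * Z - 1) \<le> X / \<kappa> - 1 + C2 * s k" using y by (simp only: mult_le_cancel_right_pos)
    then show ?thesis by (simp add: q_def algebra_simps)
   qed
   have f1: "\<bar>f (s k) - 1\<bar> \<le> C3 * s k" by (rule elim(3))
   have f2: "1/2 \<le> f (s k)" using f1 c3'(1) by linarith
   have q0: "0 \<le> q"
   proof -
    have "0 \<le> \<theta> * (f (s k) * Z)" using \<theta> f2 Z by (intro mult_nonneg_nonneg) auto
    then show ?thesis using fz by linarith
   qed
   have inv: "1 / t \<le> 1 + 2 * d" if "\<bar>t - 1\<bar> \<le> d" "1/2 \<le> t" "d \<le> 1/2" for t d :: real
   proof -
    have "1 \<le> (1 + 2 * d) * (1 - d)"
    proof -
     have "0 \<le> d * (1 - 2 * d)" using that by (intro mult_nonneg_nonneg) auto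
     then show ?thesis by (simp add: algebra_simps)
    qed
    also have "\<dots> \<le> (1 + 2 * d) * t" using that by (intro mult_left_mono) auto
    finally show ?thesis using that by (simp add: divide_le_eq)
   qed
   have tZ: "\<theta> * Z \<le> q * (1 + 2 * (C3 * s k))"
   proof -
    have "\<theta> * Z \<le> q * (1 / f (s k))" using fz f2 by (simp add: field_simps)
    also have "\<dots> \<le> q * (1 + 2 * (C3 * s k))"
     using q0 inv[OF f1 f2] c3'(1) by (intro mult_left_mono) auto
    finally show ?thesis .
   qed
   have qX: "q \<le> X * (1 + 2 * (C\<kappa> * s k)) - 1 + \<theta> + C2 * s k"
   proof -
    have "X * (1 / \<kappa>) \<le> X * (1 + 2 * (C\<kappa> * s k))"
     using X0 inv[OF \<kappa> \<kappa>'] c3'(2) by (intro mult_left_mono) auto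
    then show ?thesis by (simp add: q_def)
   qed
   have l1: "l k \<le> 1" using elim(2) \<eta> by linarith
   \<comment> \<open>Up to errors of order \<open>s k\<close> one has
     \<open>\<theta> * Z \<le> X - 1 + \<theta>\<close>, hence \<open>1 - \<theta> * l k + l k *
     (\<theta> * Z) \<le> 1 - l k + l k * X\<close>. The loss \<open>\<theta>\<close> cancels and
     survives only in the definition of \<open>l\<close>.\<close>
   have br: "(1 - \<theta> * l k) + \<theta> * l k * Z \<le> 1 - l k + l k * X * (1 + \<epsilon>) + \<epsilon>"
   proof -
    let ?u = "C3 * s k" and ?v = "C\<kappa> * s k" and ?w = "C2 * s k"
    have uvw: "0 \<le> ?u" "0 \<le> ?v" "0 \<le> ?w" using C0 sk by auto
    have "\<theta> * l k * Z = l k * (\<theta> * Z)" by simp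
    also have "\<dots> \<le> l k * ((X * (1 + 2 * ?v) - 1 + \<theta> + ?w) * (1 + 2 * ?u))"
    proof (intro mult_left_mono l0)
     have "q * (1 + 2 * ?u) \<le> (X * (1 + 2 * ?v) - 1 + \<theta> + ?w) * (1 + 2 * ?u)"
      using qX uvw by (intro mult_right_mono) auto
     then show "\<theta> * Z \<le> (X * (1 + 2 * ?v) - 1 + \<theta> + ?w) * (1 + 2 * ?u)" using tZ by linarith
    qed
    also have "\<dots> = l k * X * ((1 + 2 * ?v) * (1 + 2 * ?u)) - l k + \<theta> * l k + l k * (?w * (1 + 2 * ?u)) - l k * ((1 - \<theta>) * (2 * ?u))"
     by (simp add: algebra_simps)
    also have "\<dots> \<le> l k * X * (1 + \<epsilon>) - l k + \<theta> * l k + \<epsilon>"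
    proof -
     have "(1 + 2 * ?v) * (1 + 2 * ?u) \<le> 1 + \<epsilon>"
     proof -
      have "4 * (?v * ?u) \<le> s k"
      proof -
       have "4 * (?v * ?u) = s k * (4 * (C3 * C\<kappa> * s k))" by simp
       also have "\<dots> \<le> s k * 1" using c3 sk by (intro mult_left_mono) auto
       finally show ?thesis by simp
      qed
      moreover have "(2 * C3 + 2 * C\<kappa> + 1) * s k \<le> \<epsilon>" unfolding \<epsilon>_def using C4 sk by (intro mult_right_mono) auto
      ultimately show ?thesis by (simp add: algebra_simps)
     qed
     then have 1: "l k * X * ((1 + 2 * ?v) * (1 + 2 * ?u)) \<le> l k * X * (1 + \<epsilon>)"
      using l0[of k] X0 by (intro mult_left_mono) auto
     have "l k * (?w * (1 + 2 * ?u)) \<le> 1 * (?w * 2)"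
      using l0[of k] l1 uvw c3'(1) C0 sk by (intro mult_mono) auto
     also have "\<dots> \<le> \<epsilon>" using C4(3) sk by (simp add: \<epsilon>_def mult_right_mono mult_ac)
     finally have 2: "l k * (?w * (1 + 2 * ?u)) \<le> \<epsilon>" .
     have "0 \<le> l k * ((1 - \<theta>) * (2 * ?u))" using l0[of k] \<theta> uvw C0 sk by (intro mult_nonneg_nonneg) auto
     then show ?thesis using 1 2 by linarith
    qed
    finally show ?thesis by simp
   qed
   have Tq0: "0 \<le> Tq" by (simp add: Tq_def)
   have br0: "0 \<le> 1 - l k + l k * X * (1 + \<epsilon>) + \<epsilon>"
    using l0[of k] l1 X0 \<epsilon>0 by (intro add_nonneg_nonneg mult_nonneg_nonneg) auto
   have Xup: "X \<le> (1 + \<epsilon>) * Tq * (1 - l k + l k * X * (1 + \<epsilon>) + \<epsilon>)"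
   proof -
    have "x \<le> (1 + M * s k) * (LBINT x. \<bar>u k x\<bar> powr Q k)" unfolding x_def by (rule nehari_upper[OF Z(3)])
    also have "\<dots> \<le> (1 + M * s k) * (Tq * (y * ((1 - \<theta> * l k) + \<theta> * l k * Z)))"
     using Z(4) M sk by (intro mult_left_mono) (auto simp: Tq_def)
    also have "\<dots> \<le> (1 + M * s k) * (Tq * (y * (1 - l k + l k * X * (1 + \<epsilon>) + \<epsilon>)))"
     using br y Tq0 M sk by (intro mult_left_mono) auto
    also have "\<dots> \<le> (1 + \<epsilon>) * (Tq * (y * (1 - l k + l k * X * (1 + \<epsilon>) + \<epsilon>)))"
     using br0 y Tq0 C4(1) sk by (intro mult_right_mono) (auto simp: \<epsilon>_def mult_right_mono)
    finally have "X * y \<le> ((1 + \<epsilon>) * Tq * (1 - l k + l k * X * (1 + \<epsilon>) + \<epsilon>)) * y" using xy by (simp add: mult_ac)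
    then show ?thesis using y by (simp only: mult_le_cancel_right_pos)
   qed
   note rb = ratio_bound[OF \<epsilon>0 \<epsilon>(1) l0[of k] less_imp_le[OF elim(2)] \<eta>(1) \<epsilon>(2) Xlow Xup Tq0]
   have d: "0 < Q k - p" "\<mu> / 2 * s k \<le> Q k - p" "Q k - p \<le> 2 * \<mu> * s k" using Q(1)[of k] elim(6) by auto
   have c_le: "c \<le> y"
   proof -
    have "- (8 * \<epsilon>) \<le> - (4 * \<epsilon>) - 2 * (4 * \<epsilon>)\<^sup>2"
    proof -
     have "\<epsilon> * \<epsilon> \<le> \<epsilon> * (1/8)" using \<epsilon>0 \<epsilon> by (intro mult_left_mono) auto
     then show ?thesis by (simp add: power2_eq_square)
    qed
    also have "\<dots> \<le> ln (1 - 4 * \<epsilon>)" using \<epsilon>0 \<epsilon> by (intro ln_one_minus_pos_lower_bound) auto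
    also have "\<dots> \<le> ln Tq" using rb(1) \<epsilon> y by (subst ln_le_cancel_iff) (auto simp: Tq_def)
    also have "\<dots> = (Q k - p) / p * ln y" using y by (simp add: Tq_def ln_powr)
    finally have 1: "- (8 * \<epsilon>) * p \<le> (Q k - p) * ln y" using p by (simp add: field_simps)
    have "- (16 * C4 * p / \<mu>) \<le> ln y"
    proof (cases "0 \<le> ln y")
     case True
     moreover have "0 \<le> 16 * C4 * p / \<mu>" using C4(6) p \<mu> by simp
     ultimately show ?thesis by linarith
    next
     case False
     then have "(Q k - p) * ln y \<le> \<mu> / 2 * s k * ln y" using d by (intro mult_right_mono_neg) auto
     then have "- (8 * (C4 * s k)) * p \<le> \<mu> / 2 * s k * ln y" using 1 by (simp add: \<epsilon>_def)
     then have "s k * (- (8 * C4 * p)) \<le> s k * (\<mu> / 2 * ln y)" by (simp add: mult_ac)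
     then have "- (8 * C4 * p) \<le> \<mu> / 2 * ln y" using sk by (simp only: mult_le_cancel_left_pos)
     then show ?thesis using \<mu> by (simp add: field_simps)
    qed
    then have "exp (- (16 * C4 * p / \<mu>)) \<le> exp (ln y)" by (simp only: exp_le_cancel_iff)
    then show ?thesis using y by (simp add: c_def)
   qed
   have yCY: "y \<le> CY"
   proof -
    have "(1/2) * y \<le> X * y" using Xlow \<epsilon> y by (intro mult_right_mono) auto
    then show ?thesis using elim(1) xy by (simp add: CY_def x_def)
   qed
   have Tq1: "Tq \<le> 1 + \<epsilon>"
   proof -
    have "Tq \<le> CY powr ((Q k - p) / p)" unfolding Tq_def using yCY y d p by (intro powr_mono2) auto
    also have "\<dots> = exp ((Q k - p) / p * ln CY)" using C1 by (simp add: powr_def CY_def)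
    also have "\<dots> \<le> exp (2 * \<mu> * s k / p * ln CY)"
     using d lnCY p by (simp add: mult_right_mono divide_right_mono)
    also have "\<dots> \<le> 1 + 2 * (2 * \<mu> * s k / p * ln CY)"
    proof (rule real_exp_bound_lemma)
     show "0 \<le> 2 * \<mu> * s k / p * ln CY" using \<mu> sk p lnCY by simp
     have "2 * (2 * \<mu> * s k / p * ln CY) = 4 * \<mu> * ln CY / p * s k" by simp
     also have "\<dots> \<le> C4 * s k" using C4(5) sk by (intro mult_right_mono) auto
     finally show "2 * \<mu> * s k / p * ln CY \<le> 1/2" using \<epsilon> by (simp add: \<epsilon>_def)
    qed
    also have "2 * (2 * \<mu> * s k / p * ln CY) = 4 * \<mu> * ln CY / p * s k" by simp
    also have "1 + \<dots> \<le> 1 + C4 * s k" using C4(5) sk by (intro add_left_mono mult_right_mono) auto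
    finally show ?thesis by (simp add: \<epsilon>_def)
   qed
   have X1: "X - 1 \<le> 28 * \<epsilon> / \<eta>" by (rule rb(2)[OF Tq1])
   have xy_abs: "\<bar>x - y\<bar> \<le> C5 * s k"
   proof -
    have "x - y = (X - 1) * y" using xy by (simp add: left_diff_distrib)
    moreover have "(X - 1) * y \<le> 28 * \<epsilon> / \<eta> * y" using X1 y by (intro mult_right_mono) auto
    moreover have "28 * \<epsilon> / \<eta> * y \<le> 28 * \<epsilon> / \<eta> * CY" using yCY \<epsilon>0 \<eta> by (intro mult_left_mono) auto
    moreover have "- \<epsilon> * y \<le> (X - 1) * y" using Xlow y by (intro mult_right_mono) auto
    moreover have "\<epsilon> * y \<le> \<epsilon> * CY" using yCY \<epsilon>0 by (intro mult_left_mono) auto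
    moreover have "C5 * s k = 28 * \<epsilon> / \<eta> * CY + \<epsilon> * CY" by (simp add: C5_def \<epsilon>_def algebra_simps)
    moreover have "0 \<le> 28 * \<epsilon> / \<eta> * CY" "0 \<le> \<epsilon> * CY" using \<epsilon>0 \<eta> C50 by auto
    ultimately show ?thesis by (simp add: abs_le_iff)
   qed
   have A_le: "A \<le> C6"
   proof -
    have x0: "0 \<le> x" using xy X0 y by simp
    have "x / \<kappa> \<le> x + 2 * C\<kappa> * C1 * s k"
    proof -
     have "x * (1 / \<kappa>) \<le> x * (1 + 2 * (C\<kappa> * s k))"
      using x0 inv[OF \<kappa> \<kappa>'] c3'(2) by (intro mult_left_mono) auto
     moreover have "x * (2 * (C\<kappa> * s k)) \<le> C1 * (2 * (C\<kappa> * s k))"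
      using elim(1) C0 sk by (intro mult_right_mono) (auto simp: x_def)
     ultimately show ?thesis by (simp add: algebra_simps)
    qed
    moreover have "a = x / \<kappa> - y - bB" using x \<kappa>' by (simp add: field_simps)
    moreover have "C2 * s k * y \<le> C2 * s k * CY" using yCY C0 sk by (intro mult_left_mono) auto
    ultimately have "a \<le> C5 * s k + 2 * C\<kappa> * C1 * s k + C2 * s k * CY" using xy_abs bb by linarith
    then have "s k * (p / (2 * ?S) * A) \<le> s k * (C5 + 2 * C\<kappa> * C1 + C2 * CY)" by (simp add: a_def algebra_simps)
    then have "p / (2 * ?S) * A \<le> C5 + 2 * C\<kappa> * C1 + C2 * CY" using sk by (simp only: mult_le_cancel_left_pos)
    then have "(2 * ?S / p) * (p / (2 * ?S) * A) \<le> (2 * ?S / p) * (C5 + 2 * C\<kappa> * C1 + C2 * CY)"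
     using p S_pos by (intro mult_left_mono) auto
    then show ?thesis using p S_pos by (simp add: C6_def mult.commute)
   qed
   have "C5 * s k \<le> C * s k" using C50 sk by (intro mult_right_mono) (auto simp: C_def)
   then show ?case using A_le c_le yCY xy_abs C50 unfolding A_def y_def x_def C_def by linarith
  qed
 qed
qed

end

section \<open>Passage to the limit\<close>

lemma Fatou_integral:
 fixes f :: "nat \<Rightarrow> 'a \<Rightarrow> real"
 assumes f: "\<And>k. integrable N (f k)" "\<And>k x. 0 \<le> f k x" and g[measurable]: "g \<in> borel_measurable N"
  and c: "AE x in N. (\<lambda>k. f k x) \<longlonglongrightarrow> g x" and C: "eventually (\<lambda>k. integral\<^sup>L N (f k) \<le> C) sequentially"
 shows "integrable N g" "integral\<^sup>L N g \<le> C"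
proof -
 have [measurable]: "f k \<in> borel_measurable N" for k using f(1) by (rule borel_measurable_integrable)
 obtain k0 where k0: "integral\<^sup>L N (f k0) \<le> C" using C by (auto simp: eventually_sequentially)
 have "0 \<le> integral\<^sup>L N (f k0)" using f(2) by (intro integral_nonneg_AE) auto
 with k0 have C0: "0 \<le> C" by linarith
 have g0: "AE x in N. 0 \<le> g x" using c by eventually_elim (rule LIMSEQ_le_const, auto simp: f(2))
 have "(\<integral>\<^sup>+x. ennreal (g x) \<partial>N) = (\<integral>\<^sup>+x. liminf (\<lambda>k. ennreal (f k x)) \<partial>N)"
 proof (rule nn_integral_cong_AE)
  show "AE x in N. ennreal (g x) = liminf (\<lambda>k. ennreal (f k x))"
   using c
  proof eventually_elim
   case (elim x)
   then have "(\<lambda>k. ennreal (f k x)) \<longlonglongrightarrow> ennreal (g x)" by (rule tendsto_ennrealI)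
   then show ?case by (rule lim_imp_Liminf[symmetric, rotated]) simp
  qed
 qed
 also have "\<dots> \<le> liminf (\<lambda>k. \<integral>\<^sup>+x. ennreal (f k x) \<partial>N)" by (rule nn_integral_liminf) measurable
 also have "\<dots> = liminf (\<lambda>k. ennreal (integral\<^sup>L N (f k)))"
  using f by (simp add: nn_integral_eq_integral)
 also have "\<dots> \<le> liminf (\<lambda>k. ennreal C)"
  by (rule Liminf_mono) (use C in \<open>eventually_elim, auto intro: ennreal_leI\<close>)
 also have "\<dots> = ennreal C" by (simp add: Liminf_const)
 finally have le: "(\<integral>\<^sup>+x. ennreal (g x) \<partial>N) \<le> ennreal C" .
 then show "integrable N g" by (intro integrableI_nonneg g g0) (auto simp: le_less_trans)
 then have "ennreal (integral\<^sup>L N g) \<le> ennreal C" using le g0 by (simp add: nn_integral_eq_integral)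
 then show "integral\<^sup>L N g \<le> C" using C0 by simp
qed

text \<open>Truncation is nondecreasing and 1-Lipschitz: differences of truncated values never have
  the opposite sign of the original differences and are no larger. The first property makes the near
  integrand nonnegative when an equation is tested with its truncated solution, the second keeps
  truncations in the space without increasing the seminorm.\<close>

definition clamp_real :: "real \<Rightarrow> real \<Rightarrow> real" where
 "clamp_real K t = max (- K) (min K t)"

lemma clamp_real_simps:
 assumes "0 \<le> K"
 shows "\<bar>clamp_real K t\<bar> \<le> K" "\<bar>clamp_real K t\<bar> \<le> \<bar>t\<bar>" "clamp_real K 0 = 0"
  "\<bar>clamp_real K a - clamp_real K b\<bar> \<le> \<bar>a - b\<bar>" "0 \<le> (a - b) * (clamp_real K a - clamp_real K b)"
  "\<bar>t\<bar> \<le> K \<Longrightarrow> clamp_real K t = t"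
proof -
 show "0 \<le> (a - b) * (clamp_real K a - clamp_real K b)"
  using assms by (cases "a \<le> b") (auto simp: clamp_real_def intro!: mult_nonneg_nonneg mult_nonpos_nonpos)
qed (use assms in \<open>auto simp: clamp_real_def\<close>)

lemma clamp_real_measurable [measurable]: "clamp_real K \<in> borel_measurable borel"
 unfolding clamp_real_def[abs_def] by measurable

lemma isCont_clamp_real: "isCont (clamp_real K) t"
 unfolding clamp_real_def[abs_def] by (intro continuous_intros)

lemma Xe_clamp:
 assumes p: "0 < p" and u: "u \<in> Xe p \<Omega> e" and K: "0 \<le> K"
 shows "(\<lambda>x. clamp_real K (u x)) \<in> Xe p \<Omega> e" "near p e (\<lambda>x. clamp_real K (u x)) (\<lambda>x. clamp_real K (u x)) \<le> near p e u u"
proof -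
 note [measurable] = XeD(1)[OF u]
 note c = clamp_real_simps[OF K]
 have 1: "\<bar>clamp_real K (u (fst z)) - clamp_real K (u (snd z))\<bar> powr p * kn e z \<le> \<bar>incr u z\<bar> powr p * kn e z" for z
  using p c(4) by (intro mult_right_mono powr_mono2) auto
 have i1: "integrable lborel (\<lambda>x. \<bar>clamp_real K (u x)\<bar> powr p)"
  by (rule Bochner_Integration.integrable_bound[OF XeD(3)[OF u]])
    (use p c(2) in \<open>auto intro!: powr_mono2\<close>)
 have i2: "integrable lborel (\<lambda>z. \<bar>clamp_real K (u (fst z)) - clamp_real K (u (snd z))\<bar> powr p * kn e z)"
  by (rule Bochner_Integration.integrable_bound[OF XeD(4)[OF u]])
    (measurable, use 1 in \<open>auto simp only: real_norm_def intro!: AE_I2 order_trans[OF _ abs_ge_self]\<close>, simp)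
 show "(\<lambda>x. clamp_real K (u x)) \<in> Xe p \<Omega> e" using i1 i2 XeD(2)[OF u] c(3) by (auto simp: Xe_def)
 show "near p e (\<lambda>x. clamp_real K (u x)) (\<lambda>x. clamp_real K (u x)) \<le> near p e u u"
  unfolding near_self by (intro integral_mono i2 XeD(4)[OF u] 1)
qed

lemma clamp_tendsto: "(\<lambda>n. clamp_real (real n) t) \<longlonglongrightarrow> t"
proof (rule tendsto_eventually)
 have "\<bar>t\<bar> \<le> real (nat \<lceil>\<bar>t\<bar>\<rceil>)" by (rule real_nat_ceiling_ge)
 then show "eventually (\<lambda>n. clamp_real (real n) t = t) sequentially"
  by (intro eventually_sequentiallyI[of "nat \<lceil>\<bar>t\<bar>\<rceil>"] clamp_real_simps(6)) auto
qed

context small_order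
begin

section \<open>Domination of the logarithmic right-hand side\<close>

lemma b_bound: "AE x in lborel. x \<in> \<Omega> \<longrightarrow> \<bar>b x\<bar> \<le> M"
 using \<alpha> b
proof eventually_elim
 case (elim x)
 show ?case
 proof
  assume x: "x \<in> \<Omega>"
  have "\<bar>(\<alpha> k x - 1) / s k\<bar> \<le> M" for k using elim(1) x s(1)[of k] by (simp add: abs_divide divide_le_eq)
  moreover have "(\<lambda>k. \<bar>(\<alpha> k x - 1) / s k\<bar>) \<longlonglongrightarrow> \<bar>b x\<bar>" using elim(2) x by (intro tendsto_rabs) auto
  ultimately show "\<bar>b x\<bar> \<le> M" by (intro LIMSEQ_le_const2) auto
 qed
qed

text \<open>\<open>M\<close> bounds the coefficient \<open>b\<close>, \<open>\<mu> / (p - 1)\<close>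
  the product of the logarithm with \<open>\<bar>t\<bar> powr (p - 1)\<close> for small
  \<open>t\<close>, and the last \<open>\<mu>\<close> the growth at large values.\<close>

definition Clog :: real where "Clog = M + \<mu> * (1 / (p - 1) + 1)"

definition log_maj :: "real \<Rightarrow> real" where "log_maj m = 1 + m powr p + m powr p * ln (1 + m)"

lemma Clog_nonneg: "0 \<le> Clog"
 using M \<mu> p by (simp add: Clog_def)

text \<open>The bound depends on \<open>t\<close> and \<open>w\<close> only through a common
  \<open>m\<close>, so that one integrable function dominates whole families: truncations, recovery
  sequences and the curves \<open>u + t * v\<close> of the first variation.\<close>

lemma log_bound:
 assumes t: "\<bar>t\<bar> \<le> m" and w: "\<bar>w\<bar> \<le> m" and \<beta>: "\<bar>\<beta>\<bar> \<le> M"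
 shows "\<bar>(\<beta> + \<mu> * ln \<bar>t\<bar>) * h p t * w\<bar> \<le> 2 * Clog * log_maj m"
proof (cases "t = 0")
 case True
 have "0 \<le> m" using t by simp
 then show ?thesis using True Clog_nonneg by (simp add: log_maj_def)
next
 case False
 let ?t = "\<bar>t\<bar>"
 have t0: "0 < ?t" "0 < m" using False t by auto
 have m1: "m \<le> 1 + m powr p"
 proof (cases "1 \<le> m")
  case True
  then have "m powr 1 \<le> m powr p" using p by (intro powr_mono) auto
  then show ?thesis using t0 by simp
 next
  case False
  have "0 \<le> m powr p" by simp
  then show ?thesis using False by linarith
 qed
 have ln0: "0 \<le> ln (1 + m)" using t0 by simp
 have tp: "?t powr (p - 1) \<le> m powr (p - 1)" using p t by (intro powr_mono2) auto
 have l: "?t powr (p - 1) * \<bar>ln ?t\<bar> \<le> 1 / (p - 1) + m powr (p - 1) * ln (1 + m)"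
 proof (cases "1 \<le> ?t")
  case True
  have "\<bar>ln ?t\<bar> \<le> ln (1 + m)" using True t by simp
  then have "?t powr (p - 1) * \<bar>ln ?t\<bar> \<le> m powr (p - 1) * ln (1 + m)" by (intro mult_mono tp) auto
  moreover have "0 \<le> 1 / (p - 1)" using p by simp
  ultimately show ?thesis by linarith
 next
  case False
  have "\<bar>ln ?t\<bar> = 1 / (p - 1) * ln (?t powr - (p - 1))" using False t0 p by (simp add: ln_powr field_simps)
  also have "\<dots> \<le> 1 / (p - 1) * ?t powr - (p - 1)" using p t0 by (intro mult_left_mono ln_bound) auto
  finally have "?t powr (p - 1) * \<bar>ln ?t\<bar> \<le> ?t powr (p - 1) * (1 / (p - 1) * ?t powr - (p - 1))" by (intro mult_left_mono) auto
  also have "\<dots> = 1 / (p - 1) * (?t powr (p - 1) * ?t powr - (p - 1))" by simp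
  also have "?t powr (p - 1) * ?t powr - (p - 1) = 1" using t0 powr_add[of ?t "p - 1" "- (p - 1)"] by simp
  also have "1 / (p - 1) * 1 = 1 / (p - 1)" by simp
  finally have "?t powr (p - 1) * \<bar>ln ?t\<bar> \<le> 1 / (p - 1)" .
  moreover have "0 \<le> m powr (p - 1) * ln (1 + m)" using ln0 by simp
  ultimately show ?thesis by linarith
 qed
 have mp: "m powr (p - 1) * m = m powr p" using powr_mult_self[of m "p - 1"] t0 by simp
 have "\<bar>(\<beta> + \<mu> * ln ?t) * h p t * w\<bar> = \<bar>\<beta> + \<mu> * ln ?t\<bar> * ?t powr (p - 1) * \<bar>w\<bar>" by (simp add: abs_mult abs_h)
 also have "\<dots> \<le> (M + \<mu> * \<bar>ln ?t\<bar>) * ?t powr (p - 1) * m"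
 proof -
  have "\<bar>\<beta> + \<mu> * ln ?t\<bar> \<le> \<bar>\<beta>\<bar> + \<bar>\<mu> * ln ?t\<bar>" by (rule abs_triangle_ineq)
  also have "\<dots> \<le> M + \<mu> * \<bar>ln ?t\<bar>" using \<mu> \<beta> by (simp add: abs_mult)
  finally show ?thesis using w M \<mu> by (intro mult_mono) auto
 qed
 also have "\<dots> = M * (?t powr (p - 1) * m) + \<mu> * ((?t powr (p - 1) * \<bar>ln ?t\<bar>) * m)" by (simp add: algebra_simps)
 also have "\<dots> \<le> M * (m powr (p - 1) * m) + \<mu> * ((1 / (p - 1) + m powr (p - 1) * ln (1 + m)) * m)"
  using M \<mu> tp l t0 by (intro add_mono mult_left_mono mult_right_mono) auto
 also have "\<dots> = M * m powr p + \<mu> / (p - 1) * m + \<mu> * (m powr p * ln (1 + m))" by (simp add: algebra_simps flip: mp)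
 also have "\<dots> \<le> Clog * log_maj m + Clog * log_maj m"
 proof -
  have C: "M \<le> Clog" "\<mu> / (p - 1) \<le> Clog" "\<mu> \<le> Clog" using M \<mu> p by (auto simp: Clog_def distrib_left)
  have lm: "0 \<le> m powr p * ln (1 + m)" using ln0 by simp
  have "M * m powr p \<le> Clog * m powr p" using C by (intro mult_right_mono) auto
  moreover have "\<mu> / (p - 1) * m \<le> Clog * (1 + m powr p)" using C m1 t0 Clog_nonneg by (intro mult_mono) auto
  moreover have "\<mu> * (m powr p * ln (1 + m)) \<le> Clog * (m powr p * ln (1 + m))" using C lm by (intro mult_right_mono) auto
  moreover have "0 \<le> Clog * (m powr p * ln (1 + m))" "0 \<le> Clog" using lm Clog_nonneg by auto
  ultimately show ?thesis by (simp add: log_maj_def algebra_simps)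
 qed
 finally show ?thesis by (simp add: mult_ac)
qed

lemma log_maj_nonneg: "0 \<le> m \<Longrightarrow> 0 \<le> log_maj m"
 by (simp add: log_maj_def)

lemma log_maj_measurable [measurable]: "log_maj \<in> borel_measurable borel"
 unfolding log_maj_def[abs_def] by measurable

lemma log_maj_integrable:
 assumes u: "u \<in> Xe p \<Omega> 0" and v: "v \<in> Xe p \<Omega> 0"
 shows "integrable lborel (\<lambda>x. indicator \<Omega> x * log_maj (\<bar>u x\<bar> + \<bar>v x\<bar>))"
proof -
 note [measurable] = XeD(1)[OF u] XeD(1)[OF v]
 let ?g = "\<lambda>t::real. \<bar>t\<bar> powr p * ln (1 + \<bar>t\<bar>)"
 let ?f = "\<lambda>t::real. (2 powr p * (1 + ln 2)) * \<bar>t\<bar> powr p + 2 powr p * ?g t"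
 have i: "integrable lborel (\<lambda>x. indicat_real \<Omega> x + (?f (u x) + ?f (v x)))"
  using indicator_integrable XeD(3)[OF u] XeD(3)[OF v] X_log_integrable[OF p u] X_log_integrable[OF p v] by simp
 have bd: "log_maj (\<bar>a\<bar> + \<bar>c\<bar>) \<le> 1 + (?f a + ?f c)" for a c :: real
 proof -
  define m where "m = max \<bar>a\<bar> \<bar>c\<bar>"
  have m: "0 \<le> m" "\<bar>a\<bar> + \<bar>c\<bar> \<le> 2 * m" by (auto simp: m_def)
  have 1: "(\<bar>a\<bar> + \<bar>c\<bar>) powr p \<le> 2 powr p * m powr p"
   using powr_mono2[of p "\<bar>a\<bar> + \<bar>c\<bar>" "2 * m"] p m by (simp add: powr_mult)
  have "ln (1 + (\<bar>a\<bar> + \<bar>c\<bar>)) \<le> ln (2 * (1 + m))" using m by (subst ln_le_cancel_iff) auto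
  also have "\<dots> = ln 2 + ln (1 + m)" using ln_mult_pos[of 2 "1 + m"] m by simp
  finally have 2: "ln (1 + (\<bar>a\<bar> + \<bar>c\<bar>)) \<le> ln 2 + ln (1 + m)" .
  have "log_maj (\<bar>a\<bar> + \<bar>c\<bar>) \<le> 1 + 2 powr p * m powr p + (2 powr p * m powr p) * (ln 2 + ln (1 + m))"
   unfolding log_maj_def using 1 2 m by (intro add_mono mult_mono) auto
  also have "\<dots> = 1 + ?f m" using m by (simp add: algebra_simps)
  also have "?f m \<le> ?f a + ?f c"
  proof -
   have nn: "0 \<le> ?f t" for t by (intro add_nonneg_nonneg mult_nonneg_nonneg) auto
   show ?thesis using nn[of a] nn[of c] unfolding m_def max_def by (auto simp only: abs_abs split: if_splits)
  qed
  finally show ?thesis by simp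
 qed
 show ?thesis
 proof (rule Bochner_Integration.integrable_bound[OF i])
  show "AE x in lborel. norm (indicator \<Omega> x * log_maj (\<bar>u x\<bar> + \<bar>v x\<bar>)) \<le> norm (indicat_real \<Omega> x + (?f (u x) + ?f (v x)))"
  proof (rule AE_I2)
   fix x
   show "norm (indicator \<Omega> x * log_maj (\<bar>u x\<bar> + \<bar>v x\<bar>)) \<le> norm (indicat_real \<Omega> x + (?f (u x) + ?f (v x)))"
   proof (cases "x \<in> \<Omega>")
    case True
    have "norm (indicator \<Omega> x * log_maj (\<bar>u x\<bar> + \<bar>v x\<bar>)) = log_maj (\<bar>u x\<bar> + \<bar>v x\<bar>)"
     using True log_maj_nonneg[of "\<bar>u x\<bar> + \<bar>v x\<bar>"] by simp
    also have "\<dots> \<le> indicat_real \<Omega> x + (?f (u x) + ?f (v x))" using bd True by simp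
    also have "\<dots> \<le> norm \<dots>" unfolding real_norm_def by (rule abs_ge_self)
    finally show ?thesis .
   qed simp
  qed
 qed measurable
qed

lemma LT_bound:
 assumes "\<And>x. x \<notin> \<Omega> \<Longrightarrow> u x = 0" "\<And>x. \<bar>u x\<bar> \<le> m x" "\<And>x. \<bar>v x\<bar> \<le> m x"
 shows "AE x in lborel. \<bar>(b x + \<mu> * ln \<bar>u x\<bar>) * h p (u x) * v x\<bar> \<le> 2 * Clog * (indicator \<Omega> x * log_maj (m x))"
 using b_bound
proof eventually_elim
 case (elim x)
 show ?case
 proof (cases "x \<in> \<Omega>")
  case True
  then show ?thesis using log_bound[OF assms(2,3), of "b x" x] elim by simp
 qed (simp add: assms(1))
qed

lemma LT_integrable:
 assumes u: "u \<in> Xe p \<Omega> 0" and v: "v \<in> Xe p \<Omega> 0"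
 shows "integrable lborel (\<lambda>x. (b x + \<mu> * ln \<bar>u x\<bar>) * h p (u x) * v x)"
proof -
 note [measurable] = XeD(1)[OF u] XeD(1)[OF v]
 have nn: "0 \<le> 2 * Clog * (indicator \<Omega> x * log_maj (\<bar>u x\<bar> + \<bar>v x\<bar>))" for x
  using Clog_nonneg log_maj_nonneg[of "\<bar>u x\<bar> + \<bar>v x\<bar>"] by simp
 show ?thesis
 proof (rule Bochner_Integration.integrable_bound[OF integrable_mult_right[OF log_maj_integrable[OF u v], of "2 * Clog"]])
  show "AE x in lborel. norm ((b x + \<mu> * ln \<bar>u x\<bar>) * h p (u x) * v x) \<le> norm (2 * Clog * (indicator \<Omega> x * log_maj (\<bar>u x\<bar> + \<bar>v x\<bar>)))"
   unfolding real_norm_def abs_of_nonneg[OF nn]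
   by (rule LT_bound) (use XeD(2)[OF u] in auto)
 qed measurable
qed

lemma ln_h_bound: "\<bar>ln \<bar>t\<bar> * h p t\<bar> \<le> 2 / (p - 1) * \<bar>t\<bar> powr ((p - 1) / 2) + \<bar>t\<bar> powr p"
 (is "_ \<le> ?B t")
proof (cases "t = 0")
 case False
 let ?t = "\<bar>t\<bar>"
 have t0: "0 < ?t" using False by simp
 have eq: "\<bar>ln ?t * h p t\<bar> = ?t powr (p - 1) * \<bar>ln ?t\<bar>" by (simp add: abs_mult abs_h)
 show ?thesis
 proof (cases "1 \<le> ?t")
  case True
  have "\<bar>ln ?t\<bar> \<le> ?t" using True ln_bound[OF t0] by simp
  then have "?t powr (p - 1) * \<bar>ln ?t\<bar> \<le> ?t powr (p - 1) * ?t" by (intro mult_left_mono) auto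
  also have "\<dots> = ?t powr p" using powr_mult_self[of ?t "p - 1"] by simp
  also have "\<dots> \<le> ?B t" using p by simp
  finally show ?thesis using eq by simp
 next
  case False
  have "\<bar>ln ?t\<bar> = 2 / (p - 1) * ln (?t powr - ((p - 1) / 2))" using False t0 p by (simp add: ln_powr)
  also have "\<dots> \<le> 2 / (p - 1) * ?t powr - ((p - 1) / 2)" using p t0 by (intro mult_left_mono ln_bound) auto
  finally have "?t powr (p - 1) * \<bar>ln ?t\<bar> \<le> ?t powr (p - 1) * (2 / (p - 1) * ?t powr - ((p - 1) / 2))"
   by (intro mult_left_mono) auto
  also have "\<dots> = 2 / (p - 1) * ?t powr ((p - 1) + - ((p - 1) / 2))" by (simp only: powr_add) (simp add: mult_ac)
  also have "(p - 1) + - ((p - 1) / 2) = (p - 1) / 2" by (simp add: field_simps)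
  finally have "?t powr (p - 1) * \<bar>ln ?t\<bar> \<le> 2 / (p - 1) * ?t powr ((p - 1) / 2)" .
  moreover have "0 \<le> ?t powr p" by simp
  ultimately show ?thesis using eq by linarith
 qed
qed simp


lemma LT_tendsto:
 assumes [measurable]: "\<And>n. u n \<in> borel_measurable borel" "\<And>n. v n \<in> borel_measurable borel" "u0 \<in> borel_measurable borel" "v0 \<in> borel_measurable borel"
  and z: "\<And>n x. x \<notin> \<Omega> \<Longrightarrow> u n x = 0"
  and c: "AE x in lborel. (\<lambda>n. u n x) \<longlonglongrightarrow> u0 x" "AE x in lborel. (\<lambda>n. v n x) \<longlonglongrightarrow> v0 x"
  and m: "integrable lborel (\<lambda>x. indicator \<Omega> x * log_maj (m x))" "\<And>n x. \<bar>u n x\<bar> \<le> m x" "\<And>n x. \<bar>v n x\<bar> \<le> m x"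
 shows "(\<lambda>n. LT (u n) (v n)) \<longlonglongrightarrow> LT u0 v0"
 unfolding LT_def
proof (rule integral_dominated_convergence[where w = "\<lambda>x. 2 * Clog * (indicator \<Omega> x * log_maj (m x))"])
 show "integrable lborel (\<lambda>x. 2 * Clog * (indicator \<Omega> x * log_maj (m x)))"
  by (intro integrable_mult_right m)
 show "AE x in lborel. norm ((b x + \<mu> * ln \<bar>u n x\<bar>) * h p (u n x) * v n x) \<le> 2 * Clog * (indicator \<Omega> x * log_maj (m x))" for n
  unfolding real_norm_def by (rule LT_bound) (use z m in auto)
 show "AE x in lborel. (\<lambda>n. (b x + \<mu> * ln \<bar>u n x\<bar>) * h p (u n x) * v n x) \<longlonglongrightarrow> (b x + \<mu> * ln \<bar>u0 x\<bar>) * h p (u0 x) * v0 x"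
  using c
 proof eventually_elim
  case (elim x)
  have hc: "(\<lambda>n. h p (u n x)) \<longlonglongrightarrow> h p (u0 x)" by (intro isCont_tendsto_compose[OF isCont_h[OF p]] elim)
  have "(\<lambda>n. (b x + \<mu> * ln \<bar>u n x\<bar>) * h p (u n x)) \<longlonglongrightarrow> (b x + \<mu> * ln \<bar>u0 x\<bar>) * h p (u0 x)"
  proof (cases "u0 x = 0")
   case False
   then show ?thesis by (intro tendsto_intros hc elim) auto
  next
   case True
   have "(\<lambda>n. ln \<bar>u n x\<bar> * h p (u n x)) \<longlonglongrightarrow> 0"
   proof (rule Lim_null_comparison)
    let ?B = "\<lambda>t. 2 / (p - 1) * \<bar>t\<bar> powr ((p - 1) / 2) + \<bar>t\<bar> powr p"
    show "eventually (\<lambda>n. norm (ln \<bar>u n x\<bar> * h p (u n x)) \<le> ?B (u n x)) sequentially"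
     by (intro always_eventually allI) (simp only: real_norm_def ln_h_bound)
    have "(\<lambda>n. ?B (u n x)) \<longlonglongrightarrow> ?B (u0 x)"
     using p by (intro tendsto_add tendsto_mult tendsto_const tendsto_powr' tendsto_rabs elim) auto
    then show "(\<lambda>n. ?B (u n x)) \<longlonglongrightarrow> 0" using True by simp
   qed
   then have "(\<lambda>n. b x * h p (u n x) + \<mu> * (ln \<bar>u n x\<bar> * h p (u n x))) \<longlonglongrightarrow> b x * h p (u0 x) + \<mu> * 0"
    by (intro tendsto_intros hc)
   then show ?thesis using True by (simp add: algebra_simps)
  qed
  from tendsto_mult[OF this elim(2)] show ?case .
 qed
qed measurable

lemma near_clamp_tendsto:
 assumes u: "u \<in> Xe p \<Omega> 0"
 shows "(\<lambda>n. near p 0 u (\<lambda>x. clamp_real (real n) (u x))) \<longlonglongrightarrow> near p 0 u u"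
 unfolding near_def
proof (rule integral_dominated_convergence[OF _ _ XeD(4)[OF u]])
 note [measurable] = XeD(1)[OF u]
 show "(\<lambda>z. h p (incr u z) * (incr u z) * kn 0 z) \<in> borel_measurable lborel"
  "(\<lambda>z. h p (incr u z) * (clamp_real (real n) (u (fst z)) - clamp_real (real n) (u (snd z))) * kn 0 z) \<in> borel_measurable lborel" for n
  by measurable
 show "AE z in lborel. (\<lambda>n. h p (incr u z) * (clamp_real (real n) (u (fst z)) - clamp_real (real n) (u (snd z))) * kn 0 z)
   \<longlonglongrightarrow> h p (incr u z) * (incr u z) * kn 0 z"
  by (intro AE_I2 tendsto_intros clamp_tendsto)
 have "norm (h p (incr u z) * (clamp_real (real n) (u (fst z)) - clamp_real (real n) (u (snd z))) * kn 0 z)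
   \<le> \<bar>incr u z\<bar> powr p * kn 0 z" for n z
 proof -
  have "\<bar>h p (incr u z)\<bar> * \<bar>clamp_real (real n) (u (fst z)) - clamp_real (real n) (u (snd z))\<bar>
   \<le> \<bar>incr u z\<bar> powr (p - 1) * \<bar>incr u z\<bar>"
   unfolding abs_h by (intro mult_left_mono clamp_real_simps) auto
  also have "\<dots> = \<bar>incr u z\<bar> powr p" using powr_mult_self[of "\<bar>incr u z\<bar>" "p - 1"] by simp
  finally show ?thesis by (simp add: abs_mult mult_right_mono)
 qed
 then show "AE z in lborel. norm (h p (incr u z) * (clamp_real (real n) (u (fst z)) - clamp_real (real n) (u (snd z))) * kn 0 z)
   \<le> \<bar>incr u z\<bar> powr p * kn 0 z" for n by (intro AE_I2)
qed

end

text \<open>What compactness and the a priori bounds provide along a subsequence; bounds that hold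
  eventually become bounds for all \<open>k\<close> when the subsequence starts late enough.\<close>

locale small_order_lim = small_order_sol +
 fixes u0 G :: "'a \<Rightarrow> real" and C c :: real
 assumes u0m [measurable]: "u0 \<in> borel_measurable borel" and u0z: "\<And>x. x \<notin> \<Omega> \<Longrightarrow> u0 x = 0"
  and conv: "AE x in lborel. (\<lambda>k. u k x) \<longlonglongrightarrow> u0 x"
  and G: "integrable lborel G" "AE x in lborel. \<forall>k. \<bar>u k x\<bar> powr p \<le> G x" "AE x in lborel. \<bar>u0 x\<bar> powr p \<le> G x"
  and bounds: "\<And>k. near p (e k) (u k) (u k) \<le> C" "0 < c" "\<And>k. c \<le> Y (u k)"
   "\<And>k. \<bar>E_frac (s k) p (u k) (u k) - Y (u k)\<bar> \<le> C * s k"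
begin

lemma um [measurable]: "u k \<in> borel_measurable borel" by (rule XeD(1)[OF uX])

lemma uz: "x \<notin> \<Omega> \<Longrightarrow> u k x = 0" by (rule XeD(2)[OF uX])

lemma u0_X: "u0 \<in> Xe p \<Omega> 0"
proof -
 have Gm[measurable]: "G \<in> borel_measurable borel" using borel_measurable_integrable[OF G(1)] by simp
 have "integrable lborel (\<lambda>x. \<bar>u0 x\<bar> powr p)"
  by (rule Bochner_Integration.integrable_bound[OF G(1)]) (measurable, use G(3) in \<open>eventually_elim, simp\<close>)
 moreover have "integrable lborel (\<lambda>z. \<bar>incr u0 z\<bar> powr p * kn 0 z)"
 proof (rule Fatou_integral(1)[where f = "\<lambda>k z. \<bar>incr (u k) z\<bar> powr p * kn (e k) z" and C = C])
  show "integrable lborel (\<lambda>z. \<bar>incr (u k) z\<bar> powr p * kn (e k) z)" for k by (rule XeD(4)[OF uX])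
  show "AE z in lborel. (\<lambda>k. \<bar>incr (u k) z\<bar> powr p * kn (e k) z) \<longlonglongrightarrow> \<bar>incr u0 z\<bar> powr p * kn 0 z"
   using AE_lborel_pair(1)[OF conv, where 'b='a] AE_lborel_pair(2)[OF conv, where 'b='a]
   by eventually_elim (use p in \<open>intro tendsto_mult tendsto_powr' tendsto_rabs tendsto_diff kn_tendsto tendsto_const; simp\<close>)
  show "eventually (\<lambda>k. (LBINT z. \<bar>incr (u k) z\<bar> powr p * kn (e k) z) \<le> C) sequentially"
   using bounds(1) by (intro always_eventually) (simp add: near_self)
 qed auto
 ultimately show ?thesis using u0z by (auto simp: Xe_def)
qed

lemma Y_tendsto: "(\<lambda>k. Y (u k)) \<longlonglongrightarrow> Y u0"
 unfolding Y_def
proof (rule integral_dominated_convergence[OF _ _ G(1)])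
 show "AE x in lborel. (\<lambda>k. \<bar>u k x\<bar> powr p) \<longlonglongrightarrow> \<bar>u0 x\<bar> powr p"
  using conv by eventually_elim (use p in \<open>intro tendsto_powr' tendsto_rabs tendsto_const; simp\<close>)
 show "AE x in lborel. norm (\<bar>u k x\<bar> powr p) \<le> G x" for k using G(2) by eventually_elim simp
qed measurable

lemma Y_u0_pos: "0 < Y u0"
 using LIMSEQ_le_const[OF Y_tendsto, of c] bounds(2,3) by fastforce

lemma energy_tendsto: "(\<lambda>k. E_frac (s k) p (u k) (u k)) \<longlonglongrightarrow> Y u0"
proof -
 have "(\<lambda>k. E_frac (s k) p (u k) (u k) - Y (u k)) \<longlonglongrightarrow> 0"
 proof (rule Lim_null_comparison)
  show "eventually (\<lambda>k. norm (E_frac (s k) p (u k) (u k) - Y (u k)) \<le> C * s k) sequentially"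
   using bounds(4) by (intro always_eventually) simp
  show "(\<lambda>k. C * s k) \<longlonglongrightarrow> 0" using tendsto_mult[OF tendsto_const[of C] s(3)] by simp
 qed
 from tendsto_add[OF this Y_tendsto] show ?thesis by simp
qed

text \<open>The equation of \<open>u k\<close> is tested with the truncation of \<open>u k\<close>.
  This is bounded, so the right-hand side converges; the far and zero order terms converge by
  domination; the near integrand is nonnegative, so Fatou's lemma handles the one remaining term.
  Testing with \<open>u k\<close> itself would leave the right-hand side without a majorant.\<close>

lemma limit_test_inequality:
 assumes K: "0 \<le> K"
 defines "v0 \<equiv> \<lambda>x. clamp_real K (u0 x)"
 shows "E0 u0 v0 \<le> LT u0 v0"
proof -
 define v where "v k = (\<lambda>x. clamp_real K (u k x))" for k
 have vX: "v k \<in> Xe p \<Omega> (e k)" for k unfolding v_def using p by (intro Xe_clamp uX K) auto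
 note [measurable] = XeD(1)[OF vX]
 have v0m[measurable]: "v0 \<in> borel_measurable borel" unfolding v0_def by measurable
 have vz: "x \<notin> \<Omega> \<Longrightarrow> v k x = 0" for k x by (rule XeD(2)[OF vX])
 have vc: "AE x in lborel. (\<lambda>k. v k x) \<longlonglongrightarrow> v0 x"
  using conv unfolding v_def v0_def by eventually_elim (rule isCont_tendsto_compose[OF isCont_clamp_real])
 have vb: "\<bar>v k x\<bar> \<le> K" "\<bar>v k x\<bar> \<le> \<bar>u k x\<bar>" for k x unfolding v_def by (intro clamp_real_simps K)+
 have G2: "integrable lborel (\<lambda>x. G x + G x)" "AE x in lborel. \<forall>k. \<bar>u k x\<bar> powr p + \<bar>v k x\<bar> powr p \<le> G x + G x"
 proof -
  show "integrable lborel (\<lambda>x. G x + G x)" using G(1) by simp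
  show "AE x in lborel. \<forall>k. \<bar>u k x\<bar> powr p + \<bar>v k x\<bar> powr p \<le> G x + G x"
   using G(2)
  proof eventually_elim
   case (elim x)
   show ?case
   proof
    fix k
    have "\<bar>v k x\<bar> powr p \<le> \<bar>u k x\<bar> powr p" using vb p by (intro powr_mono2) auto
    then show "\<bar>u k x\<bar> powr p + \<bar>v k x\<bar> powr p \<le> G x + G x" using elim[rule_format, of k] by linarith
   qed
  qed
 qed
 let ?c = "p / (2 * sphere_area DIM('a))"
 have c0: "0 < ?c" using p S_pos by simp
 let ?H = "\<lambda>k. LBINT x. h p (u k x) * v k x"
 let ?P = "\<lambda>k. LBINT x. pert k (u k) x * h p (u k x) * v k x"
 let ?A = "\<lambda>k. near p (e k) (u k) (v k)"
 let ?B = "\<lambda>k. far p (e k) (u k) (v k)"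
 have B: "?B \<longlonglongrightarrow> far p 0 u0 v0"
  using uz vz conv vc G2 e_pos kf_tendsto by (intro far_tendsto[where G = "\<lambda>x. G x + G x"]) (auto intro: less_imp_le)
 have H: "?H \<longlonglongrightarrow> (LBINT x. h p (u0 x) * v0 x)"
  using conv vc G2 by (intro h_mult_tendsto[where G = "\<lambda>x. G x + G x"]) auto
 have P: "?P \<longlonglongrightarrow> LT u0 v0"
  using uz conv vc G vb by (intro pert_tendsto(1)[where G = G and K = K]) auto
 have Pi: "eventually (\<lambda>k. integrable lborel (\<lambda>x. pert k (u k) x * h p (u k x) * v k x)) sequentially"
  using uz conv vc G vb by (intro pert_tendsto(2)[where G = G and K = K and ?u0.0 = u0 and ?v0.0 = v0]) auto
 \<comment> \<open>The near part, solved from the weak equation after the common leading term has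
   been cancelled and the rest divided by \<open>s k\<close>.\<close>
 define R where "R k = (?P k - (kappa DIM('a) p (s k) - 1) / s k * ?H k) / (kappa DIM('a) p (s k) * ?c) - ?B k" for k
 have A_eq: "eventually (\<lambda>k. ?A k = R k) sequentially"
  using Pi
 proof eventually_elim
  case (elim k)
  have "E_frac (s k) p (u k) (v k) = (LBINT x. h p (u k x) * v k x + s k * (pert k (u k) x * h p (u k x) * v k x))"
   unfolding weak[OF vX] pert_eq ..
  also have "\<dots> = ?H k + s k * ?P k"
   using integrable_h_mult[OF p um XeD(1)[OF vX] XeD(3)[OF uX] XeD(3)[OF vX], of k k] elim by simp
  finally have eq: "kappa DIM('a) p (s k) * (?H k + s k * ?c * (?A k + ?B k)) = ?H k + s k * ?P k"
   using E_frac_expansion[OF uX vX, of k] by simp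
  have alg: "A = (P - (\<kappa> - 1) / \<sigma> * H) / (\<kappa> * c) - B"
   if "\<kappa> * (H + \<sigma> * c * (A + B)) = H + \<sigma> * P" "0 < \<kappa>" "0 < \<sigma>" "0 < c" for \<kappa> \<sigma> c A B P H :: real
  proof -
   have "\<sigma> * (P - (\<kappa> - 1) / \<sigma> * H) = \<sigma> * P - (\<kappa> - 1) * H" using that by (simp add: right_diff_distrib)
   moreover have "\<sigma> * (\<kappa> * c * (A + B)) = \<sigma> * P - (\<kappa> - 1) * H" using that(1) by (simp add: algebra_simps)
   ultimately have "\<sigma> * (\<kappa> * c * (A + B)) = \<sigma> * (P - (\<kappa> - 1) / \<sigma> * H)" by simp
   then have "\<kappa> * c * (A + B) = P - (\<kappa> - 1) / \<sigma> * H" using that by simp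
   then show ?thesis using that by (simp add: field_simps)
  qed
  show ?case unfolding R_def by (rule alg[OF eq kappa_gt_0 s(1) c0])
 qed
 have "R \<longlonglongrightarrow> (LT u0 v0 - rho DIM('a) p * (LBINT x. h p (u0 x) * v0 x)) / (1 * ?c) - far p 0 u0 v0"
  unfolding R_def using c0 by (intro tendsto_diff tendsto_divide tendsto_mult tendsto_const kappa_tendsto P H B) auto
 then have A: "?A \<longlonglongrightarrow> (LT u0 v0 - rho DIM('a) p * (LBINT x. h p (u0 x) * v0 x)) / ?c - far p 0 u0 v0" (is "_ \<longlonglongrightarrow> ?L")
  using A_eq by (simp add: tendsto_cong)
 have near_le: "near p 0 u0 v0 \<le> ?L + \<epsilon>" if "0 < \<epsilon>" for \<epsilon>
  unfolding near_def
 proof (rule Fatou_integral(2)[where f = "\<lambda>k z. h p (incr (u k) z) * (incr (v k) z) * kn (e k) z"])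
  show "integrable lborel (\<lambda>z. h p (incr (u k) z) * (incr (v k) z) * kn (e k) z)" for k
   by (rule near_integrable[OF p uX vX])
  show "0 \<le> h p (incr (u k) z) * (incr (v k) z) * kn (e k) z" for k z
   unfolding v_def by (intro mult_nonneg_nonneg h_mult_same_sign_nonneg clamp_real_simps K kn_nonneg)
  show "AE z in lborel. (\<lambda>k. h p (incr (u k) z) * (incr (v k) z) * kn (e k) z)
    \<longlonglongrightarrow> h p (incr u0 z) * (incr v0 z) * kn 0 z"
   using AE_lborel_pair(1)[OF conv, where 'b='a] AE_lborel_pair(2)[OF conv, where 'b='a]
    AE_lborel_pair(1)[OF vc, where 'b='a] AE_lborel_pair(2)[OF vc, where 'b='a]
   by eventually_elim (intro tendsto_mult tendsto_diff kn_tendsto isCont_tendsto_compose[OF isCont_h[OF p]])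
  have "eventually (\<lambda>k. ?A k < ?L + \<epsilon>) sequentially" using A that by (intro order_tendstoD(2)) auto
  then show "eventually (\<lambda>k. (LBINT z. h p (incr (u k) z) * (incr (v k) z) * kn (e k) z) \<le> ?L + \<epsilon>) sequentially"
   unfolding near_def by eventually_elim simp
 qed measurable
 then have "near p 0 u0 v0 \<le> ?L" by (rule field_le_epsilon)
 then have "?c * near p 0 u0 v0 \<le> ?c * ?L" using c0 by (intro mult_left_mono) auto
 also have "?c * ?L = LT u0 v0 - rho DIM('a) p * (LBINT x. h p (u0 x) * v0 x) - ?c * far p 0 u0 v0"
 proof -
  have "c * (X / c - F) = X - c * F" if "0 < c" for c X F :: real using that by (simp add: right_diff_distrib)
  from this[OF c0] show ?thesis .
 qed
 finally show ?thesis by (simp add: E0_def C_lim_eq distrib_left)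
qed

lemma limit_energy_inequality: "E0 u0 u0 \<le> LT u0 u0"
proof -
 let ?v = "\<lambda>n x. clamp_real (real n) (u0 x)"
 have vX: "?v n \<in> Xe p \<Omega> 0" for n using p by (intro Xe_clamp u0_X) auto
 note [measurable] = XeD(1)[OF vX]
 have G2: "\<bar>u0 x\<bar> powr p + \<bar>?v n x\<bar> powr p \<le> \<bar>u0 x\<bar> powr p + \<bar>u0 x\<bar> powr p" for n x
  using p clamp_real_simps(2)[of "real n" "u0 x"] by (intro add_left_mono powr_mono2) auto
 have i: "integrable lborel (\<lambda>x. \<bar>u0 x\<bar> powr p + \<bar>u0 x\<bar> powr p)" using XeD(3)[OF u0_X] by simp
 have far: "(\<lambda>n. far p 0 u0 (?v n)) \<longlonglongrightarrow> far p 0 u0 u0"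
  using u0z XeD(2)[OF vX] G2 i clamp_tendsto
  by (intro far_tendsto[where u = "\<lambda>_. u0" and G = "\<lambda>x. \<bar>u0 x\<bar> powr p + \<bar>u0 x\<bar> powr p"]) auto
 have H: "(\<lambda>n. LBINT x. h p (u0 x) * ?v n x) \<longlonglongrightarrow> (LBINT x. h p (u0 x) * u0 x)"
  using G2 i clamp_tendsto
  by (intro h_mult_tendsto[where u = "\<lambda>_. u0" and G = "\<lambda>x. \<bar>u0 x\<bar> powr p + \<bar>u0 x\<bar> powr p"]) auto
 have LT: "(\<lambda>n. LT u0 (?v n)) \<longlonglongrightarrow> LT u0 u0"
  using u0z clamp_real_simps(2) clamp_tendsto u0_X
  by (intro LT_tendsto[where u = "\<lambda>_. u0" and m = "\<lambda>x. \<bar>u0 x\<bar> + \<bar>u0 x\<bar>"] log_maj_integrable) (auto intro: order_trans[OF clamp_real_simps(2)])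
 have "(\<lambda>n. E0 u0 (?v n)) \<longlonglongrightarrow> E0 u0 u0"
  unfolding E0_def by (intro tendsto_add tendsto_mult tendsto_const near_clamp_tendsto[OF u0_X] far H)
 from LIMSEQ_le[OF this LT] show ?thesis using limit_test_inequality by auto
qed

end

section \<open>Density of Lipschitz functions\<close>

definition trans_diff :: "real \<Rightarrow> ('a::euclidean_space \<Rightarrow> real) \<Rightarrow> 'a \<Rightarrow> ennreal" where
 "trans_diff p v a = (\<integral>\<^sub>+x. ennreal (\<bar>v (x - a) - v x\<bar> powr p))"

lemma trans_diff_measurable [measurable]:
 assumes [measurable]: "v \<in> borel_measurable borel"
 shows "trans_diff p v \<in> borel_measurable (borel :: 'a::euclidean_space measure)"
proof -
 have "(\<lambda>(a, x). ennreal (\<bar>v (x - a) - v x\<bar> powr p)) \<in> borel_measurable ((borel :: 'a measure) \<Otimes>\<^sub>M lborel)"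
  by measurable
 then show ?thesis unfolding trans_diff_def[abs_def]
  by (rule lborel.borel_measurable_nn_integral)
qed

lemma trans_diff_triangle:
 assumes p: "0 < p" and [measurable]: "v \<in> borel_measurable borel"
 shows "trans_diff p v a \<le> ennreal (2 powr p) * (trans_diff p v (a - b) + trans_diff p v b)"
proof -
 have "trans_diff p v a \<le> (\<integral>\<^sub>+x. ennreal (2 powr p) * (ennreal (\<bar>v (x - a) - v (x - b)\<bar> powr p) + ennreal (\<bar>v (x - b) - v x\<bar> powr p)))"
  unfolding trans_diff_def
 proof (rule nn_integral_mono)
  fix x
  have "\<bar>v (x - a) - v x\<bar> powr p \<le> 2 powr p * (\<bar>v (x - a) - v (x - b)\<bar> powr p + \<bar>v (x - b) - v x\<bar> powr p)"
   using abs_add_powr_le[OF p, of "v (x - a) - v (x - b)" "v (x - b) - v x"] by simp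
  then have "ennreal (\<bar>v (x - a) - v x\<bar> powr p) \<le> ennreal (2 powr p * (\<bar>v (x - a) - v (x - b)\<bar> powr p + \<bar>v (x - b) - v x\<bar> powr p))"
   by (rule ennreal_leI)
  then show "ennreal (\<bar>v (x - a) - v x\<bar> powr p) \<le> ennreal (2 powr p) * (ennreal (\<bar>v (x - a) - v (x - b)\<bar> powr p) + ennreal (\<bar>v (x - b) - v x\<bar> powr p))"
   by (simp add: ennreal_mult)
 qed
 also have "\<dots> = ennreal (2 powr p) * ((\<integral>\<^sub>+x. ennreal (\<bar>v (x - a) - v (x - b)\<bar> powr p)) + trans_diff p v b)"
  by (simp add: nn_integral_cmult nn_integral_add trans_diff_def)
 also have "(\<integral>\<^sub>+x. ennreal (\<bar>v (x - a) - v (x - b)\<bar> powr p)) = trans_diff p v (a - b)"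
  unfolding trans_diff_def
  using nn_integral_lborel_shift'[of "\<lambda>x. ennreal (\<bar>v (x - (a - b)) - v x\<bar> powr p)" b] by (simp add: algebra_simps)
 finally show ?thesis .
qed

text \<open>The substitution \<open>y = x - a\<close> and Tonelli's theorem turn the seminorm into
  an integral of translation differences against the singular kernel. In this form its finiteness
  forces \<open>trans_diff\<close> to be small near \<open>0\<close> on average.\<close>

lemma near_as_trans_diff:
 assumes v: "v \<in> Xe p \<Omega> (0::real)"
 shows "(\<integral>\<^sub>+a. trans_diff p v a * ennreal (kn 0 (a, 0))) = ennreal (near p 0 v v)"
proof -
 note [measurable] = XeD(1)[OF v]
 have "ennreal (near p 0 v v) = (\<integral>\<^sub>+z. ennreal (\<bar>incr v z\<bar> powr p * kn 0 z))"
  by (rule nn_integral_near[OF v, symmetric])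
 also have "\<dots> = (\<integral>\<^sub>+x. \<integral>\<^sub>+y. ennreal (\<bar>v x - v y\<bar> powr p * kn 0 (x, y)))"
  by (subst nn_integral_pair_lborel(1)) auto
 also have "\<dots> = (\<integral>\<^sub>+x. \<integral>\<^sub>+a. ennreal (\<bar>v (x - a) - v x\<bar> powr p) * ennreal (kn 0 (a, 0)))"
 proof (rule nn_integral_cong)
  fix x
  have "(\<integral>\<^sub>+y. ennreal (\<bar>v x - v y\<bar> powr p * kn 0 (x, y))) = (\<integral>\<^sub>+a. ennreal (\<bar>v x - v (x - a)\<bar> powr p * kn 0 (x, x - a)))"
   using nn_integral_lborel_reflect[of "\<lambda>y. ennreal (\<bar>v x - v y\<bar> powr p * kn 0 (x, y))" x] by simp
  also have "\<dots> = (\<integral>\<^sub>+a. ennreal (\<bar>v (x - a) - v x\<bar> powr p) * ennreal (kn 0 (a, 0)))"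
   by (intro nn_integral_cong) (simp add: kn_def abs_minus_commute ennreal_mult)
  finally show "(\<integral>\<^sub>+y. ennreal (\<bar>v x - v y\<bar> powr p * kn 0 (x, y))) = \<dots>" .
 qed
 also have "\<dots> = (\<integral>\<^sub>+z. ennreal (\<bar>v (fst z - snd z) - v (fst z)\<bar> powr p) * ennreal (kn 0 (snd z, 0)))"
  by (subst nn_integral_pair_lborel(1)) auto
 also have "\<dots> = (\<integral>\<^sub>+a. \<integral>\<^sub>+x. ennreal (\<bar>v (x - a) - v x\<bar> powr p) * ennreal (kn 0 (a, 0)))"
  by (subst nn_integral_pair_lborel(2)) auto
 also have "\<dots> = (\<integral>\<^sub>+a. trans_diff p v a * ennreal (kn 0 (a, 0)))"
  by (simp add: trans_diff_def nn_integral_multc)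
 finally show ?thesis ..
qed

text \<open>Membership in \<open>X\<close> itself yields the continuity of translations in \<open>L\<^sup>p\<close>: average the
 triangle inequality over the intermediate translation.\<close>

lemma trans_diff_tendsto:
 fixes v :: "'a::euclidean_space \<Rightarrow> real"
 assumes p: "0 < p" and v: "v \<in> Xe p \<Omega> (0::real)" and \<epsilon>: "0 < \<epsilon>"
 obtains r where "0 < r" "\<And>a. norm a \<le> r \<Longrightarrow> trans_diff p v a \<le> ennreal \<epsilon>"
proof -
 note vm[measurable] = XeD(1)[OF v]
 have tm[measurable]: "trans_diff p v \<in> borel_measurable borel" by (rule trans_diff_measurable[OF vm])
 have bm[measurable]: "ball (0::'a) r \<in> sets borel" for r by simp
 let ?\<omega> = "unit_ball_vol (real DIM('a))"
 have \<omega>: "0 < ?\<omega>" by simp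
 \<comment> \<open>The integral over a shrinking ball of a function with finite integral, hence a
   quantity that tends to \<open>0\<close>.\<close>
 define T where "T r = (\<integral>\<^sub>+a. indicator (ball 0 r) a * (trans_diff p v a * ennreal (kn 0 (a, 0))))" for r
 \<comment> \<open>\<open>2 powr p * 2\<close> comes from the two terms of the triangle inequality.
   \<open>2 ^ DIM('a) / ?\<omega>\<close> compares \<open>(2 * r) ^ DIM('a)\<close>, the bound for
   the inverse of the kernel on the doubled ball, with the volume of the ball of radius
   \<open>r\<close> over which the average is taken.\<close>
 define C where "C = 2 powr p * 2 * 2 ^ DIM('a) / ?\<omega>"
 have key: "trans_diff p v a \<le> ennreal C * T (2 * r)" if r: "0 < r" "2 * r \<le> 1" and a: "norm a \<le> r" for a r
 proof -
  have in2: "(\<integral>\<^sub>+b. indicator (ball 0 r) b * trans_diff p v b) \<le> (\<integral>\<^sub>+b. indicator (ball 0 (2 * r)) b * trans_diff p v b)"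
   using r by (intro nn_integral_mono) (auto simp: indicator_def)
  have in1: "(\<integral>\<^sub>+b. indicator (ball 0 r) b * trans_diff p v (a - b)) \<le> (\<integral>\<^sub>+b. indicator (ball 0 (2 * r)) b * trans_diff p v b)"
  proof -
   have "(\<integral>\<^sub>+b. indicator (ball 0 r) b * trans_diff p v (a - b)) \<le> (\<integral>\<^sub>+b. indicator (ball 0 (2 * r)) (a - b) * trans_diff p v (a - b))"
   proof (rule nn_integral_mono)
    fix b
    have "norm (a - b) < 2 * r" if "norm b < r" using norm_triangle_ineq4[of a b] that a by linarith
    then show "indicator (ball 0 r) b * trans_diff p v (a - b) \<le> indicator (ball 0 (2 * r)) (a - b) * trans_diff p v (a - b)"
     by (auto simp: indicator_def)
   qed
   also have "\<dots> = (\<integral>\<^sub>+b. indicator (ball 0 (2 * r)) b * trans_diff p v b)"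
    by (rule nn_integral_lborel_reflect[where f = "\<lambda>b. indicator (ball 0 (2 * r)) b * trans_diff p v b"])
     (intro borel_measurable_times_ennreal borel_measurable_indicator tm bm)
   finally show ?thesis .
  qed
  have inT: "(\<integral>\<^sub>+b. indicator (ball 0 (2 * r)) b * trans_diff p v b) \<le> ennreal ((2 * r) ^ DIM('a)) * T (2 * r)"
  proof -
   have "(\<integral>\<^sub>+b. indicator (ball 0 (2 * r)) b * trans_diff p v b)
    \<le> (\<integral>\<^sub>+b. ennreal ((2 * r) ^ DIM('a)) * (indicator (ball 0 (2 * r)) b * (trans_diff p v b * ennreal (kn 0 (b, 0)))))"
   proof (rule nn_integral_mono_AE)
    have "AE b in lborel. b \<noteq> (0::'a)" by (rule AE_lborel_singleton)
    then show "AE b in lborel. indicator (ball 0 (2 * r)) b * trans_diff p v b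
     \<le> ennreal ((2 * r) ^ DIM('a)) * (indicator (ball 0 (2 * r)) b * (trans_diff p v b * ennreal (kn 0 (b, 0))))"
    proof eventually_elim
     case (elim b)
     show ?case
     proof (cases "norm b < 2 * r")
      case True
      have b: "0 < norm b" "norm b \<le> 1" using elim True r by auto
      have "1 \<le> (2 * r) ^ DIM('a) * kn 0 (b, 0)"
      proof -
       have "norm b ^ DIM('a) \<le> (2 * r) ^ DIM('a)" using True by (intro power_mono) auto
       moreover have "kn 0 (b, 0) = 1 / norm b ^ DIM('a)"
        using b by (simp add: kn_def powr_minus powr_realpow divide_inverse)
       ultimately show ?thesis using b by simp
      qed
      then have "1 \<le> ennreal ((2 * r) ^ DIM('a)) * ennreal (kn 0 (b, 0))"
       using r by (subst ennreal_mult[symmetric]) (auto simp: ennreal_1[symmetric] simp del: ennreal_1 intro!: ennreal_leI)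
      then have "1 * trans_diff p v b \<le> (ennreal ((2 * r) ^ DIM('a)) * ennreal (kn 0 (b, 0))) * trans_diff p v b"
       by (rule mult_right_mono) simp
      then show ?thesis using True by (simp add: mult_ac)
     qed simp
    qed
   qed
   also have "\<dots> = ennreal ((2 * r) ^ DIM('a)) * T (2 * r)" unfolding T_def by (rule nn_integral_cmult) measurable
   finally show ?thesis .
  qed
  have "ennreal (?\<omega> * r ^ DIM('a)) * trans_diff p v a = (\<integral>\<^sub>+b. indicator (ball 0 r) (b::'a) * trans_diff p v a)"
   using r by (simp add: nn_integral_multc emeasure_ball)
  also have "\<dots> \<le> (\<integral>\<^sub>+b. ennreal (2 powr p) * (indicator (ball 0 r) b * trans_diff p v (a - b) + indicator (ball 0 r) b * trans_diff p v b))"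
   using trans_diff_triangle[OF p XeD(1)[OF v], of a] by (intro nn_integral_mono) (auto simp: indicator_def)
  also have "\<dots> = ennreal (2 powr p) * ((\<integral>\<^sub>+b. indicator (ball 0 r) b * trans_diff p v (a - b)) + (\<integral>\<^sub>+b. indicator (ball 0 r) b * trans_diff p v b))"
   by (simp add: nn_integral_cmult nn_integral_add)
  also have "\<dots> \<le> ennreal (2 powr p) * (ennreal ((2 * r) ^ DIM('a)) * T (2 * r) + ennreal ((2 * r) ^ DIM('a)) * T (2 * r))"
   by (intro mult_left_mono add_mono order_trans[OF in1 inT] order_trans[OF in2 inT]) auto
  also have "\<dots> = ennreal (2 powr p * 2 * (2 * r) ^ DIM('a)) * T (2 * r)"
   using r by (simp add: ennreal_mult mult_2[symmetric] mult.assoc)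
  finally have m: "ennreal (?\<omega> * r ^ DIM('a)) * trans_diff p v a \<le> ennreal (2 powr p * 2 * (2 * r) ^ DIM('a)) * T (2 * r)" .
  have rN: "0 < ?\<omega> * r ^ DIM('a)" using r \<omega> by simp
  have "trans_diff p v a = ennreal (1 / (?\<omega> * r ^ DIM('a))) * (ennreal (?\<omega> * r ^ DIM('a)) * trans_diff p v a)"
  proof -
   have "x = ennreal (1 / q) * (ennreal q * x)" if "0 < q" for q :: real and x
    using that by (simp add: mult.assoc[symmetric] ennreal_mult[symmetric])
   from this[OF rN] show ?thesis .
  qed
  also have "\<dots> \<le> ennreal (1 / (?\<omega> * r ^ DIM('a))) * (ennreal (2 powr p * 2 * (2 * r) ^ DIM('a)) * T (2 * r))"
   by (rule mult_left_mono[OF m]) simp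
  also have "\<dots> = ennreal (1 / (?\<omega> * r ^ DIM('a)) * (2 powr p * 2 * (2 * r) ^ DIM('a))) * T (2 * r)"
  proof -
   have "ennreal a * (ennreal b * x) = ennreal (a * b) * x" if "0 \<le> a" "0 \<le> b" for a b :: real and x
    using that by (simp add: ennreal_mult mult.assoc)
   then show ?thesis using rN r by simp
  qed
  also have "1 / (?\<omega> * r ^ DIM('a)) * (2 powr p * 2 * (2 * r) ^ DIM('a)) = C"
   using r by (simp add: C_def power_mult_distrib)
  finally show ?thesis .
 qed
 have fin: "(\<integral>\<^sub>+a. trans_diff p v a * ennreal (kn 0 (a, 0))) < \<infinity>"
  unfolding near_as_trans_diff[OF v] by simp
 have "(\<lambda>n. T (1 / real (Suc n))) \<longlonglongrightarrow> (\<integral>\<^sup>+a. 0 \<partial>(lborel::'a measure))"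
  unfolding T_def
 proof (rule nn_integral_dominated_convergence[where w = "\<lambda>a. trans_diff p v a * ennreal (kn 0 (a, 0))"])
  show "AE a in lborel. indicator (ball 0 (1 / real (Suc n))) a * (trans_diff p v a * ennreal (kn 0 (a, 0))) \<le> trans_diff p v a * ennreal (kn 0 (a, 0))" for n
   by (intro AE_I2) (auto simp: indicator_def)
  have "AE b in lborel. b \<noteq> (0::'a)" by (rule AE_lborel_singleton)
  then show "AE a in lborel. (\<lambda>n. indicator (ball 0 (1 / real (Suc n))) a * (trans_diff p v a * ennreal (kn 0 (a, 0)))) \<longlonglongrightarrow> 0"
  proof eventually_elim
   case (elim a)
   have "(\<lambda>n. 1 / real (Suc n)) \<longlonglongrightarrow> 0" by (rule LIMSEQ_Suc[OF lim_1_over_n])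
   then have "eventually (\<lambda>n. 1 / real (Suc n) < norm a) sequentially" using elim by (intro order_tendstoD) auto
   then have "eventually (\<lambda>n. indicator (ball 0 (1 / real (Suc n))) a * (trans_diff p v a * ennreal (kn 0 (a, 0))) = 0) sequentially"
    by eventually_elim simp
   then show ?case by (rule tendsto_eventually)
  qed
 qed (use fin in measurable)
 then have "(\<lambda>n. T (1 / real (Suc n))) \<longlonglongrightarrow> 0" by simp
 then have "(\<lambda>n. ennreal C * T (1 / real (Suc n))) \<longlonglongrightarrow> ennreal C * 0" by (intro ennreal_tendsto_cmult) auto
 then have "eventually (\<lambda>n. ennreal C * T (1 / real (Suc n)) < ennreal \<epsilon>) sequentially"
  using \<epsilon> by (intro order_tendstoD(2)) auto
 then obtain n where n: "ennreal C * T (1 / real (Suc n)) < ennreal \<epsilon>" by (auto simp: eventually_sequentially)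
 define r where "r = 1 / real (Suc n) / 2"
 have r: "0 < r" "2 * r \<le> 1" "2 * r = 1 / real (Suc n)" by (auto simp: r_def simp del: of_nat_Suc)
 show ?thesis
 proof (rule that[OF r(1)])
  fix a :: 'a assume "norm a \<le> r"
  from key[OF r(1,2) this] n show "trans_diff p v a \<le> ennreal \<epsilon>" unfolding r(3) by simp
 qed
qed

text \<open>Convexity at the points \<open>a / (1 - d)\<close> and \<open>b / d\<close>. Unlike the
  crude factor \<open>2 powr p\<close>, the factor of \<open>\<bar>a\<bar> powr p\<close> tends to
  \<open>1\<close> as \<open>d \<rightarrow> 0\<close>, so that a small remainder \<open>b\<close>
  hardly changes the main term. Recovery of the energy depends on this.\<close>

lemma abs_add_powr_le_weighted:
 fixes a b :: real
 assumes p: "1 < p" and d: "0 < d" "d < 1"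
 shows "\<bar>a + b\<bar> powr p \<le> (1 - d) powr (1 - p) * \<bar>a\<bar> powr p + d powr (1 - p) * \<bar>b\<bar> powr p"
proof -
 have "\<bar>(1 - d) *\<^sub>R (a / (1 - d)) + d *\<^sub>R (b / d)\<bar> powr p \<le> (1 - d) * \<bar>a / (1 - d)\<bar> powr p + d * \<bar>b / d\<bar> powr p"
  using convex_onD[OF convex_on_abs_powr[OF p], of d "a / (1 - d)" "b / d"] d by auto
 moreover have "e * \<bar>c / e\<bar> powr p = e powr (1 - p) * \<bar>c\<bar> powr p" if "0 < e" for e c :: real
  using that by (simp add: powr_divide powr_diff)
 ultimately show ?thesis using d by simp
qed

lemma sum_powr_le:
 fixes a :: "'i \<Rightarrow> real"
 assumes "finite J" "0 < p" and a: "\<And>i. i \<in> J \<Longrightarrow> 0 \<le> a i"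
 shows "(\<Sum>i\<in>J. a i) powr p \<le> real (card J) powr p * (\<Sum>i\<in>J. a i powr p)"
proof (cases "J = {}")
 case False
 define m where "m = Max (a ` J)"
 have m: "m \<in> a ` J" "\<And>i. i \<in> J \<Longrightarrow> a i \<le> m" using assms(1) False by (auto simp: m_def intro!: Max_in)
 then obtain j where j: "j \<in> J" "m = a j" by auto
 have "(\<Sum>i\<in>J. a i) \<le> real (card J) * m" using m(2) by (rule sum_bounded_above)
 then have "(\<Sum>i\<in>J. a i) powr p \<le> (real (card J) * m) powr p" using a assms(2) by (intro powr_mono2) (auto intro: sum_nonneg)
 also have "\<dots> = real (card J) powr p * a j powr p" using j a by (simp add: powr_mult)
 also have "a j powr p \<le> (\<Sum>i\<in>J. a i powr p)" using j assms(1) by (intro member_le_sum) auto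
 finally show ?thesis by (simp add: mult_left_mono)
qed simp

text \<open>Averages inherit every bound shared by the members of the family on which
  \<open>\<eta>\<close> does not vanish. It serves twice: with \<open>k = 1\<close> for the distance
  in the \<open>p\<close>-th mean, and on pairs with \<open>k = kn 0\<close> for the
  seminorm.\<close>

lemma jensen_average:
 fixes F :: "'c::euclidean_space \<Rightarrow> 'a::euclidean_space \<Rightarrow> real" and \<eta> :: "'a \<Rightarrow> real"
 assumes p: "1 < p" and [measurable]: "(\<lambda>x. F (fst x) (snd x)) \<in> borel_measurable borel" "\<eta> \<in> borel_measurable borel" "k \<in> borel_measurable borel"
  and \<eta>: "\<And>z. 0 \<le> \<eta> z" "integrable lborel \<eta>" "(LBINT z. \<eta> z) = 1"
  and F: "\<And>c z. \<bar>F c z\<bar> \<le> K" and k: "\<And>c. 0 \<le> k c"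
  and B: "\<And>z. \<eta> z \<noteq> 0 \<Longrightarrow> (\<integral>\<^sub>+c. ennreal (\<bar>F c z\<bar> powr p * k c)) \<le> B"
 shows "(\<integral>\<^sub>+c. ennreal (\<bar>LBINT z. \<eta> z * F c z\<bar> powr p * k c)) \<le> B"
proof -
 have [measurable]: "(\<lambda>z. F c z) \<in> borel_measurable borel" for c
 proof -
  have "(\<lambda>x. F (fst x) (snd x)) \<circ> Pair c \<in> borel_measurable borel" by (intro measurable_comp[of _ _ borel]) measurable
  then show ?thesis by (simp add: comp_def)
 qed
 have "(\<integral>\<^sub>+c. ennreal (\<bar>LBINT z. \<eta> z * F c z\<bar> powr p * k c))
   \<le> (\<integral>\<^sub>+c. \<integral>\<^sub>+z. ennreal (\<eta> z) * ennreal (\<bar>F c z\<bar> powr p * k c))"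
 proof (rule nn_integral_mono)
  fix c
  have i: "integrable lborel (\<lambda>z. \<eta> z * F c z)"
   by (rule integrable_dominated[OF integrable_mult_right[OF \<eta>(2), of K]])
     (measurable, use F \<eta>(1) in \<open>simp add: abs_mult mult.commute[of K] mult_left_mono\<close>)
  have "ennreal (\<bar>LBINT z. \<eta> z * F c z\<bar> powr p * k c) = ennreal (\<bar>LBINT z. \<eta> z * F c z\<bar> powr p) * ennreal (k c)"
   using k by (intro ennreal_mult) auto
  also have "\<dots> \<le> (\<integral>\<^sub>+z. ennreal (\<eta> z * \<bar>F c z\<bar> powr p)) * ennreal (k c)"
   using \<eta> by (intro mult_right_mono jensen_abs_powr p i) auto
  also have "\<dots> = (\<integral>\<^sub>+z. ennreal (\<eta> z * \<bar>F c z\<bar> powr p) * ennreal (k c))"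
   by (rule nn_integral_multc[symmetric]) measurable
  also have "\<dots> = (\<integral>\<^sub>+z. ennreal (\<eta> z) * ennreal (\<bar>F c z\<bar> powr p * k c))"
   using \<eta>(1) k by (intro nn_integral_cong) (simp add: ennreal_mult mult.assoc)
  finally show "ennreal (\<bar>LBINT z. \<eta> z * F c z\<bar> powr p * k c) \<le> \<dots>" .
 qed
 also have "\<dots> = (\<integral>\<^sub>+x. ennreal (\<eta> (snd x)) * ennreal (\<bar>F (fst x) (snd x)\<bar> powr p * k (fst x)))"
  by (subst nn_integral_pair_lborel(1)) auto
 also have "\<dots> = (\<integral>\<^sub>+z. \<integral>\<^sub>+c. ennreal (\<eta> z) * ennreal (\<bar>F c z\<bar> powr p * k c))"
  by (subst nn_integral_pair_lborel(2)) auto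
 also have "\<dots> \<le> (\<integral>\<^sub>+z. ennreal (\<eta> z) * B)"
 proof (rule nn_integral_mono)
  fix z
  have [measurable]: "(\<lambda>c. F c z) \<in> borel_measurable borel"
  proof -
   have "(\<lambda>x. F (fst x) (snd x)) \<circ> (\<lambda>c. (c, z)) \<in> borel_measurable borel" by (intro measurable_comp[of _ _ borel]) measurable
   then show ?thesis by (simp add: comp_def)
  qed
  have "(\<integral>\<^sub>+c. ennreal (\<eta> z) * ennreal (\<bar>F c z\<bar> powr p * k c)) = ennreal (\<eta> z) * (\<integral>\<^sub>+c. ennreal (\<bar>F c z\<bar> powr p * k c))"
   by (rule nn_integral_cmult) measurable
  also have "\<dots> \<le> ennreal (\<eta> z) * B"
   using B[of z] by (cases "\<eta> z = 0") (auto intro: mult_left_mono)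
  finally show "(\<integral>\<^sub>+c. ennreal (\<eta> z) * ennreal (\<bar>F c z\<bar> powr p * k c)) \<le> ennreal (\<eta> z) * B" .
 qed
 also have "\<dots> = (\<integral>\<^sub>+z. ennreal (\<eta> z)) * B" by (rule nn_integral_multc) measurable
 also have "(\<integral>\<^sub>+z. ennreal (\<eta> z)) = 1"
  using \<eta> by (subst nn_integral_eq_integral) auto
 finally show ?thesis by simp
qed

text \<open>Locally translated copies of \<open>v\<close> are glued by a partition of unity \<open>\<phi>\<close>; the remaining weight
 \<open>1 - (\<Sum>i\<in>J. \<phi> i x)\<close> lives outside \<open>\<Omega>\<close>, where \<open>v\<close> vanishes.\<close>

locale gluing =
 fixes p L :: real and \<Omega> :: "'a::euclidean_space set" and J :: "'i set" and \<phi> :: "'i \<Rightarrow> 'a \<Rightarrow> real" and v :: "'a \<Rightarrow> real"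
 assumes p: "1 < p" and J: "finite J"
  and \<phi>: "\<And>i x. i \<in> J \<Longrightarrow> 0 \<le> \<phi> i x" "\<And>i x y. i \<in> J \<Longrightarrow> \<bar>\<phi> i x - \<phi> i y\<bar> \<le> L * norm (x - y)"
   "\<And>x. (\<Sum>i\<in>J. \<phi> i x) \<le> 1" "\<And>x. x \<in> \<Omega> \<Longrightarrow> (\<Sum>i\<in>J. \<phi> i x) = 1"
  and v: "v \<in> Xe p \<Omega> 0" and L: "0 \<le> L"
begin

lemma v_measurable [measurable]: "v \<in> borel_measurable borel" by (rule XeD(1)[OF v])

lemma phi_measurable: "i \<in> J \<Longrightarrow> \<phi> i \<in> borel_measurable borel"
proof -
 assume i: "i \<in> J"
 have "L-lipschitz_on UNIV (\<phi> i)"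
  by (rule lipschitz_onI) (use \<phi>(2)[OF i] L in \<open>auto simp: dist_real_def dist_norm\<close>)
 then show ?thesis by (intro borel_measurable_continuous_onI lipschitz_on_continuous_on)
qed

definition glue :: "('i \<Rightarrow> 'a) \<Rightarrow> 'a \<Rightarrow> real" where
 "glue a x = (\<Sum>i\<in>J. \<phi> i x * v (x - a i))"

lemma v_eq: "v x = (\<Sum>i\<in>J. \<phi> i x * v x)"
 using \<phi>(4)[of x] XeD(2)[OF v, of x] by (cases "x \<in> \<Omega>") (auto simp flip: sum_distrib_right)

lemma phi_le_1: "i \<in> J \<Longrightarrow> \<phi> i x \<le> 1"
 by (rule order_trans[OF member_le_sum \<phi>(3)]) (use J \<phi>(1) in auto)

lemma glue_diff_bound:
 assumes "\<And>i. i \<in> J \<Longrightarrow> trans_diff p v (a i) \<le> ennreal \<epsilon>" "0 \<le> \<epsilon>"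
 shows "(\<integral>\<^sub>+x. ennreal (\<bar>glue a x - v x\<bar> powr p)) \<le> ennreal (real (card J) powr p * (real (card J) * \<epsilon>))"
proof -
 have "(\<integral>\<^sub>+x. ennreal (\<bar>glue a x - v x\<bar> powr p))
   \<le> (\<integral>\<^sub>+x. ennreal (real (card J) powr p) * (\<Sum>i\<in>J. ennreal (\<bar>v (x - a i) - v x\<bar> powr p)))"
 proof (rule nn_integral_mono)
  fix x
  have "glue a x - v x = (\<Sum>i\<in>J. \<phi> i x * (v (x - a i) - v x))"
   unfolding glue_def by (subst v_eq) (simp add: right_diff_distrib sum_subtractf)
  then have "\<bar>glue a x - v x\<bar> \<le> (\<Sum>i\<in>J. \<bar>\<phi> i x * (v (x - a i) - v x)\<bar>)" by (simp add: sum_abs)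
  also have "\<dots> \<le> (\<Sum>i\<in>J. \<bar>v (x - a i) - v x\<bar>)"
   using \<phi>(1) phi_le_1 by (intro sum_mono) (simp add: abs_mult mult_left_le_one_le)
  finally have "\<bar>glue a x - v x\<bar> powr p \<le> (\<Sum>i\<in>J. \<bar>v (x - a i) - v x\<bar>) powr p" using p by (intro powr_mono2) auto
  also have "\<dots> \<le> real (card J) powr p * (\<Sum>i\<in>J. \<bar>v (x - a i) - v x\<bar> powr p)" using p J by (intro sum_powr_le) auto
  finally have "ennreal (\<bar>glue a x - v x\<bar> powr p) \<le> ennreal (real (card J) powr p * (\<Sum>i\<in>J. \<bar>v (x - a i) - v x\<bar> powr p))" by (rule ennreal_leI)
  then show "ennreal (\<bar>glue a x - v x\<bar> powr p) \<le> ennreal (real (card J) powr p) * (\<Sum>i\<in>J. ennreal (\<bar>v (x - a i) - v x\<bar> powr p))"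
   by (simp add: ennreal_mult sum_nonneg sum_ennreal)
 qed
 also have "\<dots> = ennreal (real (card J) powr p) * (\<Sum>i\<in>J. trans_diff p v (a i))"
  by (simp add: nn_integral_cmult nn_integral_sum trans_diff_def del: sum_ennreal)
 also have "\<dots> \<le> ennreal (real (card J) powr p) * (\<Sum>i\<in>J. ennreal \<epsilon>)"
  using assms(1) by (intro mult_left_mono sum_mono) auto
 also have "\<dots> = ennreal (real (card J) powr p * (real (card J) * \<epsilon>))"
  using assms(2) by (simp add: ennreal_mult ennreal_of_nat_eq_real_of_nat)
 finally show ?thesis .
qed

text \<open>The kernel depends on differences only, so a common translation of both points can be
  moved from \<open>v\<close> to the weight \<open>\<phi> i\<close>, where by the Lipschitz bound it
  costs at most \<open>L * norm a\<close>.\<close>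

lemma shift_pair:
 assumes i: "i \<in> J"
 shows "(\<integral>\<^sub>+z. ennreal (\<phi> i (fst z) * (\<bar>v (fst z - a) - v (snd z - a)\<bar> powr p * kn 0 z)))
  = (\<integral>\<^sub>+z. ennreal (\<phi> i (a + fst z) * (\<bar>incr v z\<bar> powr p * kn 0 z)))"
proof -
 note [measurable] = phi_measurable[OF i]
 have "kn 0 ((a, a) + z) = kn 0 z" for z :: "'a \<times> 'a" by (simp add: kn_def)
 then show ?thesis
  using nn_integral_lborel_shift[of "\<lambda>z. ennreal (\<phi> i (fst z) * (\<bar>v (fst z - a) - v (snd z - a)\<bar> powr p * kn 0 z))" "(a, a)"]
  by simp
qed

text \<open>An increment of \<open>glue a\<close> is \<open>P + R\<close>, where \<open>P\<close> is
  a convex combination of increments of translated copies and \<open>R\<close> collects the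
  increments of the weights. Convexity and translation invariance give \<open>P\<close> nearly the
  energy of \<open>v\<close>. In \<open>R\<close> the Lipschitz weights lower the order of the
  kernel to \<open>- p\<close>, so that only translation differences remain. The parameter
  \<open>d\<close> joins the two with a factor near \<open>1\<close> on \<open>P\<close>.\<close>

lemma glue_near_bound:
 assumes a: "\<And>i. i \<in> J \<Longrightarrow> trans_diff p v (a i) \<le> ennreal \<epsilon>" "0 \<le> \<epsilon>" "\<And>i. i \<in> J \<Longrightarrow> norm (a i) \<le> r"
  and d: "0 < d" "d < 1"
  and c0: "0 \<le> c0" "\<And>x::'a. (\<integral>\<^sub>+y. ennreal (kn (- p) (x, y))) = ennreal c0"
 shows "(\<integral>\<^sub>+z. ennreal (\<bar>incr (glue a) z\<bar> powr p * kn 0 z))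
  \<le> ennreal ((1 - d) powr (1 - p) * ((1 + real (card J) * (L * r)) * near p 0 v v)
     + d powr (1 - p) * (L powr p * (real (card J) powr p * (real (card J) * (\<epsilon> * c0)))))"
proof -
 let ?m = "real (card J)"
 let ?V = "\<lambda>z. \<bar>incr v z\<bar> powr p * kn 0 z"
 \<comment> \<open>Where the leftover weight is nonzero, \<open>v (fst z)\<close> is
   \<open>0\<close>. Keeping the full increment of \<open>v\<close> in this term makes the weights
   add up to \<open>1\<close>, as the convexity argument needs.\<close>
 define P where "P z = (\<Sum>i\<in>J. \<phi> i (fst z) * (v (fst z - a i) - v (snd z - a i))) + (1 - (\<Sum>i\<in>J. \<phi> i (fst z))) * (incr v z)" for z
 define R where "R z = (\<Sum>i\<in>J. (\<phi> i (fst z) - \<phi> i (snd z)) * (v (snd z - a i) - v (snd z)))" for z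
 note [measurable] = phi_measurable
 have split: "glue a (fst z) - glue a (snd z) = P z + R z" for z
 proof -
  define x where "x = fst z"
  define y where "y = snd z"
  have vx: "(1 - (\<Sum>i\<in>J. \<phi> i x)) * v x = 0" using v_eq[of x] by (simp add: left_diff_distrib sum_distrib_right)
  have vy: "(\<Sum>i\<in>J. \<phi> i y) * v y = v y" using v_eq[of y] by (simp add: sum_distrib_right)
  have "P z = glue a x - (\<Sum>i\<in>J. \<phi> i x * v (y - a i)) - v y + (\<Sum>i\<in>J. \<phi> i x) * v y"
   using vx unfolding P_def glue_def x_def y_def by (simp add: right_diff_distrib left_diff_distrib sum_subtractf)
  moreover have "R z = (\<Sum>i\<in>J. \<phi> i x * v (y - a i)) - glue a y - (\<Sum>i\<in>J. \<phi> i x) * v y + (\<Sum>i\<in>J. \<phi> i y) * v y"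
   unfolding R_def glue_def x_def y_def by (simp add: right_diff_distrib left_diff_distrib sum_subtractf sum_distrib_right)
  ultimately show ?thesis using vy by (simp add: x_def y_def)
 qed
 have Pb: "\<bar>P z\<bar> powr p \<le> (\<Sum>i\<in>J. \<phi> i (fst z) * \<bar>v (fst z - a i) - v (snd z - a i)\<bar> powr p) + (1 - (\<Sum>i\<in>J. \<phi> i (fst z))) * \<bar>incr v z\<bar> powr p" for z
 proof -
  \<comment> \<open>The extra index \<open>None\<close> carries the leftover weight.\<close>
  let ?S = "insert None (Some ` J)"
  define w where "w o' = (case o' of None \<Rightarrow> 1 - (\<Sum>i\<in>J. \<phi> i (fst z)) | Some i \<Rightarrow> \<phi> i (fst z))" for o'
  define y where "y o' = (case o' of None \<Rightarrow> incr v z | Some i \<Rightarrow> v (fst z - a i) - v (snd z - a i))" for o'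
  have sums: "(\<Sum>o'\<in>?S. g o') = g None + (\<Sum>i\<in>J. g (Some i))" for g :: "'i option \<Rightarrow> real"
   using J by (subst sum.insert) (auto simp: sum.reindex)
  have "\<bar>\<Sum>o'\<in>?S. w o' *\<^sub>R y o'\<bar> powr p \<le> (\<Sum>o'\<in>?S. w o' * \<bar>y o'\<bar> powr p)"
   using J \<phi>(1,3) by (intro convex_on_sum[OF _ _ convex_on_abs_powr[OF p]]) (auto simp: sums w_def)
  then show ?thesis unfolding sums by (simp add: w_def y_def P_def add.commute)
 qed
 have Rb: "\<bar>R z\<bar> powr p \<le> (L powr p * ?m powr p) * (\<Sum>i\<in>J. norm (fst z - snd z) powr p * \<bar>v (snd z - a i) - v (snd z)\<bar> powr p)" for z
 proof -
  let ?n = "norm (fst z - snd z)"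
  have "\<bar>R z\<bar> \<le> (\<Sum>i\<in>J. \<bar>(\<phi> i (fst z) - \<phi> i (snd z)) * (v (snd z - a i) - v (snd z))\<bar>)" unfolding R_def by (rule sum_abs)
  also have "\<dots> \<le> (\<Sum>i\<in>J. L * ?n * \<bar>v (snd z - a i) - v (snd z)\<bar>)"
   using \<phi>(2) by (intro sum_mono) (simp add: abs_mult mult_right_mono)
  finally have "\<bar>R z\<bar> powr p \<le> (\<Sum>i\<in>J. L * ?n * \<bar>v (snd z - a i) - v (snd z)\<bar>) powr p" using p by (intro powr_mono2) auto
  also have "\<dots> \<le> ?m powr p * (\<Sum>i\<in>J. (L * ?n * \<bar>v (snd z - a i) - v (snd z)\<bar>) powr p)" using p J L by (intro sum_powr_le) auto
  also have "\<dots> = (L powr p * ?m powr p) * (\<Sum>i\<in>J. ?n powr p * \<bar>v (snd z - a i) - v (snd z)\<bar> powr p)"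
   using L by (simp add: powr_mult sum_distrib_left mult_ac)
  finally show ?thesis .
 qed
 have P_int: "(\<integral>\<^sub>+z. ennreal (\<bar>P z\<bar> powr p * kn 0 z)) \<le> ennreal ((1 + ?m * (L * r)) * near p 0 v v)"
 proof -
  let ?E = "\<lambda>z. 1 - (\<Sum>i\<in>J. \<phi> i (fst z))"
  have "(\<integral>\<^sub>+z. ennreal (\<bar>P z\<bar> powr p * kn 0 z))
    \<le> (\<integral>\<^sub>+z. (\<Sum>i\<in>J. ennreal (\<phi> i (fst z) * (\<bar>v (fst z - a i) - v (snd z - a i)\<bar> powr p * kn 0 z))) + ennreal (?E z * ?V z))"
  proof (rule nn_integral_mono)
   fix z
   have "\<bar>P z\<bar> powr p * kn 0 z \<le> (\<Sum>i\<in>J. \<phi> i (fst z) * (\<bar>v (fst z - a i) - v (snd z - a i)\<bar> powr p * kn 0 z)) + ?E z * ?V z"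
    using mult_right_mono[OF Pb[of z] kn_nonneg[of 0 z]] by (simp add: distrib_right sum_distrib_right mult.assoc)
   then have "ennreal (\<bar>P z\<bar> powr p * kn 0 z) \<le> ennreal ((\<Sum>i\<in>J. \<phi> i (fst z) * (\<bar>v (fst z - a i) - v (snd z - a i)\<bar> powr p * kn 0 z)) + ?E z * ?V z)"
    by (rule ennreal_leI)
   also have "\<dots> = (\<Sum>i\<in>J. ennreal (\<phi> i (fst z) * (\<bar>v (fst z - a i) - v (snd z - a i)\<bar> powr p * kn 0 z))) + ennreal (?E z * ?V z)"
    using \<phi>(1,3) by (subst ennreal_plus) (auto intro!: sum_nonneg mult_nonneg_nonneg simp del: ennreal_mult'' simp flip: sum_ennreal)
   finally show "ennreal (\<bar>P z\<bar> powr p * kn 0 z) \<le> \<dots>" .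
  qed
  also have "\<dots> = (\<Sum>i\<in>J. \<integral>\<^sup>+z. ennreal (\<phi> i (fst z) * (\<bar>v (fst z - a i) - v (snd z - a i)\<bar> powr p * kn 0 z)) \<partial>lborel) + (\<integral>\<^sub>+z. ennreal (?E z * ?V z))"
   by (subst nn_integral_add) (auto intro!: nn_integral_sum)
  also have "(\<Sum>i\<in>J. \<integral>\<^sup>+z. ennreal (\<phi> i (fst z) * (\<bar>v (fst z - a i) - v (snd z - a i)\<bar> powr p * kn 0 z)) \<partial>lborel)
    = (\<Sum>i\<in>J. \<integral>\<^sup>+z. ennreal (\<phi> i (a i + fst z) * ?V z) \<partial>lborel)"
   by (intro sum.cong refl shift_pair)
  also have "\<dots> + (\<integral>\<^sub>+z. ennreal (?E z * ?V z)) = (\<integral>\<^sub>+z. (\<Sum>i\<in>J. ennreal (\<phi> i (a i + fst z) * ?V z)) + ennreal (?E z * ?V z))"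
   by (subst nn_integral_add) (auto intro!: nn_integral_sum[symmetric])
  also have "\<dots> \<le> (\<integral>\<^sub>+z. ennreal ((1 + ?m * (L * r)) * ?V z))"
  proof (rule nn_integral_mono)
   fix z
   have V0: "0 \<le> ?V z" by simp
   have "(\<Sum>i\<in>J. ennreal (\<phi> i (a i + fst z) * ?V z)) + ennreal (?E z * ?V z) = ennreal ((\<Sum>i\<in>J. \<phi> i (a i + fst z) * ?V z) + ?E z * ?V z)"
    using \<phi>(1,3) by (subst ennreal_plus) (auto intro!: sum_nonneg mult_nonneg_nonneg simp del: ennreal_mult'' simp flip: sum_ennreal)
   also have "\<dots> \<le> ennreal ((1 + ?m * (L * r)) * ?V z)"
   proof (rule ennreal_leI)
    have "(\<Sum>i\<in>J. \<phi> i (a i + fst z)) \<le> (\<Sum>i\<in>J. \<phi> i (fst z) + L * r)"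
    proof (rule sum_mono)
     fix i assume i: "i \<in> J"
     have "\<phi> i (a i + fst z) - \<phi> i (fst z) \<le> L * norm (a i)" using \<phi>(2)[OF i, of "a i + fst z" "fst z"] by simp
     also have "\<dots> \<le> L * r" using a(3)[OF i] L by (intro mult_left_mono)
     finally show "\<phi> i (a i + fst z) \<le> \<phi> i (fst z) + L * r" by simp
    qed
    then have "(\<Sum>i\<in>J. \<phi> i (a i + fst z)) + ?E z \<le> 1 + ?m * (L * r)" by (simp add: sum.distrib)
    from mult_right_mono[OF this V0]
    show "(\<Sum>i\<in>J. \<phi> i (a i + fst z) * ?V z) + ?E z * ?V z \<le> (1 + ?m * (L * r)) * ?V z"
     by (simp only: distrib_right[of _ "?E z"] sum_distrib_right)
   qed
   finally show "(\<Sum>i\<in>J. ennreal (\<phi> i (a i + fst z) * ?V z)) + ennreal (?E z * ?V z) \<le> \<dots>" .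
  qed
  also have "\<dots> = ennreal ((1 + ?m * (L * r)) * near p 0 v v)"
  proof (cases "J = {}")
   case True
   then show ?thesis using nn_integral_near[OF v] by simp
  next
   case False
   then have "0 \<le> r" using a(3) norm_ge_zero order_trans by blast
   then have m0: "0 \<le> 1 + ?m * (L * r)" using L by simp
   have "(\<integral>\<^sub>+z. ennreal ((1 + ?m * (L * r)) * ?V z)) = ennreal (1 + ?m * (L * r)) * (\<integral>\<^sub>+z. ennreal (?V z))"
    using m0 by (subst nn_integral_cmult[symmetric]) (auto simp: ennreal_mult simp del: ennreal_mult'')
   then show ?thesis unfolding nn_integral_near[OF v] using m0 by (simp add: ennreal_mult near_self_nonneg)
  qed
  finally show ?thesis .
 qed
 have R_int: "(\<integral>\<^sub>+z. ennreal (\<bar>R z\<bar> powr p * kn 0 z)) \<le> ennreal (L powr p * (?m powr p * (?m * (\<epsilon> * c0))))"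
 proof -
  have "(\<integral>\<^sub>+z. ennreal (\<bar>R z\<bar> powr p * kn 0 z))
   \<le> (\<integral>\<^sub>+z. ennreal (L powr p * ?m powr p) * (\<Sum>i\<in>J. ennreal (\<bar>v (snd z - a i) - v (snd z)\<bar> powr p) * ennreal (kn (- p) z)))"
  proof (rule nn_integral_mono)
   fix z :: "'a \<times> 'a"
   have w: "norm (fst z - snd z) powr p * kn 0 z = kn (- p) z" using kn_weight[of z p 0] by simp
   have "\<bar>R z\<bar> powr p * kn 0 z \<le> (L powr p * ?m powr p) * (\<Sum>i\<in>J. norm (fst z - snd z) powr p * \<bar>v (snd z - a i) - v (snd z)\<bar> powr p) * kn 0 z"
    by (rule mult_right_mono[OF Rb kn_nonneg])
   also have "\<dots> = (L powr p * ?m powr p) * (\<Sum>i\<in>J. \<bar>v (snd z - a i) - v (snd z)\<bar> powr p * kn (- p) z)"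
    by (simp add: sum_distrib_left sum_distrib_right mult_ac flip: w)
   finally have "ennreal (\<bar>R z\<bar> powr p * kn 0 z) \<le> ennreal ((L powr p * ?m powr p) * (\<Sum>i\<in>J. \<bar>v (snd z - a i) - v (snd z)\<bar> powr p * kn (- p) z))"
    by (rule ennreal_leI)
   also have "\<dots> = ennreal (L powr p * ?m powr p) * (\<Sum>i\<in>J. ennreal (\<bar>v (snd z - a i) - v (snd z)\<bar> powr p * kn (- p) z))"
    by (subst ennreal_mult) (auto intro!: sum_nonneg simp flip: sum_ennreal simp del: ennreal_mult'')
   also have "(\<Sum>i\<in>J. ennreal (\<bar>v (snd z - a i) - v (snd z)\<bar> powr p * kn (- p) z)) = (\<Sum>i\<in>J. ennreal (\<bar>v (snd z - a i) - v (snd z)\<bar> powr p) * ennreal (kn (- p) z))"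
    by (intro sum.cong refl ennreal_mult) auto
   finally show "ennreal (\<bar>R z\<bar> powr p * kn 0 z) \<le> ennreal (L powr p * ?m powr p) * (\<Sum>i\<in>J. ennreal (\<bar>v (snd z - a i) - v (snd z)\<bar> powr p) * ennreal (kn (- p) z))" .
  qed
  also have "\<dots> = ennreal (L powr p * ?m powr p) * (\<Sum>i\<in>J. \<integral>\<^sup>+z. ennreal (\<bar>v (snd z - a i) - v (snd z)\<bar> powr p) * ennreal (kn (- p) z) \<partial>lborel)"
   by (subst nn_integral_cmult) (auto intro!: arg_cong2[where f = "(*)"] nn_integral_sum)
  also have "(\<Sum>i\<in>J. \<integral>\<^sup>+z. ennreal (\<bar>v (snd z - a i) - v (snd z)\<bar> powr p) * ennreal (kn (- p) z) \<partial>lborel) = (\<Sum>i\<in>J. trans_diff p v (a i) * ennreal c0)"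
  proof (intro sum.cong refl)
   fix i
   have "(\<integral>\<^sub>+z. ennreal (\<bar>v (snd z - a i) - v (snd z)\<bar> powr p) * ennreal (kn (- p) z))
    = (\<integral>\<^sub>+y. \<integral>\<^sub>+x. ennreal (\<bar>v (y - a i) - v y\<bar> powr p) * ennreal (kn (- p) (x, y)))"
    by (subst nn_integral_pair_lborel(2)) auto
   also have "\<dots> = trans_diff p v (a i) * ennreal c0"
    unfolding kn_sym[of "- p" _] trans_diff_def
    by (simp add: nn_integral_cmult nn_integral_multc c0(2) kn_sym[of "- p" _ "_::'a", symmetric])
   finally show "(\<integral>\<^sub>+z. ennreal (\<bar>v (snd z - a i) - v (snd z)\<bar> powr p) * ennreal (kn (- p) z)) = trans_diff p v (a i) * ennreal c0" .
  qed
  also have "ennreal (L powr p * ?m powr p) * (\<Sum>i\<in>J. trans_diff p v (a i) * ennreal c0) \<le> ennreal (L powr p * ?m powr p) * (\<Sum>i\<in>J. ennreal \<epsilon> * ennreal c0)"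
   using a(1) by (intro mult_left_mono sum_mono mult_right_mono) auto
  also have "\<dots> = ennreal (L powr p * (?m powr p * (?m * (\<epsilon> * c0))))"
   using a(2) c0(1) by (simp add: ennreal_mult ennreal_of_nat_eq_real_of_nat mult_ac)
  finally show ?thesis .
 qed
 have PRm[measurable]: "P \<in> borel_measurable borel" "R \<in> borel_measurable borel" unfolding P_def R_def by measurable
 have "(\<integral>\<^sub>+z. ennreal (\<bar>incr (glue a) z\<bar> powr p * kn 0 z))
  \<le> (\<integral>\<^sub>+z. ennreal ((1 - d) powr (1 - p)) * ennreal (\<bar>P z\<bar> powr p * kn 0 z) + ennreal (d powr (1 - p)) * ennreal (\<bar>R z\<bar> powr p * kn 0 z))"
 proof (rule nn_integral_mono)
  fix z :: "'a \<times> 'a"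
  have "\<bar>incr (glue a) z\<bar> powr p * kn 0 z \<le> ((1 - d) powr (1 - p) * \<bar>P z\<bar> powr p + d powr (1 - p) * \<bar>R z\<bar> powr p) * kn 0 z"
   unfolding split by (intro mult_right_mono abs_add_powr_le_weighted p d) simp
  then have "ennreal (\<bar>incr (glue a) z\<bar> powr p * kn 0 z) \<le> ennreal ((1 - d) powr (1 - p) * (\<bar>P z\<bar> powr p * kn 0 z) + d powr (1 - p) * (\<bar>R z\<bar> powr p * kn 0 z))"
   by (intro ennreal_leI) (simp add: distrib_right mult.assoc)
  also have "\<dots> = ennreal ((1 - d) powr (1 - p)) * ennreal (\<bar>P z\<bar> powr p * kn 0 z) + ennreal (d powr (1 - p)) * ennreal (\<bar>R z\<bar> powr p * kn 0 z)"
   by (simp add: ennreal_mult)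
  finally show "ennreal (\<bar>incr (glue a) z\<bar> powr p * kn 0 z) \<le> \<dots>" .
 qed
 also have "\<dots> = ennreal ((1 - d) powr (1 - p)) * (\<integral>\<^sub>+z. ennreal (\<bar>P z\<bar> powr p * kn 0 z)) + ennreal (d powr (1 - p)) * (\<integral>\<^sub>+z. ennreal (\<bar>R z\<bar> powr p * kn 0 z))"
  by (subst nn_integral_add) (auto intro!: arg_cong2[where f = "(+)"] nn_integral_cmult simp del: ennreal_mult'')
 also have "\<dots> \<le> ennreal ((1 - d) powr (1 - p)) * ennreal ((1 + ?m * (L * r)) * near p 0 v v) + ennreal (d powr (1 - p)) * ennreal (L powr p * (?m powr p * (?m * (\<epsilon> * c0))))"
  by (intro add_mono mult_left_mono P_int R_int) auto
 also have "\<dots> = ennreal ((1 - d) powr (1 - p) * ((1 + ?m * (L * r)) * near p 0 v v) + d powr (1 - p) * (L powr p * (?m powr p * (?m * (\<epsilon> * c0)))))"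
 proof -
  have 1: "0 \<le> L powr p * (?m powr p * (?m * (\<epsilon> * c0)))" using a(2) c0(1) by simp
  have 2: "0 \<le> (1 + ?m * (L * r)) * near p 0 v v"
  proof (cases "J = {}")
   case False
   then have "0 \<le> r" using a(3) norm_ge_zero order_trans by blast
   then show ?thesis using L near_self_nonneg[of p 0 v] by simp
  qed (simp add: near_self_nonneg)
  show ?thesis using 1 2 by (simp only: ennreal_mult[symmetric] powr_ge_zero) (subst ennreal_plus, auto)
 qed
 finally show ?thesis .
qed

end

text \<open>Near a boundary point \<open>\<Omega>\<close> lies above a Lipschitz graph in direction
  \<open>e\<close>, so moving an exterior point by \<open>- t *\<^sub>R e\<close> keeps it exterior,
  with a margin proportional to \<open>t\<close> that tolerates a perturbation \<open>z\<close> of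
  size \<open>c * t\<close>. For translated copies of a function this says that their supports move
  into \<open>\<Omega>\<close> with room for a mollification. The index \<open>None\<close> is the
  interior piece, whose weight vanishes outside \<open>\<Omega>\<close> and whose direction is
  \<open>0\<close>.\<close>

lemma lipschitz_domain_partition:
 fixes \<Omega> :: "'a::euclidean_space set"
 assumes \<Omega>: "bounded \<Omega>" "open \<Omega>" "lipschitz_boundary \<Omega>"
 obtains J :: "'a option set" and \<phi> d L c t0 where "finite J" "0 \<le> L"
  "\<And>i x. i \<in> J \<Longrightarrow> 0 \<le> \<phi> i x" "\<And>i x y. i \<in> J \<Longrightarrow> \<bar>\<phi> i x - \<phi> i y\<bar> \<le> L * norm (x - y)"
  "\<And>x. (\<Sum>i\<in>J. \<phi> i x) \<le> 1" "\<And>x. x \<in> \<Omega> \<Longrightarrow> (\<Sum>i\<in>J. \<phi> i x) = 1"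
  "\<And>i. i \<in> J \<Longrightarrow> norm (d i :: 'a) \<le> 1" "0 < c" "c \<le> 1" "0 < t0"
  "\<And>i t z x. i \<in> J \<Longrightarrow> 0 < t \<Longrightarrow> t < t0 \<Longrightarrow> norm z \<le> c * t \<Longrightarrow> x \<notin> \<Omega> \<Longrightarrow> \<phi> i x \<noteq> 0 \<Longrightarrow> x - (t *\<^sub>R d i + z) \<notin> \<Omega>"
proof (cases "\<Omega> = {}")
 case True
 show ?thesis by (rule that[of "{}" 0 "\<lambda>_ _. 0" "\<lambda>_. 0" 1 1]) (use True in auto)
next
 case False
 have nU: "- \<Omega> \<noteq> {}" using \<Omega>(1) not_bounded_UNIV by (metis Compl_eq_Diff_UNIV Diff_eq_empty_iff top.extremum_uniqueI)
 have clC: "closed (- \<Omega>)" using \<Omega>(2) by auto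
 define ok where "ok z e r l g \<longleftrightarrow> norm e = 1 \<and> 0 < r \<and> l-lipschitz_on {y. y \<bullet> e = 0} g \<and>
    \<Omega> \<inter> ball z r = {y \<in> ball z r. g (y - (y \<bullet> e) *\<^sub>R e) < y \<bullet> e}" for z e :: 'a and r l :: real and g
 have "\<exists>q. z \<in> frontier \<Omega> \<longrightarrow> ok z (fst q) (fst (snd q)) (fst (snd (snd q))) (snd (snd (snd q)))" for z
 proof (cases "z \<in> frontier \<Omega>")
  case True
  then obtain e r l g where "ok z e r l g" using \<Omega>(3) unfolding lipschitz_boundary_def ok_def by blast
  then show ?thesis by (intro exI[of _ "(e, r, l, g)"]) simp
 qed simp
 then obtain q where q: "\<And>z. z \<in> frontier \<Omega> \<Longrightarrow> ok z (fst (q z)) (fst (snd (q z))) (fst (snd (snd (q z)))) (snd (snd (snd (q z))))"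
  by metis
 define e where "e z = fst (q z)" for z
 define r where "r z = fst (snd (q z))" for z
 define l where "l z = fst (snd (snd (q z)))" for z
 define g where "g z = snd (snd (snd (q z)))" for z
 have chart: "norm (e z) = 1 \<and> 0 < r z \<and> (l z)-lipschitz_on {y. y \<bullet> e z = 0} (g z) \<and>
    \<Omega> \<inter> ball z (r z) = {y \<in> ball z (r z). g z (y - (y \<bullet> e z) *\<^sub>R e z) < y \<bullet> e z}" if "z \<in> frontier \<Omega>" for z
  using q[OF that] unfolding ok_def e_def r_def l_def g_def .
 have "compact (frontier \<Omega>)" using \<Omega>(1) by (rule compact_frontier_bounded)
 then obtain F where F: "finite F" "F \<subseteq> frontier \<Omega>" "frontier \<Omega> \<subseteq> (\<Union>z\<in>F. ball z (r z / 4))"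
 proof (rule compactE_image)
  show "\<And>z. z \<in> frontier \<Omega> \<Longrightarrow> open (ball z (r z / 4))" by simp
  show "frontier \<Omega> \<subseteq> (\<Union>z\<in>frontier \<Omega>. ball z (r z / 4))" using chart by fastforce
 qed (use that in blast)
 define J where "J = insert None (Some ` F)"
 have J: "finite J" using F by (simp add: J_def)
 \<comment> \<open>The balls of radius \<open>r z / 4\<close> cover the boundary, the boundary
   weights live on radius \<open>r z / 2\<close>, and with \<open>t0 \<le> r z / 4\<close> the
   shifts and perturbations together move points by less than \<open>r z / 2\<close>. Shifted points
   thus stay in the chart of radius \<open>r z\<close>.\<close>
 define \<psi> where "\<psi> i x = (case i of None \<Rightarrow> infdist x (- \<Omega>) | Some z \<Rightarrow> max 0 (r z / 2 - dist x z))" for i x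
 have \<psi>0: "0 \<le> \<psi> i x" for i x by (auto simp: \<psi>_def infdist_nonneg split: option.split)
 have infl: "\<bar>infdist x A - infdist y A\<bar> \<le> norm (x - y)" for x y :: 'a and A
  using infdist_triangle[of x A y] infdist_triangle[of y A x] by (auto simp: dist_norm norm_minus_commute)
 have \<psi>l: "\<bar>\<psi> i x - \<psi> i y\<bar> \<le> norm (x - y)" for i x y
 proof (cases i)
  case None
  then show ?thesis using infl by (simp add: \<psi>_def)
 next
  case (Some z)
  then show ?thesis using dist_triangle[of x z y] dist_triangle[of y z x]
   by (auto simp: \<psi>_def dist_norm norm_minus_commute max_def)
 qed
 \<comment> \<open>Adding the distance to \<open>\<Omega>\<close> makes the denominator positive
   everywhere and changes nothing on \<open>\<Omega>\<close>. The quotients therefore sum to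
   \<open>1\<close> on \<open>\<Omega>\<close> and to at most \<open>1\<close> elsewhere.\<close>
 define D where "D x = (\<Sum>i\<in>J. \<psi> i x) + infdist x \<Omega>" for x
 let ?m = "real (card J) + 1"
 have Dl: "\<bar>D x - D y\<bar> \<le> ?m * norm (x - y)" for x y
 proof -
  have "D x - D y = (\<Sum>i\<in>J. \<psi> i x - \<psi> i y) + (infdist x \<Omega> - infdist y \<Omega>)" by (simp add: D_def sum_subtractf)
  also have "\<bar>\<dots>\<bar> \<le> (\<Sum>i\<in>J. \<bar>\<psi> i x - \<psi> i y\<bar>) + \<bar>infdist x \<Omega> - infdist y \<Omega>\<bar>"
   by (rule order_trans[OF abs_triangle_ineq]) (intro add_right_mono sum_abs)
  also have "\<dots> \<le> (\<Sum>i\<in>J. norm (x - y)) + norm (x - y)" by (intro add_mono sum_mono \<psi>l infl)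
  finally show ?thesis by (simp add: distrib_right)
 qed
 have sum0: "0 \<le> (\<Sum>i\<in>J. \<psi> i x)" for x by (intro sum_nonneg \<psi>0)
 have Dpos: "0 < D x" for x
 proof -
  have pos: "0 < D x" if "i \<in> J" "0 < \<psi> i x" for i
  proof -
   have "\<psi> i x \<le> (\<Sum>i\<in>J. \<psi> i x)" using that(1) J \<psi>0 by (intro member_le_sum) auto
   then show ?thesis using that(2) infdist_nonneg[of x \<Omega>] by (simp add: D_def)
  qed
  consider "x \<in> \<Omega>" | "x \<notin> closure \<Omega>" | "x \<in> frontier \<Omega>"
   using \<Omega>(2) by (auto simp: frontier_def interior_open)
  then show ?thesis
  proof cases
   case 1
   then have "0 < infdist x (- \<Omega>)"
    using in_closed_iff_infdist_zero[OF clC nU, of x] infdist_nonneg[of x "- \<Omega>"] by fastforce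
   then show ?thesis by (intro pos[of None]) (auto simp: J_def \<psi>_def)
  next
   case 2
   then have "0 < infdist x \<Omega>"
    using in_closure_iff_infdist_zero[OF False, of x] infdist_nonneg[of x \<Omega>] by fastforce
   then show ?thesis using sum0[of x] by (simp add: D_def)
  next
   case 3
   then obtain z where z: "z \<in> F" "dist z x < r z / 4" using F(3) by auto
   have "0 < r z" using chart z(1) F(2) by blast
   then show ?thesis using z by (intro pos[of "Some z"]) (auto simp: J_def \<psi>_def dist_commute)
  qed
 qed
 obtain B where B: "\<And>x. x \<in> \<Omega> \<Longrightarrow> norm x \<le> B" using \<Omega>(1) by (auto simp: bounded_iff)
 have "continuous_on (cball 0 (B + 1)) D"
 proof -
  have "?m-lipschitz_on UNIV D"
   by (rule lipschitz_onI) (use Dl in \<open>auto simp: dist_real_def dist_norm\<close>)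
  then show ?thesis by (intro lipschitz_on_continuous_on[OF lipschitz_on_subset]) auto
 qed
 moreover have "cball (0::'a) (B + 1) \<noteq> {}"
 proof -
  obtain y where "y \<in> \<Omega>" using False by blast
  then have "0 \<le> B" using B[of y] norm_ge_zero[of y] by linarith
  then show ?thesis by simp
 qed
 ultimately obtain x0 where x0: "\<And>x. x \<in> cball 0 (B + 1) \<Longrightarrow> D x0 \<le> D x"
  using continuous_attains_inf[OF compact_cball, of 0 "B + 1" D] by blast
 \<comment> \<open>\<open>D\<close> attains a positive minimum on a large ball, and outside that
   ball the distance to \<open>\<Omega>\<close> is at least \<open>1\<close>. The uniform lower
   bound makes the quotients Lipschitz on the whole space.\<close>
 define \<delta> where "\<delta> = min (D x0) 1"
 have \<delta>: "0 < \<delta>" using Dpos by (simp add: \<delta>_def)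
 have D\<delta>: "\<delta> \<le> D x" for x
 proof (cases "x \<in> cball 0 (B + 1)")
  case True
  then show ?thesis using x0 by (force simp: \<delta>_def)
 next
  case False
  have "1 \<le> infdist x \<Omega>"
   unfolding infdist_notempty[OF \<open>\<Omega> \<noteq> {}\<close>]
  proof (rule cINF_greatest)
   fix y assume "y \<in> \<Omega>"
   then show "1 \<le> dist x y" using B[of y] False norm_triangle_ineq2[of x y] by (simp add: dist_norm)
  qed (use \<open>\<Omega> \<noteq> {}\<close> in auto)
  then show ?thesis using sum0[of x] by (simp add: D_def \<delta>_def)
 qed
 define \<phi> where "\<phi> i x = \<psi> i x / D x" for i x
 define L where "L = (1 + ?m) / \<delta>"
 have \<phi>0: "0 \<le> \<phi> i x" for i x using \<psi>0 Dpos by (simp add: \<phi>_def less_imp_le)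
 have \<phi>1: "\<phi> i x \<le> 1" if "i \<in> J" for i x
 proof -
  have "\<psi> i x \<le> (\<Sum>i\<in>J. \<psi> i x)" using that J \<psi>0 by (intro member_le_sum) auto
  then show ?thesis using infdist_nonneg[of x \<Omega>] Dpos[of x] by (simp add: \<phi>_def D_def)
 qed
 have \<phi>l: "\<bar>\<phi> i x - \<phi> i y\<bar> \<le> L * norm (x - y)" if i: "i \<in> J" for i x y
 proof -
  have "\<phi> i x - \<phi> i y = (\<psi> i x - \<psi> i y) / D x + \<phi> i y * ((D y - D x) / D x)"
   using Dpos[of x] Dpos[of y] by (simp add: \<phi>_def field_simps)
  also have "\<bar>\<dots>\<bar> \<le> \<bar>\<psi> i x - \<psi> i y\<bar> / D x + \<phi> i y * (\<bar>D y - D x\<bar> / D x)"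
   by (rule order_trans[OF abs_triangle_ineq]) (use Dpos[of x] \<phi>0 in \<open>simp add: abs_mult\<close>)
  also have "\<dots> \<le> norm (x - y) / \<delta> + 1 * ((?m * norm (x - y)) / \<delta>)"
   using \<psi>l D\<delta> \<delta> \<phi>1[OF i] \<phi>0 Dl[of y x] Dpos[of x]
   by (intro add_mono mult_mono frac_le) (auto simp: norm_minus_commute)
  also have "\<dots> = L * norm (x - y)" using \<delta> by (simp add: L_def field_simps)
  finally show ?thesis .
 qed
 have sum_eq: "(\<Sum>i\<in>J. \<phi> i x) = (\<Sum>i\<in>J. \<psi> i x) / D x" for x by (simp add: \<phi>_def sum_divide_distrib)
 have l0: "0 \<le> l z" if "z \<in> F" for z using chart that F(2) lipschitz_on_nonneg by blast
 define d where "d i = (case i of None \<Rightarrow> 0 | Some z \<Rightarrow> e z)" for i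
 \<comment> \<open>A perturbation \<open>z\<close> changes the height by at most
   \<open>norm z\<close> and the graph by at most \<open>l z\<close> times as much, with
   \<open>l z\<close> the Lipschitz constant of the chart; the descent \<open>t\<close> must cover
   both.\<close>
 define c where "c = Min (insert 1 ((\<lambda>z. 1 / (1 + l z)) ` F))"
 define t0 where "t0 = Min (insert 1 ((\<lambda>z. r z / 4) ` F))"
 have c: "0 < c" "c \<le> 1" "\<And>z. z \<in> F \<Longrightarrow> c \<le> 1 / (1 + l z)"
 proof -
  have "0 < 1 / (1 + l z)" if "z \<in> F" for z using l0[OF that] by simp
  then show "0 < c" using F(1) unfolding c_def by (subst Min_gr_iff) auto
 qed (use F(1) in \<open>auto simp: c_def intro!: Min_le\<close>)
 have t0: "0 < t0" "\<And>z. z \<in> F \<Longrightarrow> t0 \<le> r z / 4"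
 proof -
  have "0 < r z / 4" if "z \<in> F" for z using chart that F(2) by auto
  then show "0 < t0" using F(1) unfolding t0_def by (subst Min_gr_iff) auto
  show "t0 \<le> r z / 4" if "z \<in> F" for z unfolding t0_def using that F(1) by (intro Min_le) auto
 qed
 show ?thesis
 proof (rule that[OF J, of L \<phi> d c t0])
  show "0 \<le> L" using \<delta> by (simp add: L_def)
  show "(\<Sum>i\<in>J. \<phi> i x) \<le> 1" for x
   unfolding sum_eq using infdist_nonneg[of x \<Omega>] Dpos[of x] by (simp add: D_def)
  show "(\<Sum>i\<in>J. \<phi> i x) = 1" if "x \<in> \<Omega>" for x
   unfolding sum_eq using that Dpos[of x] by (simp add: D_def)
  show "norm (d i) \<le> 1" if "i \<in> J" for i
   using that chart F(2) by (auto simp: J_def d_def)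
  fix i t and z x :: 'a
  assume i: "i \<in> J" and t: "0 < t" "t < t0" and z: "norm z \<le> c * t" and x: "x \<notin> \<Omega>" and ne: "\<phi> i x \<noteq> 0"
  show "x - (t *\<^sub>R d i + z) \<notin> \<Omega>"
  proof (cases i)
   case None
   then have "\<phi> i x = 0" using x by (simp add: \<phi>_def \<psi>_def)
   then show ?thesis using ne by simp
  next
   case (Some y)
   then have y: "y \<in> F" "y \<in> frontier \<Omega>" using i F(2) by (auto simp: J_def)
   let ?e = "e y"
   note ch = chart[OF y(2)]
   have e1: "norm ?e = 1" "?e \<bullet> ?e = 1" using ch by (auto simp: norm_eq_1)
   have dx: "dist x y < r y / 2" using ne Some by (auto simp: \<phi>_def \<psi>_def max_def split: if_splits)
   let ?x' = "x - (t *\<^sub>R d i + z)"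
   have di: "d i = ?e" using Some by (simp add: d_def)
   have zt: "norm z \<le> t"
   proof -
    have "c * t \<le> 1 * t" using c(2) t by (intro mult_right_mono) auto
    then show ?thesis using z by simp
   qed
   have "dist ?x' y < r y"
   proof -
    have "norm (?x' - y) \<le> norm (x - y) + norm (t *\<^sub>R d i + z)"
     using norm_triangle_ineq4[of "x - y" "t *\<^sub>R d i + z"] by (simp add: algebra_simps)
    also have "norm (t *\<^sub>R d i + z) \<le> t + norm z" using norm_triangle_ineq[of "t *\<^sub>R d i" z] e1 t by (simp add: di)
    finally show ?thesis using zt t t0(2)[OF y(1)] dx by (simp add: dist_norm)
   qed
   then have in_ball: "?x' \<in> ball y (r y)" by (simp add: dist_commute)
   have xb: "x \<in> ball y (r y)" using dx ch by (simp add: dist_commute)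
   have up: "x \<bullet> ?e \<le> g y (x - (x \<bullet> ?e) *\<^sub>R ?e)" using ch x xb by fastforce
   let ?P = "\<lambda>u. u - (u \<bullet> ?e) *\<^sub>R ?e"
   have P0: "?P u \<bullet> ?e = 0" for u using e1 by (simp add: inner_diff_left)
   have lip: "\<bar>g y (?P x) - g y (?P ?x')\<bar> \<le> l y * norm (?P x - ?P ?x')"
    using lipschitz_onD[of "l y" "{u. u \<bullet> ?e = 0}" "g y" "?P x" "?P ?x'"] ch P0 by (simp add: dist_real_def dist_norm)
   have "?P x - ?P ?x' = ?P z" using e1 by (simp add: di inner_diff_left inner_add_left algebra_simps)
   also have "norm (?P z) \<le> norm z"
   proof -
    have "norm (?P z) ^ 2 = norm z ^ 2 - (z \<bullet> ?e) ^ 2"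
     unfolding power2_norm_eq_inner using e1(2) by (simp add: inner_diff_left inner_diff_right inner_commute power2_eq_square algebra_simps)
    then have "norm (?P z) ^ 2 \<le> norm z ^ 2" by simp
    then show ?thesis by (rule power2_le_imp_le) simp
   qed
   finally have "norm (?P x - ?P ?x') \<le> norm z" .
   then have gl: "g y (?P x) - g y (?P ?x') \<le> l y * norm z"
    using lip mult_left_mono[OF _ l0[OF y(1)], of "norm (?P x - ?P ?x')" "norm z"] by linarith
   have xe: "?x' \<bullet> ?e = x \<bullet> ?e - t - z \<bullet> ?e" using e1 by (simp add: di inner_diff_left inner_add_left)
   have ze: "\<bar>z \<bullet> ?e\<bar> \<le> norm z" using Cauchy_Schwarz_ineq2[of z ?e] e1 by simp
   have "norm z * (1 + l y) \<le> t"
   proof -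
    have "norm z * (1 + l y) \<le> (c * t) * (1 + l y)" using z l0[OF y(1)] by (intro mult_right_mono) auto
    also have "\<dots> = t * (c * (1 + l y))" by simp
    also have "c * (1 + l y) \<le> 1" using c(3)[OF y(1)] l0[OF y(1)] by (simp add: pos_le_divide_eq)
    finally show ?thesis using t by (simp add: mult_left_mono)
   qed
   then have "?x' \<bullet> ?e \<le> g y (?P ?x')" using gl up xe ze by (simp add: distrib_left mult.commute)
   moreover have "\<Omega> \<inter> ball y (r y) = {w \<in> ball y (r y). g y (w - (w \<bullet> ?e) *\<^sub>R ?e) < w \<bullet> ?e}" using ch by simp
   ultimately have "\<not> ?x' \<in> \<Omega> \<inter> ball y (r y)" by (simp only: mem_Collect_eq not_less simp_thms de_Morgan_conj)
   with in_ball show ?thesis by simp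
  qed
 qed (use \<phi>0 \<phi>l c t0 in auto)
qed

section \<open>Mollified gluing and recovery sequences\<close>

lemma mollifier_exists:
 assumes \<epsilon>: "0 < \<epsilon>"
 obtains \<eta> :: "'a::euclidean_space \<Rightarrow> real" and K where "\<eta> \<in> borel_measurable borel" "\<And>z. 0 \<le> \<eta> z" "integrable lborel \<eta>"
  "(LBINT z. \<eta> z) = 1" "\<And>z. \<eta> z \<noteq> 0 \<Longrightarrow> norm z < \<epsilon>" "\<And>z w. \<bar>\<eta> z - \<eta> w\<bar> \<le> K * norm (z - w)" "\<And>z. \<eta> z \<le> K" "0 \<le> K"
proof -
 define f where "f z = max 0 (\<epsilon> - norm (z::'a))" for z
 have [measurable]: "f \<in> borel_measurable borel" unfolding f_def by measurable
 have f0: "0 \<le> f z" "f z \<le> \<epsilon>" for z using \<epsilon> by (auto simp: f_def)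
 have fl: "\<bar>f z - f w\<bar> \<le> norm (z - w)" for z w
  using norm_triangle_ineq2[of z w] norm_triangle_ineq2[of w z] by (auto simp: f_def max_def norm_minus_commute)
 have fi: "integrable lborel f"
 proof (rule Bochner_Integration.integrable_bound)
  show "integrable lborel (\<lambda>z. \<epsilon> * indicat_real (ball (0::'a) \<epsilon>) z)"
   using emeasure_bounded_finite[OF bounded_ball] by (intro integrable_mult_right integrable_real_indicator) auto
  show "AE z in lborel. norm (f z) \<le> norm (\<epsilon> * indicat_real (ball (0::'a) \<epsilon>) z)"
   using \<epsilon> by (intro AE_I2) (auto simp: f_def indicator_def max_def)
 qed measurable
 define Z where "Z = (LBINT z. f z)"
 have "Z \<noteq> 0"
 proof
  assume "Z = 0"
  then have "AE z in lborel. f z = 0" unfolding Z_def using fi f0 by (subst (asm) integral_nonneg_eq_0_iff_AE) auto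
  then have "AE z in lborel. z \<notin> ball (0::'a) \<epsilon>" by eventually_elim (auto simp: f_def max_def split: if_splits)
  then have "ball (0::'a) \<epsilon> \<in> null_sets lborel" by (rule AE_iff_null_sets[THEN iffD2, rotated]) simp
  then have "emeasure lborel (ball (0::'a) \<epsilon>) = 0" by auto
  then show False using \<epsilon> by (simp add: emeasure_ball mult_le_0_iff not_le)
 qed
 moreover have "0 \<le> Z" unfolding Z_def using f0 by (intro integral_nonneg_AE) auto
 ultimately have Z: "0 < Z" by linarith
 show ?thesis
 proof (rule that[of "\<lambda>z. f z / Z" "(1 + \<epsilon>) / Z"])
  show "\<bar>f z / Z - f w / Z\<bar> \<le> (1 + \<epsilon>) / Z * norm (z - w)" for z w
  proof -
   have "\<bar>f z / Z - f w / Z\<bar> = \<bar>f z - f w\<bar> / Z" using Z by (simp flip: diff_divide_distrib)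
   also have "\<dots> \<le> ((1 + \<epsilon>) * norm (z - w)) / Z"
    using Z fl[of z w] \<epsilon> mult_right_mono[of 1 "1 + \<epsilon>" "norm (z - w)"] by (intro divide_right_mono) auto
   finally show ?thesis by simp
  qed
  show "(LBINT z. f z / Z) = 1" using Z by (simp add: Z_def)
  show "norm z < \<epsilon>" if "f z / Z \<noteq> 0" for z using that by (auto simp: f_def max_def split: if_splits)
  show "f z / Z \<le> (1 + \<epsilon>) / Z" for z using f0(2)[of z] Z by (intro divide_right_mono) auto
 qed (use Z f0 fi \<epsilon> in \<open>auto intro: less_imp_le\<close>)
qed

lemma integral_lborel_reflect:
 fixes f :: "'a::euclidean_space \<Rightarrow> real"
 assumes [measurable]: "f \<in> borel_measurable borel"
 shows "(LBINT x. f (c - x)) = (LBINT x. f x)"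
proof -
 have "distr lborel borel (\<lambda>x. c - x) = (lborel :: 'a measure)"
  using lborel_affine[of "-1" c] by (simp add: density_1)
 then show ?thesis using integral_distr[of "\<lambda>x. c - x" lborel borel f] by simp
qed

context gluing
begin

text \<open>Averaging over the small extra shift \<open>z\<close> turns each translated copy into a
  convolution with \<open>\<eta>\<close>, which is Lipschitz because a reflection moves the variable
  from \<open>v\<close> into \<open>\<eta>\<close>. By \<open>out\<close> every shift on which
  \<open>\<eta>\<close> does not vanish keeps exterior points exterior where the weight is nonzero,
  so the average vanishes outside \<open>\<Omega>\<close>.\<close>

lemma smooth_glue:
 assumes \<Omega>: "bounded \<Omega>" "open \<Omega>" and K: "\<And>x. \<bar>v x\<bar> \<le> K"
  and \<eta>: "\<eta> \<in> borel_measurable borel" "\<And>z. 0 \<le> \<eta> z" "integrable lborel \<eta>" "(LBINT z. \<eta> z) = 1"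
   "\<And>z w. \<bar>\<eta> z - \<eta> w\<bar> \<le> K\<eta> * norm (z - w)" "\<And>z. \<eta> z \<le> K\<eta>" "0 \<le> K\<eta>"
  and out: "\<And>i x z. i \<in> J \<Longrightarrow> x \<notin> \<Omega> \<Longrightarrow> \<eta> z \<noteq> 0 \<Longrightarrow> \<phi> i x \<noteq> 0 \<Longrightarrow> x - (a i + z) \<notin> \<Omega>"
 defines "w \<equiv> \<lambda>x. LBINT z. \<eta> z * glue (\<lambda>i. a i + z) x"
 shows "\<exists>L'. \<forall>x y. \<bar>w x - w y\<bar> \<le> L' * norm (x - y)" "\<And>x. \<bar>w x\<bar> \<le> K" "\<And>x. x \<notin> \<Omega> \<Longrightarrow> w x = 0"
proof -
 note [measurable] = \<eta>(1)
 have K0: "0 \<le> K" using K[of 0] by linarith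
 have v1: "integrable lborel v" by (rule Lp_imp_L1(1)[OF p \<Omega> XeD(1-3)[OF v]])
 have vi: "integrable lborel (\<lambda>z. \<eta> z * v (x - (a i + z)))" for i x
  by (rule Bochner_Integration.integrable_bound[OF integrable_mult_right[OF \<eta>(3), of K]])
    (use K \<eta>(2) K0 in \<open>auto simp: abs_mult mult.commute[of K] intro!: AE_I2 mult_left_mono\<close>)
 define V where "V i x = (LBINT z. \<eta> z * v (x - (a i + z)))" for i x
 have w_eq: "w x = (\<Sum>i\<in>J. \<phi> i x * V i x)" for x
 proof -
  have "w x = (LBINT z. (\<Sum>i\<in>J. \<phi> i x * (\<eta> z * v (x - (a i + z)))))"
   by (simp add: w_def glue_def sum_distrib_left mult_ac)
  also have "\<dots> = (\<Sum>i\<in>J. \<phi> i x * V i x)" using vi by (simp add: V_def)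
  finally show ?thesis .
 qed
 have Vb: "\<bar>V i x\<bar> \<le> K" for i x
 proof -
  have "\<bar>V i x\<bar> \<le> (LBINT z. \<bar>\<eta> z * v (x - (a i + z))\<bar>)" unfolding V_def by (rule integral_abs_bound)
  also have "\<dots> \<le> (LBINT z. \<eta> z * K)"
   using \<eta>(2,3) K by (intro integral_mono integrable_abs[OF vi]) (auto simp: abs_mult mult_left_mono)
  finally show ?thesis using \<eta>(4) by simp
 qed
 have Vr: "V i x = (LBINT y. \<eta> (x - a i - y) * v y)" for i x
 proof -
  have "(LBINT y. \<eta> (x - a i - y) * v y) = (LBINT y. (\<lambda>z. \<eta> z * v (x - (a i + z))) (x - a i - y))" by simp
  also have "\<dots> = V i x" unfolding V_def by (rule integral_lborel_reflect) measurable
  finally show ?thesis ..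
 qed
 have ri: "integrable lborel (\<lambda>y. \<eta> (x - a i - y) * v y)" for x i
 proof (rule Bochner_Integration.integrable_bound[OF integrable_mult_right[OF v1, of K\<eta>]])
  show "AE y in lborel. norm (\<eta> (x - a i - y) * v y) \<le> norm (K\<eta> * v y)"
   using \<eta>(2,6,7) by (intro AE_I2) (simp add: abs_mult mult_right_mono)
 qed measurable
 define N1 where "N1 = (LBINT y. \<bar>v y\<bar>)"
 have Vl: "\<bar>V i x - V i y\<bar> \<le> K\<eta> * N1 * norm (x - y)" for i x y
 proof -
  have "V i x - V i y = (LBINT q. (\<eta> (x - a i - q) - \<eta> (y - a i - q)) * v q)"
   unfolding Vr using ri by (simp add: left_diff_distrib)
  also have "\<bar>\<dots>\<bar> \<le> (LBINT q. \<bar>(\<eta> (x - a i - q) - \<eta> (y - a i - q)) * v q\<bar>)" by (rule integral_abs_bound)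
  also have "\<dots> \<le> (LBINT q. K\<eta> * norm (x - y) * \<bar>v q\<bar>)"
  proof (rule integral_mono)
   show "integrable lborel (\<lambda>q. \<bar>(\<eta> (x - a i - q) - \<eta> (y - a i - q)) * v q\<bar>)"
    using ri by (simp add: left_diff_distrib)
   show "\<bar>(\<eta> (x - a i - q) - \<eta> (y - a i - q)) * v q\<bar> \<le> K\<eta> * norm (x - y) * \<bar>v q\<bar>" for q
    using \<eta>(5)[of "x - a i - q" "y - a i - q"] by (simp add: abs_mult mult_right_mono)
  qed (use v1 in auto)
  also have "\<dots> = K\<eta> * N1 * norm (x - y)" by (simp add: N1_def)
  finally show ?thesis .
 qed
 show "\<bar>w x\<bar> \<le> K" for x
 proof -
  have "\<bar>w x\<bar> \<le> (\<Sum>i\<in>J. \<phi> i x * K)"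
   unfolding w_eq using \<phi>(1) Vb by (intro order_trans[OF sum_abs] sum_mono) (simp add: abs_mult mult_left_mono)
  also have "\<dots> \<le> 1 * K" unfolding sum_distrib_right[symmetric] using \<phi>(3) K0 by (intro mult_right_mono)
  finally show ?thesis by simp
 qed
 show "w x = 0" if x: "x \<notin> \<Omega>" for x
 proof -
  have "\<eta> z * glue (\<lambda>i. a i + z) x = 0" for z
  proof (cases "\<eta> z = 0")
   case False
   have "\<phi> i x * v (x - (a i + z)) = 0" if "i \<in> J" for i
    using XeD(2)[OF v out[OF that x False]] by auto
   then have "glue (\<lambda>i. a i + z) x = 0" unfolding glue_def by (intro sum.neutral) auto
   then show ?thesis by simp
  qed simp
  then have "(\<lambda>z. \<eta> z * glue (\<lambda>i. a i + z) x) = (\<lambda>_. 0)" by (rule ext)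
  then show ?thesis unfolding w_def by (simp only: Bochner_Integration.integral_zero)
 qed
 show "\<exists>L'. \<forall>x y. \<bar>w x - w y\<bar> \<le> L' * norm (x - y)"
 proof (intro exI allI)
  fix x y
  have "w x - w y = (\<Sum>i\<in>J. \<phi> i x * (V i x - V i y) + (\<phi> i x - \<phi> i y) * V i y)"
   unfolding w_eq sum_subtractf[symmetric] by (intro sum.cong refl) (simp add: algebra_simps)
  also have "\<bar>\<dots>\<bar> \<le> (\<Sum>i\<in>J. 1 * (K\<eta> * N1 * norm (x - y)) + L * norm (x - y) * K)"
  proof (intro order_trans[OF sum_abs] sum_mono order_trans[OF abs_triangle_ineq] add_mono)
   fix i assume i: "i \<in> J"
   show "\<bar>\<phi> i x * (V i x - V i y)\<bar> \<le> 1 * (K\<eta> * N1 * norm (x - y))"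
    using Vl[of i x y] phi_le_1[OF i, of x] \<phi>(1)[OF i, of x] unfolding abs_mult by (intro mult_mono) auto
   show "\<bar>(\<phi> i x - \<phi> i y) * V i y\<bar> \<le> L * norm (x - y) * K"
    using Vb[of i y] \<phi>(2)[OF i, of x y] L unfolding abs_mult by (intro mult_mono) auto
  qed
  also have "\<dots> = (real (card J) * (K\<eta> * N1 + L * K)) * norm (x - y)" by (simp add: algebra_simps)
  finally show "\<bar>w x - w y\<bar> \<le> (real (card J) * (K\<eta> * N1 + L * K)) * norm (x - y)" .
 qed
qed

text \<open>The estimates for \<open>glue\<close> hold for each shift separately and pass to the
  average by Jensen's inequality with unchanged constants.\<close>

lemma smooth_glue_bounds:
 assumes K: "\<And>x. \<bar>v x\<bar> \<le> K"
  and \<eta>: "\<eta> \<in> borel_measurable borel" "\<And>z. 0 \<le> \<eta> z" "integrable lborel \<eta>" "(LBINT z. \<eta> z) = 1"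
  and a: "\<And>i z. i \<in> J \<Longrightarrow> \<eta> z \<noteq> 0 \<Longrightarrow> trans_diff p v (a i + z) \<le> ennreal \<epsilon>" "0 \<le> \<epsilon>" "\<And>i z. i \<in> J \<Longrightarrow> \<eta> z \<noteq> 0 \<Longrightarrow> norm (a i + z) \<le> r"
  and d: "0 < d" "d < 1"
  and c0: "0 \<le> c0" "\<And>x::'a. (\<integral>\<^sub>+y. ennreal (kn (- p) (x, y))) = ennreal c0"
 defines "w \<equiv> \<lambda>x. LBINT z. \<eta> z * glue (\<lambda>i. a i + z) x"
 shows "(\<integral>\<^sub>+x. ennreal (\<bar>w x - v x\<bar> powr p)) \<le> ennreal (real (card J) powr p * (real (card J) * \<epsilon>))"
  and "(\<integral>\<^sub>+z. ennreal (\<bar>incr w z\<bar> powr p * kn 0 z))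
   \<le> ennreal ((1 - d) powr (1 - p) * ((1 + real (card J) * (L * r)) * near p 0 v v)
     + d powr (1 - p) * (L powr p * (real (card J) powr p * (real (card J) * (\<epsilon> * c0)))))"
proof -
 note [measurable] = \<eta>(1) phi_measurable
 let ?G = "\<lambda>x z. glue (\<lambda>i. a i + z) x"
 have gb: "\<bar>?G x z\<bar> \<le> K" for x z
 proof -
  have K0: "0 \<le> K" using K[of 0] by linarith
  have "\<bar>?G x z\<bar> \<le> (\<Sum>i\<in>J. \<phi> i x * K)"
   unfolding glue_def using \<phi>(1) K by (intro order_trans[OF sum_abs] sum_mono) (simp add: abs_mult mult_left_mono)
  also have "\<dots> \<le> 1 * K" unfolding sum_distrib_right[symmetric] using \<phi>(3) K0 by (intro mult_right_mono)
  finally show ?thesis by simp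
 qed
 have gm: "(\<lambda>x. ?G (f x) (g x)) \<in> borel_measurable borel"
  if "f \<in> borel_measurable borel" "g \<in> borel_measurable borel" for f g :: "'c::euclidean_space \<Rightarrow> 'a"
  using that unfolding glue_def by measurable
 have gi: "integrable lborel (\<lambda>z. \<eta> z * ?G x z)" for x
 proof (rule integrable_dominated[OF integrable_mult_right[OF \<eta>(3), of K]])
  have "(\<lambda>z. ?G x z) \<in> borel_measurable borel" by (rule gm) auto
  from borel_measurable_times[OF \<eta>(1) this] show "(\<lambda>z. \<eta> z * ?G x z) \<in> borel_measurable lborel"
   by (simp only: measurable_lborel1 measurable_lborel2)
  show "\<bar>\<eta> z * ?G x z\<bar> \<le> K * \<eta> z" for z
   using mult_left_mono[OF gb[of z x] \<eta>(2)[of z]] \<eta>(2)[of z] by (simp only: abs_mult abs_of_nonneg mult.commute[of K])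
 qed
 have "(\<integral>\<^sub>+x. ennreal (\<bar>LBINT z. \<eta> z * (?G x z - v x)\<bar> powr p * 1)) \<le> ennreal (real (card J) powr p * (real (card J) * \<epsilon>))"
 proof (rule jensen_average[OF p _ _ _ \<eta>(2-4), where K = "K + K"])
  show "(\<lambda>x. ?G (fst x) (snd x) - v (fst x)) \<in> borel_measurable borel"
   using gm[of fst snd] by measurable
  show "\<bar>?G c z - v c\<bar> \<le> K + K" for c z using gb[of z c] K[of c] by linarith
  show "(\<integral>\<^sub>+x. ennreal (\<bar>?G x z - v x\<bar> powr p * 1)) \<le> ennreal (real (card J) powr p * (real (card J) * \<epsilon>))" if "\<eta> z \<noteq> 0" for z
   using glue_diff_bound[of "\<lambda>i. a i + z" \<epsilon>] a that by simp
 qed auto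
 moreover have "(LBINT z. \<eta> z * (?G x z - v x)) = w x - v x" for x
  using gi \<eta>(3,4) by (simp add: right_diff_distrib w_def)
 ultimately show "(\<integral>\<^sub>+x. ennreal (\<bar>w x - v x\<bar> powr p)) \<le> ennreal (real (card J) powr p * (real (card J) * \<epsilon>))" by simp
 have "(\<integral>\<^sub>+c. ennreal (\<bar>LBINT z. \<eta> z * (?G (fst c) z - ?G (snd c) z)\<bar> powr p * kn 0 c))
   \<le> ennreal ((1 - d) powr (1 - p) * ((1 + real (card J) * (L * r)) * near p 0 v v)
     + d powr (1 - p) * (L powr p * (real (card J) powr p * (real (card J) * (\<epsilon> * c0)))))"
 proof (rule jensen_average[OF p _ _ _ \<eta>(2-4), where K = "K + K"])
  have "(\<lambda>x. fst (fst x)) \<in> borel_measurable (borel :: (('a \<times> 'a) \<times> 'a) measure)" "(\<lambda>x. snd (fst x)) \<in> borel_measurable (borel :: (('a \<times> 'a) \<times> 'a) measure)"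
   by measurable
  then show "(\<lambda>x::('a \<times> 'a) \<times> 'a. ?G (fst (fst x)) (snd x) - ?G (snd (fst x)) (snd x)) \<in> borel_measurable borel"
   by (intro borel_measurable_diff gm) measurable
  show "\<bar>?G (fst c) z - ?G (snd c) z\<bar> \<le> K + K" for c z using gb[of z "fst c"] gb[of z "snd c"] by linarith
  show "(\<integral>\<^sub>+c. ennreal (\<bar>?G (fst c) z - ?G (snd c) z\<bar> powr p * kn 0 c))
   \<le> ennreal ((1 - d) powr (1 - p) * ((1 + real (card J) * (L * r)) * near p 0 v v)
     + d powr (1 - p) * (L powr p * (real (card J) powr p * (real (card J) * (\<epsilon> * c0)))))" if "\<eta> z \<noteq> 0" for z
   by (rule glue_near_bound[OF a(1)[OF _ that] a(2) a(3)[OF _ that] d c0])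
 qed auto
 moreover have "(LBINT z. \<eta> z * (?G (fst c) z - ?G (snd c) z)) = incr w c" for c
  using gi by (simp add: right_diff_distrib w_def)
 ultimately show "(\<integral>\<^sub>+z. ennreal (\<bar>incr w z\<bar> powr p * kn 0 z))
   \<le> ennreal ((1 - d) powr (1 - p) * ((1 + real (card J) * (L * r)) * near p 0 v v)
     + d powr (1 - p) * (L powr p * (real (card J) powr p * (real (card J) * (\<epsilon> * c0)))))" by simp
qed

end

text \<open>The choices are made in this order: \<open>\<delta>\<close> so that the factor on the
  main term costs less than half of \<open>\<epsilon>\<close>, then \<open>x\<close> for the
  remaining terms, whose constants depend on \<open>\<delta>\<close>, and last the shift length
  \<open>t\<close>. Only an upper bound is claimed for the seminorm of \<open>w\<close>, which is
  what the comparison functional can use.\<close>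

lemma lipschitz_recovery:
 fixes \<Omega> :: "'a::euclidean_space set" and v :: "'a \<Rightarrow> real"
 assumes p: "1 < p" and \<Omega>: "bounded \<Omega>" "open \<Omega>" "lipschitz_boundary \<Omega>"
  and v: "v \<in> Xe p \<Omega> 0" and K: "\<And>x. \<bar>v x\<bar> \<le> K" and \<epsilon>: "0 < \<epsilon>"
 obtains w L' where "\<And>x y. \<bar>w x - w y\<bar> \<le> L' * norm (x - y)" "\<And>x. \<bar>w x\<bar> \<le> K" "\<And>x. x \<notin> \<Omega> \<Longrightarrow> w x = 0"
  "(LBINT x. \<bar>w x - v x\<bar> powr p) \<le> \<epsilon>" "near p 0 w w \<le> near p 0 v v + \<epsilon>"
proof -
 obtain J :: "'a option set" and \<phi> d L c t0 where part: "finite J" "0 \<le> L"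
  "\<And>i x. i \<in> J \<Longrightarrow> 0 \<le> \<phi> i x" "\<And>i x y. i \<in> J \<Longrightarrow> \<bar>\<phi> i x - \<phi> i y\<bar> \<le> L * norm (x - y)"
  "\<And>x. (\<Sum>i\<in>J. \<phi> i x) \<le> 1" "\<And>x. x \<in> \<Omega> \<Longrightarrow> (\<Sum>i\<in>J. \<phi> i x) = 1"
  "\<And>i. i \<in> J \<Longrightarrow> norm (d i :: 'a) \<le> 1" "0 < c" "c \<le> 1" "0 < t0"
  "\<And>i t z x. i \<in> J \<Longrightarrow> 0 < t \<Longrightarrow> t < t0 \<Longrightarrow> norm z \<le> c * t \<Longrightarrow> x \<notin> \<Omega> \<Longrightarrow> \<phi> i x \<noteq> 0 \<Longrightarrow> x - (t *\<^sub>R d i + z) \<notin> \<Omega>"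
  by (rule lipschitz_domain_partition[OF \<Omega>]) (rule that; assumption)
 interpret gluing p L \<Omega> J \<phi> v
  by unfold_locales (use p part v in auto)
 let ?m = "real (card J)" and ?A = "near p 0 v v"
 have "- p < 0" using p by simp
 note knf = nn_integral_kn_finite[OF this]
 define c0 where "c0 = enn2real (\<integral>\<^sub>+y. ennreal (kn (- p) (0::'a, y)))"
 have c0: "0 \<le> c0" "(\<integral>\<^sub>+y. ennreal (kn (- p) (x::'a, y))) = ennreal c0" for x
 proof -
  have "(\<integral>\<^sub>+y. ennreal (kn (- p) (x, y))) = (\<integral>\<^sub>+y. ennreal (kn (- p) (0::'a, y)))" by (rule knf(1))
  also have "\<dots> = ennreal c0" using knf(2)[where 'a='a] by (simp add: c0_def)
  finally show "(\<integral>\<^sub>+y. ennreal (kn (- p) (x, y))) = ennreal c0" .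
 qed (simp add: c0_def)
 have "((\<lambda>d. (1 - d) powr (1 - p) * ?A) \<longlongrightarrow> (1 - 0) powr (1 - p) * ?A) (at_right 0)"
  by (intro tendsto_intros) auto
 then have "eventually (\<lambda>d. (1 - d) powr (1 - p) * ?A < ?A + \<epsilon> / 2) (at_right 0)"
  using \<epsilon> by (intro order_tendstoD(2)) auto
 moreover have "eventually (\<lambda>d. d \<in> {0<..<1}) (at_right (0::real))" by (rule eventually_at_right_real) simp
 ultimately have "eventually (\<lambda>d. (1 - d) powr (1 - p) * ?A < ?A + \<epsilon> / 2 \<and> d \<in> {0<..<1}) (at_right 0)" by (rule eventually_conj)
 then obtain \<delta> where \<delta>: "(1 - \<delta>) powr (1 - p) * ?A < ?A + \<epsilon> / 2" "0 < \<delta>" "\<delta> < 1"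
  using eventually_happens[of _ "at_right (0::real)"] by auto
 let ?B = "\<lambda>x. (1 - \<delta>) powr (1 - p) * ((1 + ?m * (L * x)) * ?A) + \<delta> powr (1 - p) * (L powr p * (?m powr p * (?m * (x * c0))))"
 have "(?B \<longlongrightarrow> ?B 0) (at_right 0)" "((\<lambda>x. ?m powr p * (?m * x)) \<longlongrightarrow> ?m powr p * (?m * 0)) (at_right 0)"
  by (intro tendsto_intros)+
 then have "eventually (\<lambda>x. ?B x < ?A + \<epsilon>) (at_right 0)" "eventually (\<lambda>x. ?m powr p * (?m * x) < \<epsilon>) (at_right 0)"
  using \<delta>(1) \<epsilon> by (auto intro!: order_tendstoD(2))
 moreover have "eventually (\<lambda>x. x \<in> {0<..<1}) (at_right (0::real))" by (rule eventually_at_right_real) simp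
 ultimately have "eventually (\<lambda>x. ?B x < ?A + \<epsilon> \<and> ?m powr p * (?m * x) < \<epsilon> \<and> x \<in> {0<..<1}) (at_right 0)" by (intro eventually_conj)
 \<comment> \<open>\<open>x\<close> serves at once as the bound for the translation differences and
   as the bound for the length of the shifts.\<close>
 then obtain x where x: "?B x < ?A + \<epsilon>" "?m powr p * (?m * x) < \<epsilon>" "0 < x"
  using eventually_happens[of _ "at_right (0::real)"] by auto
 have "0 < p" using p by simp
 then obtain r0 where r0: "0 < r0" "\<And>a. norm a \<le> r0 \<Longrightarrow> trans_diff p v a \<le> ennreal x"
  using trans_diff_tendsto[OF _ v x(3)] by blast
 define t where "t = min (min r0 x) t0 / 4"
 have t: "0 < t" "t < t0" "2 * t \<le> r0" "2 * t \<le> x" using r0 x part(10) by (auto simp: t_def)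
 obtain \<eta> :: "'a \<Rightarrow> real" and K\<eta> where \<eta>: "\<eta> \<in> borel_measurable borel" "\<And>z. 0 \<le> \<eta> z" "integrable lborel \<eta>"
  "(LBINT z. \<eta> z) = 1" "\<And>z. \<eta> z \<noteq> 0 \<Longrightarrow> norm z < c * t" "\<And>z w. \<bar>\<eta> z - \<eta> w\<bar> \<le> K\<eta> * norm (z - w)" "\<And>z. \<eta> z \<le> K\<eta>" "0 \<le> K\<eta>"
  by (rule mollifier_exists[OF mult_pos_pos[OF part(8) t(1)]]) (rule that; assumption)
 have na: "norm (t *\<^sub>R d i + z) \<le> 2 * t" if "i \<in> J" "\<eta> z \<noteq> 0" for i z
 proof -
  have "norm (t *\<^sub>R d i + z) \<le> t * norm (d i) + norm z" using norm_triangle_ineq[of "t *\<^sub>R d i" z] t by simp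
  also have "\<dots> \<le> t * 1 + c * t" using part(7)[OF that(1)] \<eta>(5)[OF that(2)] t by (intro add_mono mult_left_mono) auto
  also have "c * t \<le> 1 * t" using part(9) t by (intro mult_right_mono) auto
  finally show ?thesis by simp
 qed
 define w where "w = (\<lambda>x. LBINT z. \<eta> z * glue (\<lambda>i. t *\<^sub>R d i + z) x)"
 have out: "x - (t *\<^sub>R d i + z) \<notin> \<Omega>" if "i \<in> J" "x \<notin> \<Omega>" "\<eta> z \<noteq> 0" "\<phi> i x \<noteq> 0" for i x z
  using part(11)[OF that(1) t(1,2) less_imp_le[OF \<eta>(5)[OF that(3)]] that(2,4)] .
 have sg: "\<exists>L'. \<forall>x y. \<bar>w x - w y\<bar> \<le> L' * norm (x - y)" "\<bar>w x\<bar> \<le> K" "x \<notin> \<Omega> \<Longrightarrow> w x = 0" for x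
  unfolding w_def by (rule smooth_glue[OF \<Omega>(1,2) K \<eta>(1-4,6-8) out]; assumption)+
 have tr: "trans_diff p v (t *\<^sub>R d i + z) \<le> ennreal x" if "i \<in> J" "\<eta> z \<noteq> 0" for i z
  using na[OF that] t by (intro r0) simp
 have nx: "norm (t *\<^sub>R d i + z) \<le> x" if "i \<in> J" "\<eta> z \<noteq> 0" for i z using na[OF that] t by linarith
 have b1: "(\<integral>\<^sub>+y. ennreal (\<bar>w y - v y\<bar> powr p)) \<le> ennreal (?m powr p * (?m * x))"
  unfolding w_def
  by (rule smooth_glue_bounds(1)[OF K \<eta>(1-4) tr less_imp_le[OF x(3)] nx \<delta>(2,3) c0])
 have b2: "(\<integral>\<^sub>+z. ennreal (\<bar>incr w z\<bar> powr p * kn 0 z)) \<le> ennreal (?B x)"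
  unfolding w_def
  by (rule smooth_glue_bounds(2)[OF K \<eta>(1-4) tr less_imp_le[OF x(3)] nx \<delta>(2,3) c0])
 obtain L' where L': "\<And>x y. \<bar>w x - w y\<bar> \<le> L' * norm (x - y)" using sg(1) by blast
 have wX: "w \<in> Xe p \<Omega> 0" using p by (intro lipschitz_in_Xe[OF p _ \<Omega>(1,2) L' sg(3)]) auto
 show ?thesis
 proof (rule that[OF L' sg(2,3)])
  show "(LBINT x. \<bar>w x - v x\<bar> powr p) \<le> \<epsilon>"
  proof (rule integral_real_bounded)
   show "(\<integral>\<^sub>+x. ennreal (\<bar>w x - v x\<bar> powr p)) \<le> ennreal \<epsilon>"
    using x(2) by (intro order_trans[OF b1] ennreal_leI) simp
  qed (use \<epsilon> in auto)
  have "ennreal (near p 0 w w) \<le> ennreal (?A + \<epsilon>)"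
   unfolding nn_integral_near[OF wX, symmetric] using x(1) by (intro order_trans[OF b2] ennreal_leI) simp
  then show "near p 0 w w \<le> ?A + \<epsilon>"
   by (rule ennreal_le_iff[THEN iffD1, rotated]) (use near_self_nonneg[of p 0 v] \<epsilon> in simp)
 qed
qed

section \<open>Minimality of the limit\<close>

lemma has_real_derivative_integral:
 fixes f f' :: "real \<Rightarrow> 'b \<Rightarrow> real"
 assumes i: "\<And>t. \<bar>t\<bar> < 1 \<Longrightarrow> integrable N (f t)" and m: "f' 0 \<in> borel_measurable N"
  and d: "\<And>t x. \<bar>t\<bar> < 1 \<Longrightarrow> ((\<lambda>t. f t x) has_real_derivative f' t x) (at t)"
  and w: "integrable N w" "AE x in N. \<forall>t. \<bar>t\<bar> < 1 \<longrightarrow> \<bar>f' t x\<bar> \<le> w x"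
 shows "((\<lambda>t. integral\<^sup>L N (f t)) has_real_derivative integral\<^sup>L N (f' 0)) (at 0)"
proof -
 have "((\<lambda>t. (integral\<^sup>L N (f t) - integral\<^sup>L N (f 0)) / t) \<longlongrightarrow> integral\<^sup>L N (f' 0)) (at 0)"
  unfolding tendsto_at_iff_sequentially comp_def
 proof (intro allI impI)
  fix X :: "nat \<Rightarrow> real" assume X: "\<forall>i. X i \<in> UNIV - {0}" "X \<longlonglongrightarrow> 0"
  have "eventually (\<lambda>n. \<bar>X n\<bar> < 1) sequentially"
   using order_tendstoD(2)[OF tendsto_rabs[OF X(2)], of 1] by simp
  then obtain n0 where n0: "\<And>n. n \<ge> n0 \<Longrightarrow> \<bar>X n\<bar> < 1" by (auto simp: eventually_sequentially)
  let ?q = "\<lambda>n x. (f (X (n + n0)) x - f 0 x) / X (n + n0)"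
  have Xn: "\<bar>X (n + n0)\<bar> < 1" "X (n + n0) \<noteq> 0" for n using n0 X(1) by auto
  have "(\<lambda>n. integral\<^sup>L N (?q n)) \<longlonglongrightarrow> integral\<^sup>L N (f' 0)"
  proof (rule integral_dominated_convergence[OF m _ w(1)])
   show "?q n \<in> borel_measurable N" for n
    using borel_measurable_integrable[OF i[OF Xn(1)[of n]]] borel_measurable_integrable[OF i[of 0]] by simp
   show "AE x in N. (\<lambda>n. ?q n x) \<longlonglongrightarrow> f' 0 x"
   proof (rule AE_I2)
    fix x
    have "((\<lambda>t. (f t x - f 0 x) / (t - 0)) \<longlongrightarrow> f' 0 x) (at 0)"
     using d[of 0 x] by (simp add: has_field_derivative_iff)
    then have "(\<lambda>n. (f (X n) x - f 0 x) / (X n - 0)) \<longlonglongrightarrow> f' 0 x"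
     using X unfolding tendsto_at_iff_sequentially comp_def by blast
    from LIMSEQ_ignore_initial_segment[OF this, of n0] show "(\<lambda>n. ?q n x) \<longlonglongrightarrow> f' 0 x" by simp
   qed
   show "AE x in N. norm (?q n x) \<le> w x" for n
    using w(2)
   proof eventually_elim
    case (elim x)
    let ?t = "X (n + n0)"
    have *: "\<exists>z. \<bar>z\<bar> < 1 \<and> f ?t x - f 0 x = ?t * f' z x"
    proof (cases "0 < ?t")
     case True
     have "\<exists>z. 0 < z \<and> z < ?t \<and> f ?t x - f 0 x = (?t - 0) * f' z x"
      using Xn(1)[of n] by (intro MVT2 True d) auto
     then show ?thesis using Xn(1)[of n] by force
    next
     case False
     then have neg: "?t < 0" using Xn(2)[of n] by linarith
     have "\<exists>z. ?t < z \<and> z < 0 \<and> f 0 x - f ?t x = (0 - ?t) * f' z x"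
      using Xn(1)[of n] neg by (intro MVT2 neg d) auto
     then obtain z where "?t < z" "z < 0" "f 0 x - f ?t x = (0 - ?t) * f' z x" by blast
     then show ?thesis using Xn(1)[of n] by (intro exI[of _ z]) auto
    qed
    then obtain z where "\<bar>z\<bar> < 1" "f ?t x - f 0 x = ?t * f' z x" by blast
    then show ?case using elim Xn(2)[of n] by simp
   qed
  qed
  moreover have "integral\<^sup>L N (?q n) = (integral\<^sup>L N (f (X (n + n0))) - integral\<^sup>L N (f 0)) / X (n + n0)" for n
   using i[OF Xn(1)[of n]] i[of 0] by simp
  ultimately have "(\<lambda>n. (integral\<^sup>L N (f (X (n + n0))) - integral\<^sup>L N (f 0)) / X (n + n0)) \<longlonglongrightarrow> integral\<^sup>L N (f' 0)" by (simp only:)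
  then show "(\<lambda>n. (integral\<^sup>L N (f (X n)) - integral\<^sup>L N (f 0)) / X n) \<longlonglongrightarrow> integral\<^sup>L N (f' 0)"
   by (rule LIMSEQ_offset)
 qed
 then show ?thesis by (simp add: has_field_derivative_iff)
qed

section \<open>First variations of the limit functionals\<close>

lemma Xe_add_scaled:
 assumes p: "0 < p" and u: "u \<in> Xe p \<Omega> e" and v: "v \<in> Xe p \<Omega> e"
 shows "(\<lambda>x. u x + t * v x) \<in> Xe p \<Omega> e"
proof -
 note tv = Xe_cmult[OF v, of t]
 note [measurable] = XeD(1)[OF u] XeD(1)[OF tv]
 have b1: "\<bar>u x + t * v x\<bar> powr p \<le> 2 powr p * (\<bar>u x\<bar> powr p + \<bar>t * v x\<bar> powr p)" for x by (rule abs_add_powr_le[OF p])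
 have b2: "\<bar>(u (fst z) + t * v (fst z)) - (u (snd z) + t * v (snd z))\<bar> powr p * kn e z
   \<le> 2 powr p * (\<bar>incr u z\<bar> powr p * kn e z + \<bar>t * v (fst z) - t * v (snd z)\<bar> powr p * kn e z)" for z
 proof -
  have "\<bar>(u (fst z) + t * v (fst z)) - (u (snd z) + t * v (snd z))\<bar> powr p
   = \<bar>(incr u z) + (t * v (fst z) - t * v (snd z))\<bar> powr p" by (simp add: algebra_simps)
  also have "\<dots> \<le> 2 powr p * (\<bar>incr u z\<bar> powr p + \<bar>t * v (fst z) - t * v (snd z)\<bar> powr p)" by (rule abs_add_powr_le[OF p])
  finally show ?thesis using mult_right_mono[OF _ kn_nonneg[of e z]] by (fastforce simp: algebra_simps)
 qed
 have m: "(\<lambda>x. u x + t * v x) \<in> borel_measurable borel" by measurable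
 have i1: "integrable lborel (\<lambda>x. \<bar>u x + t * v x\<bar> powr p)"
  using b1 by (intro integrable_dominated[OF integrable_mult_right[OF Bochner_Integration.integrable_add[OF XeD(3)[OF u] XeD(3)[OF tv]], of "2 powr p"]]) simp_all
 have i2: "integrable lborel (\<lambda>z. \<bar>(u (fst z) + t * v (fst z)) - (u (snd z) + t * v (snd z))\<bar> powr p * kn e z)"
  by (rule integrable_dominated[OF integrable_mult_right[OF Bochner_Integration.integrable_add[OF XeD(4)[OF u] XeD(4)[OF tv]], of "2 powr p"]])
    (measurable, unfold abs_mult abs_of_nonneg[OF powr_ge_zero] abs_of_nonneg[OF kn_nonneg], rule b2[unfolded abs_mult])
 show ?thesis using m i1 i2 XeD(2)[OF u] XeD(2)[OF v] by (auto simp: Xe_def)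
qed

context small_order
begin

lemma log_maj_ge: "0 \<le> m \<Longrightarrow> m powr p \<le> log_maj m" "0 \<le> m \<Longrightarrow> 1 \<le> log_maj m"
 by (auto simp: log_maj_def)

lemma Y_has_derivative:
 assumes u: "u \<in> Xe p \<Omega> 0" and v: "v \<in> Xe p \<Omega> 0"
 shows "((\<lambda>t. Y (\<lambda>x. u x + t * v x)) has_real_derivative p * (LBINT x. h p (u x) * v x)) (at 0)"
proof -
 note [measurable] = XeD(1)[OF u] XeD(1)[OF v]
 let ?w = "\<lambda>x. p * (2 powr p * (\<bar>u x\<bar> powr p + \<bar>v x\<bar> powr p) + \<bar>v x\<bar> powr p)"
 have "((\<lambda>t. Y (\<lambda>x. u x + t * v x)) has_real_derivative (LBINT x. p * h p (u x + 0 * v x) * v x)) (at 0)"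
  unfolding Y_def
 proof (rule has_real_derivative_integral[where f' = "\<lambda>t x. p * h p (u x + t * v x) * v x" and w = ?w])
  show "integrable lborel (\<lambda>x. \<bar>u x + t * v x\<bar> powr p)" for t using p by (intro XeD(3)[OF Xe_add_scaled[OF _ u v]]) simp
  show "((\<lambda>t. \<bar>u x + t * v x\<bar> powr p) has_real_derivative p * h p (u x + t * v x) * v x) (at t)" for t x
   by (rule DERIV_chain2[OF abs_powr_has_derivative[OF p]]) (auto intro!: derivative_eq_intros)
  show "integrable lborel ?w" using XeD(3)[OF u] XeD(3)[OF v] by simp
  show "AE x in lborel. \<forall>t. \<bar>t\<bar> < 1 \<longrightarrow> \<bar>p * h p (u x + t * v x) * v x\<bar> \<le> ?w x"
  proof (intro AE_I2 allI impI)
   fix x and t :: real assume t: "\<bar>t\<bar> < 1"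
   have "\<bar>u x + t * v x\<bar> powr p \<le> 2 powr p * (\<bar>u x\<bar> powr p + \<bar>t * v x\<bar> powr p)" using p by (intro abs_add_powr_le) auto
   also have "\<dots> \<le> 2 powr p * (\<bar>u x\<bar> powr p + \<bar>v x\<bar> powr p)"
    using p t by (intro mult_left_mono add_left_mono powr_mono2) (auto simp: abs_mult mult_left_le_one_le)
   finally have "\<bar>h p (u x + t * v x) * v x\<bar> \<le> 2 powr p * (\<bar>u x\<bar> powr p + \<bar>v x\<bar> powr p) + \<bar>v x\<bar> powr p"
    using abs_h_mult_le[OF p, of "u x + t * v x" "v x"] by linarith
   then have "p * \<bar>h p (u x + t * v x) * v x\<bar> \<le> ?w x" using p by (intro mult_left_mono) auto
   then show "\<bar>p * h p (u x + t * v x) * v x\<bar> \<le> ?w x" using p by (simp add: abs_mult)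
  qed
 qed measurable
 then show ?thesis by (simp add: mult.assoc)
qed

lemma near_has_derivative:
 assumes u: "u \<in> Xe p \<Omega> 0" and v: "v \<in> Xe p \<Omega> 0"
 shows "((\<lambda>t. near p 0 (\<lambda>x. u x + t * v x) (\<lambda>x. u x + t * v x)) has_real_derivative p * near p 0 u v) (at 0)"
proof -
 note [measurable] = XeD(1)[OF u] XeD(1)[OF v]
 let ?U = "\<lambda>z. incr u z" and ?V = "\<lambda>z. incr v z"
 let ?w = "\<lambda>z. p * (2 powr p * (\<bar>?U z\<bar> powr p * kn 0 z + \<bar>?V z\<bar> powr p * kn 0 z) + \<bar>?V z\<bar> powr p * kn 0 z)"
 have eq: "(u (fst z) + t * v (fst z)) - (u (snd z) + t * v (snd z)) = ?U z + t * ?V z" for z t by (simp add: algebra_simps)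
 have "((\<lambda>t. LBINT z. \<bar>?U z + t * ?V z\<bar> powr p * kn 0 z) has_real_derivative (LBINT z. p * h p (?U z + 0 * ?V z) * ?V z * kn 0 z)) (at 0)"
 proof (rule has_real_derivative_integral[where f' = "\<lambda>t z. p * h p (?U z + t * ?V z) * ?V z * kn 0 z" and w = ?w])
  show "integrable lborel (\<lambda>z. \<bar>?U z + t * ?V z\<bar> powr p * kn 0 z)" for t
   using XeD(4)[OF Xe_add_scaled[OF _ u v, of t]] p unfolding eq by simp
  show "((\<lambda>t. \<bar>?U z + t * ?V z\<bar> powr p * kn 0 z) has_real_derivative p * h p (?U z + t * ?V z) * ?V z * kn 0 z) (at t)" for t z
   by (intro DERIV_cmult_right DERIV_chain2[OF abs_powr_has_derivative[OF p]]) (auto intro!: derivative_eq_intros)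
  show "integrable lborel ?w" using XeD(4)[OF u] XeD(4)[OF v] by simp
  show "AE z in lborel. \<forall>t. \<bar>t\<bar> < 1 \<longrightarrow> \<bar>p * h p (?U z + t * ?V z) * ?V z * kn 0 z\<bar> \<le> ?w z"
  proof (intro AE_I2 allI impI)
   fix z :: "'a \<times> 'a" and t :: real assume t: "\<bar>t\<bar> < 1"
   have "\<bar>?U z + t * ?V z\<bar> powr p \<le> 2 powr p * (\<bar>?U z\<bar> powr p + \<bar>t * ?V z\<bar> powr p)" using p by (intro abs_add_powr_le) auto
   also have "\<dots> \<le> 2 powr p * (\<bar>?U z\<bar> powr p + \<bar>?V z\<bar> powr p)"
    using p t unfolding abs_mult by (intro mult_left_mono add_left_mono powr_mono2 mult_left_le_one_le) auto
   finally have "\<bar>h p (?U z + t * ?V z) * ?V z\<bar> \<le> 2 powr p * (\<bar>?U z\<bar> powr p + \<bar>?V z\<bar> powr p) + \<bar>?V z\<bar> powr p"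
    using abs_h_mult_le[OF p, of "?U z + t * ?V z" "?V z"] by linarith
   then have "\<bar>h p (?U z + t * ?V z) * ?V z\<bar> * kn 0 z \<le> (2 powr p * (\<bar>?U z\<bar> powr p + \<bar>?V z\<bar> powr p) + \<bar>?V z\<bar> powr p) * kn 0 z"
    by (rule mult_right_mono) simp
   then have "p * (\<bar>h p (?U z + t * ?V z) * ?V z\<bar> * kn 0 z) \<le> p * ((2 powr p * (\<bar>?U z\<bar> powr p + \<bar>?V z\<bar> powr p) + \<bar>?V z\<bar> powr p) * kn 0 z)"
    using p by (intro mult_left_mono) auto
   moreover have "\<bar>p * h p (?U z + t * ?V z) * ?V z * kn 0 z\<bar> = p * (\<bar>h p (?U z + t * ?V z) * ?V z\<bar> * kn 0 z)"
    using p by (simp add: abs_mult mult.assoc)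
   moreover have "p * ((2 powr p * (\<bar>?U z\<bar> powr p + \<bar>?V z\<bar> powr p) + \<bar>?V z\<bar> powr p) * kn 0 z) = ?w z" by (simp add: algebra_simps)
   ultimately show "\<bar>p * h p (?U z + t * ?V z) * ?V z * kn 0 z\<bar> \<le> ?w z" by linarith
  qed
 qed measurable
 then show ?thesis unfolding near_self eq by (simp add: near_def mult.assoc)
qed

lemma Upsilon_self_has_derivative:
 "((\<lambda>t. Upsilon p (z1 + t * t1) (z2 + t * t2) (z1 + t * t1) (z2 + t * t2)) has_real_derivative
   p * Upsilon p (z1 + t * t1) (z2 + t * t2) t1 t2) (at t)"
proof -
 have eq: "Upsilon p (z1 + t * t1) (z2 + t * t2) (z1 + t * t1) (z2 + t * t2)
   = \<bar>(z1 - z2) + t * (t1 - t2)\<bar> powr p - \<bar>z1 + t * t1\<bar> powr p - \<bar>z2 + t * t2\<bar> powr p" for t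
 proof -
  have "(z1 + t * t1) - (z2 + t * t2) = (z1 - z2) + t * (t1 - t2)" by (simp add: algebra_simps)
  then show ?thesis by (simp only: Upsilon_def h_mult_self)
 qed
 have d: "((\<lambda>t. \<bar>a + t * c\<bar> powr p) has_real_derivative p * h p (a + t * c) * c) (at t)" for a c
  by (rule DERIV_chain2[OF abs_powr_has_derivative[OF p]]) (auto intro!: derivative_eq_intros)
 have "(z1 - z2) + t * (t1 - t2) = (z1 + t * t1) - (z2 + t * t2)" by (simp add: algebra_simps)
 with DERIV_diff[OF DERIV_diff[OF d[of "z1 - z2" "t1 - t2"] d[of z1 t1]] d[of z2 t2]]
 show ?thesis unfolding eq by (simp add: Upsilon_def algebra_simps)
qed

lemma far_has_derivative:
 assumes u: "u \<in> Xe p \<Omega> 0" and v: "v \<in> Xe p \<Omega> 0"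
 shows "((\<lambda>t. far p 0 (\<lambda>x. u x + t * v x) (\<lambda>x. u x + t * v x)) has_real_derivative p * far p 0 u v) (at 0)"
proof -
 note [measurable] = XeD(1)[OF u] XeD(1)[OF v]
 let ?y = "\<lambda>t x. u x + t * v x"
 let ?F = "\<lambda>x. 2 powr p * (\<bar>u x\<bar> powr p + \<bar>v x\<bar> powr p) + \<bar>v x\<bar> powr p"
 let ?w = "\<lambda>z. p * ((2 powr p + 1) * far_maj \<Omega> ?F z)"
 have "((\<lambda>t. LBINT z. Upsilon p (?y t (fst z)) (?y t (snd z)) (?y t (fst z)) (?y t (snd z)) * kf 0 z)
   has_real_derivative (LBINT z. p * Upsilon p (?y 0 (fst z)) (?y 0 (snd z)) (v (fst z)) (v (snd z)) * kf 0 z)) (at 0)"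
 proof (rule has_real_derivative_integral[where f' = "\<lambda>t z. p * Upsilon p (?y t (fst z)) (?y t (snd z)) (v (fst z)) (v (snd z)) * kf 0 z" and w = ?w])
  show "integrable lborel (\<lambda>z. Upsilon p (?y t (fst z)) (?y t (snd z)) (?y t (fst z)) (?y t (snd z)) * kf 0 z)" for t
  proof -
   have "?y t \<in> Xe p \<Omega> 0" using p by (intro Xe_add_scaled u v) simp
   then show ?thesis by (intro far_integrable(1)[OF p _ \<Omega>]) simp
  qed
  show "(\<lambda>z. p * Upsilon p (?y 0 (fst z)) (?y 0 (snd z)) (v (fst z)) (v (snd z)) * kf 0 z) \<in> borel_measurable lborel"
   unfolding Upsilon_def by measurable
  show "((\<lambda>t. Upsilon p (?y t (fst z)) (?y t (snd z)) (?y t (fst z)) (?y t (snd z)) * kf 0 z) has_real_derivative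
    p * Upsilon p (?y t (fst z)) (?y t (snd z)) (v (fst z)) (v (snd z)) * kf 0 z) (at t)" for t z
   by (intro DERIV_cmult_right Upsilon_self_has_derivative)
  have "integrable lborel ?F" using XeD(3)[OF u] XeD(3)[OF v] by simp
  from far_maj_integrable(1)[OF \<Omega> this] show "integrable lborel ?w" by simp
  show "AE z in lborel. \<forall>t. \<bar>t\<bar> < 1 \<longrightarrow> \<bar>p * Upsilon p (?y t (fst z)) (?y t (snd z)) (v (fst z)) (v (snd z)) * kf 0 z\<bar> \<le> ?w z"
  proof (intro AE_I2 allI impI)
   fix z :: "'a \<times> 'a" and t :: real assume t: "\<bar>t\<bar> < 1"
   have "\<bar>Upsilon p (?y t (fst z)) (?y t (snd z)) (v (fst z)) (v (snd z)) * kf 0 z\<bar> \<le> (2 powr p + 1) * far_maj \<Omega> ?F z"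
   proof (rule far_bound[OF p])
    fix x
    have "\<bar>?y t x\<bar> powr p \<le> 2 powr p * (\<bar>u x\<bar> powr p + \<bar>t * v x\<bar> powr p)" using p by (intro abs_add_powr_le) auto
    also have "\<dots> \<le> 2 powr p * (\<bar>u x\<bar> powr p + \<bar>v x\<bar> powr p)"
     using p t unfolding abs_mult by (intro mult_left_mono add_left_mono powr_mono2 mult_left_le_one_le) auto
    finally show "\<bar>?y t x\<bar> powr p + \<bar>v x\<bar> powr p \<le> ?F x" by simp
   qed (use XeD(2)[OF u] XeD(2)[OF v] in auto)
   then have "p * \<bar>Upsilon p (?y t (fst z)) (?y t (snd z)) (v (fst z)) (v (snd z)) * kf 0 z\<bar> \<le> ?w z"
    using p by (intro mult_left_mono) auto
   then show "\<bar>p * Upsilon p (?y t (fst z)) (?y t (snd z)) (v (fst z)) (v (snd z)) * kf 0 z\<bar> \<le> ?w z"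
    using p by (simp add: abs_mult mult.assoc)
  qed
 qed
 then show ?thesis by (simp add: far_def mult.assoc)
qed

text \<open>This holds also at \<open>0\<close>, where \<open>\<bar>t\<bar> powr (p - 1)\<close>
  beats the logarithm because \<open>p > 1\<close>.\<close>

lemma log_powr_has_derivative:
 "((\<lambda>t. (\<beta> + \<mu> * ln \<bar>t\<bar>) * \<bar>t\<bar> powr p) has_real_derivative p * ((\<beta> + \<mu> * ln \<bar>t\<bar>) * h p t) + \<mu> * h p t) (at t)"
proof (cases "t = 0")
 case True
 have "((\<lambda>y. (\<beta> + \<mu> * ln \<bar>y\<bar>) * \<bar>y\<bar> powr p / y) \<longlongrightarrow> 0) (at 0)"
 proof (rule Lim_null_comparison)
  let ?B = "\<lambda>y::real. \<bar>\<beta>\<bar> * \<bar>y\<bar> powr (p - 1) + \<mu> * (2 / (p - 1) * \<bar>y\<bar> powr ((p - 1) / 2) + \<bar>y\<bar> powr p)"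
  show "\<forall>\<^sub>F y in at 0. norm ((\<beta> + \<mu> * ln \<bar>y\<bar>) * \<bar>y\<bar> powr p / y) \<le> ?B y"
   unfolding eventually_at_filter
  proof (rule always_eventually, intro allI impI)
   fix y :: real assume y: "y \<noteq> 0"
   have "(\<beta> + \<mu> * ln \<bar>y\<bar>) * \<bar>y\<bar> powr p / y = \<beta> * h p y + \<mu> * (ln \<bar>y\<bar> * h p y)"
    unfolding h_mult_self[symmetric] using y by (simp add: field_simps)
   also have "norm \<dots> \<le> \<bar>\<beta>\<bar> * \<bar>h p y\<bar> + \<mu> * \<bar>ln \<bar>y\<bar> * h p y\<bar>"
    unfolding real_norm_def by (rule order_trans[OF abs_triangle_ineq]) (use \<mu> in \<open>simp add: abs_mult\<close>)
   also have "\<dots> \<le> ?B y" using \<mu> ln_h_bound[of y] by (intro add_mono mult_left_mono) (auto simp: abs_h)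
   finally show "norm ((\<beta> + \<mu> * ln \<bar>y\<bar>) * \<bar>y\<bar> powr p / y) \<le> ?B y" .
  qed
  have "(?B \<longlongrightarrow> ?B 0) (at 0)"
   using p by (intro tendsto_add tendsto_mult tendsto_const tendsto_powr' tendsto_rabs tendsto_ident_at) auto
  then show "(?B \<longlongrightarrow> 0) (at 0)" by simp
 qed
 then show ?thesis using True p by (simp add: has_field_derivative_iff)
next
 case False
 have "((\<lambda>t. ln \<bar>t\<bar>) has_real_derivative 1 / t) (at t)"
 proof (cases "0 < t")
  case True
  have "(ln has_real_derivative 1 / t) (at t)" using True by (rule DERIV_ln_divide)
  then show ?thesis
   by (rule has_field_derivative_transform_within[where d = t]) (use True in \<open>auto simp: dist_real_def\<close>)
 next
  case f: False
  have "((\<lambda>t. ln (- t)) has_real_derivative 1 / t) (at t)"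
   using f False by (auto intro!: derivative_eq_intros)
  then show ?thesis
   by (rule has_field_derivative_transform_within[where d = "- t"]) (use f False in \<open>auto simp: dist_real_def\<close>)
 qed
 note d = DERIV_mult[OF DERIV_add[OF DERIV_const[of \<beta>] DERIV_cmult[OF this, of \<mu>]] abs_powr_has_derivative[OF p, of t]]
 have "\<bar>t\<bar> powr p / t = h p t" unfolding h_mult_self[symmetric] using False by simp
 then have "(0 + \<mu> * (1 / t)) * \<bar>t\<bar> powr p = \<mu> * h p t" by (metis add_0 mult.assoc mult.left_commute mult.right_neutral times_divide_eq_right mult.commute)
 with d show ?thesis by (simp add: algebra_simps)
qed

text \<open>Differentiating the logarithm adds \<open>\<mu>\<close> times the integral of
  \<open>h p (u x) * v x\<close>. In the functional \<open>H\<close> at \<open>u0\<close> this term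
  is compensated by the derivative of \<open>Y v * ln (Y v / Y u0)\<close>, and exactly the weak
  equation is left.\<close>

lemma LT_has_derivative:
 assumes u: "u \<in> Xe p \<Omega> 0" and v: "v \<in> Xe p \<Omega> 0"
 shows "((\<lambda>t. LT (\<lambda>x. u x + t * v x) (\<lambda>x. u x + t * v x)) has_real_derivative p * LT u v + \<mu> * (LBINT x. h p (u x) * v x)) (at 0)"
proof -
 note [measurable] = XeD(1)[OF u] XeD(1)[OF v]
 let ?y = "\<lambda>t x. u x + t * v x"
 let ?m = "\<lambda>x. \<bar>u x\<bar> + \<bar>v x\<bar>"
 let ?w = "\<lambda>x. (p * (2 * Clog) + \<mu> * 2) * (indicator \<Omega> x * log_maj (?m x))"
 let ?f' = "\<lambda>t x. p * ((b x + \<mu> * ln \<bar>?y t x\<bar>) * h p (?y t x) * v x) + \<mu> * (h p (?y t x) * v x)"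
 have yX: "?y t \<in> Xe p \<Omega> 0" for t using p by (intro Xe_add_scaled u v) auto
 have "((\<lambda>t. LBINT x. (b x + \<mu> * ln \<bar>?y t x\<bar>) * \<bar>?y t x\<bar> powr p) has_real_derivative (LBINT x. ?f' 0 x)) (at 0)"
 proof (rule has_real_derivative_integral[where f' = ?f' and w = ?w])
  show "integrable lborel (\<lambda>x. (b x + \<mu> * ln \<bar>?y t x\<bar>) * \<bar>?y t x\<bar> powr p)" for t
   using LT_integrable[OF yX yX, of t t] by (simp add: mult.assoc h_mult_self)
  show "((\<lambda>t. (b x + \<mu> * ln \<bar>?y t x\<bar>) * \<bar>?y t x\<bar> powr p) has_real_derivative ?f' t x) (at t)" for t x
  proof -
   have "((\<lambda>t. ?y t x) has_real_derivative v x) (at t)" by (auto intro!: derivative_eq_intros)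
   from DERIV_chain2[OF log_powr_has_derivative this, of "b x"] show ?thesis by (simp add: algebra_simps)
  qed
  show "integrable lborel ?w" by (intro integrable_mult_right log_maj_integrable u v)
  show "AE x in lborel. \<forall>t. \<bar>t\<bar> < 1 \<longrightarrow> \<bar>?f' t x\<bar> \<le> ?w x"
   using b_bound
  proof eventually_elim
   case (elim x)
   show ?case
   proof (intro allI impI)
    fix t :: real assume t: "\<bar>t\<bar> < 1"
    show "\<bar>?f' t x\<bar> \<le> ?w x"
    proof (cases "x \<in> \<Omega>")
     case True
     have "\<bar>t * v x\<bar> \<le> \<bar>v x\<bar>" using t unfolding abs_mult by (intro mult_left_le_one_le) auto
     then have ty: "\<bar>?y t x\<bar> \<le> ?m x" using abs_triangle_ineq[of "u x" "t * v x"] by linarith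
     have vm: "\<bar>v x\<bar> \<le> ?m x" by simp
     have 1: "\<bar>(b x + \<mu> * ln \<bar>?y t x\<bar>) * h p (?y t x) * v x\<bar> \<le> 2 * Clog * log_maj (?m x)"
      by (rule log_bound[OF ty vm]) (use elim True in simp)
     have "\<bar>h p (?y t x) * v x\<bar> \<le> \<bar>?y t x\<bar> powr p + \<bar>v x\<bar> powr p" by (rule abs_h_mult_le[OF p])
     also have "\<dots> \<le> ?m x powr p + ?m x powr p" using ty vm p by (intro add_mono powr_mono2) auto
     also have "\<dots> \<le> 2 * log_maj (?m x)" using log_maj_ge(1)[of "?m x"] by simp
     finally have 2: "\<bar>h p (?y t x) * v x\<bar> \<le> 2 * log_maj (?m x)" .
     have "\<bar>?f' t x\<bar> \<le> p * \<bar>(b x + \<mu> * ln \<bar>?y t x\<bar>) * h p (?y t x) * v x\<bar> + \<mu> * \<bar>h p (?y t x) * v x\<bar>"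
      by (rule order_trans[OF abs_triangle_ineq]) (use p \<mu> in \<open>simp add: abs_mult\<close>)
     also have "\<dots> \<le> p * (2 * Clog * log_maj (?m x)) + \<mu> * (2 * log_maj (?m x))"
      using p \<mu> by (intro add_mono mult_left_mono 1 2) auto
     finally show ?thesis using True by (simp add: algebra_simps)
    next
     case False
     then show ?thesis using XeD(2)[OF u] XeD(2)[OF v] by simp
    qed
   qed
  qed
 qed measurable
 moreover have "(LBINT x. ?f' 0 x) = p * LT u v + \<mu> * (LBINT x. h p (u x) * v x)"
  using LT_integrable[OF u v] integrable_h_mult[OF p XeD(1)[OF u] XeD(1)[OF v] XeD(3)[OF u] XeD(3)[OF v]]
  by (simp add: LT_def)
 ultimately show ?thesis by (simp add: LT_def mult.assoc h_mult_self)
qed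

end

locale small_order_min = small_order_lim +
 assumes lip: "lipschitz_boundary \<Omega>"
begin

text \<open>\<open>H v \<ge> 0\<close> is the logarithm of the inequality \<open>Y u0 \<le> Y v * exp (p * (E0 v v - LT v v) / (\<mu> * Y v))\<close>,
 obtained by comparing the \<open>u k\<close> with multiples of \<open>v\<close>.\<close>

definition H :: "('a \<Rightarrow> real) \<Rightarrow> real" where
 "H v = p * (E0 v v - LT v v) + \<mu> * (Y v * ln (Y v / Y u0))"

text \<open>A Lipschitz function has finite energy for all orders in question, so its multiples
  compete with every \<open>u k\<close>. The forms of the \<open>u k\<close> tend to
  \<open>Y u0\<close>, and logarithms are taken in the limiting comparison.\<close>

lemma H_lipschitz_nonneg:
 assumes L: "\<And>x y. \<bar>w x - w y\<bar> \<le> L * norm (x - y)" and 0: "\<And>x. x \<notin> \<Omega> \<Longrightarrow> w x = 0" and Yw: "0 < Y w"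
 shows "0 \<le> H w"
proof -
 obtain K where K: "\<And>x. \<bar>w x\<bar> \<le> K" using lipschitz_bounded[OF \<Omega>(1) L 0] by blast
 have wX: "w \<in> Xe p \<Omega> (p / 2)" using p by (intro lipschitz_in_Xe[OF p _ \<Omega> L 0]) auto
 obtain T where T: "T \<longlonglongrightarrow> Y w * exp (p * (E0 w w - LT w w) / (\<mu> * Y w))"
  "eventually (\<lambda>k. E_frac (s k) p (u k) (u k) \<le> T k) sequentially"
  using energy_upper_bound[OF wX K Yw] by blast
 have "Y u0 \<le> Y w * exp (p * (E0 w w - LT w w) / (\<mu> * Y w))"
  using tendsto_le[OF _ T(1) energy_tendsto T(2)] by simp
 then have "ln (Y u0) \<le> ln (Y w * exp (p * (E0 w w - LT w w) / (\<mu> * Y w)))"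
  using Y_u0_pos Yw by (subst ln_le_cancel_iff) auto
 also have "\<dots> = ln (Y w) + p * (E0 w w - LT w w) / (\<mu> * Y w)" using Yw by (simp add: ln_mult)
 finally have "0 \<le> p * (E0 w w - LT w w) / (\<mu> * Y w) + ln (Y w / Y u0)" using Yw Y_u0_pos by (simp add: ln_div)
 then have "0 \<le> (\<mu> * Y w) * (p * (E0 w w - LT w w) / (\<mu> * Y w) + ln (Y w / Y u0))"
  using Yw \<mu> by (intro mult_nonneg_nonneg) auto
 then show ?thesis using Yw \<mu> by (simp add: H_def distrib_left mult.assoc)
qed

text \<open>The near part enters \<open>H\<close> with a positive coefficient, so an upper bound for
  it along \<open>w n\<close> suffices, while the other terms converge by domination. Both density
  steps, from Lipschitz to bounded and from bounded to arbitrary functions, pass through this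
  lemma.\<close>

lemma H_limit_nonneg:
 assumes w: "\<And>n. w n \<in> Xe p \<Omega> 0" and v: "v \<in> Xe p \<Omega> 0" and Yv: "0 < Y v"
  and c: "AE x in lborel. (\<lambda>n. w n x) \<longlonglongrightarrow> v x"
  and m: "integrable lborel (\<lambda>x. indicator \<Omega> x * log_maj (m x))" "\<And>n x. \<bar>w n x\<bar> \<le> m x"
  and near: "\<And>n. near p 0 (w n) (w n) \<le> near p 0 v v + d n" "d \<longlonglongrightarrow> 0"
  and H: "\<And>n. 0 < Y (w n) \<Longrightarrow> 0 \<le> H (w n)"
 shows "0 \<le> H v"
proof -
 note [measurable] = XeD(1)[OF w] XeD(1)[OF v]
 let ?c = "C_lim DIM('a) p / 2"
 have c0: "0 \<le> ?c" using p S_pos by (simp add: C_lim_eq)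
 let ?G = "\<lambda>x. indicator \<Omega> x * log_maj (m x)"
 have wG: "\<bar>w n x\<bar> powr p \<le> ?G x" for n x
 proof (cases "x \<in> \<Omega>")
  case True
  have "\<bar>w n x\<bar> powr p \<le> m x powr p" using m(2) p by (intro powr_mono2) auto
  also have "\<dots> \<le> log_maj (m x)" using m(2)[of n x] by (intro log_maj_ge) auto
  finally show ?thesis using True by simp
 qed (use XeD(2)[OF w] in simp)
 have G2: "integrable lborel (\<lambda>x. ?G x + ?G x)" using m(1) by simp
 have wG2: "\<bar>w n x\<bar> powr p + \<bar>w n x\<bar> powr p \<le> ?G x + ?G x" for n x using wG by (intro add_mono)
 have far: "(\<lambda>n. far p 0 (w n) (w n)) \<longlonglongrightarrow> far p 0 v v"
  using XeD(2)[OF w] c G2 wG2 by (intro far_tendsto[where G = "\<lambda>x. ?G x + ?G x"]) auto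
 have Yt: "(\<lambda>n. Y (w n)) \<longlonglongrightarrow> Y v"
  using h_mult_tendsto[of w w v v "\<lambda>x. ?G x + ?G x"] c G2 wG2 by (simp add: h_mult_self Y_def)
 have LTt: "(\<lambda>n. LT (w n) (w n)) \<longlonglongrightarrow> LT v v"
  using XeD(2)[OF w] c m by (intro LT_tendsto[where m = m]) auto
 define R where "R n = p * ((?c * ((near p 0 v v + d n) + far p 0 (w n) (w n)) + rho DIM('a) p * Y (w n)) - LT (w n) (w n)) + \<mu> * (Y (w n) * ln (Y (w n) / Y u0))" for n
 have "R \<longlonglongrightarrow> p * ((?c * ((near p 0 v v + 0) + far p 0 v v) + rho DIM('a) p * Y v) - LT v v) + \<mu> * (Y v * ln (Y v / Y u0))"
  unfolding R_def using Yv Y_u0_pos by (intro tendsto_intros near(2) far Yt LTt) auto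
 also have "p * ((?c * ((near p 0 v v + 0) + far p 0 v v) + rho DIM('a) p * Y v) - LT v v) + \<mu> * (Y v * ln (Y v / Y u0)) = H v"
  by (simp add: H_def E0_def h_mult_self Y_def)
 finally have RH: "R \<longlonglongrightarrow> H v" .
 have "eventually (\<lambda>n. 0 < Y (w n)) sequentially" using Yt Yv by (rule order_tendstoD(1))
 then have "eventually (\<lambda>n. 0 \<le> R n) sequentially"
 proof eventually_elim
  case (elim n)
  have "E0 (w n) (w n) \<le> ?c * ((near p 0 v v + d n) + far p 0 (w n) (w n)) + rho DIM('a) p * Y (w n)"
   using near(1)[of n] c0 unfolding E0_def h_mult_self Y_def[symmetric] by (intro add_right_mono mult_left_mono) auto
  then have "H (w n) \<le> R n" unfolding H_def R_def using p by (intro add_right_mono mult_left_mono) auto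
  then show ?case using H[OF elim] by linarith
 qed
 then show ?thesis using RH by (intro tendsto_lowerbound[of R]) auto
qed

lemma H_bounded_nonneg:
 assumes v: "v \<in> Xe p \<Omega> 0" and K: "\<And>x. \<bar>v x\<bar> \<le> K" and Yv: "0 < Y v"
 shows "0 \<le> H v"
proof -
 note [measurable] = XeD(1)[OF v]
 define P where "P n w \<longleftrightarrow> (\<exists>L. (\<forall>x y. \<bar>w x - w y\<bar> \<le> L * norm (x - y)) \<and> (\<forall>x. \<bar>w x\<bar> \<le> K) \<and> (\<forall>x. x \<notin> \<Omega> \<longrightarrow> w x = 0) \<and>
  (LBINT x. \<bar>w x - v x\<bar> powr p) \<le> 1 / real (Suc n) \<and> near p 0 w w \<le> near p 0 v v + 1 / real (Suc n))" for n w
 have "\<exists>w. P n w" for n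
 proof -
  have "0 < 1 / real (Suc n)" by simp
  then show ?thesis unfolding P_def by (rule lipschitz_recovery[OF p \<Omega> lip v K]) blast
 qed
 then have "\<forall>n. \<exists>w. P n w" by blast
 from choice[OF this] obtain w where "\<forall>n. P n (w n)" by blast
 then have w: "\<exists>L. (\<forall>x y. \<bar>w n x - w n y\<bar> \<le> L * norm (x - y)) \<and> (\<forall>x. \<bar>w n x\<bar> \<le> K) \<and> (\<forall>x. x \<notin> \<Omega> \<longrightarrow> w n x = 0) \<and>
  (LBINT x. \<bar>w n x - v x\<bar> powr p) \<le> 1 / real (Suc n) \<and> near p 0 (w n) (w n) \<le> near p 0 v v + 1 / real (Suc n)" for n
  unfolding P_def by blast
 have wX: "w n \<in> Xe p \<Omega> 0" for n using w[of n] p by (auto intro!: lipschitz_in_Xe[OF p _ \<Omega>])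
 note [measurable] = XeD(1)[OF wX]
 have vX1: "(\<lambda>x. w n x + (- 1) * v x) \<in> Xe p \<Omega> 0" for n using p by (intro Xe_add_scaled wX v) auto
 have di: "integrable lborel (\<lambda>x. \<bar>w n x - v x\<bar> powr p)" for n using XeD(3)[OF vX1, of n] by simp
 have "(\<lambda>n. LBINT x. norm (\<bar>w n x - v x\<bar> powr p)) \<longlonglongrightarrow> 0"
 proof (rule tendsto_sandwich[OF _ _ tendsto_const LIMSEQ_Suc[OF lim_1_over_n]])
  show "eventually (\<lambda>n. 0 \<le> (LBINT x. norm (\<bar>w n x - v x\<bar> powr p))) sequentially"
   by (intro always_eventually allI integral_nonneg_AE) auto
  show "eventually (\<lambda>n. (LBINT x. norm (\<bar>w n x - v x\<bar> powr p)) \<le> 1 / real (Suc n)) sequentially"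
   using w by (intro always_eventually allI) simp
 qed
 from tendsto_L1_AE_subseq[OF di this]
 obtain r where r: "strict_mono (r :: nat \<Rightarrow> nat)" "AE x in lborel. (\<lambda>n. \<bar>w (r n) x - v x\<bar> powr p) \<longlonglongrightarrow> 0" by blast
 have c: "AE x in lborel. (\<lambda>n. w (r n) x) \<longlonglongrightarrow> v x"
  using r(2)
 proof eventually_elim
  case (elim x)
  have "(\<lambda>n. (\<bar>w (r n) x - v x\<bar> powr p) powr (1 / p)) \<longlonglongrightarrow> 0 powr (1 / p)"
   using p by (intro tendsto_powr' elim tendsto_const) auto
  then have "(\<lambda>n. \<bar>w (r n) x - v x\<bar>) \<longlonglongrightarrow> 0" using p by (simp add: powr_powr)
  then show ?case by (simp add: tendsto_rabs_zero_iff LIM_zero_iff)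
 qed
 show ?thesis
 proof (rule H_limit_nonneg[OF wX v Yv c, of "\<lambda>_. K" "\<lambda>n. 1 / real (Suc (r n))"])
  show "integrable lborel (\<lambda>x. indicator \<Omega> x * log_maj K)" using indicator_integrable by simp
  show "\<bar>w (r n) x\<bar> \<le> K" for n x using w by blast
  show "near p 0 (w (r n)) (w (r n)) \<le> near p 0 v v + 1 / real (Suc (r n))" for n using w by blast
  show "(\<lambda>n. 1 / real (Suc (r n))) \<longlonglongrightarrow> 0"
   using LIMSEQ_subseq_LIMSEQ[OF LIMSEQ_Suc[OF lim_1_over_n] r(1)] by (simp add: comp_def)
  show "0 \<le> H (w (r n))" if "0 < Y (w (r n))" for n
  proof -
   obtain L where L: "\<forall>x y. \<bar>w (r n) x - w (r n) y\<bar> \<le> L * norm (x - y)" "\<forall>x. x \<notin> \<Omega> \<longrightarrow> w (r n) x = 0" using w[of "r n"] by blast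
   show ?thesis by (rule H_lipschitz_nonneg[OF _ _ that, of L]) (use L in auto)
  qed
 qed
qed

lemma H_nonneg:
 assumes v: "v \<in> Xe p \<Omega> 0" and Yv: "0 < Y v"
 shows "0 \<le> H v"
proof (rule H_limit_nonneg[OF _ v Yv, of "\<lambda>n x. clamp_real (real n) (v x)" "\<lambda>x. \<bar>v x\<bar> + \<bar>v x\<bar>" "\<lambda>_. 0"])
 show cX: "(\<lambda>x. clamp_real (real n) (v x)) \<in> Xe p \<Omega> 0" for n using p by (intro Xe_clamp v) auto
 show "AE x in lborel. (\<lambda>n. clamp_real (real n) (v x)) \<longlonglongrightarrow> v x" by (intro AE_I2 clamp_tendsto)
 show "integrable lborel (\<lambda>x. indicator \<Omega> x * log_maj (\<bar>v x\<bar> + \<bar>v x\<bar>))" by (rule log_maj_integrable[OF v v])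
 show "\<bar>clamp_real (real n) (v x)\<bar> \<le> \<bar>v x\<bar> + \<bar>v x\<bar>" for n x
  using clamp_real_simps(2)[of "real n" "v x"] by simp
 show "near p 0 (\<lambda>x. clamp_real (real n) (v x)) (\<lambda>x. clamp_real (real n) (v x)) \<le> near p 0 v v + 0" for n
  using Xe_clamp(2)[OF _ v, of "real n"] p by simp
 show "0 \<le> H (\<lambda>x. clamp_real (real n) (v x))" if "0 < Y (\<lambda>x. clamp_real (real n) (v x))" for n
  by (rule H_bounded_nonneg[OF cX _ that, of "real n"]) (rule clamp_real_simps, simp)
qed simp

lemma limit_nehari: "E0 u0 u0 = LT u0 u0"
proof -
 have "0 \<le> p * (E0 u0 u0 - LT u0 u0)" using H_nonneg[OF u0_X Y_u0_pos] Y_u0_pos by (simp add: H_def)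
 then have "LT u0 u0 \<le> E0 u0 u0" using p by (simp add: zero_le_mult_iff)
 then show ?thesis using limit_energy_inequality by simp
qed

lemma limit_minimal:
 assumes v: "v \<in> Xe p \<Omega> 0" and Yv: "0 < Y v" and N: "E0 v v = LT v v"
 shows "Y u0 \<le> Y v"
proof -
 have "0 \<le> \<mu> * (Y v * ln (Y v / Y u0))" using H_nonneg[OF v Yv] N by (simp add: H_def)
 then have "0 \<le> ln (Y v / Y u0)" using \<mu> Yv by (simp add: zero_le_mult_iff)
 then have "1 \<le> Y v / Y u0" using Yv Y_u0_pos by (subst (asm) ln_ge_zero_iff) auto
 then show ?thesis using Y_u0_pos by (simp add: le_divide_eq)
qed

text \<open>\<open>u0\<close> minimises \<open>H\<close>, so the derivative of \<open>H\<close> vanishes there.\<close>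

lemma limit_weak:
 assumes v: "v \<in> Xe p \<Omega> 0"
 shows "E0 u0 v = LT u0 v"
proof -
 let ?y = "\<lambda>t x. u0 x + t * v x"
 let ?h = "LBINT x. h p (u0 x) * v x"
 let ?c = "C_lim DIM('a) p / 2"
 have yX: "?y t \<in> Xe p \<Omega> 0" for t using p by (intro Xe_add_scaled u0_X v) auto
 note Yd = Y_has_derivative[OF u0_X v]
 have Ed: "((\<lambda>t. E0 (?y t) (?y t)) has_real_derivative p * E0 u0 v) (at 0)"
 proof -
  have "((\<lambda>t. ?c * (near p 0 (?y t) (?y t) + far p 0 (?y t) (?y t)) + rho DIM('a) p * Y (?y t)) has_real_derivative
    ?c * (p * near p 0 u0 v + p * far p 0 u0 v) + rho DIM('a) p * (p * ?h)) (at 0)"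
   by (intro DERIV_add DERIV_cmult near_has_derivative far_has_derivative u0_X v Yd)
  moreover have "?c * (p * near p 0 u0 v + p * far p 0 u0 v) + rho DIM('a) p * (p * ?h) = p * E0 u0 v"
   by (simp add: E0_def algebra_simps)
  moreover have "(\<lambda>t. E0 (?y t) (?y t)) = (\<lambda>t. ?c * (near p 0 (?y t) (?y t) + far p 0 (?y t) (?y t)) + rho DIM('a) p * Y (?y t))"
   by (simp only: E0_def h_mult_self Y_def)
  ultimately show ?thesis by (simp only:)
 qed
 have Ld: "((\<lambda>t. Y (?y t) * ln (Y (?y t) / Y u0)) has_real_derivative p * ?h) (at 0)"
 proof -
  have "((\<lambda>t. ln (Y (?y t) / Y u0)) has_real_derivative (1 / (Y (?y 0) / Y u0)) * (p * ?h / Y u0)) (at 0)"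
   by (rule DERIV_chain2[OF DERIV_ln_divide DERIV_cdivide[OF Yd]]) (use Y_u0_pos in simp)
  from DERIV_mult[OF Yd this] show ?thesis using Y_u0_pos by simp
 qed
 have Hd: "((\<lambda>t. H (?y t)) has_real_derivative p * (p * E0 u0 v - (p * LT u0 v + \<mu> * ?h)) + \<mu> * (p * ?h)) (at 0)"
  unfolding H_def by (intro DERIV_add DERIV_cmult DERIV_diff Ed LT_has_derivative u0_X v Ld)
 have "isCont (\<lambda>t. Y (?y t)) 0" by (rule DERIV_isCont[OF Yd])
 then have lim: "((\<lambda>t. Y (?y t)) \<longlongrightarrow> Y u0) (at 0)" by (simp add: isCont_def)
 \<comment> \<open>\<open>H\<close> is known to be nonnegative only where \<open>Y\<close> is
   positive. By continuity of \<open>Y\<close> this covers a neighbourhood of \<open>t = 0\<close>,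
   which is enough for a local minimum.\<close>
 obtain \<delta> where \<delta>: "0 < \<delta>" "\<And>t. t \<noteq> 0 \<Longrightarrow> dist t 0 < \<delta> \<Longrightarrow> 0 < Y (?y t)"
  using order_tendstoD(1)[OF lim Y_u0_pos] unfolding eventually_at by blast
 have \<delta>2: "0 < Y (?y t)" if "dist t 0 < \<delta>" for t
  using \<delta>(2)[OF _ that] Y_u0_pos by (cases "t = 0") simp_all
 have H0: "H (?y 0) = 0" using limit_nehari Y_u0_pos by (simp add: H_def)
 have "\<forall>t. \<bar>0 - t\<bar> < \<delta> \<longrightarrow> H (?y 0) \<le> H (?y t)"
  unfolding H0 using H_nonneg[OF yX \<delta>2] by (simp add: dist_real_def)
 from DERIV_local_min[OF Hd \<delta>(1) this]
 have "p * (p * (E0 u0 v - LT u0 v)) = 0" by (simp add: algebra_simps)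
 then show ?thesis using p by simp
qed

end

section \<open>Borel representatives\<close>

lemma (in small_order_sol) converging_subsequence:
 assumes lip: "lipschitz_boundary \<Omega>"
 obtains \<rho> u0 where "strict_mono (\<rho> :: nat \<Rightarrow> nat)" "u0 \<in> Xe p \<Omega> 0" "0 < Y u0" "E0 u0 u0 = LT u0 u0"
  "\<And>v. v \<in> Xe p \<Omega> 0 \<Longrightarrow> 0 < Y v \<Longrightarrow> E0 v v = LT v v \<Longrightarrow> Y u0 \<le> Y v"
  "\<And>v. v \<in> Xe p \<Omega> 0 \<Longrightarrow> E0 u0 v = LT u0 v"
  "(\<lambda>k. LBINT x. \<bar>u (\<rho> k) x - u0 x\<bar> powr p) \<longlonglongrightarrow> 0"
proof -
 obtain C c where C: "0 < c" "0 < C" "eventually (\<lambda>k. near p (e k) (u k) (u k) \<le> C \<and> c \<le> Y (u k) \<and> Y (u k) \<le> C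
   \<and> \<bar>E_frac (s k) p (u k) (u k) - Y (u k)\<bar> \<le> C * s k) sequentially" by (rule a_priori)
 then obtain k0 where k0: "\<And>k. k0 \<le> k \<Longrightarrow> near p (e k) (u k) (u k) \<le> C \<and> c \<le> Y (u k) \<and> Y (u k) \<le> C
   \<and> \<bar>E_frac (s k) p (u k) (u k) - Y (u k)\<bar> \<le> C * s k" unfolding eventually_sequentially by blast
 let ?u = "\<lambda>k. u (k + k0)"
 have X0: "u k \<in> Xe p \<Omega> 0" for k using e_pos[of k] by (intro Xe_antimono[OF _ uX[of k]]) simp
 \<comment> \<open>The near kernel increases with its order, so the bound at order
   \<open>e k\<close> yields the one at order \<open>0\<close>, where the compactness lemma
   works.\<close>
 have near0: "near p 0 (?u k) (?u k) \<le> C" for k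
 proof -
  have "near p 0 (?u k) (?u k) \<le> near p (e (k + k0)) (?u k) (?u k)"
   unfolding near_self using e_pos[of "k + k0"]
   by (intro integral_mono XeD(4)[OF X0] XeD(4)[OF uX] mult_left_mono kn_mono) auto
  then show ?thesis using k0[of "k + k0"] by simp
 qed
 have Y0: "(LBINT x. \<bar>?u k x\<bar> powr p) \<le> C" for k using k0[of "k + k0"] by (simp add: Y_def)
 obtain r1 where r1: "strict_mono (r1 :: nat \<Rightarrow> nat)"
  "\<And>\<epsilon>. 0 < \<epsilon> \<Longrightarrow> \<exists>K. \<forall>m\<ge>K. \<forall>n\<ge>K. (LBINT x. \<bar>?u (r1 m) x - ?u (r1 n) x\<bar> powr p) \<le> \<epsilon>"
  by (rule X_compact[OF p \<Omega> X0 Y0 near0]) (rule that; assumption)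
 obtain r2 g G where r2: "strict_mono (r2 :: nat \<Rightarrow> nat)" and g [measurable]: "g \<in> borel_measurable borel"
  and gl: "AE x in lborel. (\<lambda>k. ?u (r1 (r2 k)) x) \<longlonglongrightarrow> g x" and G: "integrable lborel G" "\<And>x. 0 \<le> G x"
  "AE x in lborel. \<forall>k. \<bar>?u (r1 (r2 k)) x\<bar> powr p \<le> G x" and gG: "AE x in lborel. \<bar>g x\<bar> powr p \<le> G x"
  and gi: "integrable lborel (\<lambda>x. \<bar>g x\<bar> powr p)"
  and gL: "(\<lambda>k. LBINT x. \<bar>?u (r1 (r2 k)) x - g x\<bar> powr p) \<longlonglongrightarrow> 0"
  by (rule Lp_subsequence[OF p XeD(1)[OF X0] XeD(3)[OF X0]]) (erule r1(2), (rule that; assumption))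
 define \<rho> where "\<rho> k = r1 (r2 k) + k0" for k
 have \<rho>: "strict_mono \<rho>" using r1(1) r2 by (simp add: \<rho>_def strict_mono_def)
 have [measurable]: "\<Omega> \<in> sets borel" using \<Omega> by auto
 \<comment> \<open>Membership in \<open>X\<close> demands the value \<open>0\<close> at every point
   outside \<open>\<Omega>\<close>, while the limit \<open>g\<close> is identified only almost
   everywhere.\<close>
 define u0 where "u0 x = indicator \<Omega> x * g x" for x
 have u0m [measurable]: "u0 \<in> borel_measurable borel" unfolding u0_def[abs_def] by measurable
 have gu0: "AE x in lborel. g x = u0 x"
  using gl
 proof eventually_elim
  case (elim x)
  show ?case
  proof (cases "x \<in> \<Omega>")
   case False
   then have "(\<lambda>k. ?u (r1 (r2 k)) x) = (\<lambda>k. 0)" using XeD(2)[OF uX] by simp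
   then show ?thesis using elim False by (simp add: u0_def LIMSEQ_const_iff)
  qed (simp add: u0_def)
 qed
 have sub: "(\<lambda>k. X (\<rho> k)) \<longlonglongrightarrow> l" if "X \<longlonglongrightarrow> l" for X and l :: real
  using LIMSEQ_subseq_LIMSEQ[OF that \<rho>] by (simp add: comp_def)
 have \<rho>k0: "k0 \<le> \<rho> k" for k by (simp add: \<rho>_def)
 interpret lim: small_order_min \<Omega> p \<mu> M "\<lambda>k. s (\<rho> k)" "\<lambda>k. Q (\<rho> k)" "\<lambda>k. \<alpha> (\<rho> k)" b "\<lambda>k. u (\<rho> k)" u0 G C c
 proof unfold_locales
  show "(\<lambda>k. s (\<rho> k)) \<longlonglongrightarrow> 0" by (rule sub[OF s(3)])
  show "(\<lambda>k. (Q (\<rho> k) - p) / s (\<rho> k)) \<longlonglongrightarrow> \<mu>" by (rule sub[OF Q(2)])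
  show "AE x in lborel. x \<in> \<Omega> \<longrightarrow> (\<forall>k. \<bar>\<alpha> (\<rho> k) x - 1\<bar> \<le> M * s (\<rho> k))" using \<alpha> by eventually_elim blast
  show "AE x in lborel. x \<in> \<Omega> \<longrightarrow> (\<lambda>k. (\<alpha> (\<rho> k) x - 1) / s (\<rho> k)) \<longlonglongrightarrow> b x"
   using b by eventually_elim (use sub in blast)
  show "AE x in lborel. (\<lambda>k. u (\<rho> k) x) \<longlonglongrightarrow> u0 x"
   using gl gu0 by eventually_elim (simp add: \<rho>_def)
  show "AE x in lborel. \<forall>k. \<bar>u (\<rho> k) x\<bar> powr p \<le> G x" using G(3) by (simp add: \<rho>_def)
  show "AE x in lborel. \<bar>u0 x\<bar> powr p \<le> G x" using gG gu0 by eventually_elim simp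
  show "E_frac (s (\<rho> k)) p (u (\<rho> k)) v = (LBINT x. \<alpha> (\<rho> k) x * \<bar>u (\<rho> k) x\<bar> powr (Q (\<rho> k) - 2) * u (\<rho> k) x * v x)"
   if "v \<in> Xe p \<Omega> (s (\<rho> k) * p)" for k v by (rule weak[OF that])
  show "E_frac (s (\<rho> k)) p (u (\<rho> k)) (u (\<rho> k)) \<le> E_frac (s (\<rho> k)) p v v"
   if "v \<in> Xe p \<Omega> (s (\<rho> k) * p)" "0 < (LBINT x. \<bar>v x\<bar> powr p)"
    "E_frac (s (\<rho> k)) p v v = (LBINT x. \<alpha> (\<rho> k) x * \<bar>v x\<bar> powr Q (\<rho> k))" for k v
   by (rule least[OF that])
  show "near p (s (\<rho> k) * p) (u (\<rho> k)) (u (\<rho> k)) \<le> C" "c \<le> Y (u (\<rho> k))"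
   "\<bar>E_frac (s (\<rho> k)) p (u (\<rho> k)) (u (\<rho> k)) - Y (u (\<rho> k))\<bar> \<le> C * s (\<rho> k)" for k
   using k0[OF \<rho>k0] by auto
 qed (use p \<Omega> s Q uX uY C lip G \<mu> M in \<open>auto simp: u0_def\<close>)
 have "(LBINT x. \<bar>u (\<rho> k) x - u0 x\<bar> powr p) = (LBINT x. \<bar>?u (r1 (r2 k)) x - g x\<bar> powr p)" for k
 proof (rule integral_cong_AE)
  note [measurable] = XeD(1)[OF X0]
  show "(\<lambda>x. \<bar>u (\<rho> k) x - u0 x\<bar> powr p) \<in> borel_measurable lborel" "(\<lambda>x. \<bar>?u (r1 (r2 k)) x - g x\<bar> powr p) \<in> borel_measurable lborel"
   by measurable
  show "AE x in lborel. \<bar>u (\<rho> k) x - u0 x\<bar> powr p = \<bar>?u (r1 (r2 k)) x - g x\<bar> powr p"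
   using gu0 by eventually_elim (simp add: \<rho>_def)
 qed
 with gL have "(\<lambda>k. LBINT x. \<bar>u (\<rho> k) x - u0 x\<bar> powr p) \<longlonglongrightarrow> 0" by simp
 from that[OF \<rho> lim.u0_X lim.Y_u0_pos lim.limit_nehari lim.limit_minimal lim.limit_weak this] show ?thesis .
qed

text \<open>The problems are posed for Lebesgue measurable functions, whereas products and
  substitutions are handled with Borel functions. Completeness of Lebesgue measure makes a function
  measurable as soon as it agrees almost everywhere with a Borel one.\<close>

lemma integral_AE_borel:
 fixes f g :: "'a::euclidean_space \<Rightarrow> real"
 assumes g: "g \<in> borel_measurable borel" and fg: "AE x in lborel. f x = g x"
 shows "f \<in> borel_measurable lebesgue" "integral\<^sup>L lebesgue f = integral\<^sup>L lborel g"
  "integrable lebesgue f \<longleftrightarrow> integrable lborel g"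
proof -
 have gm: "g \<in> borel_measurable lebesgue" using g by (simp add: measurable_completion)
 have ae: "AE x in lebesgue. f x = g x" using fg by (simp add: AE_completion_iff)
 show fm: "f \<in> borel_measurable lebesgue"
 proof (rule measurableI)
  fix A :: "real set" assume A: "A \<in> sets borel"
  show "f -` A \<inter> space lebesgue \<in> sets lebesgue"
  proof (rule completion.in_sets_AE)
   show "AE x in lebesgue. x \<in> g -` A \<inter> space lebesgue \<longleftrightarrow> x \<in> f -` A \<inter> space lebesgue"
    using ae by eventually_elim simp
   show "g -` A \<inter> space lebesgue \<in> sets lebesgue" by (rule measurable_sets[OF gm A])
  qed simp
 qed simp
 have "integral\<^sup>L lebesgue f = integral\<^sup>L lebesgue g" by (rule integral_cong_AE[OF fm gm ae])
 then show "integral\<^sup>L lebesgue f = integral\<^sup>L lborel g" using integral_lebesgue_borel[OF g] by simp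
 show "integrable lebesgue f \<longleftrightarrow> integrable lborel g"
  using integrable_cong_AE[OF fm gm ae] integral_lebesgue_borel[OF g] by simp
qed

lemma integral_on_AE_borel:
 fixes f g :: "'a::euclidean_space \<Rightarrow> real"
 assumes \<Omega>: "open \<Omega>" and g: "g \<in> borel_measurable borel" "\<And>x. x \<notin> \<Omega> \<Longrightarrow> g x = 0"
  and fg: "AE x in lborel. x \<in> \<Omega> \<longrightarrow> f x = g x"
 shows "f \<in> borel_measurable (lebesgue_on \<Omega>)" "integral\<^sup>L (lebesgue_on \<Omega>) f = integral\<^sup>L lborel g"
  "integrable (lebesgue_on \<Omega>) f \<longleftrightarrow> integrable lborel g"
proof -
 have S: "\<Omega> \<inter> space lebesgue \<in> sets lebesgue" using \<Omega> by auto
 have "AE x in lborel. indicator \<Omega> x *\<^sub>R f x = g x"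
  using fg by eventually_elim (auto simp: indicator_def g(2))
 note * = integral_AE_borel[OF g(1) this]
 show "f \<in> borel_measurable (lebesgue_on \<Omega>)" using *(1) by (simp add: borel_measurable_restrict_space_iff[OF S])
 show "integral\<^sup>L (lebesgue_on \<Omega>) f = integral\<^sup>L lborel g" using *(2) by (simp add: integral_restrict_space[OF S])
 show "integrable (lebesgue_on \<Omega>) f \<longleftrightarrow> integrable lborel g" using *(3) by (simp add: integrable_restrict_space[OF S])
qed

lemma lebesgue_on_ex_borel:
 fixes f :: "'a::euclidean_space \<Rightarrow> real"
 assumes \<Omega>: "open \<Omega>" and f: "f \<in> borel_measurable (lebesgue_on \<Omega>)"
 obtains g where "g \<in> borel_measurable borel" "\<And>x. x \<notin> \<Omega> \<Longrightarrow> g x = 0" "AE x in lborel. x \<in> \<Omega> \<longrightarrow> f x = g x"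
proof -
 have S: "\<Omega> \<inter> space lebesgue \<in> sets lebesgue" "\<Omega> \<in> sets borel" using \<Omega> by auto
 have "(\<lambda>x. indicator \<Omega> x *\<^sub>R f x) \<in> borel_measurable lebesgue"
  using f by (simp add: borel_measurable_restrict_space_iff[OF S(1)])
 from completion_ex_borel_measurable_real[OF this]
 obtain g where g: "g \<in> borel_measurable lborel" "AE x in lborel. indicator \<Omega> x *\<^sub>R f x = g x" by blast
 show ?thesis
 proof (rule that[of "\<lambda>x. indicator \<Omega> x * g x"])
  show "(\<lambda>x. indicator \<Omega> x * g x) \<in> borel_measurable borel" using g(1) S(2) by measurable
  show "AE x in lborel. x \<in> \<Omega> \<longrightarrow> f x = indicator \<Omega> x * g x" using g(2) by eventually_elim auto
 qed simp
qed

section \<open>Transfer of the fractional problem\<close>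

lemma AE_pair_cong:
 fixes u u' v v' :: "'a::euclidean_space \<Rightarrow> real"
 assumes "AE x in lborel. u x = u' x" "AE x in lborel. v x = v' x"
 shows "AE z in lborel. F (u (fst z)) (u (snd z)) (v (fst z)) (v (snd z)) z = F (u' (fst z)) (u' (snd z)) (v' (fst z)) (v' (snd z)) (z :: 'a \<times> 'a)"
 using AE_lborel_pair(1)[OF assms(1), where 'b='a] AE_lborel_pair(2)[OF assms(1), where 'b='a]
  AE_lborel_pair(1)[OF assms(2), where 'b='a] AE_lborel_pair(2)[OF assms(2), where 'b='a]
 by eventually_elim simp

lemma E_frac_cong_AE:
 fixes u u' v v' :: "'a::euclidean_space \<Rightarrow> real"
 assumes u: "AE x in lborel. u x = u' x" and v: "AE x in lborel. v x = v' x"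
  and [measurable]: "u' \<in> borel_measurable borel" "v' \<in> borel_measurable borel"
 shows "E_frac s p u v = E_frac s p u' v'"
proof -
 let ?F = "\<lambda>a b c d z. h p (a - b) * (c - d) / norm (fst z - snd z :: 'a) powr (real DIM('a) + s * p)"
 have m: "(\<lambda>z. ?F (u' (fst z)) (u' (snd z)) (v' (fst z)) (v' (snd z)) z) \<in> borel_measurable borel" by measurable
 note 1 = integral_AE_borel(2)[OF m AE_pair_cong[OF u v, of ?F]]
 have "AE x in lborel. u' x = u' x" "AE x in lborel. v' x = v' x" by auto
 note 2 = integral_AE_borel(2)[OF m AE_pair_cong[OF this, of ?F]]
 show ?thesis using 1 2 by (simp add: E_frac_def case_prod_unfold)
qed

lemma W0_ex_borel:
 fixes u :: "'a::euclidean_space \<Rightarrow> real"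
 assumes p: "0 < p" and \<Omega>: "open \<Omega>" and u: "u \<in> W0 s p \<Omega>"
 obtains w where "w \<in> Xe p \<Omega> (s * p)" "AE x in lborel. u x = w x"
proof -
 have um: "u \<in> borel_measurable lebesgue" using u by (auto simp: W0_def Lp_fun_def)
 have "u \<in> borel_measurable (lebesgue_on \<Omega>)" by (rule measurable_restrict_space1[OF um])
 from lebesgue_on_ex_borel[OF \<Omega> this]
 obtain w where w: "w \<in> borel_measurable borel" "\<And>x. x \<notin> \<Omega> \<Longrightarrow> w x = 0" "AE x in lborel. x \<in> \<Omega> \<longrightarrow> u x = w x" by blast
 note [measurable] = w(1)
 have "AE x in lborel. x \<notin> \<Omega> \<longrightarrow> u x = 0" using u by (simp add: W0_def AE_completion_iff)
 with w(3) have uw: "AE x in lborel. u x = w x" by eventually_elim (use w(2) in auto)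
 have "AE x in lborel. \<bar>u x\<bar> powr p = \<bar>w x\<bar> powr p" using uw by eventually_elim simp
 from integral_AE_borel(3)[OF _ this] have i: "integrable lborel (\<lambda>x. \<bar>w x\<bar> powr p)"
  using u by (simp add: W0_def Lp_fun_def)
 let ?F = "\<lambda>a b c d z. \<bar>a - b\<bar> powr p / norm (fst z - snd z :: 'a) powr (real DIM('a) + s * p)"
 let ?f = "\<lambda>z. ?F (w (fst z)) (w (snd z)) (w (fst z)) (w (snd z)) z"
 have m: "?f \<in> borel_measurable borel" by measurable
 have "integrable lborel ?f"
  using integral_AE_borel(3)[OF m AE_pair_cong[OF uw uw, of ?F]] u by (simp add: W0_def case_prod_unfold)
 then have "integrable lborel (\<lambda>z. \<bar>incr w z\<bar> powr p * kn (s * p) z)"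
 proof (rule Bochner_Integration.integrable_bound)
  show "AE z in lborel. norm (\<bar>incr w z\<bar> powr p * kn (s * p) z) \<le> norm (?f z)"
  proof (rule AE_I2)
   fix z :: "'a \<times> 'a"
   let ?A = "\<bar>incr w z\<bar> powr p"
   have "kn (s * p) z \<le> norm (fst z - snd z) powr - (real DIM('a) + s * p)" by (simp add: kn_def indicator_def)
   then have "?A * kn (s * p) z \<le> ?A * norm (fst z - snd z) powr - (real DIM('a) + s * p)" by (rule mult_left_mono) simp
   also have "\<dots> = ?f z" unfolding powr_minus divide_inverse ..
   finally show "norm (?A * kn (s * p) z) \<le> norm (?f z)" by (simp add: abs_mult)
  qed
 qed measurable
 with i w have "w \<in> Xe p \<Omega> (s * p)" by (auto simp: Xe_def)
 then show ?thesis using uw by (rule that)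
qed

lemma Xe_in_W0:
 fixes w :: "'a::euclidean_space \<Rightarrow> real"
 assumes p: "0 < p" "0 < s" and w: "w \<in> Xe p \<Omega> (s * p)"
 shows "w \<in> W0 s p \<Omega>"
proof -
 note [measurable] = XeD(1)[OF w]
 have e: "0 < s * p" using p by simp
 let ?f = "\<lambda>z::'a\<times>'a. \<bar>incr w z\<bar> powr p / norm (fst z - snd z) powr (real DIM('a) + s * p)"
 let ?g = "\<lambda>z::'a\<times>'a. \<bar>incr w z\<bar> powr p * kn (s * p) z + 2 powr p * (\<bar>w (fst z)\<bar> powr p * kf (s * p) z + \<bar>w (snd z)\<bar> powr p * kf (s * p) z)"
 have "integrable lborel ?g"
  using XeD(4)[OF w] integrable_kf_fst(1,2)[OF e XeD(3)[OF w]] by simp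
 then have "integrable lborel ?f"
 proof (rule Bochner_Integration.integrable_bound)
  show "AE z in lborel. norm (?f z) \<le> norm (?g z)"
  proof (rule AE_I2)
   fix z :: "'a \<times> 'a"
   have "?f z = \<bar>incr w z\<bar> powr p * (kn (s * p) z + kf (s * p) z)"
    unfolding divide_inverse powr_minus[symmetric] using kn_plus_kf[of "s * p" "fst z" "snd z"] by simp
   also have "\<dots> = \<bar>incr w z\<bar> powr p * kn (s * p) z + \<bar>incr w z\<bar> powr p * kf (s * p) z"
    by (simp add: distrib_left)
   also have "\<bar>incr w z\<bar> powr p * kf (s * p) z \<le> 2 powr p * (\<bar>w (fst z)\<bar> powr p + \<bar>w (snd z)\<bar> powr p) * kf (s * p) z"
    by (intro mult_right_mono abs_diff_powr_le p) simp
   finally have "?f z \<le> ?g z" by (simp add: algebra_simps)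
   moreover have "0 \<le> ?f z" by simp
   ultimately show "norm (?f z) \<le> norm (?g z)" by simp
  qed
 qed measurable
 then have "integrable lebesgue ?f" by (subst integral_lebesgue_borel) auto
 moreover have "integrable lebesgue (\<lambda>x. \<bar>w x\<bar> powr p)" using XeD(3)[OF w] by (subst integral_lebesgue_borel) auto
 moreover have "w \<in> borel_measurable lebesgue" by (simp add: measurable_completion)
 ultimately show ?thesis using XeD(2)[OF w] by (auto simp: W0_def Lp_fun_def case_prod_unfold)
qed

lemma nontrivial_iff:
 assumes p: "0 < p" and w: "w \<in> Xe p \<Omega> e" and uw: "AE x in lborel. u x = w x"
 shows "nontrivial u \<longleftrightarrow> 0 < (LBINT x. \<bar>w x\<bar> powr p)"
proof -
 have "(AE x in lborel. u x = 0) \<longleftrightarrow> (AE x in lborel. \<bar>w x\<bar> powr p = 0)"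
 proof
  assume "AE x in lborel. u x = 0"
  then show "AE x in lborel. \<bar>w x\<bar> powr p = 0" using uw by eventually_elim simp
 next
  assume "AE x in lborel. \<bar>w x\<bar> powr p = 0"
  then show "AE x in lborel. u x = 0" using uw by eventually_elim simp
 qed
 also have "\<dots> \<longleftrightarrow> (LBINT x. \<bar>w x\<bar> powr p) = 0"
  by (rule integral_nonneg_eq_0_iff_AE[symmetric, OF XeD(3)[OF w]]) simp
 finally show ?thesis
  using integral_nonneg_AE[of "\<lambda>x. \<bar>w x\<bar> powr p" lborel] by (auto simp: nontrivial_def AE_completion_iff less_le)
qed

text \<open>Testing the weak equation with the representative itself puts it on the Nehari set;
  there, since \<open>p < r\<close>, the infimum property of the energy turns into a comparison of
  forms.\<close>

lemma least_energy_sol_frac_borel: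
 fixes u b \<beta> :: "'a::euclidean_space \<Rightarrow> real"
 assumes p: "1 < p" "p < r" and s: "0 < s" and \<Omega>: "open \<Omega>"
  and \<beta> [measurable]: "\<beta> \<in> borel_measurable borel" and b: "AE x in lborel. x \<in> \<Omega> \<longrightarrow> b x = \<beta> x"
  and u: "least_energy_sol_frac s p \<Omega> b r u" "nontrivial u"
 obtains w where "w \<in> Xe p \<Omega> (s * p)" "AE x in lborel. u x = w x" "0 < (LBINT x. \<bar>w x\<bar> powr p)"
  "\<And>v. v \<in> Xe p \<Omega> (s * p) \<Longrightarrow> E_frac s p w v = (LBINT x. \<beta> x * \<bar>w x\<bar> powr (r - 2) * w x * v x)"
  "\<And>v. v \<in> Xe p \<Omega> (s * p) \<Longrightarrow> 0 < (LBINT x. \<bar>v x\<bar> powr p) \<Longrightarrow>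
    E_frac s p v v = (LBINT x. \<beta> x * \<bar>v x\<bar> powr r) \<Longrightarrow> E_frac s p w w \<le> E_frac s p v v"
proof -
 have p0: "0 < p" using p by simp
 have uW: "u \<in> W0 s p \<Omega>" and uw': "\<And>v. v \<in> W0 s p \<Omega> \<Longrightarrow>
    E_frac s p u v = (LINT x|lebesgue_on \<Omega>. b x * \<bar>u x\<bar> powr (r - 2) * u x * v x)"
  and uJ: "ereal (J_frac s p \<Omega> b r u) = (INF v \<in> Nehari_frac s p \<Omega> b r. ereal (J_frac s p \<Omega> b r v))"
  using u(1) by (auto simp: least_energy_sol_frac_def weak_sol_frac_def)
 obtain w where w: "w \<in> Xe p \<Omega> (s * p)" and uw: "AE x in lborel. u x = w x" by (rule W0_ex_borel[OF p0 \<Omega> uW])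
 note [measurable] = XeD(1)[OF w]
 have weak: "E_frac s p w v = (LBINT x. \<beta> x * \<bar>w x\<bar> powr (r - 2) * w x * v x)" if v: "v \<in> Xe p \<Omega> (s * p)" for v
 proof -
  note [measurable] = XeD(1)[OF v]
  have "E_frac s p w v = E_frac s p u v" by (rule E_frac_cong_AE[symmetric, OF uw]) auto
  also have "\<dots> = (LINT x|lebesgue_on \<Omega>. b x * \<bar>u x\<bar> powr (r - 2) * u x * v x)"
   by (rule uw'[OF Xe_in_W0[OF p0 s v]])
  also have "\<dots> = (LBINT x. \<beta> x * \<bar>w x\<bar> powr (r - 2) * w x * v x)"
  proof (rule integral_on_AE_borel(2)[OF \<Omega>])
   show "AE x in lborel. x \<in> \<Omega> \<longrightarrow> b x * \<bar>u x\<bar> powr (r - 2) * u x * v x = \<beta> x * \<bar>w x\<bar> powr (r - 2) * w x * v x"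
    using b uw by eventually_elim simp
  qed (auto simp: XeD(2)[OF v])
  finally show ?thesis .
 qed
 have nl: "(LINT x|lebesgue_on \<Omega>. b x * \<bar>v x\<bar> powr r) = (LBINT x. \<beta> x * \<bar>v' x\<bar> powr r)"
  if v: "v' \<in> Xe p \<Omega> (s * p)" "AE x in lborel. v x = v' x" for v v'
 proof (rule integral_on_AE_borel(2)[OF \<Omega>])
  note [measurable] = XeD(1)[OF v(1)]
  show "(\<lambda>x. \<beta> x * \<bar>v' x\<bar> powr r) \<in> borel_measurable borel" by measurable
  show "AE x in lborel. x \<in> \<Omega> \<longrightarrow> b x * \<bar>v x\<bar> powr r = \<beta> x * \<bar>v' x\<bar> powr r"
   using b v(2) by eventually_elim simp
 qed (simp add: XeD(2)[OF v(1)])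
 have J: "J_frac s p \<Omega> b r v = (1 / p - 1 / r) * E_frac s p v' v'"
  if v: "v' \<in> Xe p \<Omega> (s * p)" "AE x in lborel. v x = v' x" "E_frac s p v' v' = (LBINT x. \<beta> x * \<bar>v' x\<bar> powr r)" for v v'
 proof -
  have "E_frac s p v v = E_frac s p v' v'" using v XeD(1)[OF v(1)] by (intro E_frac_cong_AE)
  then show ?thesis using nl[OF v(1,2)] v(3) by (simp add: J_frac_def seminorm_frac_p_E_frac algebra_simps)
 qed
 have wN: "E_frac s p w w = (LBINT x. \<beta> x * \<bar>w x\<bar> powr r)"
 proof -
  have "\<bar>t\<bar> powr (r - 2) * t * t = \<bar>t\<bar> powr r" for t :: real using h_mult_self[of r t] by (simp add: h_def)
  then show ?thesis using weak[OF w] by (simp add: mult.assoc)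
 qed
 have le: "E_frac s p w w \<le> E_frac s p v v"
  if v: "v \<in> Xe p \<Omega> (s * p)" "0 < (LBINT x. \<bar>v x\<bar> powr p)" "E_frac s p v v = (LBINT x. \<beta> x * \<bar>v x\<bar> powr r)" for v
 proof -
  have vv: "AE x in lborel. v x = v x" by simp
  have "v \<in> Nehari_frac s p \<Omega> b r"
   using Xe_in_W0[OF p0 s v(1)] nontrivial_iff[OF p0 v(1) vv] v(2,3) nl[OF v(1) vv]
   by (simp add: Nehari_frac_def seminorm_frac_p_E_frac)
  then have "ereal (J_frac s p \<Omega> b r u) \<le> ereal (J_frac s p \<Omega> b r v)" unfolding uJ by (rule INF_lower)
  then have "(1 / p - 1 / r) * E_frac s p w w \<le> (1 / p - 1 / r) * E_frac s p v v"
   using J[OF w uw wN] J[OF v(1) vv v(3)] by simp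
  moreover have "0 < 1 / p - 1 / r" using p by (simp add: field_simps)
  ultimately show ?thesis by (simp add: mult_le_cancel_left_pos)
 qed
 have "0 < (LBINT x. \<bar>w x\<bar> powr p)" using u(2) nontrivial_iff[OF p0 w uw] by simp
 from that[OF w uw this weak le] show ?thesis .
qed

text \<open>The limit form counts pairs at distance exactly \<open>1\<close> in both of its
  integrals, while \<open>kf\<close> leaves them to \<open>kn\<close>. These pairs form a null set,
  being fibred by spheres.\<close>

lemma AE_norm_diff_neq:
 assumes "0 < c"
 shows "AE z in lborel. norm (fst z - snd z :: 'a::euclidean_space) \<noteq> c"
proof -
 have "AE y in lborel. norm (x - y) \<noteq> c" for x :: 'a
 proof -
  have "sphere x c \<in> null_sets lborel"
   using negligible_sphere[of x c] by (simp add: negligible_iff_null_sets null_sets_completion_iff)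
  then show ?thesis by (rule AE_I') (auto simp: dist_norm)
 qed
 then have "(\<integral>\<^sub>+y. indicator {c} (norm (x - y))) = 0" for x :: 'a
  by (subst nn_integral_0_iff_AE) (auto simp: indicator_def)
 then have "(\<integral>\<^sub>+z. indicator {c} (norm (fst z - snd z :: 'a))) = 0"
  by (subst nn_integral_pair_lborel(1)) auto
 then show ?thesis by (subst (asm) nn_integral_0_iff_AE) (auto simp: indicator_def)
qed

lemma kernel_0:
 "indicator {..1} (norm (x - y)) / norm (x - y) ^ DIM('a) = kn 0 (x, y)"
 "indicator {1<..} (norm (x - y)) / norm (x - y) ^ DIM('a) = kf 0 (x, y)"
 for x y :: "'a::euclidean_space"
 by (cases "x = y"; simp add: kn_def kf_def powr_minus powr_realpow divide_inverse)+

section \<open>Transfer of the limit problem\<close>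

lemma X_space_ex_borel:
 fixes u :: "'a::euclidean_space \<Rightarrow> real"
 assumes \<Omega>: "open \<Omega>" and u: "u \<in> X_space p \<Omega>"
 obtains w where "w \<in> Xe p \<Omega> 0" "AE x in lborel. u x = w x"
proof -
 have "u \<in> borel_measurable (lebesgue_on \<Omega>)" using u by (simp add: X_space_def Lp_fun_def)
 from lebesgue_on_ex_borel[OF \<Omega> this]
 obtain w where w: "w \<in> borel_measurable borel" "\<And>x. x \<notin> \<Omega> \<Longrightarrow> w x = 0" "AE x in lborel. x \<in> \<Omega> \<longrightarrow> u x = w x" by blast
 note [measurable] = w(1)
 have uw: "AE x in lborel. u x = w x"
  using w(3) by eventually_elim (use w(2) u in \<open>auto simp: X_space_def\<close>)
 have "AE x in lborel. x \<in> \<Omega> \<longrightarrow> \<bar>u x\<bar> powr p = \<bar>w x\<bar> powr p" using uw by eventually_elim simp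
 from integral_on_AE_borel(3)[OF \<Omega> _ _ this] have i: "integrable lborel (\<lambda>x. \<bar>w x\<bar> powr p)"
  using u w(2) by (simp add: X_space_def Lp_fun_def)
 let ?F = "\<lambda>a b c d z. indicator {..1} (norm (fst z - snd z :: 'a)) * (\<bar>a - b\<bar> powr p / norm (fst z - snd z) ^ DIM('a))"
 let ?f = "\<lambda>z. ?F (w (fst z)) (w (snd z)) (w (fst z)) (w (snd z)) z"
 have m: "?f \<in> borel_measurable borel" by measurable
 have "integrable lebesgue (\<lambda>z. ?F (u (fst z)) (u (snd z)) (u (fst z)) (u (snd z)) z)"
  using u by (simp add: X_space_def set_integrable_def case_prod_unfold indicator_def)
 then have "integrable lborel ?f" by (simp only: integral_AE_borel(3)[OF m AE_pair_cong[OF uw uw, of ?F]])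
 moreover have "?f z = \<bar>incr w z\<bar> powr p * kn 0 z" for z
  using kernel_0(1)[of "fst z" "snd z", symmetric] by (simp add: mult.commute)
 ultimately have "w \<in> Xe p \<Omega> 0" using i w by (simp add: Xe_def)
 then show ?thesis using uw by (rule that)
qed

lemma Xe_in_X_space:
 fixes w :: "'a::euclidean_space \<Rightarrow> real"
 assumes \<Omega>: "open \<Omega>" and w: "w \<in> Xe p \<Omega> 0"
 shows "w \<in> X_space p \<Omega>"
proof -
 note [measurable] = XeD(1)[OF w]
 have "integrable (lebesgue_on \<Omega>) (\<lambda>x. \<bar>w x\<bar> powr p)"
  using XeD(3)[OF w] integral_on_AE_borel(3)[OF \<Omega>, of "\<lambda>x. \<bar>w x\<bar> powr p" "\<lambda>x. \<bar>w x\<bar> powr p"] XeD(2)[OF w] by simp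
 moreover have "w \<in> borel_measurable (lebesgue_on \<Omega>)"
  by (rule integral_on_AE_borel(1)[OF \<Omega>, of w]) (auto simp: XeD(2)[OF w])
 moreover have "integrable lebesgue (\<lambda>z. \<bar>incr w z\<bar> powr p * kn 0 z)"
  using XeD(4)[OF w] by (subst integral_lebesgue_borel) auto
 moreover have "indicator {(x::'a, y::'a). norm (x - y) \<le> 1} z *\<^sub>R (case z of (x, y) \<Rightarrow> \<bar>w x - w y\<bar> powr p / norm (x - y) ^ DIM('a))
   = \<bar>incr w z\<bar> powr p * kn 0 z" for z
  by (cases z) (simp add: kernel_0(1)[symmetric] indicator_def)
 ultimately show ?thesis using XeD(2)[OF w] by (simp add: X_space_def Lp_fun_def set_integrable_def)
qed

context small_order
begin

lemma E_lim_eq_E0: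
 assumes u: "AE x in lborel. u x = u' x" "u' \<in> Xe p \<Omega> 0" and v: "AE x in lborel. v x = v' x" "v' \<in> Xe p \<Omega> 0"
 shows "E_lim p u v = E0 u' v'"
proof -
 note [measurable] = XeD(1)[OF u(2)] XeD(1)[OF v(2)]
 let ?F = "\<lambda>a b c d z::'a\<times>'a. indicator {..1} (norm (fst z - snd z)) * (h p (a - b) * (c - d) / norm (fst z - snd z) ^ DIM('a))"
 let ?G = "\<lambda>a b c d z::'a\<times>'a. indicator {1..} (norm (fst z - snd z)) * (Upsilon p a b c d / norm (fst z - snd z) ^ DIM('a))"
 have mF: "(\<lambda>z. ?F (u' (fst z)) (u' (snd z)) (v' (fst z)) (v' (snd z)) z) \<in> borel_measurable borel" by measurable
 have mG: "(\<lambda>z. ?G (u' (fst z)) (u' (snd z)) (v' (fst z)) (v' (snd z)) z) \<in> borel_measurable borel"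
  unfolding Upsilon_def by measurable
 have 1: "(LINT z:{(x::'a, y::'a). norm (x - y) \<le> 1}|lebesgue. (case z of (x, y) \<Rightarrow> h p (u x - u y) * (v x - v y) / norm (x - y) ^ DIM('a))) = near p 0 u' v'"
 proof -
  have "(LINT z:{(x::'a, y::'a). norm (x - y) \<le> 1}|lebesgue. (case z of (x, y) \<Rightarrow> h p (u x - u y) * (v x - v y) / norm (x - y) ^ DIM('a)))
    = (LINT z|lebesgue. ?F (u (fst z)) (u (snd z)) (v (fst z)) (v (snd z)) z)"
   unfolding set_lebesgue_integral_def by (rule Bochner_Integration.integral_cong) (auto simp: indicator_def)
  also have "\<dots> = (LBINT z. ?F (u' (fst z)) (u' (snd z)) (v' (fst z)) (v' (snd z)) z)"
   by (rule integral_AE_borel(2)[OF mF AE_pair_cong[OF u(1) v(1), of ?F]])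
  also have "\<dots> = near p 0 u' v'"
   unfolding near_def
  proof (rule Bochner_Integration.integral_cong)
   fix z :: "'a \<times> 'a"
   show "?F (u' (fst z)) (u' (snd z)) (v' (fst z)) (v' (snd z)) z = h p (incr u' z) * (incr v' z) * kn 0 z"
    by (cases z) (simp add: kernel_0(1)[symmetric])
  qed simp
  finally show ?thesis .
 qed
 have 2: "(LINT z:{(x::'a, y::'a). norm (x - y) \<ge> 1}|lebesgue. (case z of (x, y) \<Rightarrow> Upsilon p (u x) (u y) (v x) (v y) / norm (x - y) ^ DIM('a))) = far p 0 u' v'"
 proof -
  have "(LINT z:{(x::'a, y::'a). norm (x - y) \<ge> 1}|lebesgue. (case z of (x, y) \<Rightarrow> Upsilon p (u x) (u y) (v x) (v y) / norm (x - y) ^ DIM('a)))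
    = (LINT z|lebesgue. ?G (u (fst z)) (u (snd z)) (v (fst z)) (v (snd z)) z)"
   unfolding set_lebesgue_integral_def by (rule Bochner_Integration.integral_cong) (auto simp: indicator_def)
  also have "\<dots> = (LBINT z. ?G (u' (fst z)) (u' (snd z)) (v' (fst z)) (v' (snd z)) z)"
   by (rule integral_AE_borel(2)[OF mG AE_pair_cong[OF u(1) v(1), of ?G]])
  also have "\<dots> = far p 0 u' v'"
   unfolding far_def
  proof (rule integral_cong_AE)
   have "AE z in lborel. norm (fst z - snd z :: 'a) \<noteq> 1" by (rule AE_norm_diff_neq) simp
   then show "AE z in lborel. ?G (u' (fst z)) (u' (snd z)) (v' (fst z)) (v' (snd z)) z = Upsilon_at p u' v' z * kf 0 z"
   proof eventually_elim
    case (elim z)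
    then have "indicat_real {1..} (norm (fst z - snd z)) = indicator {1<..} (norm (fst z - snd z))"
     by (auto simp: indicator_def)
    then show ?case using kernel_0(2)[of "fst z" "snd z", symmetric] by simp
   qed
  qed (use mG in simp, unfold Upsilon_def, measurable)
  finally show ?thesis .
 qed
 have 3: "(LINT x|lebesgue. h p (u x) * v x) = (LBINT x. h p (u' x) * v' x)"
 proof (rule integral_AE_borel(2))
  show "AE x in lborel. h p (u x) * v x = h p (u' x) * v' x" using u(1) v(1) by eventually_elim simp
 qed measurable
 show ?thesis unfolding E_lim_def E0_def 1 2 3 by (simp add: distrib_left)
qed

lemma LT_lebesgue_on:
 assumes b': "AE x in lborel. x \<in> \<Omega> \<longrightarrow> b' x = b x"
  and u: "AE x in lborel. u x = u' x" "u' \<in> Xe p \<Omega> 0" and v: "AE x in lborel. v x = v' x" "v' \<in> Xe p \<Omega> 0"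
 shows "(LINT x|lebesgue_on \<Omega>. (b' x + \<mu> * ln \<bar>u x\<bar>) * h p (u x) * v x) = LT u' v'"
 unfolding LT_def
proof (rule integral_on_AE_borel(2)[OF \<Omega>(2)])
 note [measurable] = XeD(1)[OF u(2)] XeD(1)[OF v(2)]
 show "(\<lambda>x. (b x + \<mu> * ln \<bar>u' x\<bar>) * h p (u' x) * v' x) \<in> borel_measurable borel" by measurable
 show "AE x in lborel. x \<in> \<Omega> \<longrightarrow> (b' x + \<mu> * ln \<bar>u x\<bar>) * h p (u x) * v x = (b x + \<mu> * ln \<bar>u' x\<bar>) * h p (u' x) * v' x"
  using b' u(1) v(1) by eventually_elim simp
qed (simp add: XeD(2)[OF v(2)])

text \<open>As \<open>ln (\<bar>u\<bar> powr p)\<close> is \<open>p * ln \<bar>u\<bar>\<close> off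
  the zeros, the logarithmic parts of the energy and of \<open>LT\<close> agree. Only the
  \<open>- 1\<close> in \<open>J_lim\<close> survives, as the multiple
  \<open>\<mu> / p\<^sup>2\<close> of \<open>Y\<close>, so that on the Nehari set comparing energies
  means comparing \<open>Y\<close>.\<close>

lemma J_lim_eq:
 assumes b': "AE x in lborel. x \<in> \<Omega> \<longrightarrow> b' x = b x" and u: "AE x in lborel. u x = u' x" "u' \<in> Xe p \<Omega> 0"
 shows "J_lim p \<Omega> b' \<mu> u = (E0 u' u' - LT u' u') / p + \<mu> / p\<^sup>2 * Y u'"
proof -
 note [measurable] = XeD(1)[OF u(2)]
 let ?U = "\<lambda>x. \<bar>u' x\<bar> powr p"
 have "integrable lborel (\<lambda>x. b x * ?U x)"
 proof (rule Bochner_Integration.integrable_bound)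
  show "integrable lborel (\<lambda>x. M * ?U x)" using XeD(3)[OF u(2)] by simp
  show "AE x in lborel. norm (b x * ?U x) \<le> norm (M * ?U x)"
   using b_bound
  proof eventually_elim
   case (elim x)
   show ?case
   proof (cases "x \<in> \<Omega>")
    case True
    then show ?thesis using elim M by (simp add: abs_mult mult_right_mono)
   qed (simp add: XeD(2)[OF u(2)])
  qed
 qed measurable
 moreover have "integrable lborel (\<lambda>x. (b x + \<mu> * ln \<bar>u' x\<bar>) * ?U x)"
  using LT_integrable[OF u(2) u(2)] by (simp add: mult.assoc h_mult_self)
 ultimately have "integrable lborel (\<lambda>x. (b x + \<mu> * ln \<bar>u' x\<bar>) * ?U x - b x * ?U x)" and ib: "integrable lborel (\<lambda>x. b x * ?U x)"
  by simp_all
 from integrable_mult_right[OF this(1), of "1 / \<mu>"] have "integrable lborel (\<lambda>x. (1 / \<mu>) * ((b x + \<mu> * ln \<bar>u' x\<bar>) * ?U x - b x * ?U x))" .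
 then have il: "integrable lborel (\<lambda>x. ln \<bar>u' x\<bar> * ?U x)" using \<mu> by (simp add: algebra_simps)
 have 1: "(LINT x|lebesgue_on \<Omega>. b' x * \<bar>u x\<bar> powr p) = (LBINT x. b x * ?U x)"
 proof (rule integral_on_AE_borel(2)[OF \<Omega>(2)])
  show "AE x in lborel. x \<in> \<Omega> \<longrightarrow> b' x * \<bar>u x\<bar> powr p = b x * ?U x" using b' u(1) by eventually_elim simp
 qed (measurable, simp add: XeD(2)[OF u(2)])
 have 2: "(LINT x|lebesgue_on \<Omega>. \<bar>u x\<bar> powr p * (ln (\<bar>u x\<bar> powr p) - 1)) = (LBINT x. p * (ln \<bar>u' x\<bar> * ?U x) - ?U x)"
 proof (rule integral_on_AE_borel(2)[OF \<Omega>(2)])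
  have key: "\<bar>t\<bar> powr p * (ln (\<bar>t\<bar> powr p) - 1) = p * (ln \<bar>t\<bar> * \<bar>t\<bar> powr p) - \<bar>t\<bar> powr p" for t :: real
   by (cases "t = 0") (simp_all add: ln_powr algebra_simps)
  show "AE x in lborel. x \<in> \<Omega> \<longrightarrow> \<bar>u x\<bar> powr p * (ln (\<bar>u x\<bar> powr p) - 1) = p * (ln \<bar>u' x\<bar> * ?U x) - ?U x"
   using u(1) by eventually_elim (simp only: key simp_thms)
 qed (measurable, simp add: XeD(2)[OF u(2)])
 have "LT u' u' = (LBINT x. b x * ?U x + \<mu> * (ln \<bar>u' x\<bar> * ?U x))"
  unfolding LT_def by (intro Bochner_Integration.integral_cong refl) (simp only: mult.assoc h_mult_self, simp add: algebra_simps)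
 also have "\<dots> = (LBINT x. b x * ?U x) + \<mu> * (LBINT x. ln \<bar>u' x\<bar> * ?U x)" using ib il by simp
 finally have L: "LT u' u' = (LBINT x. b x * ?U x) + \<mu> * (LBINT x. ln \<bar>u' x\<bar> * ?U x)" .
 have I: "(LBINT x. p * (ln \<bar>u' x\<bar> * ?U x) - ?U x) = p * (LBINT x. ln \<bar>u' x\<bar> * ?U x) - Y u'"
  unfolding Y_def using il XeD(3)[OF u(2)] by simp
 show ?thesis
  unfolding J_lim_def 1 2 L I E_lim_eq_E0[OF u u] using p by (simp add: field_simps power2_eq_square)
qed

lemma least_energy_limit:
 assumes b': "AE x in lborel. x \<in> \<Omega> \<longrightarrow> b' x = b x" and u0: "u0 \<in> Xe p \<Omega> 0" "0 < Y u0" and nehari: "E0 u0 u0 = LT u0 u0"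
  and min: "\<And>v. v \<in> Xe p \<Omega> 0 \<Longrightarrow> 0 < Y v \<Longrightarrow> E0 v v = LT v v \<Longrightarrow> Y u0 \<le> Y v"
  and weak: "\<And>v. v \<in> Xe p \<Omega> 0 \<Longrightarrow> E0 u0 v = LT u0 v"
 shows "nontrivial u0" "least_energy_sol_lim p \<Omega> b' \<mu> u0"
proof -
 have p0: "0 < p" using p by simp
 have uu: "AE x in lborel. u0 x = u0 x" by simp
 have X: "u0 \<in> X_space p \<Omega>" by (rule Xe_in_X_space[OF \<Omega>(2) u0(1)])
 show nt: "nontrivial u0" using nontrivial_iff[OF p0 u0(1) uu] u0(2) by (simp add: Y_def)
 have LT2: "(LINT x|lebesgue_on \<Omega>. (b' x + \<mu> * ln \<bar>v x\<bar>) * \<bar>v x\<bar> powr p) = LT v' v'"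
  if "AE x in lborel. v x = v' x" "v' \<in> Xe p \<Omega> 0" for v v'
  using LT_lebesgue_on[OF b' that that] by (simp add: mult.assoc h_mult_self)
 have "weak_sol_lim p \<Omega> b' \<mu> u0"
  unfolding weak_sol_lim_def
 proof (intro conjI ballI X)
  fix v assume "v \<in> X_space p \<Omega>"
  then obtain v' where v': "v' \<in> Xe p \<Omega> 0" "AE x in lborel. v x = v' x" by (rule X_space_ex_borel[OF \<Omega>(2)])
  show "E_lim p u0 v = (LINT x|lebesgue_on \<Omega>. (b' x + \<mu> * ln \<bar>u0 x\<bar>) * h p (u0 x) * v x)"
   unfolding E_lim_eq_E0[OF uu u0(1) v'(2,1)] LT_lebesgue_on[OF b' uu u0(1) v'(2,1)] by (rule weak[OF v'(1)])
 qed
 moreover have "ereal (J_lim p \<Omega> b' \<mu> u0) = (INF v \<in> Nehari_lim p \<Omega> b' \<mu>. ereal (J_lim p \<Omega> b' \<mu> v))"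
 proof (rule antisym)
  show "ereal (J_lim p \<Omega> b' \<mu> u0) \<le> (INF v \<in> Nehari_lim p \<Omega> b' \<mu>. ereal (J_lim p \<Omega> b' \<mu> v))"
  proof (rule INF_greatest)
   fix v assume v: "v \<in> Nehari_lim p \<Omega> b' \<mu>"
   then have "v \<in> X_space p \<Omega>" by (simp add: Nehari_lim_def)
   then obtain v' where v': "v' \<in> Xe p \<Omega> 0" "AE x in lborel. v x = v' x" by (rule X_space_ex_borel[OF \<Omega>(2)])
   have N: "E0 v' v' = LT v' v'" using v E_lim_eq_E0[OF v'(2,1) v'(2,1)] LT2[OF v'(2,1)] by (simp add: Nehari_lim_def)
   have "0 < Y v'" using v nontrivial_iff[OF p0 v'] by (simp add: Nehari_lim_def Y_def)
   from min[OF v'(1) this N] have "\<mu> / p\<^sup>2 * Y u0 \<le> \<mu> / p\<^sup>2 * Y v'" using \<mu> by (intro mult_left_mono) auto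
   then show "ereal (J_lim p \<Omega> b' \<mu> u0) \<le> ereal (J_lim p \<Omega> b' \<mu> v)"
    unfolding J_lim_eq[OF b' uu u0(1)] J_lim_eq[OF b' v'(2,1)] N nehari by simp
  qed
  have "u0 \<in> Nehari_lim p \<Omega> b' \<mu>"
   using X nt nehari E_lim_eq_E0[OF uu u0(1) uu u0(1)] LT2[OF uu u0(1)] by (simp add: Nehari_lim_def)
  then show "(INF v \<in> Nehari_lim p \<Omega> b' \<mu>. ereal (J_lim p \<Omega> b' \<mu> v)) \<le> ereal (J_lim p \<Omega> b' \<mu> u0)" by (rule INF_lower)
 qed
 ultimately show "least_energy_sol_lim p \<Omega> b' \<mu> u0" by (simp add: least_energy_sol_lim_def)
qed

end

section \<open>The hypotheses on the exponent and the coefficient\<close>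

lemma C1_on_at_0:
 assumes f: "C1_on {0..1/2} f f'" "(f \<longlongrightarrow> l) (at_right 0)" and \<sigma>: "\<And>k. \<sigma> k \<in> {0<..<1/2 :: real}" "\<sigma> \<longlonglongrightarrow> 0"
 shows "f 0 = l" "(\<lambda>k. (f (\<sigma> k) - l) / \<sigma> k) \<longlonglongrightarrow> f' 0"
proof -
 have w: "at 0 within {0..1/2} = at_right (0::real)" by (rule at_within_Icc_at_right) simp
 have d: "(f has_real_derivative f' 0) (at_right 0)" using f(1) by (simp add: C1_on_def flip: w)
 have "(f \<longlongrightarrow> f 0) (at_right 0)"
  using DERIV_continuous[OF d] by (simp add: continuous_within)
 from tendsto_unique[OF _ this f(2)] show eq: "f 0 = l" by simp
 have "((\<lambda>t. (f t - f 0) / (t - 0)) \<longlongrightarrow> f' 0) (at_right 0)" using d by (simp add: has_field_derivative_iff)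
 moreover have "filterlim \<sigma> (at_right 0) sequentially"
 proof -
  have "\<sigma> k \<in> {0<..} \<and> \<sigma> k \<noteq> 0" for k using \<sigma>(1)[of k] by auto
  then show ?thesis using \<sigma>(2) by (auto simp: filterlim_at intro!: always_eventually)
 qed
 ultimately show "(\<lambda>k. (f (\<sigma> k) - l) / \<sigma> k) \<longlonglongrightarrow> f' 0"
  using filterlim_compose[of "\<lambda>t. (f t - f 0) / (t - 0)"] by (simp add: eq)
qed

text \<open>The bounds in (a\<open>\<^sub>2\<close>) hold off a null set depending on \<open>s\<close>; rational \<open>s\<close> and continuity of
 \<open>a'(\<cdot>, x)\<close> make this null set uniform.\<close>

lemma coefficient_derivative_bound:
 fixes \<Omega> :: "'a::euclidean_space set"
 assumes a0: "AE x in lebesgue_on \<Omega>. C1_on {0..1/2} (\<lambda>s. a s x) (\<lambda>s. a' s x)"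
  and a2: "(SUP s \<in> {0..1/2}. Linf_norm (lebesgue_on \<Omega>) (a' s)) < \<infinity>"
 obtains M where "0 \<le> M" "AE x in lebesgue_on \<Omega>. \<forall>s\<in>{0..1/2}. \<bar>a' s x\<bar> \<le> M"
proof -
 obtain B :: real where B: "(SUP s \<in> {0..1/2}. Linf_norm (lebesgue_on \<Omega>) (a' s)) \<le> ereal B"
  using a2 by (cases "SUP s \<in> {0..1/2}. Linf_norm (lebesgue_on \<Omega>) (a' s)") auto
 have 1: "AE x in lebesgue_on \<Omega>. \<bar>a' s x\<bar> \<le> B" if "s \<in> {0..1/2}" for s
 proof -
  have L: "Linf_norm (lebesgue_on \<Omega>) (a' s) \<le> ereal B" using SUP_upper[OF that] B by (rule order_trans)
  have "AE x in lebesgue_on \<Omega>. ereal \<bar>a' s x\<bar> \<le> Linf_norm (lebesgue_on \<Omega>) (a' s)"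
   unfolding Linf_norm_def by (rule esssup_AE)
  then have "AE x in lebesgue_on \<Omega>. ereal \<bar>a' s x\<bar> \<le> ereal B"
   by eventually_elim (rule order_trans[OF _ L])
  then show ?thesis by simp
 qed
 have "AE x in lebesgue_on \<Omega>. \<forall>s\<in>\<rat> \<inter> {0..1/2}. \<bar>a' s x\<bar> \<le> B"
  using 1 by (intro AE_ball_countable') (auto intro: countable_Int1 countable_rat)
 then have "AE x in lebesgue_on \<Omega>. \<forall>s\<in>{0..1/2}. \<bar>a' s x\<bar> \<le> max 0 B"
  using a0
 proof eventually_elim
  case (elim x)
  have c: "continuous_on {0..1/2} (\<lambda>s. a' s x)" using elim by (simp add: C1_on_def)
  show ?case
  proof (intro ballI)
   fix s :: real assume s: "s \<in> {0..1/2}"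
   \<comment> \<open>An irrational \<open>s\<close> is approached by rationals from below, with
     \<open>max 0\<close> keeping them in the interval.\<close>
   have dense: "\<exists>X. (\<forall>n. X n \<in> \<rat> \<inter> {0..1/2}) \<and> X \<longlonglongrightarrow> s"
   proof (cases "s \<in> \<rat>")
    case True
    with s show ?thesis by (intro exI[of _ "\<lambda>_. s"]) auto
   next
    case False
    then have "s \<noteq> 0" by auto
    with s have s0: "0 < s" by simp
    have "\<exists>r\<in>\<rat>. max 0 (s - 1 / Suc n) < r \<and> r < s" for n
     by (rule Rats_dense_in_real) (use s0 in simp)
    then obtain X where X: "\<And>n. X n \<in> \<rat>" "\<And>n. max 0 (s - 1 / Suc n) < X n" "\<And>n. X n < s" by metis
    have "X \<longlonglongrightarrow> s"
    proof (rule tendsto_sandwich)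
     show "(\<lambda>n. s - 1 / real (Suc n)) \<longlonglongrightarrow> s"
      using tendsto_diff[OF tendsto_const LIMSEQ_Suc[OF lim_1_over_n], of s] by simp
     show "eventually (\<lambda>n. s - 1 / real (Suc n) \<le> X n) sequentially"
      using X(2) by (intro always_eventually allI) (meson less_imp_le max_less_iff_conj)
     show "eventually (\<lambda>n. X n \<le> s) sequentially" using X(3) by (intro always_eventually allI) (rule less_imp_le)
    qed simp
    moreover have "X n \<in> \<rat> \<inter> {0..1/2}" for n using X[of n] s by (auto intro: less_imp_le)
    ultimately show ?thesis by blast
   qed
   then obtain X where X: "\<And>n. X n \<in> \<rat> \<inter> {0..1/2}" "X \<longlonglongrightarrow> s" by blast
   have "(\<lambda>n. a' (X n) x) \<longlonglongrightarrow> a' s x"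
    using X s by (intro continuous_on_tendsto_compose[OF c]) (auto intro: always_eventually)
   then have "\<bar>a' s x\<bar> \<le> B"
    using X elim(1) by (intro tendsto_upperbound[OF tendsto_rabs]) (auto intro!: always_eventually)
   then show "\<bar>a' s x\<bar> \<le> max 0 B" by simp
  qed
 qed
 then show ?thesis by (intro that[of "max 0 B"]) simp_all
qed

theorem theorem2p14:
 fixes \<Omega> :: "'a::euclidean_space set"
  and p \<mu> \<delta> c1 c2 :: real
  and q q' \<nu> :: "real \<Rightarrow> real"
  and a a' :: "real \<Rightarrow> 'a \<Rightarrow> real"
  and \<sigma> :: "nat \<Rightarrow> real"
  and u :: "real \<Rightarrow> 'a \<Rightarrow> real"
 assumes p: "1 < p"
  and \<Omega>: "bounded \<Omega>" "open \<Omega>" "lipschitz_boundary \<Omega>"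
  and q_C1: "C1_on {0..1/2} q q'"
  and q_lim: "(q \<longlongrightarrow> p) (at_right 0)"
  and \<mu>: "\<mu> = q' 0" "0 < \<mu>" "\<mu> < p\<^sup>2 / real DIM('a)"
  and q_range: "\<And>s. s \<in> {0<..1/2} \<Longrightarrow> p < q s \<and> q s < crit_exp DIM('a) s p"
  and a0: "AE x in lebesgue_on \<Omega>.
        C1_on {0..1/2} (\<lambda>s. a s x) (\<lambda>s. a' s x) \<and> ((\<lambda>s. a s x) \<longlongrightarrow> 1) (at_right 0)"
  and \<delta>: "0 < \<delta>" "\<delta> < 1"
  and a1: "\<And>s. s \<in> {0<..1/2} \<Longrightarrow> Lp_fun (lebesgue_on \<Omega>) (\<nu> s) (a s)"
  and \<nu>: "\<And>s. s \<in> {0<..1/2} \<Longrightarrow>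
        \<nu> s > max (crit_exp DIM('a) s p / (crit_exp DIM('a) s p - q s))
             (1 + (real DIM('a) - s * p) * p
                / (s * (p\<^sup>2 - real DIM('a) * \<mu> - \<delta> * p\<^sup>2)))"
  and a2: "\<And>s. s \<in> {0..1/2} \<Longrightarrow> Linf_fun (lebesgue_on \<Omega>) (a' s)"
      "(SUP s \<in> {0..1/2}. Linf_norm (lebesgue_on \<Omega>) (a' s)) < \<infinity>"
  and a3: "0 < c1" "c1 \<le> c2"
      "\<And>s. s \<in> {0<..1/2} \<Longrightarrow>
        c1 \<le> Lp_norm (lebesgue_on \<Omega>) (\<nu> s) (a s) powr (1 / (p - q s)) \<and>
        Lp_norm (lebesgue_on \<Omega>) (\<nu> s) (a s) powr (1 / (p - q s)) \<le> c2"
  and \<sigma>: "\<And>k. \<sigma> k \<in> {0<..<1/2}" "\<sigma> \<longlonglongrightarrow> 0"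
  and u: "\<And>k. nontrivial (u (\<sigma> k))"
      "\<And>k. least_energy_sol_frac (\<sigma> k) p \<Omega> (a (\<sigma> k)) (q (\<sigma> k)) (u (\<sigma> k))"
 shows "\<exists>u0. u0 \<in> X_space p \<Omega> \<and> nontrivial u0 \<and> least_energy_sol_lim p \<Omega> (a' 0) \<mu> u0 \<and>
      (\<exists>r :: nat \<Rightarrow> nat. strict_mono r \<and>
       (\<lambda>k. Lp_norm (lebesgue_on \<Omega>) p (\<lambda>x. u (\<sigma> (r k)) x - u0 x)) \<longlonglongrightarrow> 0)"
proof -
 have S: "\<Omega> \<inter> space lebesgue \<in> sets lebesgue" using \<Omega> by auto
 have AE_on: "(AE x in lebesgue_on \<Omega>. P x) \<longleftrightarrow> (AE x in lborel. x \<in> \<Omega> \<longrightarrow> P x)" for P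
  by (simp add: AE_restrict_space_iff[OF S] AE_completion_iff)
 have \<sigma>': "0 < \<sigma> k" "\<sigma> k < 1/2" "\<sigma> k \<in> {0<..1/2}" for k using \<sigma>(1)[of k] by auto
 have qp: "p < q (\<sigma> k)" for k using q_range[OF \<sigma>'(3)] by simp
 have a0': "AE x in lebesgue_on \<Omega>. C1_on {0..1/2} (\<lambda>s. a s x) (\<lambda>s. a' s x)" using a0 by eventually_elim simp
 obtain M where M: "0 \<le> M" "AE x in lebesgue_on \<Omega>. \<forall>s\<in>{0..1/2}. \<bar>a' s x\<bar> \<le> M"
  by (rule coefficient_derivative_bound[OF a0' a2(2)])
 \<comment> \<open>Continuity and the limit give the value \<open>1\<close> at order
   \<open>0\<close>. The bound on the derivative then gives the linear estimate by the mean value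
   theorem, and the one-sided derivative gives the limit of the quotients.\<close>
 have aM: "AE x in lebesgue_on \<Omega>. (\<forall>k. \<bar>a (\<sigma> k) x - 1\<bar> \<le> M * \<sigma> k) \<and> (\<lambda>k. (a (\<sigma> k) x - 1) / \<sigma> k) \<longlonglongrightarrow> a' 0 x"
  using a0 M(2)
 proof eventually_elim
  case (elim x)
  have C1: "C1_on {0..1/2} (\<lambda>s. a s x) (\<lambda>s. a' s x)" and l: "((\<lambda>s. a s x) \<longlongrightarrow> 1) (at_right 0)" using elim by auto
  note at0 = C1_on_at_0[OF C1 l \<sigma>]
  have "\<bar>a (\<sigma> k) x - 1\<bar> \<le> M * \<sigma> k" for k
  proof -
   have "norm (a (\<sigma> k) x - a 0 x) \<le> M * norm (\<sigma> k - 0)"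
    by (rule field_differentiable_bound[of "{0..1/2}" "\<lambda>s. a s x" "\<lambda>s. a' s x"])
      (use C1 elim \<sigma>'[of k] in \<open>auto simp: C1_on_def\<close>)
   then show ?thesis using at0(1) \<sigma>'[of k] by simp
  qed
  with at0(2) show ?case by blast
 qed
 have am: "a (\<sigma> k) \<in> borel_measurable (lebesgue_on \<Omega>)" for k using a1[OF \<sigma>'(3)] by (simp add: Lp_fun_def)
 have "\<exists>g. g \<in> borel_measurable borel \<and> (AE x in lborel. x \<in> \<Omega> \<longrightarrow> a (\<sigma> k) x = g x)" for k
  by (rule lebesgue_on_ex_borel[OF \<Omega>(2) am[of k]]) blast
 then have "\<forall>k. \<exists>g. g \<in> borel_measurable borel \<and> (AE x in lborel. x \<in> \<Omega> \<longrightarrow> a (\<sigma> k) x = g x)" by blast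
 from choice[OF this] obtain \<alpha> where \<alpha>: "\<And>k. \<alpha> k \<in> borel_measurable borel" "\<And>k. AE x in lborel. x \<in> \<Omega> \<longrightarrow> a (\<sigma> k) x = \<alpha> k x"
  by blast
 have "a' 0 \<in> borel_measurable (lebesgue_on \<Omega>)" using a2(1)[of 0] by (simp add: Linf_fun_def)
 from lebesgue_on_ex_borel[OF \<Omega>(2) this]
 obtain b where b: "b \<in> borel_measurable borel" "AE x in lborel. x \<in> \<Omega> \<longrightarrow> a' 0 x = b x" by blast
 \<comment> \<open>Only countably many orders occur, so the exceptional sets of the representatives
   unite to one null set.\<close>
 have "AE x in lborel. \<forall>k. x \<in> \<Omega> \<longrightarrow> a (\<sigma> k) x = \<alpha> k x" unfolding AE_all_countable using \<alpha>(2) by blast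
 then have \<alpha>b: "AE x in lborel. x \<in> \<Omega> \<longrightarrow> (\<forall>k. \<bar>\<alpha> k x - 1\<bar> \<le> M * \<sigma> k)"
  "AE x in lborel. x \<in> \<Omega> \<longrightarrow> (\<lambda>k. (\<alpha> k x - 1) / \<sigma> k) \<longlonglongrightarrow> b x"
  using aM[unfolded AE_on] b(2) by (eventually_elim, simp)+
 let ?P = "\<lambda>k w. w \<in> Xe p \<Omega> (\<sigma> k * p) \<and> (AE x in lborel. u (\<sigma> k) x = w x) \<and> 0 < (LBINT x. \<bar>w x\<bar> powr p) \<and>
  (\<forall>v \<in> Xe p \<Omega> (\<sigma> k * p). E_frac (\<sigma> k) p w v = (LBINT x. \<alpha> k x * \<bar>w x\<bar> powr (q (\<sigma> k) - 2) * w x * v x)) \<and>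
  (\<forall>v \<in> Xe p \<Omega> (\<sigma> k * p). 0 < (LBINT x. \<bar>v x\<bar> powr p) \<longrightarrow>
    E_frac (\<sigma> k) p v v = (LBINT x. \<alpha> k x * \<bar>v x\<bar> powr q (\<sigma> k)) \<longrightarrow> E_frac (\<sigma> k) p w w \<le> E_frac (\<sigma> k) p v v)"
 have "\<exists>w. ?P k w" for k
  by (rule least_energy_sol_frac_borel[OF p qp \<sigma>'(1) \<Omega>(2) \<alpha> u(2) u(1)]) blast
 then have "\<forall>k. \<exists>w. ?P k w" by blast
 from choice[OF this] obtain w where w: "\<forall>k. ?P k (w k)" by blast
 interpret so: small_order_sol \<Omega> p \<mu> M \<sigma> "\<lambda>k. q (\<sigma> k)" \<alpha> b w
 proof unfold_locales
  show "E_frac (\<sigma> k) p (w k) v = (LBINT x. \<alpha> k x * \<bar>w k x\<bar> powr (q (\<sigma> k) - 2) * w k x * v x)"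
   if "v \<in> Xe p \<Omega> (\<sigma> k * p)" for k v using w that by blast
  show "E_frac (\<sigma> k) p (w k) (w k) \<le> E_frac (\<sigma> k) p v v"
   if "v \<in> Xe p \<Omega> (\<sigma> k * p)" "0 < (LBINT x. \<bar>v x\<bar> powr p)"
    "E_frac (\<sigma> k) p v v = (LBINT x. \<alpha> k x * \<bar>v x\<bar> powr q (\<sigma> k))" for k v using w that by blast
 qed (use p \<Omega> \<mu> \<sigma> \<sigma>' qp C1_on_at_0(2)[OF q_C1 q_lim \<sigma>] \<alpha> M(1) \<alpha>b b(1) w in auto)
 obtain r u0 where r: "strict_mono (r :: nat \<Rightarrow> nat)" and u0: "u0 \<in> Xe p \<Omega> 0" "0 < so.Y u0" "so.E0 u0 u0 = so.LT u0 u0"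
  "\<And>v. v \<in> Xe p \<Omega> 0 \<Longrightarrow> 0 < so.Y v \<Longrightarrow> so.E0 v v = so.LT v v \<Longrightarrow> so.Y u0 \<le> so.Y v"
  "\<And>v. v \<in> Xe p \<Omega> 0 \<Longrightarrow> so.E0 u0 v = so.LT u0 v"
  and L: "(\<lambda>k. LBINT x. \<bar>w (r k) x - u0 x\<bar> powr p) \<longlonglongrightarrow> 0"
  by (rule so.converging_subsequence[OF \<Omega>(3)]) (rule that; assumption)
 have "Lp_norm (lebesgue_on \<Omega>) p (\<lambda>x. u (\<sigma> (r k)) x - u0 x) = (LBINT x. \<bar>w (r k) x - u0 x\<bar> powr p) powr (1 / p)" for k
 proof -
  have wk: "w (r k) \<in> Xe p \<Omega> (\<sigma> (r k) * p)" "AE x in lborel. u (\<sigma> (r k)) x = w (r k) x" using w by auto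
  note [measurable] = XeD(1)[OF wk(1)] XeD(1)[OF u0(1)]
  have "(LINT x|lebesgue_on \<Omega>. \<bar>u (\<sigma> (r k)) x - u0 x\<bar> powr p) = (LBINT x. \<bar>w (r k) x - u0 x\<bar> powr p)"
  proof (rule integral_on_AE_borel(2)[OF \<Omega>(2)])
   show "AE x in lborel. x \<in> \<Omega> \<longrightarrow> \<bar>u (\<sigma> (r k)) x - u0 x\<bar> powr p = \<bar>w (r k) x - u0 x\<bar> powr p"
    using wk(2) by eventually_elim simp
  qed (measurable, simp add: XeD(2)[OF wk(1)] XeD(2)[OF u0(1)])
  then show ?thesis by (simp add: Lp_norm_def)
 qed
 moreover have "(\<lambda>k. (LBINT x. \<bar>w (r k) x - u0 x\<bar> powr p) powr (1 / p)) \<longlonglongrightarrow> 0"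
  using L p by (intro tendsto_zero_powrI[OF _ tendsto_const]) (auto intro!: always_eventually integral_nonneg_AE)
 ultimately have "(\<lambda>k. Lp_norm (lebesgue_on \<Omega>) p (\<lambda>x. u (\<sigma> (r k)) x - u0 x)) \<longlonglongrightarrow> 0" by simp
 then show ?thesis
  using Xe_in_X_space[OF \<Omega>(2) u0(1)] so.least_energy_limit[OF b(2) u0(1-5)] r by blast
qed

end
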